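(* Let $B^H_t$, $t\ge 0$, be a fractional Brownian motion with Hurst parameter $H\in(0,1)$ on a probability space $(\Omega,\mathcal{F},\mathbb{P})$, let $L$ be its local time, and let $C=\lim_{n\to+\infty}\frac1n\mathbb{E}\,\mathrm{TV}^1(B^H,[0,n])$. Then for any sequence $(c_n)_{n\ge1}$ such that $c_n>0$ for all $n$ and $\lim_{n\to+\infty}c_n=0$, with probability $1$ it holds that for each $t\in[0,+\infty)$ the measures $$c_n^{1/H-1}\,\mathrm{n}^{y,c_n}(B^H(\omega),[0,t])\,\mathrm{d}y$$ converge weakly to $C\cdot L^y_t(\omega)\,\mathrm{d}y$ as $n\to+\infty$.
   Context: Fractional Brownian motion with Hurst parameter $H\in(0,1)$: a centred Gaussian process with continuous paths, self-similar with index $H$ (i.e. $(A^{-H}B^H_{At})_{t\ge0}$ has the same law as $B^H$ for all $A>0$) and with stationary increments, $B^H_t-B^H_s\sim\mathcal{N}(0,\mathrm{const}\cdot|t-s|^{2H})$ with a positive constant. Truncated variation: for $x:[0,+\infty)\to\mathbb{R}$, $c\ge 0$ and $0\le s<t$, $\mathrm{TV}^{c}(x,[s,t])=\sup_{\pi}\sum_{[u,v]\in\pi}\max(|x_v-x_u|-c,0)$, the supremum being over all finite partitions $\pi$ of $[s,t]$ into subintervals with disjoint interiors. Numbers of interval crossings of a càdlàg path $x$: for $y\in\mathbb{R}$, $c>0$, put $\sigma^c_0=s$ and for $n=0,1,2,\dots$ $$\rho^c_n=\inf\{u\in[\sigma^c_n,t]: x_u\ge y+c/2\},\qquad \sigma^c_{n+1}=\inf\{u\in[\rho^c_n,t]: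 x_u<y-c/2\},$$ with $\inf\emptyset=+\infty$ and $[+\infty,t]=\emptyset$. Then $\mathrm{d}^{y,c}(x,[s,t])=\max\{n:\sigma^c_n\le t\}$, $\mathrm{u}^{y,c}(x,[s,t])=\mathrm{d}^{-y,c}(-x,[s,t])$ and $\mathrm{n}^{y,c}(x,[s,t])=\mathrm{u}^{y,c}(x,[s,t])+\mathrm{d}^{y,c}(x,[s,t])$. Local time of a process $X$ (relative to Lebesgue measures in space and time): with the occupation measure $\mu_t(\Gamma)=\int_{[0,t]}\mathbf{1}_\Gamma(X_s(\omega))\,\mathrm{d}s$, $X$ possesses a local time if for each $t\ge0$, $\mu_t$ is $\mathbb{P}$-a.s. absolutely continuous with respect to the Lebesgue measure $\mathrm{d}y$; the local time is $L^y_t(\omega)=(\mathrm{d}\mu_t/\mathrm{d}y)(y)$ (defined $\mathbb{P}$-a.s.). It is known that $B^H$ possesses a local time. *)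

theory Defs
  imports "HOL-Probability.Probability"
begin

(* Degenerate normal laws (variance 0) are Dirac measures. *)
definition normal_law :: "real \<Rightarrow> real \<Rightarrow> real measure" where
  "normal_law m v =
     (if v = 0 then return borel m else density lborel (normal_density m (sqrt v)))"

definition centred_gaussian_process ::
    "'a measure \<Rightarrow> (real \<Rightarrow> 'a \<Rightarrow> real) \<Rightarrow> bool" where
  "centred_gaussian_process M X \<longleftrightarrow>
     (\<forall>t\<ge>0. X t \<in> borel_measurable M) \<and>
     (\<forall>I a. finite I \<and> I \<subseteq> {0..} \<longrightarrow>
        (\<exists>v\<ge>0. distr M borel (\<lambda>\<omega>. \<Sum>t\<in>I. a t * X t \<omega>) = normal_law 0 v))"

(* The law on the product space over the index set {0..}; restrict only places
   the sample path in the extensional function space underlying PiM. *)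
definition process_law :: "'a measure \<Rightarrow> (real \<Rightarrow> 'a \<Rightarrow> real) \<Rightarrow> (real \<Rightarrow> real) measure" where
  "process_law M X =
     distr M (\<Pi>\<^sub>M t\<in>{0..}. borel) (\<lambda>\<omega>. restrict (\<lambda>t. X t \<omega>) {0..})"

definition self_similar ::
    "'a measure \<Rightarrow> real \<Rightarrow> (real \<Rightarrow> 'a \<Rightarrow> real) \<Rightarrow> bool" where
  "self_similar M H X \<longleftrightarrow>
     (\<forall>A>0. process_law M (\<lambda>t \<omega>. A powr (- H) * X (A * t) \<omega>) = process_law M X)"

definition stationary_increments :: "'a measure \<Rightarrow> (real \<Rightarrow> 'a \<Rightarrow> real) \<Rightarrow> bool" where
  "stationary_increments M X \<longleftrightarrow>
     (\<forall>h\<ge>0. process_law M (\<lambda>t \<omega>. X (h + t) \<omega> - X h \<omega>)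
            = process_law M (\<lambda>t \<omega>. X t \<omega> - X 0 \<omega>))"

definition fractional_brownian_motion ::
    "'a measure \<Rightarrow> real \<Rightarrow> (real \<Rightarrow> 'a \<Rightarrow> real) \<Rightarrow> bool" where
  "fractional_brownian_motion M H B \<longleftrightarrow>
     centred_gaussian_process M B \<and>
     (\<forall>\<omega>\<in>space M. continuous_on {0..} (\<lambda>t. B t \<omega>)) \<and>
     self_similar M H B \<and>
     stationary_increments M B \<and>
     (\<exists>K>0. \<forall>s\<ge>0. \<forall>t\<ge>0.
        distr M borel (\<lambda>\<omega>. B t \<omega> - B s \<omega>) = normal_law 0 (K * \<bar>t - s\<bar> powr (2 * H)))"

(* Divisions may contain degenerate intervals {a..a}; for c \<ge> 0 these contribute 0. *)
definition truncated_variation ::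
    "real \<Rightarrow> (real \<Rightarrow> real) \<Rightarrow> real \<Rightarrow> real \<Rightarrow> ennreal" where
  "truncated_variation c x s t =
     (SUP p \<in> {p. p division_of {s..t}}.
        ennreal (\<Sum>K\<in>p. max (\<bar>x (Sup K) - x (Inf K)\<bar> - c) 0))"

(* inf {u \<in> [a, t]. P u}, equal to \<infinity> if there is no such u, in particular if a = \<infinity>. *)
definition first_time :: "(real \<Rightarrow> bool) \<Rightarrow> ereal \<Rightarrow> real \<Rightarrow> ereal" where
  "first_time P a t = Inf (ereal ` {u. a \<le> ereal u \<and> u \<le> t \<and> P u})"

primrec crossing_sigma ::
    "(real \<Rightarrow> real) \<Rightarrow> real \<Rightarrow> real \<Rightarrow> real \<Rightarrow> real \<Rightarrow> nat \<Rightarrow> ereal" where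
  "crossing_sigma x y c s t 0 = ereal s"
| "crossing_sigma x y c s t (Suc n) =
     (let \<rho> = first_time (\<lambda>u. x u \<ge> y + c / 2) (crossing_sigma x y c s t n) t
      in first_time (\<lambda>u. x u < y - c / 2) \<rho> t)"

(* For c > 0 and a cadlag path the set below is finite, so Max is meaningful. *)
definition downcrossings ::
    "real \<Rightarrow> real \<Rightarrow> (real \<Rightarrow> real) \<Rightarrow> real \<Rightarrow> real \<Rightarrow> nat" where
  "downcrossings y c x s t = Max {n. crossing_sigma x y c s t n \<le> ereal t}"

definition upcrossings ::
    "real \<Rightarrow> real \<Rightarrow> (real \<Rightarrow> real) \<Rightarrow> real \<Rightarrow> real \<Rightarrow> nat" where
  "upcrossings y c x s t = downcrossings (- y) c (\<lambda>u. - x u) s t"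

definition crossings ::
    "real \<Rightarrow> real \<Rightarrow> (real \<Rightarrow> real) \<Rightarrow> real \<Rightarrow> real \<Rightarrow> nat" where
  "crossings y c x s t = upcrossings y c x s t + downcrossings y c x s t"

definition occupation_measure :: "(real \<Rightarrow> real) \<Rightarrow> real \<Rightarrow> real measure" where
  "occupation_measure x t = distr (restrict_space lborel {0..t}) borel x"

(* Taking the Radon-Nikodym derivative path by path fixes one version of the local
   time for all t at once.  Occupation measures increase with t, so absolute
   continuity at all integer times, and hence almost surely, gives it for every t.
   (RN_deriv is 0 on the exceptional set where absolute continuity fails.) *)
definition local_time :: "(real \<Rightarrow> real) \<Rightarrow> real \<Rightarrow> real \<Rightarrow> ennreal" where
  "local_time x t y = RN_deriv lborel (occupation_measure x t) y"

(* Unlike weak_conv_m, which compares distribution functions, this is the right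
   notion for finite measures of varying total mass. *)
definition converges_weakly :: "(nat \<Rightarrow> real measure) \<Rightarrow> real measure \<Rightarrow> bool" where
  "converges_weakly \<mu> \<nu> \<longleftrightarrow>
     (\<forall>n. finite_measure (\<mu> n) \<and> sets (\<mu> n) = sets borel) \<and>
     finite_measure \<nu> \<and> sets \<nu> = sets borel \<and>
     (\<forall>f :: real \<Rightarrow> real. continuous_on UNIV f \<and> bounded (range f) \<longrightarrow>
        (\<lambda>n. \<integral>y. f y \<partial>\<mu> n) \<longlonglongrightarrow> (\<integral>y. f y \<partial>\<nu>))"

end

theory Submission
  imports Defs
begin

text \<open>Crossing the band of width $c$ around $y$ by $x$ is crossing the level $y$ by the play (hysteresis)
  operator applied to $x$; hence the integral of the crossing numbers over $y$ is the truncated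
  variation of $x$, up to a bounded error and a slight change of $c$.  The crossings made during
  a short time interval only concern levels $y$ near the position of the path, so the
  theorem follows from $c^{1/H-1}\,\mathrm{TV}^c(B,[s,t]) \to C(t-s)$ almost surely for all rational $s<t$, together with the
  absolute continuity of the occupation measure.

  By scaling, the former reduces to $\mathrm{TV}^1(B,[0,n])/n \to C$ with a polynomial rate in $L^2$,
  monotonicity in $c$ reducing $c \to 0$ to a sparse sequence.  Convergence of
  the means is superadditivity.  For the variance, $\mathrm{TV}^1$ over a finite grid is a maximum of affine functions
  of a Gaussian vector, so by Pisier's rotation argument its variance is at most a constant times the mean
  variance of the maximising linear functional, a signed sum of increments over disjoint
  intervals.  If $2H \le 1$ disjoint increments are negatively correlated, which bounds this
  by twice the sum of the single variances; if $2H \ge 1$ they are positively correlated, which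
  bounds it by the variance of $B_n - B_0$.  Finally, the occupation measure is
  absolutely continuous because the expected number of pairs of times with $|B_s - B_u| < \epsilon$
  is $O(\epsilon)$.\<close>

section \<open>Truncated variation over sets of times\<close>

text \<open>It is not known beforehand that \<open>TV^1\<close> has a finite mean, so the variance
  bound must first prove this, on grids and uniformly in the mesh. The variance of the maximising
  functional grows with the number of its intervals, which has no deterministic bound. It is
  controlled by a second threshold \<open>c' < c\<close>: lowering the threshold raises the value of
  the same family by \<open>c - c'\<close> for each of its intervals, so their number is at most
  \<open>TV^c' / (c - c')\<close>. With \<open>c' = (1/2)^H\<close>, self-similarity turns
  \<open>TV^c'\<close> over \<open>[0,1]\<close> into a multiple of \<open>TV^1\<close> over
  \<open>[0,2]\<close>, and the variance becomes bounded by an affine function of the mean that it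
  is meant to control. Over \<open>[0,n]\<close> the variance has order \<open>n^max(1,2H)\<close>,
  of exponent below 2, which is why second moments along a polynomially growing sequence suffice.
  Statements about laws are made on finite grids, where the supremum is a finite maximum and
  measurable, and pass to intervals through nested dyadic grids. Weak convergence is reduced to a
  lower bound for nonnegative test functions and an upper bound for the total mass, so the local
  analysis of crossings is one-sided.\<close>

definition segs :: "real set \<Rightarrow> (real \<times> real) set set" where
  "segs D = {P. finite P \<and> (\<forall>p\<in>P. fst p \<in> D \<and> snd p \<in> D \<and> fst p < snd p) \<and>
     (\<forall>p\<in>P. \<forall>q\<in>P. p \<noteq> q \<longrightarrow> snd p \<le> fst q \<or> snd q \<le> fst p)}"

definition gain :: "real \<Rightarrow> (real \<Rightarrow> real) \<Rightarrow> real \<times> real \<Rightarrow> real" where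
  "gain c x p = max (\<bar>x (snd p) - x (fst p)\<bar> - c) 0"

text \<open>The families in \<open>segs D\<close> may leave gaps, unlike partitions. As
  \<open>gain\<close> is nonnegative, this leaves the supremum over an interval unchanged for
  \<open>c >= 0\<close>, and it lets \<open>D\<close> be a finite grid, where the supremum is a
  maximum over finitely many families.\<close>

definition tvs :: "real \<Rightarrow> (real \<Rightarrow> real) \<Rightarrow> real set \<Rightarrow> ennreal" where
  "tvs c x D = (SUP P\<in>segs D. ennreal (sum (gain c x) P))"

lemma gain_nonneg [simp]: "0 \<le> gain c x p"
  by (simp add: gain_def)

lemma segs_empty [simp]: "{} \<in> segs D"
  by (simp add: segs_def)

lemma segs_finite: "P \<in> segs D \<Longrightarrow> finite P"
  by (simp add: segs_def)

lemma segs_mem: "P \<in> segs D \<Longrightarrow> p \<in> P \<Longrightarrow> fst p \<in> D \<and> snd p \<in> D \<and> fst p < snd p"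
  by (simp add: segs_def)

lemma segs_disj:
  "P \<in> segs D \<Longrightarrow> p \<in> P \<Longrightarrow> q \<in> P \<Longrightarrow> p \<noteq> q \<Longrightarrow> snd p \<le> fst q \<or> snd q \<le> fst p"
  by (simp add: segs_def)

lemma segs_mono: "D \<subseteq> E \<Longrightarrow> segs D \<subseteq> segs E"
  by (auto simp: segs_def)

lemma segs_subset: "P \<in> segs D \<Longrightarrow> Q \<subseteq> P \<Longrightarrow> Q \<in> segs D"
  unfolding segs_def using finite_subset by blast

lemma segs_restrict:
  "P \<in> segs D \<Longrightarrow> Q \<subseteq> P \<Longrightarrow> (\<And>p. p \<in> Q \<Longrightarrow> fst p \<in> E \<and> snd p \<in> E) \<Longrightarrow> Q \<in> segs (D \<inter> E)"
  unfolding segs_def using finite_subset by blast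

lemma segs_Un:
  assumes "P \<in> segs D" "Q \<in> segs E" "D \<subseteq> {..m}" "E \<subseteq> {m..}"
  shows "P \<union> Q \<in> segs (D \<union> E)" "P \<inter> Q = {}"
proof -
  have 1: "snd p \<le> m" if "p \<in> P" for p using segs_mem[OF assms(1) that] assms(3) by auto
  have 2: "m \<le> fst p" if "p \<in> Q" for p using segs_mem[OF assms(2) that] assms(4) by auto
  show "P \<union> Q \<in> segs (D \<union> E)"
    unfolding segs_def
  proof (intro CollectI conjI ballI impI)
    fix p q assume pq: "p \<in> P \<union> Q" "q \<in> P \<union> Q" "p \<noteq> q"
    have "snd p' \<le> fst q'" if "p' \<in> P" "q' \<in> Q" for p' q'
      using 1[OF that(1)] 2[OF that(2)] by simp
    then show "snd p \<le> fst q \<or> snd q \<le> fst p"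
      using segs_disj[OF assms(1), of p q] segs_disj[OF assms(2), of p q] pq by blast
  next
    show "finite (P \<union> Q)" using segs_finite assms(1,2) by blast
    fix p assume "p \<in> P \<union> Q"
    then have "fst p \<in> D \<union> E \<and> snd p \<in> D \<union> E \<and> fst p < snd p"
      using segs_mem[OF assms(1), of p] segs_mem[OF assms(2), of p] by blast
    then show "fst p \<in> D \<union> E" "snd p \<in> D \<union> E" "fst p < snd p" by blast+
  qed
  show "P \<inter> Q = {}"
  proof (rule ccontr)
    assume "P \<inter> Q \<noteq> {}"
    then obtain p where "p \<in> P" "p \<in> Q" by blast
    then show False using 1[of p] 2[of p] segs_mem[OF assms(1), of p] by simp
  qed
qed

lemma segs_insert:
  assumes "P \<in> segs D" "\<And>p. p \<in> P \<Longrightarrow> snd p \<le> u" "u < v" "u \<in> D" "v \<in> D"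
  shows "insert (u, v) P \<in> segs D" "(u, v) \<notin> P"
  using assms unfolding segs_def by force+

lemma segs_insert_first:
  assumes "P \<in> segs D" "\<And>p. p \<in> P \<Longrightarrow> v \<le> fst p" "u < v" "u \<in> D" "v \<in> D"
  shows "insert (u, v) P \<in> segs D" "(u, v) \<notin> P"
  using assms unfolding segs_def by force+

lemma segs_last:
  assumes "P \<in> segs D" "P \<noteq> {}"
  obtains u v Q where "P = insert (u, v) Q" "(u, v) \<notin> Q" "Q \<in> segs (D \<inter> {..u})"
    "u \<in> D" "v \<in> D" "u < v"
proof -
  have fin: "finite P" using assms(1) by (rule segs_finite)
  define m where "m = Max (snd ` P)"
  have "m \<in> snd ` P" unfolding m_def using fin assms(2) by (intro Max_in) auto
  then obtain p where p: "p \<in> P" "snd p = m" by auto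
  have le: "snd q \<le> m" if "q \<in> P" for q
    unfolding m_def using fin that by auto
  define Q where "Q = P - {p}"
  have q: "snd q \<le> fst p" if "q \<in> Q" for q
  proof -
    have "q \<in> P" "q \<noteq> p" using that by (auto simp: Q_def)
    then show ?thesis
      using segs_disj[OF assms(1), of q p] p le[of q] segs_mem[OF assms(1), of q] by force
  qed
  have "Q \<in> segs (D \<inter> {..fst p})"
  proof (rule segs_restrict[OF assms(1)])
    show "Q \<subseteq> P" by (auto simp: Q_def)
    fix r assume r: "r \<in> Q"
    then show "fst r \<in> {..fst p} \<and> snd r \<in> {..fst p}"
      using q[OF r] segs_mem[OF assms(1), of r] by (auto simp: Q_def)
  qed
  moreover have "P = insert (fst p, snd p) Q" "(fst p, snd p) \<notin> Q"
    using p(1) by (auto simp: Q_def)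
  ultimately show thesis
    using that segs_mem[OF assms(1) p(1)] by blast
qed

text \<open>Intervals are added from left to right: a nonempty family has one with the largest right
  end, and all others end before it begins. The membership
  \<open>Q \<in> segs (D \<inter> {..u})\<close> hands this order to each inductive step.\<close>

lemma segs_induct [consumes 1, case_names empty insert]:
  assumes "P \<in> segs D"
    and "R {}"
    and "\<And>u v Q. \<lbrakk>Q \<in> segs (D \<inter> {..u}); u \<in> D; v \<in> D; u < v; (u, v) \<notin> Q; R Q\<rbrakk>
           \<Longrightarrow> R (insert (u, v) Q)"
  shows "R P"
  using assms(1)
proof (induction "card P" arbitrary: P)
  case 0
  then show ?case using assms(2) segs_finite[of P D] by auto
next
  case (Suc n)
  then have "P \<noteq> {}" by auto
  from segs_last[OF Suc.prems this] obtain u v Q where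
    Q: "P = insert (u, v) Q" "(u, v) \<notin> Q" "Q \<in> segs (D \<inter> {..u})" "u \<in> D" "v \<in> D" "u < v" .
  have "Q \<in> segs D" using Q(3) segs_mono[of "D \<inter> {..u}" D] by auto
  moreover have "card Q = n" using Suc.hyps(2) Q segs_finite[OF Q(3)] by simp
  ultimately have "R Q" using Suc.hyps(1) by blast
  then show ?case using assms(3) Q by blast
qed

text \<open>The gaps between the intervals would only add further nonnegative increments of the
  monotone \<open>G\<close>.\<close>

lemma segs_telescope:
  assumes "P \<in> segs D" "D \<subseteq> {s..t}" "s \<le> t" "mono_on {s..t} G"
  shows "(\<Sum>p\<in>P. G (snd p) - G (fst p)) \<le> G t - (G s :: real)"
proof -
  have mono: "G a \<le> G b" if "s \<le> a" "a \<le> b" "b \<le> t" for a b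
    using assms(4) that by (auto simp: mono_on_def)
  \<comment> \<open>The bound is proved for every right end \<open>w\<close>, so that the induction
    hypothesis can be used at the left end \<open>u\<close> of the last interval.\<close>
  have "\<forall>w\<in>{s..t}. P \<in> segs (D \<inter> {..w}) \<longrightarrow> (\<Sum>p\<in>P. G (snd p) - G (fst p)) \<le> G w - G s"
    using assms(1)
  proof (induction rule: segs_induct)
    case empty
    then show ?case using mono by auto
  next
    case (insert u v Q)
    show ?case
    proof (intro ballI impI)
      fix w assume w: "w \<in> {s..t}" "insert (u, v) Q \<in> segs (D \<inter> {..w})"
      then have "v \<le> w" using segs_mem[OF w(2), of "(u, v)"] by auto
      moreover have "u \<in> {s..t}" "v \<in> {s..t}" using insert assms(2) by auto
      moreover have "(\<Sum>p\<in>Q. G (snd p) - G (fst p)) \<le> G u - G s"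
        using insert \<open>u \<in> {s..t}\<close> by blast
      moreover have "G v \<le> G w" using mono[of v w] w calculation by auto
      ultimately show "(\<Sum>p\<in>insert (u, v) Q. G (snd p) - G (fst p)) \<le> G w - G s"
        using insert(5) segs_finite[OF insert(1)] by simp
    qed
  qed
  moreover have "D \<inter> {..t} = D" using assms(2) by auto
  ultimately show ?thesis using assms(1,3) by auto
qed

lemma tvs_upper: "P \<in> segs D \<Longrightarrow> ennreal (sum (gain c x) P) \<le> tvs c x D"
  unfolding tvs_def by (rule SUP_upper)

lemma tvs_least: "(\<And>P. P \<in> segs D \<Longrightarrow> ennreal (sum (gain c x) P) \<le> z) \<Longrightarrow> tvs c x D \<le> z"
  unfolding tvs_def by (rule SUP_least)

lemma tvs_mono_set: "D \<subseteq> E \<Longrightarrow> tvs c x D \<le> tvs c x E"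
  unfolding tvs_def by (rule SUP_subset_mono[OF segs_mono]) auto

lemma tvs_antimono: "c \<le> c' \<Longrightarrow> tvs c' x D \<le> tvs c x D"
  unfolding tvs_def
  by (rule SUP_mono) (auto intro!: bexI ennreal_leI sum_mono simp: gain_def)

lemma tvs_cong: 
  assumes "\<And>t. t \<in> D \<Longrightarrow> x t = y t" shows "tvs c x D = tvs c y D"
  unfolding tvs_def
  by (intro SUP_cong refl arg_cong[where f=ennreal] sum.cong)
     (use assms in \<open>auto simp: gain_def dest: segs_mem\<close>)

lemma tvs_superadditive:
  assumes "D \<subseteq> {..m}" "E \<subseteq> {m..}"
  shows "tvs c x D + tvs c x E \<le> tvs c x (D \<union> E)"
proof -
  have ne: "segs D \<noteq> {}" "segs E \<noteq> {}" using segs_empty by blast+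
  have "tvs c x D + tvs c x E =
     (SUP P\<in>segs D. SUP Q\<in>segs E. ennreal (sum (gain c x) P) + ennreal (sum (gain c x) Q))"
    unfolding tvs_def
    by (subst ennreal_SUP_add_left[OF ne(1), symmetric], subst ennreal_SUP_add_right[OF ne(2)]) simp
  also have "\<dots> \<le> tvs c x (D \<union> E)"
  proof (intro SUP_least)
    fix P Q assume PQ: "P \<in> segs D" "Q \<in> segs E"
    have "ennreal (sum (gain c x) P) + ennreal (sum (gain c x) Q) = ennreal (sum (gain c x) (P \<union> Q))"
      using segs_Un(2)[OF PQ assms] segs_finite PQ
      by (subst sum.union_disjoint) (auto simp: ennreal_plus sum_nonneg)
    then show "ennreal (sum (gain c x) P) + ennreal (sum (gain c x) Q) \<le> tvs c x (D \<union> E)"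
      using tvs_upper[OF segs_Un(1)[OF PQ assms]] by simp
  qed
  finally show ?thesis .
qed

text \<open>At most one interval contains \<open>m\<close> in its interior. Cutting it there
  replaces one deduction of \<open>c\<close> by two, which loses at most \<open>c\<close>.\<close>

lemma tvs_subadditive:
  assumes m: "m \<in> D" and c: "0 \<le> c"
  shows "tvs c x D \<le> tvs c x (D \<inter> {..m}) + tvs c x (D \<inter> {m..}) + ennreal c"
proof (rule tvs_least)
  fix P assume P: "P \<in> segs D"
  define L where "L = {p\<in>P. snd p \<le> m}"
  define R where "R = {p\<in>P. m \<le> fst p}"
  define S where "S = {p\<in>P. fst p < m \<and> m < snd p}"
  have fin: "finite P" "finite L" "finite R" "finite S"
    using segs_finite[OF P] by (auto simp: L_def R_def S_def)
  have PU: "P = L \<union> R \<union> S" "L \<inter> R = {}" "(L \<union> R) \<inter> S = {}"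
    using segs_mem[OF P] by (fastforce simp: L_def R_def S_def)+
  have L: "L \<in> segs (D \<inter> {..m})"
    by (rule segs_restrict[OF P]) (use segs_mem[OF P] in \<open>fastforce simp: L_def\<close>)+
  have R: "R \<in> segs (D \<inter> {m..})"
    by (rule segs_restrict[OF P]) (use segs_mem[OF P] in \<open>fastforce simp: R_def\<close>)+
  have sumP: "sum (gain c x) P = sum (gain c x) L + sum (gain c x) R + sum (gain c x) S"
    using fin PU by (simp add: sum.union_disjoint)
  obtain L' R' where LR: "L' \<in> segs (D \<inter> {..m})" "R' \<in> segs (D \<inter> {m..})"
    "sum (gain c x) P \<le> sum (gain c x) L' + sum (gain c x) R' + c"
  proof (cases "S = {}")
    case True
    then show thesis using that[OF L R] sumP c by simp
  next
    case False
    then obtain u v where uv: "(u, v) \<in> S" by auto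
    then have uv': "(u, v) \<in> P" "u < m" "m < v" by (auto simp: S_def)
    have "p = (u, v)" if p: "p \<in> S" for p
    proof (rule ccontr)
      assume "p \<noteq> (u, v)"
      with segs_disj[OF P _ uv'(1), of p] p have "snd p \<le> u \<or> v \<le> fst p" by (auto simp: S_def)
      then show False using p uv' by (auto simp: S_def)
    qed
    then have S: "S = {(u, v)}" using uv by blast
    have uvD: "u \<in> D" "v \<in> D" using segs_mem[OF P uv'(1)] by auto
    have Lle: "snd p \<le> u" if p: "p \<in> L" for p
    proof -
      have "p \<in> P" "snd p \<le> m" "p \<noteq> (u, v)" using p uv' by (auto simp: L_def)
      then show ?thesis using segs_disj[OF P _ uv'(1), of p] segs_mem[OF P, of p] uv' by auto
    qed
    have Rge: "v \<le> fst p" if p: "p \<in> R" for p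
    proof -
      have "p \<in> P" "m \<le> fst p" "p \<noteq> (u, v)" using p uv' by (auto simp: R_def)
      then show ?thesis using segs_disj[OF P _ uv'(1), of p] segs_mem[OF P, of p] uv' by auto
    qed
    have L': "insert (u, m) L \<in> segs (D \<inter> {..m})" "(u, m) \<notin> L"
      using segs_insert[OF L Lle] uv' uvD m by auto
    have R': "insert (m, v) R \<in> segs (D \<inter> {m..})" "(m, v) \<notin> R"
      using segs_insert_first[OF R Rge] uv' uvD m by auto
    have "gain c x (u, v) \<le> gain c x (u, m) + gain c x (m, v) + c"
      using c by (auto simp: gain_def)
    then show thesis
      using that[OF L'(1) R'(1)] L' R' sumP S fin by simp
  qed
  have "ennreal (sum (gain c x) P) \<le> ennreal (sum (gain c x) L' + sum (gain c x) R' + c)"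
    using LR(3) by (rule ennreal_leI)
  also have "\<dots> = ennreal (sum (gain c x) L') + ennreal (sum (gain c x) R') + ennreal c"
    using c by (simp add: ennreal_plus sum_nonneg)
  also have "\<dots> \<le> tvs c x (D \<inter> {..m}) + tvs c x (D \<inter> {m..}) + ennreal c"
    using tvs_upper[OF LR(1)] tvs_upper[OF LR(2)] by (intro add_mono) auto
  finally show "ennreal (sum (gain c x) P) \<le> \<dots>" .
qed

lemma segs_image:
  assumes "strict_mono_on D \<phi>" "P \<in> segs D"
  shows "map_prod \<phi> \<phi> ` P \<in> segs (\<phi> ` D)" "inj_on (map_prod \<phi> \<phi>) P"
proof -
  have le: "\<phi> a \<le> \<phi> b" if "a \<in> D" "b \<in> D" "a \<le> b" for a b
    using assms(1) that by (metis strict_mono_onD order_le_less)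
  have lt: "\<phi> a < \<phi> b" if "a \<in> D" "b \<in> D" "a < b" for a b
    using assms(1) that by (metis strict_mono_onD)
  show "map_prod \<phi> \<phi> ` P \<in> segs (\<phi> ` D)"
    unfolding segs_def
    using segs_finite[OF assms(2)] segs_mem[OF assms(2)] segs_disj[OF assms(2)]
    by (auto intro!: lt) (metis le fst_conv snd_conv)+
  have "inj_on \<phi> D" using assms(1) by (rule strict_mono_on_imp_inj_on)
  then show "inj_on (map_prod \<phi> \<phi>) P"
    using segs_mem[OF assms(2)] by (force simp: inj_on_def)
qed

lemma segs_image_eq:
  assumes "strict_mono_on D \<phi>"
  shows "segs (\<phi> ` D) = (\<lambda>P. map_prod \<phi> \<phi> ` P) ` segs D"
proof (intro equalityI subsetI)
  fix Q assume Q: "Q \<in> segs (\<phi> ` D)"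
  have inj: "inj_on \<phi> D" using assms by (rule strict_mono_on_imp_inj_on)
  define \<psi> where "\<psi> = the_inv_into D \<phi>"
  have "strict_mono_on (\<phi> ` D) \<psi>"
  proof (rule strict_mono_onI)
    fix a b assume "a \<in> \<phi> ` D" "b \<in> \<phi> ` D" "a < b"
    then obtain a' b' where ab: "a' \<in> D" "b' \<in> D" "a = \<phi> a'" "b = \<phi> b'" by auto
    then have "a' < b'" using \<open>a < b\<close> assms
      by (metis strict_mono_onD linorder_neqE_linordered_idom order.asym less_irrefl)
    then show "\<psi> a < \<psi> b" using ab inj by (simp add: \<psi>_def the_inv_into_f_f)
  qed
  then have "map_prod \<psi> \<psi> ` Q \<in> segs (\<psi> ` \<phi> ` D)" by (rule segs_image) (rule Q)
  moreover have "\<psi> ` \<phi> ` D = D" using inj by (force simp: \<psi>_def the_inv_into_f_f image_image)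
  moreover have "map_prod \<phi> \<phi> ` map_prod \<psi> \<psi> ` Q = Q"
  proof -
    have "map_prod \<phi> \<phi> (map_prod \<psi> \<psi> q) = q" if "q \<in> Q" for q
      using segs_mem[OF Q that] inj by (cases q) (auto simp: \<psi>_def f_the_inv_into_f)
    then show ?thesis by (auto simp: image_image)
  qed
  ultimately show "Q \<in> (\<lambda>P. map_prod \<phi> \<phi> ` P) ` segs D" by (metis image_eqI)
qed (use segs_image[OF assms] in auto)

lemma tvs_image:
  assumes "strict_mono_on D \<phi>"
  shows "tvs c x (\<phi> ` D) = tvs c (\<lambda>t. x (\<phi> t)) D"
proof -
  have "ennreal (sum (gain c x) (map_prod \<phi> \<phi> ` P)) = ennreal (sum (gain c (\<lambda>t. x (\<phi> t))) P)"
    if "P \<in> segs D" for P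
    using segs_image(2)[OF assms that] by (simp add: sum.reindex gain_def)
  then show ?thesis
    unfolding tvs_def segs_image_eq[OF assms] by (simp add: image_image)
qed

lemma tvs_scale:
  assumes "0 < k"
  shows "tvs (k * c) (\<lambda>t. k * x t + b) D = ennreal k * tvs c x D"
proof -
  have "gain (k * c) (\<lambda>t. k * x t + b) p = k * gain c x p" for p
  proof -
    have "\<bar>k * x (snd p) + b - (k * x (fst p) + b)\<bar> = k * \<bar>x (snd p) - x (fst p)\<bar>"
      using assms by (simp add: abs_mult right_diff_distrib[symmetric])
    then show ?thesis using assms
      by (simp add: gain_def max_mult_distrib_left right_diff_distrib)
  qed
  then show ?thesis
    unfolding tvs_def using assms
    by (simp add: sum_distrib_left[symmetric] ennreal_mult sum_nonneg SUP_mult_left_ennreal)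
qed

lemma truncated_variation_eq_tvs:
  assumes "0 \<le> c"
  shows "truncated_variation c x s t = tvs c x {s..t}"
proof (rule antisym)
  let ?g = "\<lambda>K. max (\<bar>x (Sup K) - x (Inf K)\<bar> - c) 0"
  show "truncated_variation c x s t \<le> tvs c x {s..t}"
    unfolding truncated_variation_def
  proof (rule SUP_least)
    fix p assume "p \<in> {p. p division_of {s..t}}"
    then have p: "p division_of {s..t}" by simp
    define p' where "p' = {K\<in>p. Inf K < Sup K}"
    have K: "\<exists>a b. K = {a..b} \<and> a \<le> b \<and> Inf K = a \<and> Sup K = b \<and> s \<le> a \<and> b \<le> t" if Kp: "K \<in> p" for K
    proof -
      obtain a b where ab: "K = {a..b}" using division_ofD(4)[OF p Kp] by (auto simp: box_real)
      moreover have "K \<noteq> {}" "K \<subseteq> {s..t}" using division_ofD(2,3)[OF p Kp] by auto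
      ultimately show ?thesis by auto
    qed
    define P where "P = (\<lambda>K. (Inf K, Sup K)) ` p'"
    have inj: "inj_on (\<lambda>K. (Inf K, Sup K)) p'"
    proof (rule inj_onI)
      fix K J assume "K \<in> p'" "J \<in> p'" "(Inf K, Sup K) = (Inf J, Sup J)"
      then show "K = J" using K[of K] K[of J] by (auto simp: p'_def)
    qed
    have P: "P \<in> segs {s..t}"
      unfolding segs_def
    proof (intro CollectI conjI ballI impI)
      show "finite P" using division_ofD(1)[OF p] by (simp add: P_def p'_def)
      fix q assume q: "q \<in> P"
      then obtain K where KK: "K \<in> p" "q = (Inf K, Sup K)" "Inf K < Sup K" by (auto simp: P_def p'_def)
      then show "fst q \<in> {s..t}" "snd q \<in> {s..t}" "fst q < snd q" using K[OF KK(1)] by auto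
      fix r assume r: "r \<in> P" "q \<noteq> r"
      then obtain J where J: "J \<in> p" "r = (Inf J, Sup J)" "Inf J < Sup J" by (auto simp: P_def p'_def)
      have "interior K \<inter> interior J = {}" using division_ofD(5)[OF p KK(1) J(1)] r KK J by auto
      moreover obtain a b a' b' where e: "K = {a..b}" "J = {a'..b'}" "Inf K = a" "Sup K = b" "Inf J = a'" "Sup J = b'"
        using K[OF KK(1)] K[OF J(1)] by auto
      ultimately have "{a<..<b} \<inter> {a'<..<b'} = {}" by simp
      moreover have "a < b" "a' < b'" using KK(3) J(3) e by (simp_all del: Inf_atLeastAtMost)
      ultimately have "b \<le> a' \<or> b' \<le> a"
        unfolding Int_greaterThanLessThan by (auto simp: max_def min_def split: if_splits)
      then show "snd q \<le> fst r \<or> snd r \<le> fst q" using e KK J by simp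
    qed
    have "(\<Sum>K\<in>p. ?g K) = (\<Sum>K\<in>p'. ?g K)"
      using division_ofD(1)[OF p] K assms
      by (intro sum.mono_neutral_right) (force simp: p'_def)+
    also have "\<dots> = sum (gain c x) P"
      using inj by (simp add: P_def sum.reindex gain_def)
    finally show "ennreal (\<Sum>K\<in>p. ?g K) \<le> tvs c x {s..t}"
      using tvs_upper[OF P] by simp
  qed
  show "tvs c x {s..t} \<le> truncated_variation c x s t"
  proof (rule tvs_least)
    fix P assume P: "P \<in> segs {s..t}"
    define p where "p = (\<lambda>q. {fst q..snd q}) ` P"
    have inj: "inj_on (\<lambda>q. {fst q..snd q}) P"
      using segs_mem[OF P] by (force simp: inj_on_def)
    have "p division_of \<Union>p"
    proof (rule division_ofI)
      show "finite p" using segs_finite[OF P] by (simp add: p_def)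
      fix K assume K: "K \<in> p"
      then show "K \<subseteq> \<Union>p" by auto
      obtain q where q: "q \<in> P" "K = {fst q..snd q}" using K by (auto simp: p_def)
      show "K \<noteq> {}" using q segs_mem[OF P q(1)] by auto
      show "\<exists>a b. K = cbox a b" using q by (auto simp: box_real)
      fix J assume J: "J \<in> p" "K \<noteq> J"
      then obtain r where r: "r \<in> P" "J = {fst r..snd r}" by (auto simp: p_def)
      then have "q \<noteq> r" using q J by auto
      then show "interior K \<inter> interior J = {}"
        using segs_disj[OF P q(1) r(1)] q r by auto
    qed simp
    moreover have "\<Union>p \<subseteq> cbox s t"
      using segs_mem[OF P] by (force simp: p_def box_real)
    ultimately obtain q where q: "p \<subseteq> q" "q division_of cbox s t"
      by (rule partial_division_extend_interval)
    have "sum ?g p = (\<Sum>q\<in>P. ?g {fst q..snd q})"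
      using inj by (simp add: p_def sum.reindex)
    also have "\<dots> = sum (gain c x) P"
    proof (rule sum.cong)
      fix q assume "q \<in> P"
      then have "fst q \<le> snd q" using segs_mem[OF P] by (simp add: less_imp_le)
      then show "?g {fst q..snd q} = gain c x q" by (simp add: gain_def)
    qed simp
    finally have "sum (gain c x) P = sum ?g p" by simp
    also have "\<dots> \<le> sum ?g q"
      using q division_ofD(1)[OF q(2)] by (intro sum_mono2) auto
    finally show "ennreal (sum (gain c x) P) \<le> truncated_variation c x s t"
      unfolding truncated_variation_def using q(2)
      by (intro SUP_upper2[of q]) (auto simp: box_real intro: ennreal_leI)
  qed
qed

text \<open>An interval shorter than the modulus of continuity \<open>d\<close> belonging to
  \<open>c\<close> gains nothing, and a longer one gains at most \<open>2 * M\<close>, hence at most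
  \<open>2 * M / d\<close> times its length. The lengths add up to at most
  \<open>t - s\<close>.\<close>

lemma tvs_finite_continuous:
  assumes "continuous_on {s..t} x" "0 < c"
  shows "tvs c x {s..t} < \<infinity>"
proof (cases "s \<le> t")
  case True
  have "uniformly_continuous_on {s..t} x"
    using assms(1) by (intro compact_uniformly_continuous) auto
  then obtain d where d: "d > 0" "\<And>u v. u \<in> {s..t} \<Longrightarrow> v \<in> {s..t} \<Longrightarrow> dist v u < d \<Longrightarrow> dist (x v) (x u) < c"
    using assms(2) unfolding uniformly_continuous_on_def by meson
  have "bounded (x ` {s..t})"
    using assms(1) by (intro compact_imp_bounded compact_continuous_image) auto
  then obtain M where M: "\<And>u. u \<in> {s..t} \<Longrightarrow> \<bar>x u\<bar> \<le> M"
    unfolding bounded_iff by (metis image_eqI real_norm_def)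
  have M0: "0 \<le> M" using M[of s] True by auto
  have g: "gain c x p \<le> 2 * M / d * snd p - 2 * M / d * fst p"
    if "fst p \<in> {s..t}" "snd p \<in> {s..t}" "fst p < snd p" for p
  proof (cases "snd p - fst p < d")
    case True
    then have "\<bar>x (snd p) - x (fst p)\<bar> < c"
      using d(2)[of "fst p" "snd p"] that by (auto simp: dist_real_def)
    then have "gain c x p = 0" by (simp add: gain_def)
    moreover have "2 * M / d * fst p \<le> 2 * M / d * snd p"
      using that M0 d by (intro mult_left_mono) auto
    ultimately show ?thesis by simp
  next
    case False
    have "gain c x p \<le> 2 * M"
      using M[of "fst p"] M[of "snd p"] that assms(2) M0 by (auto simp: gain_def)
    also have "\<dots> = 2 * M / d * d" using d by simp
    also have "\<dots> \<le> 2 * M / d * (snd p - fst p)" using False M0 d by (intro mult_left_mono) auto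
    finally show ?thesis by (simp add: right_diff_distrib)
  qed
  have "tvs c x {s..t} \<le> ennreal (2 * M / d * t - 2 * M / d * s)"
  proof (rule tvs_least, rule ennreal_leI)
    fix P assume P: "P \<in> segs {s..t}"
    have "sum (gain c x) P \<le> (\<Sum>p\<in>P. 2 * M / d * snd p - 2 * M / d * fst p)"
      using segs_mem[OF P] by (intro sum_mono g) auto
    also have "\<dots> \<le> 2 * M / d * t - 2 * M / d * s"
    proof (rule segs_telescope[OF P _ True])
      show "mono_on {s..t} (\<lambda>r. 2 * M / d * r)"
        using M0 d by (intro mono_onI mult_left_mono) auto
    qed simp
    finally show "sum (gain c x) P \<le> 2 * M / d * t - 2 * M / d * s" .
  qed
  then show ?thesis by (rule le_less_trans) simp
next
  case False
  then have "segs {s..t} = {{}}" by (auto simp: segs_def)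
  then show ?thesis by (simp add: tvs_def)
qed

section \<open>Dyadic grids and interval crossings\<close>

definition dy :: "nat \<Rightarrow> real \<Rightarrow> real \<Rightarrow> real set" where
  "dy N s t = (\<lambda>j. s + (t - s) * (real j / 2 ^ N)) ` {..2 ^ N}"

lemma finite_dy [simp]: "finite (dy N s t)"
  by (simp add: dy_def)

lemma dy_ends: "s \<in> dy N s t" "t \<in> dy N s t"
  unfolding dy_def by (auto intro: image_eqI[of _ _ 0] image_eqI[of _ _ "2 ^ N"])

lemma dy_subset: "s \<le> t \<Longrightarrow> dy N s t \<subseteq> {s..t}"
proof
  fix u assume st: "s \<le> t" and "u \<in> dy N s t"
  then obtain j where j: "j \<le> 2 ^ N" "u = s + (t - s) * (real j / 2 ^ N)" by (auto simp: dy_def)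
  have "real j \<le> 2 ^ N" using j(1) by (metis of_nat_le_iff of_nat_numeral of_nat_power)
  then have "0 \<le> real j / 2 ^ N" "real j / 2 ^ N \<le> 1" by simp_all
  then show "u \<in> {s..t}" using st j(2) mult_left_mono[of "real j / 2 ^ N" 1 "t - s"] by simp
qed

lemma dy_Suc: "dy N s t \<subseteq> dy (Suc N) s t"
proof
  fix u assume "u \<in> dy N s t"
  then obtain j where "j \<le> 2 ^ N" "u = s + (t - s) * (real j / 2 ^ N)" by (auto simp: dy_def)
  then have "2 * j \<le> 2 ^ Suc N" "u = s + (t - s) * (real (2 * j) / 2 ^ Suc N)" by simp_all
  then show "u \<in> dy (Suc N) s t" unfolding dy_def by blast
qed

text \<open>Meant for rounding to a grid, where \<open>r\<close> is monotone but may collapse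
  intervals; \<open>lt\<close> excludes this for the family at hand and thereby also gives
  injectivity.\<close>

lemma segs_image_mono:
  assumes P: "P \<in> segs D" and mono: "mono_on D r"
    and lt: "\<And>p. p \<in> P \<Longrightarrow> r (fst p) < r (snd p)"
    and E: "\<And>p. p \<in> P \<Longrightarrow> r (fst p) \<in> E \<and> r (snd p) \<in> E"
  shows "(\<lambda>p. (r (fst p), r (snd p))) ` P \<in> segs E" "inj_on (\<lambda>p. (r (fst p), r (snd p))) P"
proof -
  have disj: "r (snd p) \<le> r (fst q) \<or> r (snd q) \<le> r (fst p)" if "p \<in> P" "q \<in> P" "p \<noteq> q" for p q
    using segs_disj[OF P that] mono_onD[OF mono] segs_mem[OF P that(1)] segs_mem[OF P that(2)] by blast
  show inj: "inj_on (\<lambda>p. (r (fst p), r (snd p))) P"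
  proof (rule inj_onI, rule ccontr)
    fix p q assume *: "p \<in> P" "q \<in> P" "(r (fst p), r (snd p)) = (r (fst q), r (snd q))" "p \<noteq> q"
    then show False using disj[OF *(1,2,4)] lt[OF *(1)] lt[OF *(2)] by simp
  qed
  show "(\<lambda>p. (r (fst p), r (snd p))) ` P \<in> segs E"
    unfolding segs_def
  proof (intro CollectI conjI ballI impI)
    fix p' assume "p' \<in> (\<lambda>p. (r (fst p), r (snd p))) ` P"
    then obtain p where p: "p \<in> P" "p' = (r (fst p), r (snd p))" by blast
    then show "fst p' \<in> E" "snd p' \<in> E" "fst p' < snd p'" using E lt by simp_all
    fix q' assume "q' \<in> (\<lambda>p. (r (fst p), r (snd p))) ` P" "p' \<noteq> q'"
    then obtain q where q: "q \<in> P" "q' = (r (fst q), r (snd q))" "p \<noteq> q" using p by blast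
    show "snd p' \<le> fst q' \<or> snd q' \<le> fst p'" using disj[OF p(1) q(1,3)] p q by simp
  qed (use segs_finite[OF P] in simp)
qed

text \<open>The end points of a fixed family are rounded down to the grid. By continuity the rounded
  sums converge to the original one, and for large \<open>N\<close> no interval of the finite family
  collapses, so the rounded family competes in the supremum over the grid.\<close>

lemma tvs_dyadic:
  assumes cont: "continuous_on {s..t} x" and st: "s < t"
  shows "tvs c x {s..t} = (SUP N. tvs c x (dy N s t))"
proof (rule antisym)
  show "(SUP N. tvs c x (dy N s t)) \<le> tvs c x {s..t}"
    using st by (intro SUP_least tvs_mono_set dy_subset) simp
  show "tvs c x {s..t} \<le> (SUP N. tvs c x (dy N s t))"
  proof (rule tvs_least)
    fix P assume P: "P \<in> segs {s..t}"
    define r where "r N u = s + (t - s) * (real (nat \<lfloor>(u - s) / (t - s) * 2 ^ N\<rfloor>) / 2 ^ N)" for N :: nat and u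
    have r_dy: "r N u \<in> dy N s t" if "u \<in> {s..t}" for N u
    proof -
      have "(u - s) / (t - s) * 2 ^ N \<le> 1 * 2 ^ N"
        using that st by (intro mult_right_mono) auto
      then have "nat \<lfloor>(u - s) / (t - s) * 2 ^ N\<rfloor> \<le> 2 ^ N"
        by (simp add: floor_le_iff nat_le_iff)
      then show ?thesis unfolding dy_def r_def by blast
    qed
    have r_mono: "mono_on {s..t} (r N)" for N
    proof (rule mono_onI)
      fix u v assume "u \<in> {s..t}" "v \<in> {s..t}" "u \<le> v"
      then have "(u - s) / (t - s) * 2 ^ N \<le> (v - s) / (t - s) * 2 ^ N"
        using st by (intro mult_right_mono divide_right_mono) auto
      then have "nat \<lfloor>(u - s) / (t - s) * 2 ^ N\<rfloor> \<le> nat \<lfloor>(v - s) / (t - s) * 2 ^ N\<rfloor>"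
        by (intro nat_mono floor_mono)
      then show "r N u \<le> r N v"
        unfolding r_def using st by (intro add_left_mono mult_left_mono divide_right_mono) auto
    qed
    have r_lim: "(\<lambda>N. r N u) \<longlonglongrightarrow> u" if u: "u \<in> {s..t}" for u
    proof (rule LIMSEQ_I)
      fix e :: real assume e: "e > 0"
      obtain N0 where N0: "(1/2) ^ N0 < e / (t - s)"
        using real_arch_pow_inv[of "e / (t - s)" "1/2"] e st by auto
      have "norm (r N u - u) < e" if "N \<ge> N0" for N
      proof -
        define w where "w = (u - s) / (t - s) * 2 ^ N"
        have w0: "w \<ge> 0" using u st by (simp add: w_def)
        have "u = s + (t - s) * (w / 2 ^ N)" using st by (simp add: w_def)
        moreover have "r N u = s + (t - s) * (real_of_int \<lfloor>w\<rfloor> / 2 ^ N)"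
          using w0 unfolding r_def w_def[symmetric] by simp
        ultimately have "u - r N u = (t - s) * ((w - real_of_int \<lfloor>w\<rfloor>) / 2 ^ N)"
          by (simp add: right_diff_distrib diff_divide_distrib)
        moreover have "0 \<le> w - real_of_int \<lfloor>w\<rfloor>" "w - real_of_int \<lfloor>w\<rfloor> \<le> 1" by linarith+
        ultimately have "0 \<le> u - r N u" "u - r N u \<le> (t - s) * (1 / 2 ^ N)"
          using st by (simp_all add: divide_right_mono)
        moreover have "(t - s) * (1 / 2 ^ N) \<le> (t - s) * (1/2) ^ N0"
          using st that by (intro mult_left_mono) (simp_all add: power_one_over frac_le power_increasing)
        moreover have "(t - s) * (1/2) ^ N0 < e" using N0 st by (simp add: field_simps)
        ultimately show ?thesis by simp
      qed
      then show "\<exists>N0. \<forall>N\<ge>N0. norm (r N u - u) < e" by blast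
    qed
    have r_in: "r N u \<in> {s..t}" if "u \<in> {s..t}" for N u
      using subsetD[OF dy_subset r_dy[OF that]] st by simp
    define g where "g N = (\<Sum>p\<in>P. gain c x (r N (fst p), r N (snd p)))" for N
    have xlim: "(\<lambda>N. x (r N u)) \<longlonglongrightarrow> x u" if "u \<in> {s..t}" for u
      by (rule continuous_on_tendsto_compose[OF cont r_lim[OF that] that])
         (simp only: r_in[OF that] eventually_True)
    have "g \<longlonglongrightarrow> sum (gain c x) P"
      unfolding g_def gain_def
    proof (intro tendsto_sum)
      fix p assume "p \<in> P"
      then have "fst p \<in> {s..t}" "snd p \<in> {s..t}" using segs_mem[OF P] by blast+
      then show "(\<lambda>N. max (\<bar>x (snd (r N (fst p), r N (snd p))) - x (fst (r N (fst p), r N (snd p)))\<bar> - c) 0)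
          \<longlonglongrightarrow> max (\<bar>x (snd p) - x (fst p)\<bar> - c) 0"
        by (auto intro!: tendsto_intros xlim)
    qed
    then have "(\<lambda>N. ennreal (g N)) \<longlonglongrightarrow> ennreal (sum (gain c x) P)" by (rule tendsto_ennrealI)
    moreover have "eventually (\<lambda>N. ennreal (g N) \<le> (SUP N. tvs c x (dy N s t))) sequentially"
    proof -
      have "eventually (\<lambda>N. r N (fst p) < r N (snd p)) sequentially" if "p \<in> P" for p
      proof -
        have *: "fst p \<in> {s..t}" "snd p \<in> {s..t}" "fst p < snd p" using segs_mem[OF P that] by blast+
        have "(\<lambda>N. r N (snd p) - r N (fst p)) \<longlonglongrightarrow> snd p - fst p"
          using * by (intro tendsto_diff r_lim)
        then have "eventually (\<lambda>N. 0 < r N (snd p) - r N (fst p)) sequentially"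
          using * by (intro order_tendstoD) auto
        then show ?thesis by simp
      qed
      then have "eventually (\<lambda>N. \<forall>p\<in>P. r N (fst p) < r N (snd p)) sequentially"
        using segs_finite[OF P] by (simp add: eventually_ball_finite)
      then show ?thesis
      proof eventually_elim
        case (elim N)
        have E: "r N (fst p) \<in> dy N s t \<and> r N (snd p) \<in> dy N s t" if "p \<in> P" for p
          using r_dy segs_mem[OF P that] by blast
        note im = segs_image_mono[OF P r_mono[of N] _ E]
        have "g N = sum (gain c x) ((\<lambda>p. (r N (fst p), r N (snd p))) ` P)"
          using im(2) elim by (simp add: g_def sum.reindex)
        then have "ennreal (g N) \<le> tvs c x (dy N s t)"
          using tvs_upper[OF im(1)] elim by simp
        then show ?case by (meson SUP_upper UNIV_I order_trans)
      qed
    qed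
    ultimately show "ennreal (sum (gain c x) P) \<le> (SUP N. tvs c x (dy N s t))"
      by (intro tendsto_upperbound) auto
  qed
qed

section \<open>Crossing times and chains of downcrossings\<close>

lemma first_time_le: "a \<le> ereal u \<Longrightarrow> u \<le> t \<Longrightarrow> P u \<Longrightarrow> first_time P a t \<le> ereal u"
  unfolding first_time_def by (rule Inf_lower) simp

lemma first_time_ge: "a \<le> first_time P a t"
  unfolding first_time_def by (rule Inf_greatest) auto

lemma first_time_lessD:
  assumes "first_time P a t < w"
  obtains u where "a \<le> ereal u" "u \<le> t" "P u" "ereal u < w"
  using assms unfolding first_time_def Inf_less_iff by auto

text \<open>The infimum need not satisfy \<open>P\<close>, but it lies in the closure of the hitting
  times, so continuity of \<open>x\<close> preserves the weak inequality. Hitting times of upper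
  levels are covered by applying this to \<open>- x\<close>.\<close>

lemma first_time_closure:
  assumes r: "first_time P a t = ereal r" and a: "ereal s \<le> a"
    and cont: "continuous_on {s..t} x"
    and P: "\<And>u. u \<in> {s..t} \<Longrightarrow> P u \<Longrightarrow> x u \<le> (z::real)"
  shows "x r \<le> z \<and> r \<in> {s..t}"
proof -
  define U where "U = {u. a \<le> ereal u \<and> u \<le> t \<and> P u}"
  have UN: "U \<noteq> {}"
  proof
    assume "U = {}"
    then have "first_time P a t = \<infinity>" unfolding first_time_def U_def[symmetric] by (simp add: top_ereal_def)
    then show False using r by simp
  qed
  have sU: "u \<in> {s..t}" if "u \<in> U" for u
    using that a unfolding U_def by (auto simp: ereal_less_eq(3)[symmetric] simp del: ereal_less_eq intro: order_trans)
  have bdd: "bdd_below U" using sU by (auto intro!: bdd_belowI[of _ s])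
  have "ereal (Inf U) = ereal r"
    using r ereal_Inf[of U] unfolding first_time_def U_def[symmetric] by simp
  then have rU: "r \<in> closure U" using closure_contains_Inf[OF UN bdd] by simp
  have "closed ({s..t} \<inter> x -` {..z})"
    using cont by (intro continuous_closed_preimage) auto
  moreover have "U \<subseteq> {s..t} \<inter> x -` {..z}" using sU P by (auto simp: U_def)
  ultimately have "closure U \<subseteq> {s..t} \<inter> x -` {..z}" by (rule closure_minimal[rotated])
  then show ?thesis using rU by auto
qed

text \<open>Certificates for downcrossings: chains of disjoint intervals, each leading from above
  the band to below it. They free the counting from the recursion of the crossing times; by
  \<open>downcrossings_iff\<close> the largest certificate has as many intervals as there are
  downcrossings.\<close>

definition downs :: "real \<Rightarrow> real \<Rightarrow> (real \<Rightarrow> real) \<Rightarrow> real set \<Rightarrow> (real \<times> real) set set" where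
  "downs y c x D = {P \<in> segs D. \<forall>p\<in>P. y + c / 2 \<le> x (fst p) \<and> x (snd p) < y - c / 2}"

text \<open>The recursively defined times are the earliest possible ones, so the \<open>n\<close>-th
  of them is no later than the end of the \<open>n\<close>-th interval of any chain.\<close>

lemma sigma_le_of_downs:
  assumes P: "P \<in> downs y c x {s..t}" and st: "s \<le> t"
  shows "crossing_sigma x y c s t (card P) \<le> ereal t"
proof -
  have "P \<in> segs {s..t}" using P by (simp add: downs_def)
  then have "(\<forall>p\<in>P. y + c / 2 \<le> x (fst p) \<and> x (snd p) < y - c / 2) \<longrightarrow>
     (\<forall>w\<in>{s..t}. (\<forall>p\<in>P. snd p \<le> w) \<longrightarrow> crossing_sigma x y c s t (card P) \<le> ereal w)"
  proof (induction rule: segs_induct)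
    case empty
    then show ?case by simp
  next
    case (insert u v Q)
    show ?case
    proof (intro impI ballI)
      fix w assume *: "\<forall>p\<in>insert (u, v) Q. y + c / 2 \<le> x (fst p) \<and> x (snd p) < y - c / 2"
        "w \<in> {s..t}" "\<forall>p\<in>insert (u, v) Q. snd p \<le> w"
      have "\<forall>p\<in>Q. snd p \<le> u" using segs_mem[OF insert(1)] by blast
      then have 1: "crossing_sigma x y c s t (card Q) \<le> ereal u"
        using insert(6) insert(2) * by blast
      have uv: "u \<le> t" "v \<le> t" "y + c / 2 \<le> x u" "x v < y - c / 2" "v \<le> w" "u < v"
        using insert(2-4) * by auto
      have "crossing_sigma x y c s t (Suc (card Q)) \<le> ereal v"
        unfolding crossing_sigma.simps Let_def
        using uv by (intro first_time_le order_trans[OF first_time_le[OF 1]]) auto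
      also have "ereal v \<le> ereal w" using uv by simp
      finally show "crossing_sigma x y c s t (card (insert (u, v) Q)) \<le> ereal w"
        using insert(5) segs_finite[OF insert(1)] by simp
    qed
  qed
  then show ?thesis using P st segs_mem[of P "{s..t}"] by (auto simp: downs_def)
qed

lemma crossing_sigma_ge: "ereal s \<le> crossing_sigma x y c s t n"
  by (induction n) (auto simp: Let_def intro: order_trans[OF _ first_time_ge] order_trans[OF order_trans[OF _ first_time_ge] first_time_ge])

text \<open>Consecutive crossing times yield the chain, with the difficulty that the strict
  condition \<open>x u < y - c / 2\<close> need not hold at the infimum itself. Each interval
  therefore ends at a true hitting time, taken close enough to the infimum to leave room for the
  next interval.\<close>

lemma downs_of_sigma:
  assumes cont: "continuous_on {s..t} x" and c: "0 < c"
    and le: "crossing_sigma x y c s t n \<le> ereal t"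
  shows "\<exists>P\<in>downs y c x {s..t}. card P = n"
proof -
  \<comment> \<open>The claim is localised to times up to \<open>w\<close>. Hitting times exist
    below every \<open>w\<close> strictly after the infimum; at \<open>w = t\<close> a finite
    infimum is enough, and \<open>n = 0\<close> asks for nothing.\<close>
  have "\<exists>P\<in>downs y c x ({s..t} \<inter> {..w}). card P = n"
    if "n = 0 \<or> crossing_sigma x y c s t n < ereal w \<or> (crossing_sigma x y c s t n \<le> ereal t \<and> w = t)" for w
    using that
  proof (induction n arbitrary: w)
    case 0
    then show ?case by (intro bexI[of _ "{}"]) (auto simp: downs_def)
  next
    case (Suc n)
    define \<rho> where "\<rho> = first_time (\<lambda>u. x u \<ge> y + c / 2) (crossing_sigma x y c s t n) t"
    have S: "crossing_sigma x y c s t (Suc n) = first_time (\<lambda>u. x u < y - c / 2) \<rho> t"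
      by (simp add: \<rho>_def)
    obtain v where v: "\<rho> \<le> ereal v" "v \<le> t" "x v < y - c / 2" "v \<le> w"
    proof (cases "crossing_sigma x y c s t (Suc n) < ereal w")
      case True
      then obtain v where "\<rho> \<le> ereal v" "v \<le> t" "x v < y - c / 2" "ereal v < ereal w"
        unfolding S by (rule first_time_lessD)
      then show thesis using that by simp
    next
      case False
      then have *: "crossing_sigma x y c s t (Suc n) \<le> ereal t" "w = t" using Suc.prems by auto
      have "crossing_sigma x y c s t (Suc n) < \<infinity>" using *(1) by (rule le_less_trans) simp
      then obtain v where "\<rho> \<le> ereal v" "v \<le> t" "x v < y - c / 2"
        unfolding S by (rule first_time_lessD)
      then show thesis using that * by simp
    qed
    have s\<sigma>: "ereal s \<le> crossing_sigma x y c s t n" by (rule crossing_sigma_ge)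
    also have \<sigma>\<rho>: "crossing_sigma x y c s t n \<le> \<rho>" unfolding \<rho>_def by (rule first_time_ge)
    finally have s\<rho>: "ereal s \<le> \<rho>" .
    obtain r where r: "\<rho> = ereal r" using s\<rho> v(1) by (cases \<rho>) auto
    have "- x r \<le> - (y + c / 2) \<and> r \<in> {s..t}"
      by (rule first_time_closure[OF r[unfolded \<rho>_def] s\<sigma>])
         (use cont in \<open>auto intro: continuous_on_minus\<close>)
    then have xr: "y + c / 2 \<le> x r" "r \<in> {s..t}" by auto
    have rv: "r < v"
    proof -
      have "r \<le> v" using v(1) r by simp
      moreover have "r \<noteq> v" using xr v(3) c by auto
      ultimately show ?thesis by simp
    qed
    \<comment> \<open>The order is strict because the path is at most \<open>y - c / 2\<close> at
      the one time and at least \<open>y + c / 2\<close> at the other; this is what the induction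
      hypothesis requires at \<open>w = r\<close>.\<close>
    have "n = 0 \<or> crossing_sigma x y c s t n < ereal r"
    proof (cases n)
      case (Suc k)
      have "crossing_sigma x y c s t n \<noteq> ereal r"
      proof
        assume *: "crossing_sigma x y c s t n = ereal r"
        have "x r \<le> y - c / 2 \<and> r \<in> {s..t}"
        proof (rule first_time_closure)
          show "first_time (\<lambda>u. x u < y - c / 2)
             (first_time (\<lambda>u. x u \<ge> y + c / 2) (crossing_sigma x y c s t k) t) t = ereal r"
            using * Suc by simp
          show "ereal s \<le> first_time (\<lambda>u. x u \<ge> y + c / 2) (crossing_sigma x y c s t k) t"
            using crossing_sigma_ge first_time_ge by (rule order_trans)
        qed (use cont in auto)
        then show False using xr c by auto
      qed
      then show ?thesis using \<sigma>\<rho> r by (simp add: order_le_neq_trans)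
    qed simp
    then obtain P where P: "P \<in> downs y c x ({s..t} \<inter> {..r})" "card P = n" using Suc.IH[of r] by blast
    have P': "P \<in> segs ({s..t} \<inter> {..w})"
      using P(1) segs_mono[of "{s..t} \<inter> {..r}" "{s..t} \<inter> {..w}"] rv v by (auto simp: downs_def)
    have "snd p \<le> r" if "p \<in> P" for p
      using P(1) that segs_mem[of P "{s..t} \<inter> {..r}" p] by (auto simp: downs_def)
    from segs_insert[OF P' this rv] have I: "insert (r, v) P \<in> segs ({s..t} \<inter> {..w})" "(r, v) \<notin> P"
      using xr rv v by auto
    have "insert (r, v) P \<in> downs y c x ({s..t} \<inter> {..w})"
      using I(1) P(1) xr v by (simp add: downs_def)
    moreover have "card (insert (r, v) P) = Suc n" using P(2) I segs_finite[OF P'] by simp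
    ultimately show ?case by blast
  qed
  moreover have "{s..t} \<inter> {..t} = {s..t}" by auto
  ultimately show ?thesis using le by metis
qed

section \<open>The play operator and its total variation\<close>

primrec play :: "real \<Rightarrow> (nat \<Rightarrow> real) \<Rightarrow> nat \<Rightarrow> real" where
  "play h X 0 = X 0"
| "play h X (Suc k) = max (X (Suc k) - h) (min (X (Suc k) + h) (play h X k))"

lemma play_bounds: "0 \<le> h \<Longrightarrow> X k - h \<le> play h X k \<and> play h X k \<le> X k + h"
  by (cases k) auto

lemma play_uminus: "0 \<le> h \<Longrightarrow> play h (\<lambda>k. - X k) k = - play h X k"
  by (induction k) (auto simp: max_def min_def)

text \<open>\<open>S\<close> stands for the truncated variation with threshold \<open>2 * h\<close>
  up to a grid time. When the play is pushed up it lands at the input minus \<open>h\<close>, when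
  pushed down at the input plus \<open>h\<close>, so a rise or fall between two turning points is
  shorter than the increment of the input by \<open>2 * h\<close>. The very first movement starts
  from the input itself, which accounts for the additional \<open>h\<close>.\<close>

lemma play_variation_le:
  assumes h: "0 \<le> h"
    and S: "\<And>i j. i \<le> j \<Longrightarrow> S i + max (\<bar>X j - X i\<bar> - 2 * h) 0 \<le> S j"
  shows "(\<Sum>k<n. \<bar>play h X (Suc k) - play h X k\<bar>) \<le> S n - S 0 + h"
proof -
  let ?W = "\<lambda>n. \<Sum>k<n. \<bar>play h X (Suc k) - play h X k\<bar>"
  \<comment> \<open>The second and third clauses remember a starting point for a rise and for a
    fall. An upward move leaves \<open>W - z\<close> unchanged and so keeps the old
    \<open>i\<close>, while a downward move to \<open>X + h\<close> makes the current index the new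
    \<open>i\<close>; the third clause is the mirror image.\<close>
  have "?W n + S 0 - h \<le> S n \<and> (\<exists>i\<le>n. ?W n + S 0 - play h X n \<le> S i - X i) \<and>
      (\<exists>i\<le>n. ?W n + S 0 + play h X n \<le> S i + X i)"
  proof (induction n)
    case 0
    then show ?case using h by simp
  next
    case (Suc n)
    define z z' W where "z = play h X n" and "z' = play h X (Suc n)" and "W = ?W n"
    have W': "?W (Suc n) = W + \<bar>z' - z\<bar>" by (simp add: z_def z'_def W_def)
    from Suc obtain i j where i: "i \<le> n" "W + S 0 - z \<le> S i - X i"
      and j: "j \<le> n" "W + S 0 + z \<le> S j + X j" and W: "W + S 0 - h \<le> S n"
      unfolding z_def W_def by blast
    have Si: "S i + (X (Suc n) - X i - 2 * h) \<le> S (Suc n)" using S[of i "Suc n"] i by auto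
    have Sj: "S j + (X j - X (Suc n) - 2 * h) \<le> S (Suc n)" using S[of j "Suc n"] j by auto
    have Sn: "S n \<le> S (Suc n)" using S[of n "Suc n"] by auto
    have "z' = max (X (Suc n) - h) (min (X (Suc n) + h) z)" by (simp add: z_def z'_def)
    then consider "z < z'" "z' = X (Suc n) - h" | "z' < z" "z' = X (Suc n) + h" | "z' = z"
      using h by linarith
    then have "W + \<bar>z' - z\<bar> + S 0 - h \<le> S (Suc n) \<and>
        (\<exists>i\<le>Suc n. W + \<bar>z' - z\<bar> + S 0 - z' \<le> S i - X i) \<and>
        (\<exists>i\<le>Suc n. W + \<bar>z' - z\<bar> + S 0 + z' \<le> S i + X i)"
    proof cases
      case 1
      then have "W + \<bar>z' - z\<bar> + S 0 - h \<le> S (Suc n)" using i Si by linarith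
      moreover have "W + \<bar>z' - z\<bar> + S 0 - z' \<le> S i - X i" using 1 i by linarith
      moreover have "W + \<bar>z' - z\<bar> + S 0 + z' \<le> S (Suc n) + X (Suc n)" using 1 i Si by linarith
      ultimately show ?thesis using i(1) by (meson le_SucI le_refl)
    next
      case 2
      then have "W + \<bar>z' - z\<bar> + S 0 - h \<le> S (Suc n)" using j Sj by linarith
      moreover have "W + \<bar>z' - z\<bar> + S 0 - z' \<le> S (Suc n) - X (Suc n)" using 2 j Sj by linarith
      moreover have "W + \<bar>z' - z\<bar> + S 0 + z' \<le> S j + X j" using 2 j by linarith
      ultimately show ?thesis using j(1) by (meson le_SucI le_refl)
    next
      case 3
      then have "W + \<bar>z' - z\<bar> + S 0 - h \<le> S (Suc n)" "W + \<bar>z' - z\<bar> + S 0 - z' \<le> S i - X i"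
        "W + \<bar>z' - z\<bar> + S 0 + z' \<le> S j + X j" using i j W Sn by linarith+
      then show ?thesis using i(1) j(1) by (meson le_SucI)
    qed
    then show ?case unfolding W' z'_def[symmetric] .
  qed
  then show ?thesis by linarith
qed

section \<open>Uniform grids and the counting of downcrossings\<close>

definition grid_index :: "nat \<Rightarrow> real \<Rightarrow> real \<Rightarrow> real \<Rightarrow> nat" where
  "grid_index N s t u = nat \<lfloor>(u - s) / (t - s) * real N\<rfloor>"

definition grid_point :: "nat \<Rightarrow> real \<Rightarrow> real \<Rightarrow> nat \<Rightarrow> real" where
  "grid_point N s t j = s + (t - s) * (real j / real N)"

lemma grid_index:
  assumes "u \<in> {s..t}" "0 < N"
  shows "grid_index N s t u \<le> N" "\<bar>u - grid_point N s t (grid_index N s t u)\<bar> \<le> (t - s) / N"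
proof -
  define w where "w = (u - s) / (t - s) * real N"
  have w0: "0 \<le> w" using assms by (simp add: w_def)
  have "(u - s) / (t - s) \<le> 1" using assms by (auto simp: divide_le_eq_1)
  then have "w \<le> 1 * real N" unfolding w_def by (rule mult_right_mono) simp
  then show "grid_index N s t u \<le> N"
    unfolding grid_index_def w_def[symmetric] by (simp add: floor_le_iff nat_le_iff)
  have u: "u = s + (t - s) * (w / real N)" using assms by (auto simp: w_def)
  have "grid_point N s t (grid_index N s t u) = s + (t - s) * (real_of_int \<lfloor>w\<rfloor> / real N)"
    using w0 unfolding grid_index_def grid_point_def w_def[symmetric] by simp
  then have "u - grid_point N s t (grid_index N s t u) = (t - s) * ((w - real_of_int \<lfloor>w\<rfloor>) / N)"
    by (subst u) (simp add: right_diff_distrib diff_divide_distrib)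
  moreover have "0 \<le> w - real_of_int \<lfloor>w\<rfloor>" "w - real_of_int \<lfloor>w\<rfloor> \<le> 1" by linarith+
  moreover have "s \<le> t" using assms by auto
  moreover have "(t - s) * ((w - real_of_int \<lfloor>w\<rfloor>) / N) \<le> (t - s) * (1 / N)"
    using calculation by (intro mult_left_mono divide_right_mono) auto
  ultimately show "\<bar>u - grid_point N s t (grid_index N s t u)\<bar> \<le> (t - s) / N" by simp
qed

lemma grid_point_bounds:
  assumes "s \<le> t" "0 < N" "j \<le> N" shows "grid_point N s t j \<in> {s..t}"
proof -
  have "0 \<le> real j / real N" "real j / real N \<le> 1" using assms by simp_all
  then show ?thesis using assms(1) mult_left_mono[of "real j / real N" 1 "t - s"]
    by (simp add: grid_point_def)
qed

lemma grid_point_mono: "s \<le> t \<Longrightarrow> i \<le> j \<Longrightarrow> grid_point N s t i \<le> grid_point N s t j"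
  unfolding grid_point_def by (intro add_left_mono mult_left_mono divide_right_mono) auto

lemma grid_index_mono:
  assumes "u \<le> v" "s \<le> t" shows "grid_index N s t u \<le> grid_index N s t v"
  unfolding grid_index_def using assms
  by (intro nat_mono floor_mono mult_right_mono divide_right_mono) auto

lemma uniform_grid:
  fixes x :: "real \<Rightarrow> real"
  assumes "continuous_on {s..t} x" "0 < \<eta>"
  obtains N where "0 < N"
    "\<And>u. u \<in> {s..t} \<Longrightarrow> \<bar>x u - x (grid_point N s t (grid_index N s t u))\<bar> < \<eta>"
proof -
  have "uniformly_continuous_on {s..t} x"
    using assms(1) by (intro compact_uniformly_continuous) auto
  then obtain d where d: "d > 0"
    "\<And>u v. u \<in> {s..t} \<Longrightarrow> v \<in> {s..t} \<Longrightarrow> dist v u < d \<Longrightarrow> dist (x v) (x u) < \<eta>"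
    using assms(2) unfolding uniformly_continuous_on_def by meson
  obtain N :: nat where N: "max 1 ((t - s) / d) < N" using reals_Archimedean2 by blast
  then have N0: "0 < N" by simp
  have Nd: "(t - s) / N < d" using N N0 d(1) by (simp add: field_simps)
  show thesis
  proof (rule that[OF N0])
    fix u assume u: "u \<in> {s..t}"
    have "dist u (grid_point N s t (grid_index N s t u)) < d"
      using grid_index(2)[OF u N0] Nd by (simp add: dist_real_def)
    moreover have "grid_point N s t (grid_index N s t u) \<in> {s..t}"
      using grid_point_bounds[OF _ N0 grid_index(1)[OF u N0]] u by simp
    ultimately show "\<bar>x u - x (grid_point N s t (grid_index N s t u))\<bar> < \<eta>"
      using d(2)[of "grid_point N s t (grid_index N s t u)" u] u by (simp add: dist_real_def)
  qed
qed

text \<open>The half width \<open>c / 2\<close> is split into the tolerance \<open>h\<close> of the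
  play and the slack \<open>\<eta>\<close> for replacing times by grid points. After rounding, each
  interval of the chain takes the play from above \<open>y\<close> to at most \<open>y\<close>, so
  the play passes \<open>y\<close> downwards in one of its grid steps; disjoint intervals use
  different steps.\<close>

lemma card_downs_le:
  assumes P: "P \<in> downs y c x {s..t}" and N: "0 < N" and h: "0 \<le> h" and c: "c / 2 = h + \<eta>"
    and close: "\<And>u. u \<in> {s..t} \<Longrightarrow> \<bar>x u - x (grid_point N s t (grid_index N s t u))\<bar> < \<eta>"
  defines "z \<equiv> play h (\<lambda>j. x (grid_point N s t j))"
  shows "card P \<le> card {k\<in>{..<N}. z (Suc k) \<le> y \<and> y < z k}"
proof (cases "P = {}")
  case False
  let ?j = "grid_index N s t"
  have seg: "P \<in> segs {s..t}" using P by (simp add: downs_def)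
  have st: "s \<le> t" using False segs_mem[OF seg] by fastforce
  have "\<exists>k. ?j (fst p) \<le> k \<and> k < ?j (snd p) \<and> z (Suc k) \<le> y \<and> y < z k" if p: "p \<in> P" for p
  proof -
    have m: "fst p \<in> {s..t}" "snd p \<in> {s..t}" "fst p < snd p" using segs_mem[OF seg p] by blast+
    have pp: "y + c / 2 \<le> x (fst p)" "x (snd p) < y - c / 2" using P p by (auto simp: downs_def)
    have zf: "y < z (?j (fst p))"
      using close[OF m(1)] pp c play_bounds[OF h, of "\<lambda>j. x (grid_point N s t j)" "?j (fst p)"]
      unfolding z_def by linarith
    have zs: "z (?j (snd p)) \<le> y"
      using close[OF m(2)] pp c play_bounds[OF h, of "\<lambda>j. x (grid_point N s t j)" "?j (snd p)"]
      unfolding z_def by linarith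
    have le: "?j (fst p) \<le> ?j (snd p)" using grid_index_mono m st by simp
    show ?thesis
    proof (rule ccontr)
      assume *: "\<not> ?thesis"
      have "?j (fst p) \<le> k \<Longrightarrow> k \<le> ?j (snd p) \<Longrightarrow> y < z k" for k
      proof (induction k rule: dec_induct)
        case base
        then show ?case using zf by simp
      next
        case (step k)
        then have "y < z k" by simp
        then show ?case using * step by (metis Suc_le_eq not_less)
      qed
      then show False using zs le by fastforce
    qed
  qed
  then obtain \<kappa> where \<kappa>: "\<And>p. p \<in> P \<Longrightarrow> ?j (fst p) \<le> \<kappa> p \<and> \<kappa> p < ?j (snd p) \<and> z (Suc (\<kappa> p)) \<le> y \<and> y < z (\<kappa> p)"
    by metis
  have "inj_on \<kappa> P"
  proof (rule inj_onI, rule ccontr)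
    fix p q assume pq: "p \<in> P" "q \<in> P" "\<kappa> p = \<kappa> q" "p \<noteq> q"
    then have "snd p \<le> fst q \<or> snd q \<le> fst p" using segs_disj[OF seg] by blast
    then have "?j (snd p) \<le> ?j (fst q) \<or> ?j (snd q) \<le> ?j (fst p)" using grid_index_mono st by blast
    then show False using \<kappa>[OF pq(1)] \<kappa>[OF pq(2)] pq(3) by auto
  qed
  moreover have "\<kappa> ` P \<subseteq> {k\<in>{..<N}. z (Suc k) \<le> y \<and> y < z k}"
  proof
    fix k assume "k \<in> \<kappa> ` P"
    then obtain p where p: "p \<in> P" "k = \<kappa> p" by blast
    then show "k \<in> {k\<in>{..<N}. z (Suc k) \<le> y \<and> y < z k}"
      using \<kappa>[OF p(1)] grid_index(1)[OF _ N, of "snd p" s t] segs_mem[OF seg p(1)] by auto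
  qed
  ultimately show ?thesis by (rule card_inj_on_le) simp
qed simp

text \<open>Combines the two translations between crossing times and chains. Passing from the
  maximum to smaller \<open>n\<close> is possible because subfamilies of a chain are chains.\<close>

lemma downcrossings_iff:
  assumes cont: "continuous_on {s..t} x" and c: "0 < c" and st: "s \<le> t"
  shows "n \<le> downcrossings y c x s t \<longleftrightarrow> (\<exists>P\<in>downs y c x {s..t}. card P = n)"
proof -
  let ?A = "{n. crossing_sigma x y c s t n \<le> ereal t}"
  have A: "n \<in> ?A \<longleftrightarrow> (\<exists>P\<in>downs y c x {s..t}. card P = n)" for n
    using downs_of_sigma[OF cont c] sigma_le_of_downs[OF _ st] by blast
  obtain N where N: "0 < N"
    "\<And>u. u \<in> {s..t} \<Longrightarrow> \<bar>x u - x (grid_point N s t (grid_index N s t u))\<bar> < c / 2"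
    using uniform_grid[OF cont, of "c / 2"] c by auto
  have "n \<le> N" if n: "n \<in> ?A" for n
  proof -
    obtain P where P: "P \<in> downs y c x {s..t}" "card P = n" using n A by blast
    \<comment> \<open>With tolerance \<open>0\<close> the play is the sampled path. Only the bound
      by the number \<open>N\<close> of grid steps matters here: it makes the set inside
      \<open>Max\<close> finite.\<close>
    let ?z = "play 0 (\<lambda>j. x (grid_point N s t j))"
    have "card P \<le> card {k\<in>{..<N}. ?z (Suc k) \<le> y \<and> y < ?z k}"
      by (rule card_downs_le[OF P(1) N(1) _ _ N(2)]) simp_all
    also have "\<dots> \<le> card {..<N}" by (intro card_mono) auto
    finally show ?thesis using P by simp
  qed
  then have fin: "finite ?A" by (meson finite_nat_set_iff_bounded_le)
  have "0 \<in> ?A" using st by simp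
  then have ne: "?A \<noteq> {}" by blast
  have M: "downcrossings y c x s t \<in> ?A" unfolding downcrossings_def using fin ne by (rule Max_in)
  show ?thesis
  proof
    assume n: "n \<le> downcrossings y c x s t"
    obtain P where P: "P \<in> downs y c x {s..t}" "card P = downcrossings y c x s t" using M A by blast
    obtain Q where Q: "Q \<subseteq> P" "card Q = n" using n P by (metis obtain_subset_with_card_n)
    then have "Q \<in> downs y c x {s..t}" using P(1) segs_subset unfolding downs_def by blast
    then show "\<exists>P\<in>downs y c x {s..t}. card P = n" using Q by blast
  next
    assume "\<exists>P\<in>downs y c x {s..t}. card P = n"
    then have "n \<in> ?A" using A by blast
    then show "n \<le> downcrossings y c x s t" unfolding downcrossings_def using fin by simp
  qed
qed

lemma card_downs_le_downcrossings:
  assumes "continuous_on {s..t} x" "0 < c" "s \<le> t" "P \<in> downs y c x {s..t}"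
  shows "card P \<le> downcrossings y c x s t"
  using downcrossings_iff[OF assms(1-3)] assms(4) by blast

lemma downcrossings_superadditive:
  assumes cont: "continuous_on {a..b} x" and c: "0 < c" and m: "a \<le> m" "m \<le> b"
  shows "downcrossings y c x a m + downcrossings y c x m b \<le> downcrossings y c x a b"
proof -
  have c1: "continuous_on {a..m} x" and c2: "continuous_on {m..b} x"
    using m by (auto intro: continuous_on_subset[OF cont])
  obtain P where P: "P \<in> downs y c x {a..m}" "card P = downcrossings y c x a m"
    using downcrossings_iff[OF c1 c m(1)] by blast
  obtain Q where Q: "Q \<in> downs y c x {m..b}" "card Q = downcrossings y c x m b"
    using downcrossings_iff[OF c2 c m(2)] by blast
  have PQ: "P \<in> segs {a..m}" "Q \<in> segs {m..b}" using P(1) Q(1) by (simp_all add: downs_def)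
  have "{a..m} \<subseteq> {..m}" "{m..b} \<subseteq> {m..}" by auto
  note U = segs_Un[OF PQ this]
  have "{a..m} \<union> {m..b} = {a..b}" using m by auto
  then have "P \<union> Q \<in> downs y c x {a..b}" using U(1) P(1) Q(1) unfolding downs_def by fastforce
  then have "card (P \<union> Q) \<le> downcrossings y c x a b"
    using card_downs_le_downcrossings[OF cont c] m by simp
  then show ?thesis using P Q U(2) segs_finite PQ by (simp add: card_Un_disjoint)
qed

lemma crossings_superadditive:
  assumes "continuous_on {a..b} x" "0 < c" "a \<le> m" "m \<le> b"
  shows "crossings y c x a m + crossings y c x m b \<le> crossings y c x a b"
proof -
  have "continuous_on {a..b} (\<lambda>u. - x u)" using assms(1) by (rule continuous_on_minus)
  from downcrossings_superadditive[OF this assms(2-4), of "- y"]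
    downcrossings_superadditive[OF assms, of y]
  show ?thesis unfolding crossings_def upcrossings_def by linarith
qed

text \<open>The band around \<open>y\<close> can only be crossed by passing through
  \<open>y\<close>. This confines the crossings made in a short time to levels near the position of
  the path.\<close>

lemma crossings_range:
  assumes cont: "continuous_on {s..t} x" and c: "0 < c" and st: "s \<le> t"
    and pos: "crossings y c x s t \<noteq> 0"
  shows "y \<in> x ` {s..t}"
proof -
  have *: "\<exists>u\<in>{s..t}. f u = z" if f: "continuous_on {s..t} f" "0 < downcrossings z c f s t" for f z
  proof -
    have "1 \<le> downcrossings z c f s t" using f(2) by simp
    then obtain P where P: "P \<in> downs z c f {s..t}" "card P = 1"
      using downcrossings_iff[OF f(1) c st, of 1 z] by blast
    then obtain p where p: "p \<in> P" by (metis card_1_singletonE insertI1)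
    have seg: "P \<in> segs {s..t}" using P by (simp add: downs_def)
    have pp: "fst p \<in> {s..t}" "snd p \<in> {s..t}" "fst p < snd p" using segs_mem[OF seg p] by blast+
    have "z \<le> f (fst p)" "f (snd p) \<le> z" using P(1) p c by (fastforce simp: downs_def)+
    moreover have "continuous_on {fst p..snd p} f"
      using pp by (intro continuous_on_subset[OF f(1)]) auto
    ultimately obtain u where "fst p \<le> u" "u \<le> snd p" "f u = z"
      using IVT2'[of f "snd p" z "fst p"] pp by auto
    then show ?thesis using pp by (intro bexI[of _ u]) auto
  qed
  have "0 < downcrossings y c x s t \<or> 0 < downcrossings (- y) c (\<lambda>u. - x u) s t"
    using pos by (auto simp: crossings_def upcrossings_def)
  then have "(\<exists>u\<in>{s..t}. x u = y) \<or> (\<exists>u\<in>{s..t}. - x u = - y)"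
    using *[OF cont] *[OF continuous_on_minus[OF cont]] by blast
  then show ?thesis by auto
qed

text \<open>The index set may be uncountable. The union of the open intervals is open, and the right
  ends left over form a countable set: each of them is preceded by a nonempty interval free of other
  such points, which contains a rational.\<close>

lemma borel_Union_greaterThanAtMost:
  fixes f g :: "'i \<Rightarrow> real"
  shows "(\<Union>i\<in>I. {f i<..g i}) \<in> sets borel"
proof -
  define U where "U = (\<Union>i\<in>I. {f i<..<g i})"
  define E where "E = (\<Union>i\<in>I. {f i<..g i}) - U"
  have "\<forall>b\<in>E. \<exists>i\<in>I. f i < b \<and> b = g i"
  proof
    fix b assume "b \<in> E"
    then obtain i where "i \<in> I" "f i < b" "b \<le> g i" "b \<notin> U" by (auto simp: E_def)
    then show "\<exists>i\<in>I. f i < b \<and> b = g i" by (intro bexI[of _ i]) (auto simp: U_def less_le)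
  qed
  then obtain i where i: "\<And>b. b \<in> E \<Longrightarrow> i b \<in> I \<and> f (i b) < b \<and> b = g (i b)" by metis
  have "\<forall>b\<in>E. \<exists>q::rat. f (i b) < of_rat q \<and> of_rat q < b" using i of_rat_dense by blast
  then obtain q :: "real \<Rightarrow> rat" where q: "\<And>b. b \<in> E \<Longrightarrow> f (i b) < of_rat (q b) \<and> of_rat (q b) < b" by metis
  have "inj_on q E"
  proof (rule linorder_inj_onI)
    fix b b' assume bb: "b < b'" "b \<in> E" "b' \<in> E"
    have "b \<notin> {f (i b')<..<g (i b')}" using bb(2) i[OF bb(3)] by (auto simp: E_def U_def)
    then have "b \<le> f (i b')" using bb i[OF bb(3)] by auto
    then show "q b \<noteq> q b'" using q[OF bb(2)] q[OF bb(3)] by auto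
  qed auto
  then have "countable E" by (rule countableI')
  have "E \<in> sets borel" by (rule sets.countable[OF _ \<open>countable E\<close>]) simp
  moreover have "U \<in> sets borel" unfolding U_def by (intro borel_open open_UN) auto
  moreover have "U \<subseteq> (\<Union>i\<in>I. {f i<..g i})" by (force simp: U_def)
  then have "(\<Union>i\<in>I. {f i<..g i}) = U \<union> E" by (auto simp: E_def)
  ultimately show ?thesis by simp
qed

text \<open>At least \<open>n\<close> downcrossings occur for those \<open>y\<close> that lie, for
  some chain of \<open>n\<close> intervals, strictly above all end values plus \<open>c / 2\<close>
  and not above any start value minus \<open>c / 2\<close>: a union, in general uncountable, of
  half-open intervals.\<close>

lemma measurable_downcrossings [measurable]:
  assumes cont: "continuous_on {s..t} x" and c: "0 < c" and st: "s \<le> t"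
  shows "(\<lambda>y. downcrossings y c x s t) \<in> measurable borel (count_space UNIV)"
proof (rule measurableI)
  have atLeast: "{y. n \<le> downcrossings y c x s t} \<in> sets borel" for n
  proof (cases "n = 0")
    case False
    have "{y. n \<le> downcrossings y c x s t} = (\<Union>P\<in>{P\<in>segs {s..t}. card P = n}.
        {Max ((\<lambda>p. x (snd p) + c / 2) ` P) <.. Min ((\<lambda>p. x (fst p) - c / 2) ` P)})" (is "_ = ?R")
    proof -
      have "P \<in> downs y c x {s..t} \<longleftrightarrow> y \<in> {Max ((\<lambda>p. x (snd p) + c / 2) ` P) <.. Min ((\<lambda>p. x (fst p) - c / 2) ` P)}"
        if "P \<in> segs {s..t}" "card P = n" for P y
      proof -
        have "finite P" "P \<noteq> {}" using that False segs_finite by auto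
        then show ?thesis using that(1)
          by (auto simp: downs_def less_diff_eq le_diff_eq)
      qed
      moreover have "P \<in> segs {s..t}" if "P \<in> downs y c x {s..t}" for P y
        using that by (simp add: downs_def)
      ultimately show ?thesis
        unfolding downcrossings_iff[OF cont c st] by blast
    qed
    then show ?thesis using borel_Union_greaterThanAtMost by simp
  qed simp
  fix A :: "nat set"
  have "(\<lambda>y. downcrossings y c x s t) -` A \<inter> space borel =
    (\<Union>n\<in>A. {y. n \<le> downcrossings y c x s t} - {y. Suc n \<le> downcrossings y c x s t})"
  proof -
    have *: "d \<in> A \<longleftrightarrow> (\<exists>n\<in>A. n \<le> d \<and> \<not> Suc n \<le> d)" for d
    proof
      assume "\<exists>n\<in>A. n \<le> d \<and> \<not> Suc n \<le> d"
      then obtain n where "n \<in> A" "n = d" by (metis le_antisym not_less_eq_eq)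
      then show "d \<in> A" by simp
    qed (rule bexI[of _ d], simp_all)
    show ?thesis
      using *[of "downcrossings _ c x s t"] by (intro set_eqI) (simp only: vimage_eq UN_iff Diff_iff mem_Collect_eq Int_iff space_borel UNIV_I simp_thms)
  qed
  also have "\<dots> \<in> sets borel"
    using atLeast by (intro sets.countable_UN'' sets.Diff) auto
  finally show "(\<lambda>y. downcrossings y c x s t) -` A \<inter> space borel \<in> sets borel" .
qed simp

lemma measurable_crossings:
  assumes cont: "continuous_on {s..t} x" and c: "0 < c" and st: "s \<le> t"
  shows "(\<lambda>y. crossings y c x s t) \<in> measurable borel (count_space UNIV)"
proof -
  have "(\<lambda>y. upcrossings y c x s t) \<in> measurable borel (count_space UNIV)"
    unfolding upcrossings_def using cont c st
    by (intro measurable_compose[OF _ measurable_downcrossings]) (auto intro: continuous_on_minus)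
  then show ?thesis
    unfolding crossings_def using measurable_downcrossings[OF assms] by measurable
qed

text \<open>An interval of the family carries the path across the band for every centre
  \<open>y\<close> from a half-open interval of length \<open>gain c x p\<close>, so integrating
  over \<open>y\<close> the number of intervals that do so gives the total gain.\<close>

lemma nn_integral_crossings_ge:
  assumes cont: "continuous_on {s..t} x" and c: "0 < c" and st: "s \<le> t"
  shows "tvs c x {s..t} \<le> (\<integral>\<^sup>+y. of_nat (crossings y c x s t) \<partial>lborel)"
proof (rule tvs_least)
  fix P assume P: "P \<in> segs {s..t}"
  let ?d = "\<lambda>p. {x (snd p) + c / 2<..x (fst p) - c / 2}" and ?u = "\<lambda>p. {x (fst p) + c / 2..<x (snd p) - c / 2}"
  have g: "ennreal (gain c x p) = (\<integral>\<^sup>+y. indicator (?d p) y + indicator (?u p) y \<partial>lborel)" for p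
  proof -
    have "(\<integral>\<^sup>+y. indicator (?d p) y + indicator (?u p) y \<partial>lborel) = emeasure lborel (?d p) + emeasure lborel (?u p)"
      by (subst nn_integral_add) auto
    also have "\<dots> = ennreal (max (x (fst p) - x (snd p) - c) 0) + ennreal (max (x (snd p) - x (fst p) - c) 0)"
      by (intro arg_cong2[where f="(+)"]; cases "x (fst p) - x (snd p) \<ge> c"; cases "x (snd p) - x (fst p) \<ge> c")
         (auto simp: max_def algebra_simps)
    also have "\<dots> = ennreal (gain c x p)"
      using c by (auto simp: gain_def max_def simp flip: ennreal_plus)
    finally show ?thesis by simp
  qed
  have "ennreal (sum (gain c x) P) = (\<Sum>p\<in>P. ennreal (gain c x p))" by (simp add: sum_ennreal)
  also have "\<dots> = (\<integral>\<^sup>+y. (\<Sum>p\<in>P. indicator (?d p) y + indicator (?u p) y) \<partial>lborel)"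
    unfolding g by (rule nn_integral_sum[symmetric]) auto
  also have "\<dots> \<le> (\<integral>\<^sup>+y. of_nat (crossings y c x s t) \<partial>lborel)"
  proof (rule nn_integral_mono)
    fix y :: real
    have fin: "finite P" using P by (rule segs_finite)
    define Pd where "Pd = {p\<in>P. y \<in> ?d p}"
    define Pu where "Pu = {p\<in>P. y \<in> ?u p}"
    have "\<forall>p\<in>Pd. y + c / 2 \<le> x (fst p) \<and> x (snd p) < y - c / 2"
      by (simp add: Pd_def less_diff_eq le_diff_eq)
    moreover have "Pd \<in> segs {s..t}" by (rule segs_subset[OF P]) (simp add: Pd_def)
    ultimately have "Pd \<in> downs y c x {s..t}" by (simp add: downs_def)
    then have 1: "card Pd \<le> downcrossings y c x s t"
      by (rule card_downs_le_downcrossings[OF cont c st])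
    have "\<forall>p\<in>Pu. - y + c / 2 \<le> - x (fst p) \<and> - x (snd p) < - y - c / 2"
      by (simp add: Pu_def)
    moreover have "Pu \<in> segs {s..t}" by (rule segs_subset[OF P]) (simp add: Pu_def)
    ultimately have "Pu \<in> downs (- y) c (\<lambda>u. - x u) {s..t}" by (simp add: downs_def)
    then have 2: "card Pu \<le> upcrossings y c x s t"
      unfolding upcrossings_def using cont c st
      by (intro card_downs_le_downcrossings) (auto intro: continuous_on_minus)
    have "(\<Sum>p\<in>P. indicator (?d p) y + indicator (?u p) y :: ennreal) = of_nat (card Pd) + of_nat (card Pu)"
      using fin unfolding Pd_def Pu_def
      by (simp add: sum.distrib indicator_def sum.If_cases Int_def del: greaterThanAtMost_iff atLeastLessThan_iff)
    also have "\<dots> \<le> of_nat (crossings y c x s t)"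
      using 1 2 unfolding crossings_def of_nat_add[symmetric] by (intro of_nat_mono) simp
    finally show "(\<Sum>p\<in>P. indicator (?d p) y + indicator (?u p) y :: ennreal) \<le> of_nat (crossings y c x s t)" .
  qed
  finally show "ennreal (sum (gain c x) P) \<le> (\<integral>\<^sup>+y. of_nat (crossings y c x s t) \<partial>lborel)" .
qed

text \<open>The crossings of the bands are bounded by the level crossings of the play of the sampled
  path, and the integral of the latter over all levels is the total variation of the play. The slack
  needed for sampling turns \<open>c\<close> into a smaller \<open>c'\<close>; the term
  \<open>c' / 2\<close> is the initial loss in \<open>play_variation_le\<close>.\<close>

lemma nn_integral_crossings_le:
  assumes cont: "continuous_on {s..t} x" and c: "0 < c'" "c' < c" and st: "s \<le> t"
  shows "(\<integral>\<^sup>+y. of_nat (crossings y c x s t) \<partial>lborel) \<le> tvs c' x {s..t} + ennreal (c' / 2)"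
proof -
  define h where "h = c' / 2"
  define \<eta> where "\<eta> = c / 2 - h"
  have \<eta>: "0 < \<eta>" "c / 2 = h + \<eta>" "0 \<le> h" using c by (auto simp: \<eta>_def h_def)
  obtain N where N: "0 < N"
    "\<And>u. u \<in> {s..t} \<Longrightarrow> \<bar>x u - x (grid_point N s t (grid_index N s t u))\<bar> < \<eta>"
    using uniform_grid[OF cont \<eta>(1)] by blast
  define X where "X = (\<lambda>j. x (grid_point N s t j))"
  define z where "z = play h X"
  let ?d = "\<lambda>k. {z (Suc k)..<z k}" and ?u = "\<lambda>k. {z k<..z (Suc k)}"
  have cr: "of_nat (crossings y c x s t) \<le> (\<Sum>k<N. indicator (?d k) y + indicator (?u k) y :: ennreal)" for y
  proof -
    have c0: "0 < c" using c by simp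
    obtain P where P: "P \<in> downs y c x {s..t}" "card P = downcrossings y c x s t"
      using downcrossings_iff[OF cont c0 st] by blast
    have "continuous_on {s..t} (\<lambda>u. - x u)" using cont by (rule continuous_on_minus)
    then obtain Q where Q: "Q \<in> downs (- y) c (\<lambda>u. - x u) {s..t}" "card Q = upcrossings y c x s t"
      unfolding upcrossings_def using downcrossings_iff[OF _ c0 st] by blast
    have "card P \<le> card {k\<in>{..<N}. z (Suc k) \<le> y \<and> y < z k}"
      using card_downs_le[OF P(1) N(1) \<eta>(3) \<eta>(2) N(2)] by (simp add: z_def X_def)
    moreover have "card Q \<le> card {k\<in>{..<N}. - z (Suc k) \<le> - y \<and> - y < - z k}"
      using card_downs_le[OF Q(1) N(1) \<eta>(3) \<eta>(2)] N(2) play_uminus[OF \<eta>(3), of "\<lambda>j. x (grid_point N s t j)"]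
      by (simp add: z_def X_def abs_minus_commute del: play.simps)
    ultimately have "crossings y c x s t \<le> card {k\<in>{..<N}. z (Suc k) \<le> y \<and> y < z k} + card {k\<in>{..<N}. y \<le> z (Suc k) \<and> z k < y}"
      unfolding crossings_def using P(2) Q(2) by simp
    then have "(of_nat (crossings y c x s t) :: ennreal) \<le> of_nat (card {k\<in>{..<N}. z (Suc k) \<le> y \<and> y < z k} + card {k\<in>{..<N}. y \<le> z (Suc k) \<and> z k < y})"
      by (rule of_nat_mono)
    also have "\<dots> = (\<Sum>k<N. indicator (?d k) y + indicator (?u k) y)"
      by (simp add: sum.distrib indicator_def sum.If_cases Int_def conj_commute)
    finally show ?thesis .
  qed
  have "(\<integral>\<^sup>+y. of_nat (crossings y c x s t) \<partial>lborel) \<le> (\<integral>\<^sup>+y. (\<Sum>k<N. indicator (?d k) y + indicator (?u k) y) \<partial>lborel)"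
    by (intro nn_integral_mono cr)
  also have "\<dots> = (\<Sum>k<N. emeasure lborel (?d k) + emeasure lborel (?u k))"
    by (simp add: nn_integral_sum nn_integral_add)
  also have "\<dots> = (\<Sum>k<N. ennreal \<bar>z (Suc k) - z k\<bar>)"
  proof (rule sum.cong[OF refl])
    fix k
    show "emeasure lborel (?d k) + emeasure lborel (?u k) = ennreal \<bar>z (Suc k) - z k\<bar>"
      by (cases "z k \<le> z (Suc k)") auto
  qed
  also have "\<dots> = ennreal (\<Sum>k<N. \<bar>z (Suc k) - z k\<bar>)" by (simp add: sum_ennreal)
  also have "\<dots> \<le> ennreal (enn2real (tvs c' x {s..t}) + c' / 2)"
  proof (rule ennreal_leI)
    define S where "S i = enn2real (tvs c' x {s..grid_point N s t (min i N)})" for i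
    have g: "grid_point N s t (min i N) \<in> {s..t}" for i using grid_point_bounds[OF st N(1)] by simp
    have fin: "tvs c' x {a..b} < \<top>" if "s \<le> a" "b \<le> t" for a b
      using tvs_finite_continuous[OF _ c(1), of a b x] continuous_on_subset[OF cont, of "{a..b}"] that
      by (auto simp: infinity_ennreal_def)
    \<comment> \<open>\<open>play_variation_le\<close> requires its hypothesis at all indices, so
      the sampled path is frozen after the last grid point, as is \<open>S\<close>.\<close>
    define Y where "Y j = X (min j N)" for j
    have S: "S i + max (\<bar>Y j - Y i\<bar> - 2 * h) 0 \<le> S j" if ij: "i \<le> j" for i j
    proof -
      let ?a = "grid_point N s t (min i N)" and ?b = "grid_point N s t (min j N)"
      have ab: "?a \<le> ?b" using grid_point_mono[OF st] ij by (simp add: min.coboundedI1 min_le_iff_disj)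
      have "ennreal (gain c' x (?a, ?b)) \<le> tvs c' x {?a..?b}"
      proof (cases "?a = ?b")
        case True
        then show ?thesis using c by (simp add: gain_def)
      next
        case False
        then have "{(?a, ?b)} \<in> segs {?a..?b}" using ab by (simp add: segs_def)
        from tvs_upper[OF this, of c' x] show ?thesis by simp
      qed
      then have "tvs c' x {s..?a} + ennreal (gain c' x (?a, ?b)) \<le> tvs c' x {s..?a} + tvs c' x {?a..?b}"
        by (rule add_left_mono)
      also have "\<dots> \<le> tvs c' x ({s..?a} \<union> {?a..?b})"
        by (rule tvs_superadditive) auto
      also have "{s..?a} \<union> {?a..?b} = {s..?b}" using ab g[of i] by auto
      finally have "enn2real (tvs c' x {s..?a} + ennreal (gain c' x (?a, ?b))) \<le> S j"
        unfolding S_def using fin[of s ?b] g[of j] by (intro enn2real_mono) auto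
      also have "enn2real (tvs c' x {s..?a} + ennreal (gain c' x (?a, ?b))) = S i + gain c' x (?a, ?b)"
        unfolding S_def using fin[of s ?a] g[of i] by (subst enn2real_plus) auto
      finally show ?thesis by (simp add: gain_def Y_def X_def h_def)
    qed
    have zY: "k \<le> N \<Longrightarrow> play h Y k = z k" for k
      unfolding z_def by (induction k) (auto simp: Y_def)
    have "(\<Sum>k<N. \<bar>z (Suc k) - z k\<bar>) = (\<Sum>k<N. \<bar>play h Y (Suc k) - play h Y k\<bar>)"
      by (intro sum.cong refl) (simp add: zY del: play.simps)
    also have "\<dots> \<le> S N - S 0 + h" by (rule play_variation_le[OF \<eta>(3) S])
    also have "\<dots> \<le> enn2real (tvs c' x {s..t}) + c' / 2"
      using N(1) by (simp add: S_def grid_point_def h_def)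
    finally show "(\<Sum>k<N. \<bar>z (Suc k) - z k\<bar>) \<le> enn2real (tvs c' x {s..t}) + c' / 2" .
  qed
  also have "\<dots> = tvs c' x {s..t} + ennreal (c' / 2)"
    using tvs_finite_continuous[OF cont c(1)] c by (simp add: ennreal_plus infinity_ennreal_def)
  finally show ?thesis .
qed

section \<open>Gaussian laws and characteristic functions\<close>

text \<open>An image of the standard normal law, which treats the Dirac case \<open>v = 0\<close> on
  the same footing as the others.\<close>

lemma normal_law_eq_distr:
  assumes "0 \<le> v"
  shows "normal_law 0 v = distr std_normal_distribution borel (\<lambda>x. sqrt v * x)"
proof (cases "v = 0")
  case True
  interpret prob_space std_normal_distribution by (rule prob_space_normal_density) simp
  show ?thesis using True by (simp add: normal_law_def distr_const)
next
  case False
  interpret prob_space std_normal_distribution by (rule prob_space_normal_density) simp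
  have "distributed std_normal_distribution lborel (\<lambda>x. x) std_normal_density"
    unfolding distributed_def by (simp add: distr_id2)
  from normal_density_affine[OF this, of "sqrt v" 0] False assms
  have "distributed std_normal_distribution lborel (\<lambda>x. 0 + sqrt v * x) (normal_density 0 (sqrt v))"
    by simp
  then have "distr std_normal_distribution lborel (\<lambda>x. sqrt v * x) = density lborel (normal_density 0 (sqrt v))"
    by (simp add: distributed_def)
  then show ?thesis using False by (simp add: normal_law_def cong: distr_cong)
qed

lemma normal_law_moments:
  fixes X :: "'a \<Rightarrow> real"
  assumes [measurable]: "X \<in> borel_measurable M" and v: "0 \<le> v" and D: "distr M borel X = normal_law 0 v"
  shows "integrable M X" "integrable M (\<lambda>\<omega>. (X \<omega>)\<^sup>2)" "(\<integral>\<omega>. (X \<omega>)\<^sup>2 \<partial>M) = v"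
    "(CLINT \<omega>|M. iexp (X \<omega>)) = complex_of_real (exp (- v / 2))"
proof -
  have D': "distr M borel X = distr std_normal_distribution borel (\<lambda>x. sqrt v * x)"
    using D normal_law_eq_distr[OF v] by simp
  have int: "integrable M (\<lambda>\<omega>. f (X \<omega>)) \<longleftrightarrow> integrable std_normal_distribution (\<lambda>x. f (sqrt v * x))"
    if [measurable]: "f \<in> borel_measurable borel" for f :: "real \<Rightarrow> real"
    using integrable_distr_eq[of X M borel f] integrable_distr_eq[of "\<lambda>x. sqrt v * x" std_normal_distribution borel f] D'
    by simp
  have m1: "integrable std_normal_distribution (\<lambda>x. x)"
    using integrable_std_normal_distribution_moment[of 1] by simp
  have m2: "integrable std_normal_distribution (\<lambda>x. x\<^sup>2)"
    by (rule integrable_std_normal_distribution_moment)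
  have id: "(\<lambda>x::real. x) \<in> borel_measurable borel" "(\<lambda>x::real. x\<^sup>2) \<in> borel_measurable borel" by simp_all
  show "integrable M X"
    by (rule iffD2[OF int[OF id(1)]]) (rule integrable_mult_right[OF m1])
  show "integrable M (\<lambda>\<omega>. (X \<omega>)\<^sup>2)"
    by (rule iffD2[OF int[OF id(2)]]) (unfold power_mult_distrib, rule integrable_mult_right[OF m2])
  have "(\<integral>\<omega>. (X \<omega>)\<^sup>2 \<partial>M) = (\<integral>x. x\<^sup>2 \<partial>distr M borel X)" by (simp add: integral_distr)
  also have "\<dots> = v * (\<integral>x. x\<^sup>2 \<partial>std_normal_distribution)"
    unfolding D' using v by (simp add: integral_distr power_mult_distrib)
  also have "\<dots> = v" using std_normal_distribution_even_moments(1)[of 1] by simp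
  finally show "(\<integral>\<omega>. (X \<omega>)\<^sup>2 \<partial>M) = v" .
  have "(CLINT \<omega>|M. iexp (X \<omega>)) = (CLINT x|distr M borel X. iexp x)" by (simp add: integral_distr)
  also have "\<dots> = (CLINT x|std_normal_distribution. iexp (sqrt v * x))" unfolding D' by (simp add: integral_distr)
  also have "\<dots> = char std_normal_distribution (sqrt v)" by (simp add: char_def)
  also have "\<dots> = complex_of_real (exp (- v / 2))" using v by (simp add: char_std_normal_distribution)
  finally show "(CLINT \<omega>|M. iexp (X \<omega>)) = complex_of_real (exp (- v / 2))" .
qed

text \<open>Levy's uniqueness theorem concerns probability measures; the total mass is read off at
  frequency \<open>0\<close> and divided out.\<close>

lemma finite_measure_eq_of_char:
  fixes \<mu> \<nu> :: "real measure"
  assumes "finite_measure \<mu>" "finite_measure \<nu>" and sets: "sets \<mu> = sets borel" "sets \<nu> = sets borel"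
    and char: "char \<mu> = char \<nu>"
  shows "\<mu> = \<nu>"
proof -
  interpret m: finite_measure \<mu> by fact
  interpret n: finite_measure \<nu> by fact
  define a where "a = measure \<mu> UNIV"
  have sp: "space \<mu> = UNIV" "space \<nu> = UNIV"
    using sets_eq_imp_space_eq[OF sets(1)] sets_eq_imp_space_eq[OF sets(2)] by simp_all
  have "char \<mu> 0 = of_real (measure \<mu> UNIV)" "char \<nu> 0 = of_real (measure \<nu> UNIV)"
    by (simp_all add: char_def sp scaleR_conv_of_real)
  then have a': "a = measure \<nu> UNIV" using char by (simp add: a_def)
  show ?thesis
  proof (cases "a = 0")
    case True
    have "emeasure \<mu> A = 0" "emeasure \<nu> A = 0" for A
      using emeasure_space[of \<mu> A] emeasure_space[of \<nu> A] m.emeasure_eq_measure[of UNIV]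
        n.emeasure_eq_measure[of UNIV] True a' by (simp_all add: sp a_def)
    then show ?thesis using sets by (intro measure_eqI) simp_all
  next
    case False
    then have a0: "a > 0" by (simp add: a_def less_le)
    let ?d = "\<lambda>\<mu>. density \<mu> (\<lambda>_. ennreal (1 / a))"
    have dist: "real_distribution (?d \<kappa>)"
      if s: "sets \<kappa> = sets borel" "space \<kappa> = UNIV" "emeasure \<kappa> UNIV = ennreal a" for \<kappa>
    proof (rule real_distribution.intro)
      have "UNIV \<in> sets \<kappa>" using s by simp
      then have "emeasure (?d \<kappa>) UNIV = ennreal (1 / a) * ennreal a" using s
        by (subst emeasure_density_const) auto
      also have "\<dots> = 1" using a0 by (simp add: ennreal_mult[symmetric])
      finally show "prob_space (?d \<kappa>)" using s by (intro prob_spaceI) simp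
    qed (use s in \<open>simp add: real_distribution_axioms_def\<close>)
    have ch: "char (?d \<kappa>) = (\<lambda>t. char \<kappa> t / a)" if s: "sets \<kappa> = sets borel" for \<kappa>
    proof
      fix t
      have meas: "(\<lambda>x. iexp (t * x)) \<in> borel_measurable \<kappa>"
        unfolding measurable_cong_sets[OF s refl] by measurable
      show "char (?d \<kappa>) t = char \<kappa> t / a"
        using a0 meas unfolding char_def
        by (subst integral_density) (auto simp: scaleR_conv_of_real)
    qed
    have "?d \<mu> = ?d \<nu>"
    proof (rule Levy_uniqueness)
      show "real_distribution (?d \<mu>)" "real_distribution (?d \<nu>)"
        by (rule dist; simp add: sets sp a_def m.emeasure_eq_measure; fail)
          (rule dist; simp add: sets sp a' n.emeasure_eq_measure; fail)
      show "char (?d \<mu>) = char (?d \<nu>)" by (simp only: ch sets char)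
    qed
    moreover have "emeasure \<kappa> A = ennreal a * emeasure (?d \<kappa>) A" if "A \<in> sets \<kappa>" for \<kappa> A
      using that a0 by (simp add: emeasure_density_const mult.assoc[symmetric] ennreal_mult[symmetric])
    ultimately have "emeasure \<mu> A = emeasure \<nu> A" if "A \<in> sets \<mu>" for A
      using that sets by (metis (no_types))
    then show ?thesis using sets by (intro measure_eqI) simp_all
  qed
qed

section \<open>Joint laws determined by characteristic functions\<close>

lemma integrable_iexp_finite:
  assumes "finite_measure M" "f \<in> borel_measurable M"
  shows "integrable M (\<lambda>x. iexp (f x))"
proof -
  interpret finite_measure M by fact
  show ?thesis using assms(2) by (intro integrable_const_bound[of _ 1]) auto
qed

lemma one_plus_cos_nonneg [simp]: "0 \<le> 1 + cos (u::real)"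
  using cos_ge_minus_one[of u] by linarith

text \<open>The weight \<open>1 + cos\<close> is nonnegative and hence a density, unlike a complex
  exponential. Varying the phase \<open>\<phi>\<close> recovers the real and the imaginary part of
  the exponential.\<close>

lemma finite_density_cos:
  assumes "finite_measure K" and [measurable]: "G \<in> borel_measurable K"
  shows "finite_measure (density K (\<lambda>\<omega>. ennreal (1 + cos (G \<omega> + \<phi>))))"
proof (rule finite_measureI)
  interpret K: finite_measure K by fact
  have "emeasure (density K (\<lambda>\<omega>. ennreal (1 + cos (G \<omega> + \<phi>)))) (space K) = (\<integral>\<^sup>+\<omega>. ennreal (1 + cos (G \<omega> + \<phi>)) \<partial>K)"
    by (simp add: emeasure_density cong: nn_integral_cong)
  also have "\<dots> \<le> (\<integral>\<^sup>+\<omega>. 2 \<partial>K)"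
  proof (rule nn_integral_mono)
    fix \<omega>
    have "1 + cos (G \<omega> + \<phi>) \<le> 2" using cos_le_one[of "G \<omega> + \<phi>"] by linarith
    from ennreal_leI[OF this] show "ennreal (1 + cos (G \<omega> + \<phi>)) \<le> 2" by simp
  qed
  also have "\<dots> < \<infinity>" by (simp add: ennreal_mult_less_top) (simp add: less_top[symmetric])
  finally show "emeasure (density K (\<lambda>\<omega>. ennreal (1 + cos (G \<omega> + \<phi>)))) (space (density K (\<lambda>\<omega>. ennreal (1 + cos (G \<omega> + \<phi>))))) \<noteq> \<infinity>"
    by simp
qed

text \<open>Writing the cosine as a half sum of exponentials expresses this characteristic function
  by joint characteristic functions of \<open>Z\<close> and \<open>G\<close>.\<close>

lemma char_density_cos:
  assumes K: "finite_measure K" and [measurable]: "G \<in> borel_measurable K" "Z \<in> borel_measurable K"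
  shows "char (distr (density K (\<lambda>\<omega>. ennreal (1 + cos (G \<omega> + \<phi>)))) borel Z) s =
    (CLINT \<omega>|K. iexp (s * Z \<omega>)) + (iexp \<phi> * (CLINT \<omega>|K. iexp (s * Z \<omega> + 1 * G \<omega>)) +
       iexp (- \<phi>) * (CLINT \<omega>|K. iexp (s * Z \<omega> + (-1) * G \<omega>))) / 2"
proof -
  have *: "integrable K (\<lambda>\<omega>. iexp (s * Z \<omega>))" "integrable K (\<lambda>\<omega>. iexp (s * Z \<omega> + 1 * G \<omega>))"
    "integrable K (\<lambda>\<omega>. iexp (s * Z \<omega> + (-1) * G \<omega>))"
    by (rule integrable_iexp_finite[OF K]; measurable)+
  have "char (distr (density K (\<lambda>\<omega>. ennreal (1 + cos (G \<omega> + \<phi>)))) borel Z) s =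
      (CLINT \<omega>|K. (1 + cos (G \<omega> + \<phi>)) *\<^sub>R iexp (s * Z \<omega>))"
    unfolding char_def by (subst integral_distr) (auto simp: integral_density)
  also have "\<dots> = (CLINT \<omega>|K. iexp (s * Z \<omega>) + (iexp \<phi> * iexp (s * Z \<omega> + 1 * G \<omega>) + iexp (- \<phi>) * iexp (s * Z \<omega> + (-1) * G \<omega>)) / 2)"
  proof (rule Bochner_Integration.integral_cong[OF refl])
    fix \<omega>
    have "complex_of_real (cos (G \<omega> + \<phi>)) = (iexp (G \<omega> + \<phi>) + iexp (- (G \<omega> + \<phi>))) / 2"
      by (simp add: cos_of_real[symmetric] cos_exp_eq del: minus_add_distrib)
    moreover have "iexp \<phi> * iexp (s * Z \<omega> + 1 * G \<omega>) = iexp (G \<omega> + \<phi>) * iexp (s * Z \<omega>)"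
      "iexp (- \<phi>) * iexp (s * Z \<omega> + (-1) * G \<omega>) = iexp (- (G \<omega> + \<phi>)) * iexp (s * Z \<omega>)"
      unfolding exp_add[symmetric] by (simp_all add: algebra_simps)
    ultimately show "(1 + cos (G \<omega> + \<phi>)) *\<^sub>R iexp (s * Z \<omega>) =
        iexp (s * Z \<omega>) + (iexp \<phi> * iexp (s * Z \<omega> + 1 * G \<omega>) + iexp (- \<phi>) * iexp (s * Z \<omega> + (-1) * G \<omega>)) / 2"
      by (simp only: scaleR_conv_of_real of_real_add of_real_1 distrib_right mult_1_left
          times_divide_eq_left)
  qed
  also have "\<dots> = (CLINT \<omega>|K. iexp (s * Z \<omega>)) + (iexp \<phi> * (CLINT \<omega>|K. iexp (s * Z \<omega> + 1 * G \<omega>)) + iexp (- \<phi>) * (CLINT \<omega>|K. iexp (s * Z \<omega> + (-1) * G \<omega>))) / 2"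
    using * by (simp only: Bochner_Integration.integral_add integral_divide_zero integral_mult_right_zero
        integrable_mult_right integrable_divide_zero Bochner_Integration.integrable_add)
  finally show ?thesis .
qed

lemma measure_density_cos:
  assumes K: "finite_measure K" and [measurable]: "G \<in> borel_measurable K" "S \<in> sets K"
  shows "measure (density K (\<lambda>\<omega>. ennreal (1 + cos (G \<omega> + \<phi>)))) S =
    measure K S + (\<integral>\<omega>. indicator S \<omega> * cos (G \<omega> + \<phi>) \<partial>K)"
proof -
  interpret K: finite_measure K by fact
  have i1: "integrable K (\<lambda>\<omega>. indicator S \<omega> :: real)"
    by (simp add: less_top[symmetric])
  have i2: "integrable K (\<lambda>\<omega>. indicator S \<omega> * cos (G \<omega> + \<phi>))"
    by (rule K.integrable_const_bound[of _ 1]) (auto simp: indicator_def)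
  have eq: "indicator S \<omega> + indicator S \<omega> * cos (G \<omega> + \<phi>) = (1 + cos (G \<omega> + \<phi>)) * indicator S \<omega>" for \<omega>
    by (simp add: indicator_def)
  have nn: "0 \<le> (\<integral>\<omega>. indicator S \<omega> + indicator S \<omega> * cos (G \<omega> + \<phi>) \<partial>K)"
    unfolding eq by (intro Bochner_Integration.integral_nonneg mult_nonneg_nonneg) auto
  have "emeasure (density K (\<lambda>\<omega>. ennreal (1 + cos (G \<omega> + \<phi>)))) S =
      (\<integral>\<^sup>+\<omega>. ennreal (1 + cos (G \<omega> + \<phi>)) * indicator S \<omega> \<partial>K)"
    by (rule emeasure_density) auto
  also have "\<dots> = (\<integral>\<^sup>+\<omega>. ennreal (indicator S \<omega> + indicator S \<omega> * cos (G \<omega> + \<phi>)) \<partial>K)"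
    unfolding eq by (intro nn_integral_cong) (simp add: ennreal_mult ennreal_indicator)
  also have "\<dots> = ennreal (\<integral>\<omega>. indicator S \<omega> + indicator S \<omega> * cos (G \<omega> + \<phi>) \<partial>K)"
  proof (rule nn_integral_eq_integral)
    show "AE \<omega> in K. 0 \<le> indicator S \<omega> + indicator S \<omega> * cos (G \<omega> + \<phi>)"
      unfolding eq by (intro AE_I2 mult_nonneg_nonneg) auto
  qed (use i1 i2 in auto)
  finally have "measure (density K (\<lambda>\<omega>. ennreal (1 + cos (G \<omega> + \<phi>)))) S =
      (\<integral>\<omega>. indicator S \<omega> + indicator S \<omega> * cos (G \<omega> + \<phi>) \<partial>K)"
    using nn by (simp add: measure_def)
  also have "\<dots> = measure K S + (\<integral>\<omega>. indicator S \<omega> * cos (G \<omega> + \<phi>) \<partial>K)"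
    using i1 i2 by (simp add: Int_absorb2 sets.sets_into_space)
  finally show ?thesis .
qed

lemma integral_density_indicator_iexp:
  assumes K: "finite_measure K" and [measurable]: "G \<in> borel_measurable K" "S \<in> sets K"
  shows "(CLINT \<omega>|density K (\<lambda>\<omega>. ennreal (indicator S \<omega>)). iexp (G \<omega>)) =
    complex_of_real (\<integral>\<omega>. indicator S \<omega> * cos (G \<omega> + 0) \<partial>K) +
    \<i> * complex_of_real (\<integral>\<omega>. indicator S \<omega> * cos (G \<omega> + (- pi / 2)) \<partial>K)"
proof -
  interpret K: finite_measure K by fact
  have i: "integrable K (\<lambda>\<omega>. indicator S \<omega> * cos (G \<omega> + \<phi>))" for \<phi>
    by (rule K.integrable_const_bound[of _ 1]) (auto simp: indicator_def)
  have "(CLINT \<omega>|density K (\<lambda>\<omega>. ennreal (indicator S \<omega>)). iexp (G \<omega>)) = (CLINT \<omega>|K. indicator S \<omega> *\<^sub>R iexp (G \<omega>))"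
    by (subst integral_density) auto
  also have "\<dots> = (CLINT \<omega>|K. complex_of_real (indicator S \<omega> * cos (G \<omega> + 0)) + \<i> * complex_of_real (indicator S \<omega> * cos (G \<omega> + (- pi / 2))))"
  proof (rule Bochner_Integration.integral_cong[OF refl])
    fix \<omega>
    have "cos (G \<omega> + (- pi / 2)) = sin (G \<omega>)" by (simp add: cos_diff)
    then show "indicator S \<omega> *\<^sub>R iexp (G \<omega>) = complex_of_real (indicator S \<omega> * cos (G \<omega> + 0)) + \<i> * complex_of_real (indicator S \<omega> * cos (G \<omega> + (- pi / 2)))"
      by (simp add: scaleR_conv_of_real exp_Euler cos_of_real sin_of_real algebra_simps)
  qed
  also have "\<dots> = (CLINT \<omega>|K. complex_of_real (indicator S \<omega> * cos (G \<omega> + 0))) + \<i> * (CLINT \<omega>|K. complex_of_real (indicator S \<omega> * cos (G \<omega> + (- pi / 2))))"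
  proof -
    have "integrable K (\<lambda>\<omega>. complex_of_real (indicator S \<omega> * cos (G \<omega> + \<phi>)))" for \<phi>
      using i by (rule integrable_of_real)
    then show ?thesis
      by (simp only: Bochner_Integration.integral_add integrable_mult_right integral_mult_right_zero)
  qed
  also have "\<dots> = complex_of_real (\<integral>\<omega>. indicator S \<omega> * cos (G \<omega> + 0) \<partial>K) + \<i> * complex_of_real (\<integral>\<omega>. indicator S \<omega> * cos (G \<omega> + (- pi / 2)) \<partial>K)"
    by (simp only: integral_complex_of_real)
  finally show ?thesis .
qed

lemma emeasure_density_indicator:
  assumes "S \<in> sets K" "T \<in> sets K"
  shows "emeasure (density K (\<lambda>\<omega>. ennreal (indicator S \<omega>))) T = emeasure K (S \<inter> T)"
proof -
  have "emeasure (density K (\<lambda>\<omega>. ennreal (indicator S \<omega>))) T = (\<integral>\<^sup>+\<omega>. ennreal (indicator S \<omega>) * indicator T \<omega> \<partial>K)"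
    using assms by (intro emeasure_density) auto
  also have "\<dots> = (\<integral>\<^sup>+\<omega>. indicator (S \<inter> T) \<omega> \<partial>K)"
    by (intro nn_integral_cong) (simp add: indicator_def)
  also have "\<dots> = emeasure K (S \<inter> T)" using assms by (intro nn_integral_indicator) auto
  finally show ?thesis .
qed

lemma finite_density_indicator:
  assumes "finite_measure K" "S \<in> sets K"
  shows "finite_measure (density K (\<lambda>\<omega>. ennreal (indicator S \<omega>)))"
proof (rule finite_measureI)
  interpret K: finite_measure K by fact
  show "emeasure (density K (\<lambda>\<omega>. ennreal (indicator S \<omega>))) (space (density K (\<lambda>\<omega>. ennreal (indicator S \<omega>)))) \<noteq> \<infinity>"
    using assms emeasure_density_indicator[of S K "space K"] by simp
qed

text \<open>Induction on the coordinates, reducing to the one-dimensional uniqueness theorem.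
  Tilting both measures by \<open>1 + cos\<close> of a linear form in the remaining coordinates and
  comparing the laws of \<open>X j\<close> and \<open>Y j\<close> shows that the measures restricted
  to the event for coordinate \<open>j\<close> still have equal characteristic functions for the
  rest. These restrictions are not probability measures, which is why \<open>M\<close> and
  \<open>N\<close> are general finite measures.\<close>

lemma measure_rectangle_eq_of_char:
  fixes M :: "'a measure" and N :: "'b measure" and X :: "'i \<Rightarrow> 'a \<Rightarrow> real" and Y :: "'i \<Rightarrow> 'b \<Rightarrow> real"
  assumes "finite J" "finite_measure M" "finite_measure N"
    and "\<And>j. j \<in> J \<Longrightarrow> X j \<in> borel_measurable M" "\<And>j. j \<in> J \<Longrightarrow> Y j \<in> borel_measurable N"
    and "\<And>\<xi>. (CLINT \<omega>|M. iexp (\<Sum>j\<in>J. \<xi> j * X j \<omega>)) = (CLINT \<omega>|N. iexp (\<Sum>j\<in>J. \<xi> j * Y j \<omega>))"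
    and "\<And>j. j \<in> J \<Longrightarrow> A j \<in> sets borel"
  shows "measure M {\<omega>\<in>space M. \<forall>j\<in>J. X j \<omega> \<in> A j} = measure N {\<omega>\<in>space N. \<forall>j\<in>J. Y j \<omega> \<in> A j}"
  using assms
proof (induction J arbitrary: M N rule: finite_induct)
  case empty
  have "complex_of_real (measure M (space M)) = complex_of_real (measure N (space N))"
    using empty(5)[of undefined] by (simp add: scaleR_conv_of_real)
  then show ?case by simp
next
  case (insert j J)
  interpret M: finite_measure M by fact
  interpret N: finite_measure N by fact
  have [measurable]: "X j \<in> borel_measurable M" "Y j \<in> borel_measurable N" "A j \<in> sets borel"
    using insert.prems by auto
  have Xm: "X i \<in> borel_measurable M" and Ym: "Y i \<in> borel_measurable N" and Am: "A i \<in> sets borel" if "i \<in> J" for i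
    using insert.prems that by auto
  define L where "L \<xi> \<omega> = (\<Sum>i\<in>J. \<xi> i * X i \<omega>)" for \<xi> \<omega>
  define R where "R \<xi> \<omega> = (\<Sum>i\<in>J. \<xi> i * Y i \<omega>)" for \<xi> \<omega>
  have mL [measurable]: "L \<xi> \<in> borel_measurable M" for \<xi>
    unfolding L_def using Xm by (intro borel_measurable_sum borel_measurable_times) auto
  have mR [measurable]: "R \<xi> \<in> borel_measurable N" for \<xi>
    unfolding R_def using Ym by (intro borel_measurable_sum borel_measurable_times) auto
  have eq: "(CLINT \<omega>|M. iexp (s * X j \<omega> + r * L \<xi> \<omega>)) = (CLINT \<omega>|N. iexp (s * Y j \<omega> + r * R \<xi> \<omega>))" for s r \<xi>
  proof -
    have *: "(\<Sum>i\<in>insert j J. (if i = j then s else r * \<xi> i) * z i) = s * z j + r * (\<Sum>i\<in>J. \<xi> i * z i)"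
      for z :: "'i \<Rightarrow> real"
    proof -
      have "(\<Sum>i\<in>J. (if i = j then s else r * \<xi> i) * z i) = (\<Sum>i\<in>J. r * (\<xi> i * z i))"
        using insert.hyps by (intro sum.cong) auto
      then show ?thesis using insert.hyps by (simp add: sum_distrib_left)
    qed
    show ?thesis
      using insert.prems(5)[of "\<lambda>i. if i = j then s else r * \<xi> i"] unfolding * L_def R_def .
  qed
  define S where "S = {\<omega>\<in>space M. X j \<omega> \<in> A j}"
  define T where "T = {\<omega>\<in>space N. Y j \<omega> \<in> A j}"
  have ST [measurable]: "S \<in> sets M" "T \<in> sets N" unfolding S_def T_def by measurable
  have w1: "measure M S + (\<integral>\<omega>. indicator S \<omega> * cos (L \<xi> \<omega> + \<phi>) \<partial>M) =
      measure N T + (\<integral>\<omega>. indicator T \<omega> * cos (R \<xi> \<omega> + \<phi>) \<partial>N)" for \<xi> \<phi>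
  proof -
    let ?M = "density M (\<lambda>\<omega>. ennreal (1 + cos (L \<xi> \<omega> + \<phi>)))" and ?N = "density N (\<lambda>\<omega>. ennreal (1 + cos (R \<xi> \<omega> + \<phi>)))"
    have "distr ?M borel (X j) = distr ?N borel (Y j)"
    proof (rule finite_measure_eq_of_char)
      show "finite_measure (distr ?M borel (X j))" "finite_measure (distr ?N borel (Y j))"
        using finite_density_cos[OF insert.prems(1), of "L \<xi>"] finite_density_cos[OF insert.prems(2), of "R \<xi>"]
        by (auto intro: finite_measure.finite_measure_distr)
      have "char (distr ?M borel (X j)) s = char (distr ?N borel (Y j)) s" for s
        using eq[of s 0 \<xi>] eq[of s 1 \<xi>] eq[of s "-1" \<xi>]
        by (simp add: char_density_cos[OF insert.prems(1)] char_density_cos[OF insert.prems(2)])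
      then show "char (distr ?M borel (X j)) = char (distr ?N borel (Y j))" by blast
    qed simp_all
    then have "measure (distr ?M borel (X j)) (A j) = measure (distr ?N borel (Y j)) (A j)" by simp
    then have "measure ?M S = measure ?N T"
      by (simp add: measure_distr vimage_def Int_def conj_commute S_def T_def)
    then show ?thesis
      by (simp only: measure_density_cos[OF insert.prems(1) mL ST(1)] measure_density_cos[OF insert.prems(2) mR ST(2)])
  qed
  \<comment> \<open>For the zero form and phase \<open>pi / 2\<close> the cosine vanishes, so the
    masses of \<open>S\<close> and \<open>T\<close> agree and drop out of \<open>w1\<close>.\<close>
  have "(\<integral>\<omega>. indicator S \<omega> * cos (L (\<lambda>_. 0) \<omega> + pi / 2) \<partial>M) = 0" "(\<integral>\<omega>. indicator T \<omega> * cos (R (\<lambda>_. 0) \<omega> + pi / 2) \<partial>N) = 0"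
    by (simp_all add: L_def R_def)
  then have w2: "(\<integral>\<omega>. indicator S \<omega> * cos (L \<xi> \<omega> + \<phi>) \<partial>M) = (\<integral>\<omega>. indicator T \<omega> * cos (R \<xi> \<omega> + \<phi>) \<partial>N)" for \<xi> \<phi>
    using w1[of "\<lambda>_. 0" "pi / 2"] w1[of \<xi> \<phi>] by linarith
  let ?M = "density M (\<lambda>\<omega>. ennreal (indicator S \<omega>))" and ?N = "density N (\<lambda>\<omega>. ennreal (indicator T \<omega>))"
  have IH: "measure ?M {\<omega>\<in>space ?M. \<forall>i\<in>J. X i \<omega> \<in> A i} = measure ?N {\<omega>\<in>space ?N. \<forall>i\<in>J. Y i \<omega> \<in> A i}"
  proof (rule insert.IH)
    show "finite_measure ?M" "finite_measure ?N"
      using finite_density_indicator insert.prems(1,2) ST by blast+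
    show "(CLINT \<omega>|?M. iexp (\<Sum>i\<in>J. \<xi> i * X i \<omega>)) = (CLINT \<omega>|?N. iexp (\<Sum>i\<in>J. \<xi> i * Y i \<omega>))" for \<xi>
      unfolding L_def[symmetric] R_def[symmetric]
        integral_density_indicator_iexp[OF insert.prems(1) mL ST(1)]
        integral_density_indicator_iexp[OF insert.prems(2) mR ST(2)] w2 ..
  qed (use Xm Ym Am in auto)
  have J: "{\<omega>\<in>space M. \<forall>i\<in>J. X i \<omega> \<in> A i} \<in> sets M" "{\<omega>\<in>space N. \<forall>i\<in>J. Y i \<omega> \<in> A i} \<in> sets N"
    using insert.hyps(1) measurable_sets_Collect[OF Xm] measurable_sets_Collect[OF Ym] Am
    by (auto intro!: sets.sets_Collect_finite_All')
  have "measure M (S \<inter> {\<omega>\<in>space M. \<forall>i\<in>J. X i \<omega> \<in> A i}) = measure N (T \<inter> {\<omega>\<in>space N. \<forall>i\<in>J. Y i \<omega> \<in> A i})"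
    using IH unfolding measure_def space_density emeasure_density_indicator[OF ST(1) J(1)]
      emeasure_density_indicator[OF ST(2) J(2)] .
  moreover have "S \<inter> {\<omega>\<in>space M. \<forall>i\<in>J. X i \<omega> \<in> A i} = {\<omega>\<in>space M. \<forall>i\<in>insert j J. X i \<omega> \<in> A i}"
    "T \<inter> {\<omega>\<in>space N. \<forall>i\<in>J. Y i \<omega> \<in> A i} = {\<omega>\<in>space N. \<forall>i\<in>insert j J. Y i \<omega> \<in> A i}"
    unfolding S_def T_def by blast+
  ultimately show ?case by simp
qed

lemma distr_PiM_eq_of_char:
  fixes M :: "'a measure" and N :: "'b measure" and X :: "'i \<Rightarrow> 'a \<Rightarrow> real" and Y :: "'i \<Rightarrow> 'b \<Rightarrow> real"
  assumes fin: "finite J" "finite_measure M" "finite_measure N"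
    and X: "\<And>j. j \<in> J \<Longrightarrow> X j \<in> borel_measurable M" and Y: "\<And>j. j \<in> J \<Longrightarrow> Y j \<in> borel_measurable N"
    and char: "\<And>\<xi>. (CLINT \<omega>|M. iexp (\<Sum>j\<in>J. \<xi> j * X j \<omega>)) = (CLINT \<omega>|N. iexp (\<Sum>j\<in>J. \<xi> j * Y j \<omega>))"
  shows "distr M (\<Pi>\<^sub>M j\<in>J. borel) (\<lambda>\<omega>. \<lambda>j\<in>J. X j \<omega>) = distr N (\<Pi>\<^sub>M j\<in>J. borel) (\<lambda>\<omega>. \<lambda>j\<in>J. Y j \<omega>)"
proof -
  have mX: "(\<lambda>\<omega>. \<lambda>j\<in>J. X j \<omega>) \<in> measurable M (\<Pi>\<^sub>M j\<in>J. borel)" using X by (rule measurable_restrict)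
  have mY: "(\<lambda>\<omega>. \<lambda>j\<in>J. Y j \<omega>) \<in> measurable N (\<Pi>\<^sub>M j\<in>J. borel)" using Y by (rule measurable_restrict)
  interpret M: finite_measure M by fact
  interpret N: finite_measure N by fact
  show ?thesis
  proof (rule measure_eqI_PiM_finite[OF fin(1)])
    fix A assume A: "\<And>i. i \<in> J \<Longrightarrow> A i \<in> sets (borel :: real measure)"
    then have S: "Pi\<^sub>E J A \<in> sets (\<Pi>\<^sub>M j\<in>J. borel)" using fin(1) by (intro sets_PiM_I_finite) auto
    have "(\<lambda>\<omega>. \<lambda>j\<in>J. X j \<omega>) -` Pi\<^sub>E J A \<inter> space M = {\<omega>\<in>space M. \<forall>j\<in>J. X j \<omega> \<in> A j}"
      "(\<lambda>\<omega>. \<lambda>j\<in>J. Y j \<omega>) -` Pi\<^sub>E J A \<inter> space N = {\<omega>\<in>space N. \<forall>j\<in>J. Y j \<omega> \<in> A j}"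
      by (auto simp: PiE_iff)
    then show "emeasure (distr M (\<Pi>\<^sub>M j\<in>J. borel) (\<lambda>\<omega>. \<lambda>j\<in>J. X j \<omega>)) (Pi\<^sub>E J A) =
        emeasure (distr N (\<Pi>\<^sub>M j\<in>J. borel) (\<lambda>\<omega>. \<lambda>j\<in>J. Y j \<omega>)) (Pi\<^sub>E J A)"
      using measure_rectangle_eq_of_char[OF fin X Y char A]
      by (simp add: emeasure_distr mX mY S M.emeasure_eq_measure N.emeasure_eq_measure)
  next
    show "range (\<lambda>_::nat. \<Pi>\<^sub>E j\<in>J. (UNIV::real set)) \<subseteq> prod_algebra J (\<lambda>_. borel)"
      using fin(1) by (auto intro!: prod_algebraI_finite)
    show "(\<Union>i::nat. \<Pi>\<^sub>E j\<in>J. (UNIV::real set)) = space (\<Pi>\<^sub>M j\<in>J. borel)"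
      by (simp add: space_PiM)
    show "emeasure (distr M (\<Pi>\<^sub>M j\<in>J. borel) (\<lambda>\<omega>. \<lambda>j\<in>J. X j \<omega>)) (\<Pi>\<^sub>E j\<in>J. UNIV) \<noteq> \<infinity>"
      using M.finite_measure_distr[OF mX] finite_measure.emeasure_finite by (auto simp: top_ennreal_def)
  qed simp_all
qed

section \<open>A Poincare inequality for maxima of affine functions of a Gaussian vector\<close>

lemma integrable_mult_of_squares:
  fixes f g :: "'a \<Rightarrow> real"
  assumes [measurable]: "f \<in> borel_measurable M" "g \<in> borel_measurable M"
    and "integrable M (\<lambda>x. (f x)\<^sup>2)" "integrable M (\<lambda>x. (g x)\<^sup>2)"
  shows "integrable M (\<lambda>x. f x * g x)"
proof (rule Bochner_Integration.integrable_bound)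
  show "integrable M (\<lambda>x. (f x)\<^sup>2 + (g x)\<^sup>2)" using assms(3,4) by simp
  have "\<bar>u * v\<bar> \<le> u\<^sup>2 + v\<^sup>2" for u v :: real
  proof -
    have "2 * (\<bar>u\<bar> * \<bar>v\<bar>) \<le> u\<^sup>2 + v\<^sup>2"
      using sum_squares_bound[of "\<bar>u\<bar>" "\<bar>v\<bar>"] by (simp add: mult.assoc)
    moreover have "0 \<le> \<bar>u\<bar> * \<bar>v\<bar>" by simp
    ultimately show ?thesis unfolding abs_mult by linarith
  qed
  then show "AE x in M. norm (f x * g x) \<le> norm ((f x)\<^sup>2 + (g x)\<^sup>2)" by (simp add: abs_mult)
qed simp

lemma ennreal_affine:
  assumes "0 \<le> A" "0 \<le> B" "0 \<le> g" "\<And>k. 0 \<le> f k"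
  shows "ennreal (A * (\<Sum>k<n. f k) + B * g) = ennreal A * (\<Sum>k<n. ennreal (f k)) + ennreal B * ennreal g"
  using assms by (simp add: ennreal_plus ennreal_mult sum_nonneg sum_ennreal)

definition affine_max :: "'i set \<Rightarrow> nat \<Rightarrow> (nat \<Rightarrow> 'i \<Rightarrow> real) \<Rightarrow> (nat \<Rightarrow> real) \<Rightarrow> ('i \<Rightarrow> real) \<Rightarrow> real" where
  "affine_max D n a b x = Max ((\<lambda>k. (\<Sum>t\<in>D. a k t * x t) - b k) ` {..<n})"

text \<open>Taking the least maximising index makes the choice depend measurably on
  \<open>x\<close>.\<close>

definition affine_argmax :: "'i set \<Rightarrow> nat \<Rightarrow> (nat \<Rightarrow> 'i \<Rightarrow> real) \<Rightarrow> (nat \<Rightarrow> real) \<Rightarrow> ('i \<Rightarrow> real) \<Rightarrow> nat" where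
  "affine_argmax D n a b x = (LEAST k. k < n \<and> (\<Sum>t\<in>D. a k t * x t) - b k = affine_max D n a b x)"

lemma affine_argmax:
  assumes "0 < n"
  shows "affine_argmax D n a b x < n"
    "(\<Sum>t\<in>D. a (affine_argmax D n a b x) t * x t) - b (affine_argmax D n a b x) = affine_max D n a b x"
proof -
  have "affine_max D n a b x \<in> (\<lambda>k. (\<Sum>t\<in>D. a k t * x t) - b k) ` {..<n}"
    unfolding affine_max_def using assms by (intro Max_in) auto
  then have "\<exists>k. k < n \<and> (\<Sum>t\<in>D. a k t * x t) - b k = affine_max D n a b x" by auto
  from LeastI_ex[OF this] show "affine_argmax D n a b x < n"
    "(\<Sum>t\<in>D. a (affine_argmax D n a b x) t * x t) - b (affine_argmax D n a b x) = affine_max D n a b x"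
    unfolding affine_argmax_def by auto
qed

lemma affine_max_ge: "k < n \<Longrightarrow> (\<Sum>t\<in>D. a k t * x t) - b k \<le> affine_max D n a b x"
  unfolding affine_max_def by (intro Max_ge) auto

lemma measurable_affine_max:
  assumes [measurable]: "\<And>t. t \<in> D \<Longrightarrow> (\<lambda>z. x z t) \<in> borel_measurable M" and n: "0 < n"
  shows "(\<lambda>z. affine_max D n a b (x z)) \<in> borel_measurable M"
  unfolding affine_max_def using n by (intro borel_measurable_Max) auto

lemma measurable_affine_argmax:
  assumes [measurable]: "\<And>t. t \<in> D \<Longrightarrow> (\<lambda>z. x z t) \<in> borel_measurable M" and n: "0 < n"
  shows "(\<lambda>z. affine_argmax D n a b (x z)) \<in> measurable M (count_space UNIV)"
proof -
  have [measurable]: "(\<lambda>z. affine_max D n a b (x z)) \<in> borel_measurable M"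
    by (rule measurable_affine_max) (use assms in auto)
  have [measurable]: "(\<lambda>z. (\<Sum>t\<in>D. a k t * x z t) - b k) \<in> borel_measurable M" for k by measurable
  show ?thesis unfolding affine_argmax_def by measurable
qed

section \<open>Rotation of two independent copies of a Gaussian family\<close>

locale gaussian_family = prob_space M for M :: "'a measure" +
  fixes D :: "'i set" and X :: "'i \<Rightarrow> 'a \<Rightarrow> real"
  assumes fin: "finite D"
    and X_meas: "\<And>t. t \<in> D \<Longrightarrow> X t \<in> borel_measurable M"
    and gauss: "\<And>a. \<exists>v\<ge>0. distr M borel (\<lambda>\<omega>. \<Sum>t\<in>D. a t * X t \<omega>) = normal_law 0 v"
begin

definition lin :: "('i \<Rightarrow> real) \<Rightarrow> 'a \<Rightarrow> real" where
  "lin a \<omega> = (\<Sum>t\<in>D. a t * X t \<omega>)"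

definition var :: "('i \<Rightarrow> real) \<Rightarrow> real" where
  "var a = (\<integral>\<omega>. (lin a \<omega>)\<^sup>2 \<partial>M)"

lemma lin_meas [measurable]: "lin a \<in> borel_measurable M"
  unfolding lin_def using X_meas by (intro borel_measurable_sum borel_measurable_times) auto

lemma lin_integrable: "integrable M (lin a)" "integrable M (\<lambda>\<omega>. (lin a \<omega>)\<^sup>2)"
  and lin_char: "(CLINT \<omega>|M. iexp (lin a \<omega>)) = complex_of_real (exp (- var a / 2))"
proof -
  obtain v where v: "v \<ge> 0" "distr M borel (lin a) = normal_law 0 v"
    using gauss[of a] unfolding lin_def[abs_def] by blast
  note m = normal_law_moments[OF lin_meas v]
  show "integrable M (lin a)" "integrable M (\<lambda>\<omega>. (lin a \<omega>)\<^sup>2)" by (rule m)+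
  show "(CLINT \<omega>|M. iexp (lin a \<omega>)) = complex_of_real (exp (- var a / 2))"
    unfolding var_def m(3) by (rule m)
qed

lemma var_nonneg: "0 \<le> var a"
  unfolding var_def by simp

lemma nn_integral_lin: "(\<integral>\<^sup>+\<omega>. ennreal ((lin a \<omega>)\<^sup>2) \<partial>M) = ennreal (var a)"
  unfolding var_def by (intro nn_integral_eq_integral lin_integrable) auto

lemma lin_combine: "lin (\<lambda>t. p * a t + q * b t) \<omega> = p * lin a \<omega> + q * lin b \<omega>"
  by (simp add: lin_def sum.distrib sum_distrib_left algebra_simps)

lemma var_combine:
  "var (\<lambda>t. p * a t + q * b t) = p\<^sup>2 * var a + q\<^sup>2 * var b + 2 * p * q * (\<integral>\<omega>. lin a \<omega> * lin b \<omega> \<partial>M)"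
proof -
  have i: "integrable M (\<lambda>\<omega>. lin a \<omega> * lin b \<omega>)"
    by (intro integrable_mult_of_squares lin_integrable) auto
  have "var (\<lambda>t. p * a t + q * b t) = (\<integral>\<omega>. p\<^sup>2 * (lin a \<omega>)\<^sup>2 + q\<^sup>2 * (lin b \<omega>)\<^sup>2 + 2 * p * q * (lin a \<omega> * lin b \<omega>) \<partial>M)"
    unfolding var_def lin_combine by (intro Bochner_Integration.integral_cong refl) (simp add: power2_eq_square algebra_simps)
  also have "\<dots> = p\<^sup>2 * var a + q\<^sup>2 * var b + 2 * p * q * (\<integral>\<omega>. lin a \<omega> * lin b \<omega> \<partial>M)"
    using i lin_integrable by (simp add: var_def)
  finally show ?thesis .
qed

text \<open>Two independent copies of the family live on the product space and are rotated into each
  other: the angle \<open>0\<close> gives the first copy, \<open>pi / 2\<close> the second.\<close>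

definition rot :: "real \<Rightarrow> 'i \<Rightarrow> 'a \<times> 'a \<Rightarrow> real" where
  "rot \<theta> t z = cos \<theta> * X t (fst z) + sin \<theta> * X t (snd z)"

lemma rot_meas: "t \<in> D \<Longrightarrow> rot \<theta> t \<in> borel_measurable (M \<Otimes>\<^sub>M M)"
  unfolding rot_def[abs_def] using X_meas[of t] by measurable

definition rot_pair :: "real \<Rightarrow> real \<Rightarrow> 'i \<times> bool \<Rightarrow> 'a \<times> 'a \<Rightarrow> real" where
  "rot_pair \<alpha> \<beta> j z = rot (if snd j then \<alpha> else \<beta>) (fst j) z"

text \<open>By \<open>cos^2 + sin^2 = 1\<close> the single angles disappear and only
  \<open>cos (\<alpha> - \<beta>)\<close> remains. Hence the joint law of the families at two angles
  is invariant under a common shift and under exchanging the angles.\<close>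

lemma rot_pair_char:
  "(CLINT z|M \<Otimes>\<^sub>M M. iexp (\<Sum>j\<in>D \<times> UNIV. \<xi> j * rot_pair \<alpha> \<beta> j z)) =
   complex_of_real (exp (- (var (\<lambda>t. \<xi> (t, True)) + var (\<lambda>t. \<xi> (t, False)) +
     2 * cos (\<alpha> - \<beta>) * (\<integral>\<omega>. lin (\<lambda>t. \<xi> (t, True)) \<omega> * lin (\<lambda>t. \<xi> (t, False)) \<omega> \<partial>M)) / 2))"
proof -
  interpret MM: pair_prob_space M M ..
  let ?a = "\<lambda>t. \<xi> (t, True)" and ?b = "\<lambda>t. \<xi> (t, False)"
  let ?A = "\<lambda>t. cos \<alpha> * ?a t + cos \<beta> * ?b t" and ?B = "\<lambda>t. sin \<alpha> * ?a t + sin \<beta> * ?b t"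
  have sum: "(\<Sum>j\<in>D \<times> UNIV. \<xi> j * rot_pair \<alpha> \<beta> j z) = lin ?A (fst z) + lin ?B (snd z)" for z
  proof -
    have "(\<Sum>j\<in>D \<times> UNIV. \<xi> j * rot_pair \<alpha> \<beta> j z) = (\<Sum>t\<in>D. \<Sum>b\<in>UNIV. \<xi> (t, b) * rot_pair \<alpha> \<beta> (t, b) z)"
      by (simp add: sum.cartesian_product)
    also have "\<dots> = (\<Sum>t\<in>D. ?A t * X t (fst z) + ?B t * X t (snd z))"
      by (intro sum.cong refl) (simp add: rot_pair_def rot_def UNIV_bool algebra_simps)
    finally show ?thesis by (simp add: lin_def sum.distrib)
  qed
  have int: "integrable (M \<Otimes>\<^sub>M M) (\<lambda>z. iexp (lin ?A (fst z) + lin ?B (snd z)))"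
    by (rule integrable_iexp_finite[OF MM.finite_measure_axioms]) measurable
  have "(CLINT z|M \<Otimes>\<^sub>M M. iexp (\<Sum>j\<in>D \<times> UNIV. \<xi> j * rot_pair \<alpha> \<beta> j z)) =
      (CLINT z|M \<Otimes>\<^sub>M M. iexp (lin ?A (fst z) + lin ?B (snd z)))" unfolding sum ..
  also have "\<dots> = (CLINT x|M. (CLINT y|M. iexp (lin ?A x + lin ?B y)))"
    using MM.integral_fst'[OF int] by simp
  also have "\<dots> = (CLINT x|M. (CLINT y|M. iexp (lin ?A x) * iexp (lin ?B y)))"
    by (simp add: exp_add distrib_left)
  also have "\<dots> = (CLINT x|M. iexp (lin ?A x)) * (CLINT y|M. iexp (lin ?B y))" by simp
  also have "\<dots> = complex_of_real (exp (- (var ?A + var ?B) / 2))"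
    unfolding lin_char of_real_mult[symmetric] mult_exp_exp by (simp add: add_divide_distrib)
  also have "var ?A + var ?B = ((cos \<alpha>)\<^sup>2 + (sin \<alpha>)\<^sup>2) * var ?a + ((cos \<beta>)\<^sup>2 + (sin \<beta>)\<^sup>2) * var ?b +
      2 * (cos \<alpha> * cos \<beta> + sin \<alpha> * sin \<beta>) * (\<integral>\<omega>. lin ?a \<omega> * lin ?b \<omega> \<partial>M)"
    unfolding var_combine by algebra
  also have "\<dots> = var ?a + var ?b + 2 * cos (\<alpha> - \<beta>) * (\<integral>\<omega>. lin ?a \<omega> * lin ?b \<omega> \<partial>M)"
    by (simp only: sin_cos_squared_add2 cos_diff mult_1_left)
  finally show ?thesis .
qed

lemma rot_pair_meas: "j \<in> D \<times> UNIV \<Longrightarrow> rot_pair \<alpha> \<beta> j \<in> borel_measurable (M \<Otimes>\<^sub>M M)"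
  unfolding rot_pair_def[abs_def] using rot_meas by auto

lemma nn_integral_rot_pair:
  fixes G :: "('i \<times> bool \<Rightarrow> real) \<Rightarrow> ennreal"
  assumes cos: "cos (\<alpha> - \<beta>) = cos (\<alpha>' - \<beta>')"
    and G: "G \<in> borel_measurable (\<Pi>\<^sub>M j\<in>D \<times> UNIV. borel)"
  shows "(\<integral>\<^sup>+z. G (\<lambda>j\<in>D \<times> UNIV. rot_pair \<alpha> \<beta> j z) \<partial>(M \<Otimes>\<^sub>M M)) =
    (\<integral>\<^sup>+z. G (\<lambda>j\<in>D \<times> UNIV. rot_pair \<alpha>' \<beta>' j z) \<partial>(M \<Otimes>\<^sub>M M))"
proof -
  interpret MM: pair_prob_space M M ..
  have fin': "finite (D \<times> (UNIV :: bool set))" using fin by simp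
  have "distr (M \<Otimes>\<^sub>M M) (\<Pi>\<^sub>M j\<in>D \<times> UNIV. borel) (\<lambda>z. \<lambda>j\<in>D \<times> UNIV. rot_pair \<alpha> \<beta> j z) =
      distr (M \<Otimes>\<^sub>M M) (\<Pi>\<^sub>M j\<in>D \<times> UNIV. borel) (\<lambda>z. \<lambda>j\<in>D \<times> UNIV. rot_pair \<alpha>' \<beta>' j z)"
    by (rule distr_PiM_eq_of_char)
       (simp_all only: rot_pair_char cos rot_pair_meas MM.finite_measure_axioms fin')
  then have "(\<integral>\<^sup>+x. G x \<partial>distr (M \<Otimes>\<^sub>M M) (\<Pi>\<^sub>M j\<in>D \<times> UNIV. borel) (\<lambda>z. \<lambda>j\<in>D \<times> UNIV. rot_pair \<alpha> \<beta> j z)) =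
      (\<integral>\<^sup>+x. G x \<partial>distr (M \<Otimes>\<^sub>M M) (\<Pi>\<^sub>M j\<in>D \<times> UNIV. borel) (\<lambda>z. \<lambda>j\<in>D \<times> UNIV. rot_pair \<alpha>' \<beta>' j z))"
    by simp
  then show ?thesis
    using G by (subst (asm) (1 2) nn_integral_distr) (auto intro!: measurable_restrict rot_pair_meas)
qed

text \<open>The maximiser \<open>s\<close> at angle \<open>0\<close> is a function of the first copy
  alone and remains a competitor at angle \<open>\<epsilon>\<close>. To first order the loss is
  \<open>sin \<epsilon>\<close> times its linear form evaluated at the independent second copy,
  whose mean square is \<open>var (a s)\<close>. This takes the place of the gradient of the
  nonsmooth maximum.\<close>

lemma small_rotation:
  fixes a :: "nat \<Rightarrow> 'i \<Rightarrow> real" and b :: "nat \<Rightarrow> real"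
  assumes n: "0 < n" and e: "0 \<le> \<epsilon>"
  defines "F \<equiv> \<lambda>\<theta> z. affine_max D n a b (\<lambda>t. rot \<theta> t z)"
    and "s \<equiv> \<lambda>\<omega>. affine_argmax D n a b (\<lambda>t. X t \<omega>)"
  shows "(\<integral>\<^sup>+z. ennreal ((F \<epsilon> z - F 0 z)\<^sup>2) \<partial>(M \<Otimes>\<^sub>M M)) \<le>
    ennreal (\<epsilon> ^ 4) * ennreal (\<Sum>k<n. var (a k)) + ennreal (4 * \<epsilon>\<^sup>2) * (\<integral>\<^sup>+\<omega>. ennreal (var (a (s \<omega>))) \<partial>M)"
proof -
  interpret MM: pair_prob_space M M ..
  have [measurable]: "F \<theta> \<in> borel_measurable (M \<Otimes>\<^sub>M M)" for \<theta>
    unfolding F_def using n rot_meas by (intro measurable_affine_max) auto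
  have s_meas [measurable]: "s \<in> measurable M (count_space UNIV)"
    unfolding s_def using n X_meas by (intro measurable_affine_argmax) auto
  have s_less: "s \<omega> < n" for \<omega> unfolding s_def by (rule affine_argmax[OF n])
  define G where "G z = ennreal ((max (affine_max D n a b (\<lambda>t. z (t, False)) - affine_max D n a b (\<lambda>t. z (t, True))) 0)\<^sup>2)"
    for z :: "'i \<times> bool \<Rightarrow> real"
  have G_meas: "G \<in> borel_measurable (\<Pi>\<^sub>M j\<in>D \<times> UNIV. borel)"
  proof -
    have [measurable]: "(\<lambda>z. affine_max D n a b (\<lambda>t. z (t, c))) \<in> borel_measurable (\<Pi>\<^sub>M j\<in>D \<times> UNIV. borel)" for c :: bool
      using n by (intro measurable_affine_max) (auto intro!: measurable_component_singleton)
    show ?thesis unfolding G_def by measurable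
  qed
  have G_rot: "G (\<lambda>j\<in>D \<times> UNIV. rot_pair \<alpha> \<beta> j z) = ennreal ((max (F \<beta> z - F \<alpha> z) 0)\<^sup>2)" for \<alpha> \<beta> z
  proof -
    have "affine_max D n a b (\<lambda>t. (\<lambda>j\<in>D \<times> UNIV. rot_pair \<alpha> \<beta> j z) (t, c)) = F (if c then \<alpha> else \<beta>) z" for c
      unfolding F_def affine_max_def
      by (intro arg_cong[where f=Max] image_cong refl arg_cong2[where f="(-)"] sum.cong) (auto simp: rot_pair_def)
    from this[of True] this[of False] show ?thesis unfolding G_def by simp
  qed
  have "(\<integral>\<^sup>+z. ennreal ((F \<epsilon> z - F 0 z)\<^sup>2) \<partial>(M \<Otimes>\<^sub>M M)) =
      (\<integral>\<^sup>+z. ennreal ((max (F \<epsilon> z - F 0 z) 0)\<^sup>2) + ennreal ((max (F 0 z - F \<epsilon> z) 0)\<^sup>2) \<partial>(M \<Otimes>\<^sub>M M))"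
  proof (rule nn_integral_cong)
    fix z
    have "(F \<epsilon> z - F 0 z)\<^sup>2 = (max (F \<epsilon> z - F 0 z) 0)\<^sup>2 + (max (F 0 z - F \<epsilon> z) 0)\<^sup>2"
      by (simp add: max_def power2_commute)
    then show "ennreal ((F \<epsilon> z - F 0 z)\<^sup>2) = ennreal ((max (F \<epsilon> z - F 0 z) 0)\<^sup>2) + ennreal ((max (F 0 z - F \<epsilon> z) 0)\<^sup>2)"
      by (simp add: ennreal_plus)
  qed
  also have "\<dots> = (\<integral>\<^sup>+z. ennreal ((max (F \<epsilon> z - F 0 z) 0)\<^sup>2) \<partial>(M \<Otimes>\<^sub>M M)) + (\<integral>\<^sup>+z. ennreal ((max (F 0 z - F \<epsilon> z) 0)\<^sup>2) \<partial>(M \<Otimes>\<^sub>M M))"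
    by (intro nn_integral_add) auto
  \<comment> \<open>Exchanging the angles \<open>0\<close> and \<open>\<epsilon>\<close> preserves
    the joint law, so it suffices to bound the decrease of the maximum.\<close>
  also have "(\<integral>\<^sup>+z. ennreal ((max (F \<epsilon> z - F 0 z) 0)\<^sup>2) \<partial>(M \<Otimes>\<^sub>M M)) = (\<integral>\<^sup>+z. ennreal ((max (F 0 z - F \<epsilon> z) 0)\<^sup>2) \<partial>(M \<Otimes>\<^sub>M M))"
    using nn_integral_rot_pair[OF _ G_meas, of 0 \<epsilon> \<epsilon> 0] unfolding G_rot by simp
  finally have split: "(\<integral>\<^sup>+z. ennreal ((F \<epsilon> z - F 0 z)\<^sup>2) \<partial>(M \<Otimes>\<^sub>M M)) =
      2 * (\<integral>\<^sup>+z. ennreal ((max (F 0 z - F \<epsilon> z) 0)\<^sup>2) \<partial>(M \<Otimes>\<^sub>M M))"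
    by (simp only: mult_2)
  have "(\<integral>\<^sup>+z. ennreal ((max (F 0 z - F \<epsilon> z) 0)\<^sup>2) \<partial>(M \<Otimes>\<^sub>M M)) \<le>
      (\<integral>\<^sup>+z. ennreal (\<epsilon> ^ 4 / 2) * (\<Sum>k<n. ennreal ((lin (a k) (fst z))\<^sup>2)) + ennreal (2 * \<epsilon>\<^sup>2) * ennreal ((lin (a (s (fst z))) (snd z))\<^sup>2) \<partial>(M \<Otimes>\<^sub>M M))"
  proof (rule nn_integral_mono)
    fix z :: "'a \<times> 'a"
    define k where "k = s (fst z)"
    have k: "k < n" using s_less by (simp add: k_def)
    have L: "(\<Sum>t\<in>D. a k t * rot \<theta> t z) = cos \<theta> * lin (a k) (fst z) + sin \<theta> * lin (a k) (snd z)" for \<theta>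
      by (simp add: lin_def rot_def sum.distrib sum_distrib_left algebra_simps)
    have "F 0 z = (\<Sum>t\<in>D. a k t * rot 0 t z) - b k"
      unfolding F_def k_def s_def using affine_argmax(2)[OF n, where D=D and a=a and b=b and x="\<lambda>t. rot 0 t z"] by (simp add: rot_def)
    moreover have "(\<Sum>t\<in>D. a k t * rot \<epsilon> t z) - b k \<le> F \<epsilon> z" unfolding F_def by (rule affine_max_ge[OF k])
    ultimately have "F 0 z - F \<epsilon> z \<le> (1 - cos \<epsilon>) * lin (a k) (fst z) + (- sin \<epsilon>) * lin (a k) (snd z)"
      unfolding L by (simp add: algebra_simps)
    then have "(max (F 0 z - F \<epsilon> z) 0)\<^sup>2 \<le> ((1 - cos \<epsilon>) * lin (a k) (fst z) + (- sin \<epsilon>) * lin (a k) (snd z))\<^sup>2"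
      by (simp add: max_def power_mono abs_le_square_iff[symmetric])
    also have "\<dots> \<le> 2 * ((1 - cos \<epsilon>) * lin (a k) (fst z))\<^sup>2 + 2 * ((- sin \<epsilon>) * lin (a k) (snd z))\<^sup>2"
    proof -
      have "(u + v)\<^sup>2 \<le> 2 * u\<^sup>2 + 2 * v\<^sup>2" for u v :: real
        using sum_squares_bound[of u v] by (simp add: power2_sum)
      then show ?thesis .
    qed
    also have "\<dots> \<le> \<epsilon> ^ 4 / 2 * (lin (a k) (fst z))\<^sup>2 + 2 * \<epsilon>\<^sup>2 * (lin (a k) (snd z))\<^sup>2"
    proof -
      have "1 - cos \<epsilon> \<le> \<epsilon>\<^sup>2 / 2"
      proof -
        have "1 - cos \<epsilon> = 2 * (sin (\<epsilon> / 2))\<^sup>2" using cos_double_sin[of "\<epsilon> / 2"] by simp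
        also have "(sin (\<epsilon> / 2))\<^sup>2 \<le> (\<epsilon> / 2)\<^sup>2"
          using abs_sin_x_le_abs_x[of "\<epsilon> / 2"] unfolding abs_le_square_iff .
        finally show ?thesis by (simp add: power_divide)
      qed
      then have "(1 - cos \<epsilon>)\<^sup>2 \<le> (\<epsilon>\<^sup>2 / 2)\<^sup>2" by (intro power_mono) auto
      then have 1: "(1 - cos \<epsilon>)\<^sup>2 \<le> \<epsilon> ^ 4 / 4" by (simp add: power_divide power_mult[symmetric])
      have 2: "(sin \<epsilon>)\<^sup>2 \<le> \<epsilon>\<^sup>2" using abs_sin_x_le_abs_x[of \<epsilon>] unfolding abs_le_square_iff .
      show ?thesis
        using mult_right_mono[OF 1, of "(lin (a k) (fst z))\<^sup>2"] mult_right_mono[OF 2, of "(lin (a k) (snd z))\<^sup>2"]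
        by (simp add: power_mult_distrib)
    qed
    \<comment> \<open>The first-copy term is not independent of the maximiser, so it is bounded by
      the sum over all \<open>k\<close>; this crude bound is harmless, being of order
      \<open>\<epsilon> ^ 4\<close>.\<close>
    also have "\<dots> \<le> \<epsilon> ^ 4 / 2 * (\<Sum>k<n. (lin (a k) (fst z))\<^sup>2) + 2 * \<epsilon>\<^sup>2 * (lin (a k) (snd z))\<^sup>2"
      using k by (intro add_right_mono mult_left_mono member_le_sum) auto
    finally have "ennreal ((max (F 0 z - F \<epsilon> z) 0)\<^sup>2) \<le> ennreal (\<epsilon> ^ 4 / 2 * (\<Sum>k<n. (lin (a k) (fst z))\<^sup>2) + 2 * \<epsilon>\<^sup>2 * (lin (a k) (snd z))\<^sup>2)"
      by (rule ennreal_leI)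
    then show "ennreal ((max (F 0 z - F \<epsilon> z) 0)\<^sup>2) \<le> ennreal (\<epsilon> ^ 4 / 2) * (\<Sum>k<n. ennreal ((lin (a k) (fst z))\<^sup>2)) + ennreal (2 * \<epsilon>\<^sup>2) * ennreal ((lin (a (s (fst z))) (snd z))\<^sup>2)"
      by (subst (asm) ennreal_affine) (simp_all add: k_def)
  qed
  also have "\<dots> = ennreal (\<epsilon> ^ 4 / 2) * ennreal (\<Sum>k<n. var (a k)) + ennreal (2 * \<epsilon>\<^sup>2) * (\<integral>\<^sup>+\<omega>. ennreal (var (a (s \<omega>))) \<partial>M)"
  proof -
    have m1 [measurable]: "(\<lambda>z. lin (a (s (fst z))) (snd z)) \<in> borel_measurable (M \<Otimes>\<^sub>M M)"
      by (rule measurable_compose_countable[where f="\<lambda>k z. lin (a k) (snd z)" and g="\<lambda>z. s (fst z)"]) measurable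
    have "(\<integral>\<^sup>+z. ennreal (\<epsilon> ^ 4 / 2) * (\<Sum>k<n. ennreal ((lin (a k) (fst z))\<^sup>2)) + ennreal (2 * \<epsilon>\<^sup>2) * ennreal ((lin (a (s (fst z))) (snd z))\<^sup>2) \<partial>(M \<Otimes>\<^sub>M M)) =
      ennreal (\<epsilon> ^ 4 / 2) * (\<Sum>k<n. \<integral>\<^sup>+z. ennreal ((lin (a k) (fst z))\<^sup>2) \<partial>(M \<Otimes>\<^sub>M M)) + ennreal (2 * \<epsilon>\<^sup>2) * (\<integral>\<^sup>+z. ennreal ((lin (a (s (fst z))) (snd z))\<^sup>2) \<partial>(M \<Otimes>\<^sub>M M))"
      by (simp add: nn_integral_add nn_integral_cmult nn_integral_sum del: sum_ennreal)
    also have "(\<Sum>k<n. \<integral>\<^sup>+z. ennreal ((lin (a k) (fst z))\<^sup>2) \<partial>(M \<Otimes>\<^sub>M M)) = (\<Sum>k<n. ennreal (var (a k)))"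
      by (intro sum.cong refl, subst nn_integral_fst[symmetric]) (auto simp: emeasure_space_1 nn_integral_lin)
    also have "(\<integral>\<^sup>+z. ennreal ((lin (a (s (fst z))) (snd z))\<^sup>2) \<partial>(M \<Otimes>\<^sub>M M)) = (\<integral>\<^sup>+\<omega>. ennreal (var (a (s \<omega>))) \<partial>M)"
      by (subst nn_integral_fst[symmetric]) (auto simp: nn_integral_lin)
    finally show ?thesis by (simp add: sum_ennreal var_nonneg)
  qed
  finally have "(\<integral>\<^sup>+z. ennreal ((F \<epsilon> z - F 0 z)\<^sup>2) \<partial>(M \<Otimes>\<^sub>M M)) \<le>
     2 * (ennreal (\<epsilon> ^ 4 / 2) * ennreal (\<Sum>k<n. var (a k)) + ennreal (2 * \<epsilon>\<^sup>2) * (\<integral>\<^sup>+\<omega>. ennreal (var (a (s \<omega>))) \<partial>M))"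
    unfolding split by (rule mult_left_mono) simp
  also have "\<dots> = ennreal (\<epsilon> ^ 4) * ennreal (\<Sum>k<n. var (a k)) + ennreal (4 * \<epsilon>\<^sup>2) * (\<integral>\<^sup>+\<omega>. ennreal (var (a (s \<omega>))) \<partial>M)"
  proof -
    have "2 * ennreal (\<epsilon> ^ 4 / 2) = ennreal (\<epsilon> ^ 4)" "2 * ennreal (2 * \<epsilon>\<^sup>2) = ennreal (4 * \<epsilon>\<^sup>2)"
      by (simp_all add: ennreal_numeral[symmetric] ennreal_mult[symmetric] del: ennreal_numeral)
    then show ?thesis by (simp add: distrib_left mult.assoc[symmetric])
  qed
  finally show ?thesis .
qed

text \<open>The quarter turn from one copy to the other is divided into \<open>N\<close> equal steps
  of the same law. Cauchy-Schwarz gives a factor \<open>N\<^sup>2\<close>, which meets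
  \<open>4 * \<epsilon>\<^sup>2\<close> with \<open>\<epsilon> = pi / 2 / N\<close> to form
  \<open>pi\<^sup>2\<close>, while the term of order \<open>\<epsilon> ^ 4\<close> vanishes as
  \<open>N\<close> grows. The left-hand side is twice the variance of \<open>F\<close>.\<close>

lemma affine_max_poincare:
  fixes a :: "nat \<Rightarrow> 'i \<Rightarrow> real" and b :: "nat \<Rightarrow> real"
  assumes n: "0 < n"
  defines "F \<equiv> \<lambda>\<omega>. affine_max D n a b (\<lambda>t. X t \<omega>)"
    and "s \<equiv> \<lambda>\<omega>. affine_argmax D n a b (\<lambda>t. X t \<omega>)"
  shows "(\<integral>\<^sup>+\<omega>. \<integral>\<^sup>+\<omega>'. ennreal ((F \<omega> - F \<omega>')\<^sup>2) \<partial>M \<partial>M) \<le>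
    ennreal (pi\<^sup>2) * (\<integral>\<^sup>+\<omega>. ennreal (var (a (s \<omega>))) \<partial>M)"
proof -
  interpret MM: pair_prob_space M M ..
  define R where "R \<theta> z = affine_max D n a b (\<lambda>t. rot \<theta> t z)" for \<theta> z
  have [measurable]: "R \<theta> \<in> borel_measurable (M \<Otimes>\<^sub>M M)" for \<theta>
    unfolding R_def using n rot_meas by (intro measurable_affine_max) auto
  have [measurable]: "F \<in> borel_measurable M"
    unfolding F_def using n X_meas by (intro measurable_affine_max) auto
  define V where "V = (\<integral>\<^sup>+\<omega>. ennreal (var (a (s \<omega>))) \<partial>M)"
  define S where "S = (\<Sum>k<n. var (a k))"
  have R0: "R 0 z = F (fst z)" and R1: "R (pi / 2) z = F (snd z)" for z
    by (simp_all add: R_def F_def rot_def)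
  have shift: "(\<integral>\<^sup>+z. ennreal ((R \<alpha> z - R \<beta> z)\<^sup>2) \<partial>(M \<Otimes>\<^sub>M M)) = (\<integral>\<^sup>+z. ennreal ((R (\<alpha> - \<beta>) z - R 0 z)\<^sup>2) \<partial>(M \<Otimes>\<^sub>M M))" for \<alpha> \<beta>
  proof -
    define G where "G z = ennreal ((affine_max D n a b (\<lambda>t. z (t, True)) - affine_max D n a b (\<lambda>t. z (t, False)))\<^sup>2)"
      for z :: "'i \<times> bool \<Rightarrow> real"
    have G_meas: "G \<in> borel_measurable (\<Pi>\<^sub>M j\<in>D \<times> UNIV. borel)"
    proof -
      have [measurable]: "(\<lambda>z. affine_max D n a b (\<lambda>t. z (t, c))) \<in> borel_measurable (\<Pi>\<^sub>M j\<in>D \<times> UNIV. borel)" for c :: bool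
        using n by (intro measurable_affine_max) (auto intro!: measurable_component_singleton)
      show ?thesis unfolding G_def by measurable
    qed
    have G_rot: "G (\<lambda>j\<in>D \<times> UNIV. rot_pair \<alpha> \<beta> j z) = ennreal ((R \<alpha> z - R \<beta> z)\<^sup>2)" for \<alpha> \<beta> z
    proof -
      have "affine_max D n a b (\<lambda>t. (\<lambda>j\<in>D \<times> UNIV. rot_pair \<alpha> \<beta> j z) (t, c)) = R (if c then \<alpha> else \<beta>) z" for c
        unfolding R_def affine_max_def
        by (intro arg_cong[where f=Max] image_cong refl arg_cong2[where f="(-)"] sum.cong) (auto simp: rot_pair_def)
      from this[of True] this[of False] show ?thesis unfolding G_def by simp
    qed
    show ?thesis using nn_integral_rot_pair[OF _ G_meas, of \<alpha> \<beta> "\<alpha> - \<beta>" 0] unfolding G_rot by simp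
  qed
  have bound: "(\<integral>\<^sup>+z. ennreal ((F (snd z) - F (fst z))\<^sup>2) \<partial>(M \<Otimes>\<^sub>M M)) \<le> ennreal (pi ^ 4 * S / 16 / (real N)\<^sup>2) + ennreal (pi\<^sup>2) * V"
    if N: "0 < N" for N :: nat
  proof -
    define \<epsilon> where "\<epsilon> = pi / 2 / N"
    have e: "0 \<le> \<epsilon>" by (simp add: \<epsilon>_def)
    have "(\<integral>\<^sup>+z. ennreal ((F (snd z) - F (fst z))\<^sup>2) \<partial>(M \<Otimes>\<^sub>M M)) \<le>
      (\<integral>\<^sup>+z. (\<Sum>i<N. ennreal (real N) * ennreal ((R (real (Suc i) * \<epsilon>) z - R (real i * \<epsilon>) z)\<^sup>2)) \<partial>(M \<Otimes>\<^sub>M M))"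
    proof (rule nn_integral_mono)
      fix z
      have "(\<Sum>i<N. R (real (Suc i) * \<epsilon>) z - R (real i * \<epsilon>) z) = R (real N * \<epsilon>) z - R (real 0 * \<epsilon>) z"
        by (rule sum_lessThan_telescope)
      also have "real N * \<epsilon> = pi / 2" using N by (simp add: \<epsilon>_def)
      finally have "F (snd z) - F (fst z) = (\<Sum>i<N. R (real (Suc i) * \<epsilon>) z - R (real i * \<epsilon>) z)"
        by (simp only: R0 R1 of_nat_0 mult_zero_left)
      then have "(F (snd z) - F (fst z))\<^sup>2 \<le> (\<Sum>i<N. real N * (R (real (Suc i) * \<epsilon>) z - R (real i * \<epsilon>) z)\<^sup>2)"
        using sum_squared_le_sum_of_squares[of "\<lambda>i. R (real (Suc i) * \<epsilon>) z - R (real i * \<epsilon>) z" "{..<N}"]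
        by (simp add: sum_distrib_left mult.commute)
      from ennreal_leI[OF this] show "ennreal ((F (snd z) - F (fst z))\<^sup>2) \<le>
          (\<Sum>i<N. ennreal (real N) * ennreal ((R (real (Suc i) * \<epsilon>) z - R (real i * \<epsilon>) z)\<^sup>2))"
        by (simp add: sum_ennreal[symmetric] ennreal_mult)
    qed
    also have "\<dots> = (\<Sum>i<N. ennreal (real N) * (\<integral>\<^sup>+z. ennreal ((R (real (Suc i) * \<epsilon>) z - R (real i * \<epsilon>) z)\<^sup>2) \<partial>(M \<Otimes>\<^sub>M M)))"
      by (simp add: nn_integral_sum nn_integral_cmult)
    also have "\<dots> = (\<Sum>i<N. ennreal (real N) * (\<integral>\<^sup>+z. ennreal ((R \<epsilon> z - R 0 z)\<^sup>2) \<partial>(M \<Otimes>\<^sub>M M)))"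
      by (subst shift) (simp add: algebra_simps)
    also have "\<dots> = ennreal ((real N)\<^sup>2) * (\<integral>\<^sup>+z. ennreal ((R \<epsilon> z - R 0 z)\<^sup>2) \<partial>(M \<Otimes>\<^sub>M M))"
      by (simp add: ennreal_of_nat_eq_real_of_nat power2_eq_square ennreal_mult mult.assoc)
    also have "\<dots> \<le> ennreal ((real N)\<^sup>2) * (ennreal (\<epsilon> ^ 4) * ennreal S + ennreal (4 * \<epsilon>\<^sup>2) * V)"
      unfolding R_def S_def V_def s_def by (intro mult_left_mono small_rotation n e) simp
    also have "\<dots> = ennreal ((real N)\<^sup>2 * \<epsilon> ^ 4 * S) + ennreal ((real N)\<^sup>2 * (4 * \<epsilon>\<^sup>2)) * V"
      by (simp add: distrib_left mult.assoc[symmetric] ennreal_mult S_def sum_nonneg var_nonneg)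
    also have "(real N)\<^sup>2 * \<epsilon> ^ 4 * S = pi ^ 4 * S / 16 / (real N)\<^sup>2"
      using N by (simp add: \<epsilon>_def power_divide field_simps power2_eq_square power4_eq_xxxx)
    also have "(real N)\<^sup>2 * (4 * \<epsilon>\<^sup>2) = pi\<^sup>2"
      using N by (simp add: \<epsilon>_def power_divide field_simps power2_eq_square)
    finally show ?thesis .
  qed
  have "(\<lambda>N. ennreal (pi ^ 4 * S / 16 / (real N)\<^sup>2) + ennreal (pi\<^sup>2) * V) \<longlonglongrightarrow> ennreal 0 + ennreal (pi\<^sup>2) * V"
  proof (intro tendsto_add tendsto_const tendsto_ennrealI)
    show "(\<lambda>N. pi ^ 4 * S / 16 / (real N)\<^sup>2) \<longlonglongrightarrow> 0"
      by (intro tendsto_divide_0[OF tendsto_const] filterlim_at_top_imp_at_infinity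
          filterlim_pow_at_top filterlim_real_sequentially) simp
  qed
  moreover have "eventually (\<lambda>N. (\<integral>\<^sup>+z. ennreal ((F (snd z) - F (fst z))\<^sup>2) \<partial>(M \<Otimes>\<^sub>M M)) \<le> ennreal (pi ^ 4 * S / 16 / (real N)\<^sup>2) + ennreal (pi\<^sup>2) * V) sequentially"
    using bound by (intro eventually_sequentiallyI[of 1]) auto
  ultimately have "(\<integral>\<^sup>+z. ennreal ((F (snd z) - F (fst z))\<^sup>2) \<partial>(M \<Otimes>\<^sub>M M)) \<le> ennreal 0 + ennreal (pi\<^sup>2) * V"
    by (intro tendsto_lowerbound) auto
  also have "(\<integral>\<^sup>+z. ennreal ((F (snd z) - F (fst z))\<^sup>2) \<partial>(M \<Otimes>\<^sub>M M)) = (\<integral>\<^sup>+\<omega>. \<integral>\<^sup>+\<omega>'. ennreal ((F \<omega> - F \<omega>')\<^sup>2) \<partial>M \<partial>M)"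
    by (subst nn_integral_fst[symmetric]) (auto simp: power2_commute)
  finally show ?thesis by (simp add: V_def)
qed

end

section \<open>Covariances of fractional Brownian motion\<close>

lemma convex_on_powr_nonneg:
  assumes "1 \<le> p" shows "convex_on {0..} (\<lambda>x::real. x powr p)"
proof (rule convex_onI)
  fix u x y :: real assume u: "0 < u" "u < 1" and xy: "x \<in> {0..}" "y \<in> {0..}"
  have small: "(w * z) powr p \<le> w * z powr p" if "0 < w" "w < 1" "0 \<le> z" for w z
  proof -
    have "w powr p \<le> w powr 1" using that assms by (intro powr_mono') auto
    then show ?thesis using that by (simp add: powr_mult mult_right_mono)
  qed
  consider "x = 0" | "y = 0" | "0 < x" "0 < y" using xy by force
  then show "((1 - u) *\<^sub>R x + u *\<^sub>R y) powr p \<le> (1 - u) * x powr p + u * y powr p"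
  proof cases
    case 3
    then show ?thesis using convex_onD[OF powr_convex[OF assms], of u x y] u by simp
  qed (use small[of u y] small[of "1 - u" x] u xy in auto)
qed simp

lemma concave_on_powr_nonneg:
  assumes "0 < p" "p \<le> 1" shows "concave_on {0..} (\<lambda>x::real. x powr p)"
  unfolding concave_on_def
proof (rule convex_onI)
  have c: "concave_on {0<..} (\<lambda>x::real. x powr p)"
  proof (rule f''_le0_imp_concave)
    show "((\<lambda>x. x powr p) has_real_derivative p * x powr (p - 1)) (at x)" if "x \<in> {0<..}" for x :: real
      using that by (auto intro!: derivative_eq_intros)
    show "((\<lambda>x. p * x powr (p - 1)) has_real_derivative p * ((p - 1) * x powr (p - 2))) (at x)" if "x \<in> {0<..}" for x :: real
      using that by (auto intro!: derivative_eq_intros)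
    show "p * ((p - 1) * x powr (p - 2)) \<le> 0" for x :: real
      using assms by (simp add: mult_nonneg_nonpos mult_nonpos_nonneg)
  qed simp
  fix u x y :: real assume u: "0 < u" "u < 1" and xy: "x \<in> {0..}" "y \<in> {0..}"
  have small: "w * z powr p \<le> (w * z) powr p" if "0 < w" "w < 1" "0 \<le> z" for w z
  proof -
    have "w powr 1 \<le> w powr p" using that assms by (intro powr_mono') auto
    then show ?thesis using that by (simp add: powr_mult mult_right_mono)
  qed
  consider "x = 0" | "y = 0" | "0 < x" "0 < y" using xy by force
  then show "- (((1 - u) *\<^sub>R x + u *\<^sub>R y) powr p) \<le> (1 - u) * - (x powr p) + u * - (y powr p)"
  proof cases
    case 3
    then show ?thesis using concave_onD[OF c, of u x y] u by simp
  qed (use small[of u y] small[of "1 - u" x] u xy in auto)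
qed simp

lemma convex_on_abs_powr:
  assumes "1 \<le> p" shows "convex_on UNIV (\<lambda>x::real. \<bar>x\<bar> powr p)"
proof (rule convex_onI)
  fix u x y :: real assume u: "0 < u" "u < 1"
  have "\<bar>(1 - u) * x + u * y\<bar> \<le> \<bar>(1 - u) * x\<bar> + \<bar>u * y\<bar>" by (rule abs_triangle_ineq)
  also have "\<dots> = (1 - u) * \<bar>x\<bar> + u * \<bar>y\<bar>" using u by (simp add: abs_mult)
  finally have "\<bar>(1 - u) * x + u * y\<bar> powr p \<le> ((1 - u) * \<bar>x\<bar> + u * \<bar>y\<bar>) powr p"
    using assms by (intro powr_mono2) auto
  also have "\<dots> \<le> (1 - u) * \<bar>x\<bar> powr p + u * \<bar>y\<bar> powr p"
    using convex_onD[OF convex_on_powr_nonneg[OF assms], of u "\<bar>x\<bar>" "\<bar>y\<bar>"] u by simp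
  finally show "\<bar>(1 - u) *\<^sub>R x + u *\<^sub>R y\<bar> powr p \<le> (1 - u) * \<bar>x\<bar> powr p + u * \<bar>y\<bar> powr p" by simp
qed simp

text \<open>\<open>b\<close> and \<open>c\<close> are complementary convex combinations of
  \<open>a\<close> and \<open>d\<close>, so the two convexity inequalities add up to the claim. It
  decides the sign of the covariance of two increments.\<close>

lemma convex_on_four_points:
  fixes f :: "real \<Rightarrow> real"
  assumes "convex_on S f" "a \<in> S" "d \<in> S" "a \<le> b" "a \<le> c" "a + d = b + c"
  shows "f b + f c \<le> f a + f d"
proof (cases "a = d")
  case True
  then have "b = d" "c = d" using assms by linarith+
  then show ?thesis using True by simp
next
  case False
  define u where "u = (b - a) / (d - a)"
  have ad: "a < d" using False assms by linarith
  have u: "0 \<le> u" "u \<le> 1" using ad assms by (auto simp: u_def)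
  have *: "u * (d - a) = b - a" using ad by (simp add: u_def)
  then have b: "b = (1 - u) * a + u * d" by (simp add: algebra_simps)
  have c: "c = (1 - (1 - u)) * a + (1 - u) * d" using * assms(6) by (simp add: algebra_simps)
  have "f b \<le> (1 - u) * f a + u * f d"
    using convex_onD[OF assms(1), of u a d] u assms by (simp add: b)
  moreover have "f c \<le> (1 - (1 - u)) * f a + (1 - u) * f d"
    using convex_onD[OF assms(1), of "1 - u" a d] u assms by (simp add: c)
  ultimately show ?thesis by (simp add: algebra_simps)
qed

section \<open>The truncated variation over a finite set as a maximum of affine functions\<close>

definition seg_coef :: "(real \<times> real) set \<Rightarrow> (real \<times> real) set \<Rightarrow> real \<Rightarrow> real" where
  "seg_coef Q P t = (\<Sum>p\<in>P. (if p \<in> Q then 1 else - 1) * (of_bool (t = snd p) - of_bool (t = fst p)))"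

lemma sum_seg_coef:
  assumes D: "finite D" and P: "P \<in> segs D"
  shows "(\<Sum>t\<in>D. seg_coef Q P t * x t) = (\<Sum>p\<in>P. (if p \<in> Q then 1 else - 1) * (x (snd p) - x (fst p)))"
proof -
  have "(\<Sum>t\<in>D. seg_coef Q P t * x t) =
      (\<Sum>p\<in>P. \<Sum>t\<in>D. (if p \<in> Q then 1 else - 1) * (of_bool (t = snd p) - of_bool (t = fst p)) * x t)"
    unfolding seg_coef_def sum_distrib_right by (rule sum.swap)
  also have "\<dots> = (\<Sum>p\<in>P. (if p \<in> Q then 1 else - 1) * (x (snd p) - x (fst p)))"
  proof (rule sum.cong[OF refl])
    fix p assume "p \<in> P"
    then have p: "fst p \<in> D" "snd p \<in> D" using segs_mem[OF P] by blast+
    have *: "(\<Sum>t\<in>D. of_bool (t = u) * x t) = x u" if "u \<in> D" for u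
    proof -
      have "(\<Sum>t\<in>D. of_bool (t = u) * x t) = (\<Sum>t\<in>D. if t = u then x t else 0)"
        by (intro sum.cong) auto
      then show ?thesis using that D by simp
    qed
    show "(\<Sum>t\<in>D. (if p \<in> Q then 1 else - 1) * (of_bool (t = snd p) - of_bool (t = fst p)) * x t) =
        (if p \<in> Q then 1 else - 1) * (x (snd p) - x (fst p))"
      unfolding mult.assoc sum_distrib_left[symmetric] left_diff_distrib sum_subtractf
      using *[OF p(1)] *[OF p(2)] by simp
  qed
  finally show ?thesis .
qed

text \<open>The term \<open>max (\<bar>d\<bar> - c) 0\<close> is the largest of
  \<open>d - c\<close>, \<open>- d - c\<close> and \<open>0\<close>, so the maximum runs over
  families \<open>P k\<close> together with the set \<open>Q k\<close> of intervals counted with a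
  positive sign. The enumeration does not depend on \<open>c\<close>, so one index can be valued at
  two thresholds; the empty family makes the maximum nonnegative.\<close>

lemma tvs_affine_max:
  assumes D: "finite D"
  shows "\<exists>n P Q. 0 < n \<and> (\<forall>k<n. P k \<in> segs D) \<and>
    (\<forall>c x. tvs c x D = ennreal (affine_max D n (\<lambda>k. seg_coef (Q k) (P k)) (\<lambda>k. c * real (card (P k))) x)) \<and>
    (\<forall>c x. 0 \<le> affine_max D n (\<lambda>k. seg_coef (Q k) (P k)) (\<lambda>k. c * real (card (P k))) x)"
proof -
  define A where "A = Sigma (segs D) Pow"
  have "segs D \<subseteq> Pow (D \<times> D)"
  proof
    fix P assume P: "P \<in> segs D"
    show "P \<in> Pow (D \<times> D)" using segs_mem[OF P] by (auto simp: mem_Times_iff)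
  qed
  then have "finite (segs D)" by (rule finite_subset) (use D in simp)
  then have "finite A" unfolding A_def using segs_finite by (intro finite_SigmaI) auto
  then obtain e where e: "bij_betw e {0..<card A} A" using ex_bij_betw_nat_finite by blast
  have A0: "({}, {}) \<in> A" by (simp add: A_def)
  then have n: "0 < card A" using \<open>finite A\<close> by (auto simp: card_gt_0_iff)
  define P where "P k = fst (e k)" for k
  define Q where "Q k = snd (e k)" for k
  have eA: "e k \<in> A" if "k < card A" for k using e that by (auto simp: bij_betw_def)
  have PA: "P k \<in> segs D" if "k < card A" for k using eA[OF that] by (auto simp: A_def P_def)
  have surj: "\<exists>k<card A. P k = R \<and> Q k = S" if "(R, S) \<in> A" for R S
  proof -
    have "(R, S) \<in> e ` {0..<card A}" using e that by (simp add: bij_betw_def)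
    then obtain k where "k < card A" "e k = (R, S)" by auto
    then show ?thesis by (auto simp: P_def Q_def)
  qed
  let ?F = "\<lambda>c x. affine_max D (card A) (\<lambda>k. seg_coef (Q k) (P k)) (\<lambda>k. c * real (card (P k))) x"
  have val: "(\<Sum>t\<in>D. seg_coef (Q k) (P k) t * x t) - c * real (card (P k)) =
      (\<Sum>p\<in>P k. (if p \<in> Q k then 1 else - 1) * (x (snd p) - x (fst p)) - c)" if "k < card A" for k c x
    using sum_seg_coef[OF D PA[OF that], of "Q k" x] by (simp add: sum_subtractf)
  have nn: "0 \<le> ?F c x" for c :: real and x
  proof -
    obtain k where k: "k < card A" "P k = {}" "Q k = {}" using surj[OF A0] by blast
    show ?thesis using affine_max_ge[OF k(1), where D=D and a="\<lambda>k. seg_coef (Q k) (P k)" and x=x and b="\<lambda>k. c * real (card (P k))"]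
      unfolding val[OF k(1)] unfolding k(2) by simp
  qed
  have eq: "tvs c x D = ennreal (?F c x)" for c x
  proof (rule antisym)
    show "tvs c x D \<le> ennreal (?F c x)"
    proof (rule tvs_least, rule ennreal_leI)
      fix R assume R: "R \<in> segs D"
      define R' where "R' = {p\<in>R. c < \<bar>x (snd p) - x (fst p)\<bar>}"
      define S where "S = {p\<in>R'. 0 < x (snd p) - x (fst p)}"
      have "R' \<in> segs D" by (rule segs_subset[OF R]) (simp add: R'_def)
      then have "(R', S) \<in> A" by (auto simp: A_def S_def)
      then obtain k where k: "k < card A" "P k = R'" "Q k = S" using surj by blast
      have "sum (gain c x) R = sum (gain c x) R'"
        using segs_finite[OF R] by (intro sum.mono_neutral_right) (auto simp: R'_def gain_def)
      also have "\<dots> = (\<Sum>p\<in>P k. (if p \<in> Q k then 1 else - 1) * (x (snd p) - x (fst p)) - c)"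
        unfolding k by (intro sum.cong) (auto simp: R'_def S_def gain_def)
      also have "\<dots> \<le> ?F c x"
        using affine_max_ge[OF k(1), where D=D and a="\<lambda>k. seg_coef (Q k) (P k)" and x=x and b="\<lambda>k. c * real (card (P k))"] by (simp only: val[OF k(1)])
      finally show "sum (gain c x) R \<le> ?F c x" .
    qed
    define k where "k = affine_argmax D (card A) (\<lambda>k. seg_coef (Q k) (P k)) (\<lambda>k. c * real (card (P k))) x"
    have k: "k < card A" unfolding k_def by (rule affine_argmax(1)[OF n])
    have "?F c x = (\<Sum>p\<in>P k. (if p \<in> Q k then 1 else - 1) * (x (snd p) - x (fst p)) - c)"
      using affine_argmax(2)[OF n, where D=D and a="\<lambda>k. seg_coef (Q k) (P k)" and b="\<lambda>k. c * real (card (P k))" and x=x]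
      unfolding k_def[symmetric] val[OF k] by simp
    also have "\<dots> \<le> sum (gain c x) (P k)" by (intro sum_mono) (auto simp: gain_def)
    finally show "ennreal (?F c x) \<le> tvs c x D"
      using tvs_upper[OF PA[OF k], of c x] by (meson ennreal_leI order_trans)
  qed
  show ?thesis using n PA eq nn by blast
qed

lemma tvs_measurable:
  assumes D: "finite D" and x: "\<And>t. t \<in> D \<Longrightarrow> (\<lambda>z. x z t) \<in> borel_measurable N"
  shows "(\<lambda>z. tvs c (x z) D) \<in> borel_measurable N"
proof -
  obtain n P Q where n: "0 < n"
    and e: "\<forall>c x. tvs c x D = ennreal (affine_max D n (\<lambda>k. seg_coef (Q k) (P k)) (\<lambda>k. c * real (card (P k))) x)"
    using tvs_affine_max[OF D] by blast
  show ?thesis unfolding e[rule_format] by (intro measurable_compose[OF measurable_affine_max[OF _ n] measurable_ennreal] x)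
qed

lemma tvs_finite_set:
  assumes "finite D" shows "tvs c x D < \<top>"
  using tvs_affine_max[OF assms] by fastforce

section \<open>Increments of fractional Brownian motion and the variance bound on grids\<close>

locale fbm = prob_space M for M :: "'a measure" +
  fixes H :: real and B :: "real \<Rightarrow> 'a \<Rightarrow> real"
  assumes H: "0 < H" "H < 1" and fbm: "fractional_brownian_motion M H B"
begin

lemma B_meas: "0 \<le> t \<Longrightarrow> B t \<in> borel_measurable M"
  using fbm by (simp add: fractional_brownian_motion_def centred_gaussian_process_def)

lemma B_cont: "\<omega> \<in> space M \<Longrightarrow> S \<subseteq> {0..} \<Longrightarrow> continuous_on S (\<lambda>t. B t \<omega>)"
  using fbm continuous_on_subset unfolding fractional_brownian_motion_def by blast

lemma gaussian: "finite D \<Longrightarrow> D \<subseteq> {0..} \<Longrightarrow> gaussian_family M D B"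
  using fbm unfolding fractional_brownian_motion_def centred_gaussian_process_def
  by unfold_locales auto

definition K :: real where
  "K = (SOME K. 0 < K \<and> (\<forall>s\<ge>0. \<forall>t\<ge>0. distr M borel (\<lambda>\<omega>. B t \<omega> - B s \<omega>) = normal_law 0 (K * \<bar>t - s\<bar> powr (2 * H))))"

lemma K: "0 < K"
  and B_increment: "0 \<le> s \<Longrightarrow> 0 \<le> t \<Longrightarrow> distr M borel (\<lambda>\<omega>. B t \<omega> - B s \<omega>) = normal_law 0 (K * \<bar>t - s\<bar> powr (2 * H))"
proof -
  have "\<exists>K. 0 < K \<and> (\<forall>s\<ge>0. \<forall>t\<ge>0. distr M borel (\<lambda>\<omega>. B t \<omega> - B s \<omega>) = normal_law 0 (K * \<bar>t - s\<bar> powr (2 * H)))"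
    using fbm by (auto simp: fractional_brownian_motion_def)
  from someI_ex[OF this] show "0 < K"
    "0 \<le> s \<Longrightarrow> 0 \<le> t \<Longrightarrow> distr M borel (\<lambda>\<omega>. B t \<omega> - B s \<omega>) = normal_law 0 (K * \<bar>t - s\<bar> powr (2 * H))"
    unfolding K_def by blast+
qed

lemma B_increment_moments:
  assumes "0 \<le> s" "0 \<le> t"
  shows "integrable M (\<lambda>\<omega>. B t \<omega> - B s \<omega>)" "integrable M (\<lambda>\<omega>. (B t \<omega> - B s \<omega>)\<^sup>2)"
    "(\<integral>\<omega>. (B t \<omega> - B s \<omega>)\<^sup>2 \<partial>M) = K * \<bar>t - s\<bar> powr (2 * H)"
proof -
  have m: "(\<lambda>\<omega>. B t \<omega> - B s \<omega>) \<in> borel_measurable M"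
    using B_meas assms by (intro borel_measurable_diff) auto
  have v: "0 \<le> K * \<bar>t - s\<bar> powr (2 * H)" using K by simp
  note mom = normal_law_moments[OF m v B_increment[OF assms]]
  show "integrable M (\<lambda>\<omega>. B t \<omega> - B s \<omega>)" "integrable M (\<lambda>\<omega>. (B t \<omega> - B s \<omega>)\<^sup>2)"
    "(\<integral>\<omega>. (B t \<omega> - B s \<omega>)\<^sup>2 \<partial>M) = K * \<bar>t - s\<bar> powr (2 * H)" by (rule mom)+
qed

definition inc :: "real \<times> real \<Rightarrow> 'a \<Rightarrow> real" where
  "inc p \<omega> = B (snd p) \<omega> - B (fst p) \<omega>"

definition cov :: "real \<times> real \<Rightarrow> real \<times> real \<Rightarrow> real" where
  "cov p q = (\<integral>\<omega>. inc p \<omega> * inc q \<omega> \<partial>M)"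

lemma inc_integrable:
  assumes "0 \<le> fst p" "0 \<le> snd p" "0 \<le> fst q" "0 \<le> snd q"
  shows "integrable M (\<lambda>\<omega>. inc p \<omega> * inc q \<omega>)"
  unfolding inc_def using assms B_meas
  by (intro integrable_mult_of_squares B_increment_moments borel_measurable_diff) auto

text \<open>Polarisation: the product of two increments is a combination of four squared
  increments.\<close>

lemma cov_eq:
  assumes "0 \<le> u" "0 \<le> v" "0 \<le> w" "0 \<le> z"
  shows "cov (u, v) (w, z) = K / 2 * (\<bar>z - u\<bar> powr (2 * H) + \<bar>w - v\<bar> powr (2 * H) - \<bar>w - u\<bar> powr (2 * H) - \<bar>z - v\<bar> powr (2 * H))"
proof -
  have "cov (u, v) (w, z) = (\<integral>\<omega>. ((B z \<omega> - B u \<omega>)\<^sup>2 + (B w \<omega> - B v \<omega>)\<^sup>2 - (B w \<omega> - B u \<omega>)\<^sup>2 - (B z \<omega> - B v \<omega>)\<^sup>2) / 2 \<partial>M)"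
    unfolding cov_def inc_def
    by (intro Bochner_Integration.integral_cong refl) (simp add: power2_eq_square algebra_simps)
  also have "\<dots> = (K * \<bar>z - u\<bar> powr (2 * H) + K * \<bar>w - v\<bar> powr (2 * H) - K * \<bar>w - u\<bar> powr (2 * H) - K * \<bar>z - v\<bar> powr (2 * H)) / 2"
    using assms by (simp add: B_increment_moments)
  finally show ?thesis by (simp add: algebra_simps)
qed

lemma cov_commute: "cov p q = cov q p"
  by (simp add: cov_def mult.commute)

lemma cov_self: "0 \<le> fst p \<Longrightarrow> 0 \<le> snd p \<Longrightarrow> cov p p = K * \<bar>snd p - fst p\<bar> powr (2 * H)"
  using B_increment_moments(3)[of "fst p" "snd p"] by (simp add: cov_def inc_def power2_eq_square)

text \<open>Both \<open>w - u\<close> and \<open>z - v\<close> lie between \<open>w - v\<close> and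
  \<open>z - u\<close>, with the same sum, and \<open>x powr (2 * H)\<close> is concave on the
  nonnegative half line; disjointness of the intervals keeps all four differences there.\<close>

lemma cov_nonpos:
  assumes h: "2 * H \<le> 1" and "0 \<le> u" "u < v" "v \<le> w" "w < z"
  shows "cov (u, v) (w, z) \<le> 0"
proof -
  have "convex_on {0..} (\<lambda>x::real. - (x powr (2 * H)))"
    using concave_on_powr_nonneg[of "2 * H"] H h by (simp add: concave_on_def)
  from convex_on_four_points[OF this, of "w - v" "z - u" "w - u" "z - v"] assms
  have "(z - u) powr (2 * H) + (w - v) powr (2 * H) - (w - u) powr (2 * H) - (z - v) powr (2 * H) \<le> 0" by simp
  moreover have "cov (u, v) (w, z) = K / 2 * ((z - u) powr (2 * H) + (w - v) powr (2 * H) - (w - u) powr (2 * H) - (z - v) powr (2 * H))"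
    using assms by (subst cov_eq) auto
  ultimately show ?thesis using K by (simp only: mult_nonneg_nonpos divide_nonneg_pos less_imp_le zero_less_numeral)
qed

text \<open>The same four differences as for disjoint intervals, but here the intervals may overlap
  and some differences may be negative; convexity of \<open>\<bar>x\<bar> powr (2 * H)\<close> holds
  on the whole line.\<close>

lemma cov_nonneg:
  assumes h: "1 \<le> 2 * H" and "0 \<le> u" "u \<le> v" "0 \<le> w" "w \<le> z"
  shows "0 \<le> cov (u, v) (w, z)"
proof -
  from convex_on_four_points[OF convex_on_abs_powr[OF h], of "w - v" "z - u" "w - u" "z - v"] assms
  have "0 \<le> \<bar>z - u\<bar> powr (2 * H) + \<bar>w - v\<bar> powr (2 * H) - \<bar>w - u\<bar> powr (2 * H) - \<bar>z - v\<bar> powr (2 * H)" by simp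
  then show ?thesis using assms K by (subst cov_eq) auto
qed

lemma signed_sum_square:
  assumes P: "P \<in> segs D" and D: "D \<subseteq> {0..}"
  shows "(\<integral>\<omega>. (\<Sum>p\<in>P. \<sigma> p * inc p \<omega>)\<^sup>2 \<partial>M) = (\<Sum>p\<in>P. \<Sum>q\<in>P. \<sigma> p * \<sigma> q * cov p q)"
proof -
  have nn: "0 \<le> fst p" "0 \<le> snd p" if "p \<in> P" for p using segs_mem[OF P that] D by auto
  have i: "integrable M (\<lambda>\<omega>. inc p \<omega> * inc q \<omega>)" if "p \<in> P" "q \<in> P" for p q
    using nn that by (intro inc_integrable) auto
  have "(\<integral>\<omega>. (\<Sum>p\<in>P. \<sigma> p * inc p \<omega>)\<^sup>2 \<partial>M) = (\<integral>\<omega>. (\<Sum>p\<in>P. \<Sum>q\<in>P. \<sigma> p * \<sigma> q * (inc p \<omega> * inc q \<omega>)) \<partial>M)"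
    by (intro Bochner_Integration.integral_cong refl) (simp add: power2_eq_square sum_product algebra_simps)
  also have "\<dots> = (\<Sum>p\<in>P. \<integral>\<omega>. (\<Sum>q\<in>P. \<sigma> p * \<sigma> q * (inc p \<omega> * inc q \<omega>)) \<partial>M)"
    using i by (intro Bochner_Integration.integral_sum Bochner_Integration.integrable_sum integrable_mult_right)
  also have "\<dots> = (\<Sum>p\<in>P. \<Sum>q\<in>P. \<integral>\<omega>. \<sigma> p * \<sigma> q * (inc p \<omega> * inc q \<omega>) \<partial>M)"
    using i by (intro sum.cong refl Bochner_Integration.integral_sum integrable_mult_right)
  finally show ?thesis by (simp add: cov_def)
qed

text \<open>Apart from the number of intervals, this is the growth exponent in \<open>T\<close> of
  the variance of signed sums of increments within \<open>[0, T]\<close>. The strong law rests on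
  its being less than \<open>2\<close>.\<close>

definition \<alpha> :: real where "\<alpha> = max 1 (2 * H)"

lemma \<alpha>: "1 \<le> \<alpha>" "\<alpha> < 2"
  using H by (auto simp: \<alpha>_def)

lemma signed_sum_le:
  assumes P: "P \<in> segs D" and D: "D \<subseteq> {0..T}" and T: "1 \<le> T"
    and \<sigma>: "\<And>p. p \<in> P \<Longrightarrow> \<sigma> p = 1 \<or> \<sigma> p = - 1"
  shows "(\<integral>\<omega>. (\<Sum>p\<in>P. \<sigma> p * inc p \<omega>)\<^sup>2 \<partial>M) \<le> 2 * K * (card P + T powr \<alpha>)"
proof -
  have D0: "D \<subseteq> {0..}" using D by auto
  have P': "P \<in> segs {0..T}" using P segs_mono[OF D] by blast
  have pp: "0 \<le> fst p" "fst p < snd p" "snd p \<le> T" if "p \<in> P" for p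
    using segs_mem[OF P that] D by auto
  have fin: "finite P" using P by (rule segs_finite)
  show ?thesis
  proof (cases "2 * H \<le> 1")
    case True
    have neg: "cov p q \<le> 0" if "p \<in> P" "q \<in> P" "p \<noteq> q" for p q
      using segs_disj[OF P that] cov_nonpos[OF True, of "fst p" "snd p" "fst q" "snd q"]
        cov_nonpos[OF True, of "fst q" "snd q" "fst p" "snd p"] pp[OF that(1)] pp[OF that(2)]
        cov_commute[of p q] by auto
    \<comment> \<open>Off the diagonal a sign times the nonpositive covariance is at most
      \<open>- cov p q\<close>. The full double sum of \<open>cov p q\<close> is the second moment
      of the unsigned sum, hence nonnegative, and may be dropped; only twice the diagonal
      remains.\<close>
    have "(\<Sum>p\<in>P. \<Sum>q\<in>P. \<sigma> p * \<sigma> q * cov p q) \<le> (\<Sum>p\<in>P. \<Sum>q\<in>P. (if p = q then 2 * cov p p else 0) - cov p q)"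
    proof (intro sum_mono)
      fix p q assume pq: "p \<in> P" "q \<in> P"
      show "\<sigma> p * \<sigma> q * cov p q \<le> (if p = q then 2 * cov p p else 0) - cov p q"
        using \<sigma>[OF pq(1)] \<sigma>[OF pq(2)] neg[OF pq] by auto
    qed
    also have "\<dots> = 2 * (\<Sum>p\<in>P. cov p p) - (\<Sum>p\<in>P. \<Sum>q\<in>P. cov p q)"
      using fin by (simp add: sum_subtractf sum_distrib_left)
    also have "(\<Sum>p\<in>P. \<Sum>q\<in>P. cov p q) = (\<integral>\<omega>. (\<Sum>p\<in>P. 1 * inc p \<omega>)\<^sup>2 \<partial>M)"
      using signed_sum_square[OF P D0, of "\<lambda>_. 1"] by simp
    also have "2 * (\<Sum>p\<in>P. cov p p) - \<dots> \<le> 2 * (\<Sum>p\<in>P. cov p p)" by simp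
    also have "(\<Sum>p\<in>P. cov p p) \<le> (\<Sum>p\<in>P. K * (1 + (snd p - fst p)))"
    proof (rule sum_mono)
      fix p assume p: "p \<in> P"
      \<comment> \<open>Summed over the family, this trades the single variances for the number of
        intervals plus their total length.\<close>
      have "x powr (2 * H) \<le> 1 + x" if "0 \<le> x" for x :: real
      proof (cases "x \<le> 1")
        case True
        have "x powr (2 * H) \<le> 1" using that True H by (intro powr_le1) auto
        then show ?thesis using that by simp
      next
        case False
        have "x powr (2 * H) \<le> x powr 1" using False \<open>2 * H \<le> 1\<close> by (intro powr_mono) auto
        then show ?thesis using False by simp
      qed
      from this[of "snd p - fst p"] show "cov p p \<le> K * (1 + (snd p - fst p))"
        using pp[OF p] K by (subst cov_self) auto
    qed
    also have "\<dots> = K * (card P + (\<Sum>p\<in>P. snd p - fst p))"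
      by (simp only: sum_distrib_left[symmetric] sum.distrib) simp
    also have "(\<Sum>p\<in>P. snd p - fst p) \<le> T - 0"
      using T by (intro segs_telescope[OF P', where G="\<lambda>x. x"]) (auto simp: mono_on_def)
    also have "T - 0 \<le> T powr \<alpha>" using powr_mono[OF \<alpha>(1) T] T by simp
    finally have "(\<Sum>p\<in>P. \<Sum>q\<in>P. \<sigma> p * \<sigma> q * cov p q) \<le> 2 * (K * (card P + T powr \<alpha>))"
      using K by simp
    then show ?thesis unfolding signed_sum_square[OF P D0] by (simp add: mult.assoc)
  next
    case False
    then have h: "1 \<le> 2 * H" by simp
    have cn: "0 \<le> cov p q" if "p \<in> P" "q \<in> P" for p q
      using cov_nonneg[OF h, of "fst p" "snd p" "fst q" "snd q"] pp[OF that(1)] pp[OF that(2)] by simp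
    have add: "cov (0, b) q - cov (0, a) q = cov (a, b) q"
      if ab: "0 \<le> a" "0 \<le> b" "0 \<le> fst q" "0 \<le> snd q" for a b q
    proof -
      have i: "integrable M (\<lambda>\<omega>. inc (0, b) \<omega> * inc q \<omega>)" "integrable M (\<lambda>\<omega>. inc (0, a) \<omega> * inc q \<omega>)"
        using ab by (intro inc_integrable; simp)+
      show ?thesis
        unfolding cov_def Bochner_Integration.integral_diff[OF i, symmetric]
        by (intro Bochner_Integration.integral_cong refl) (simp add: inc_def algebra_simps)
    qed
    \<comment> \<open>As a function of \<open>b\<close>, the covariance \<open>cov (0, b) q\<close>
      increases, so the covariances over disjoint intervals telescope. Applying this in each of the
      two arguments leaves the variance of \<open>inc (0, T)\<close>.\<close>
    have tel: "(\<Sum>p\<in>P. cov p q) \<le> cov (0, T) q" if q: "0 \<le> fst q" "fst q \<le> snd q" for q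
    proof -
      have "(\<Sum>p\<in>P. cov p q) = (\<Sum>p\<in>P. cov (0, snd p) q - cov (0, fst p) q)"
      proof (rule sum.cong[OF refl])
        fix p assume p: "p \<in> P"
        show "cov p q = cov (0, snd p) q - cov (0, fst p) q"
          using add[of "fst p" "snd p" q] pp[OF p] q by simp
      qed
      also have "\<dots> \<le> cov (0, T) q - cov (0, 0) q"
      proof (rule segs_telescope[OF P'])
        show "mono_on {0..T} (\<lambda>b. cov (0, b) q)"
        proof (rule mono_onI)
          fix a b assume ab: "a \<in> {0..T}" "b \<in> {0..T}" "a \<le> b"
          then have "0 \<le> cov (a, b) (fst q, snd q)" using q by (intro cov_nonneg[OF h]) auto
          then show "cov (0, a) q \<le> cov (0, b) q" using add[of a b q] ab q by simp
        qed
      qed (use T in auto)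
      also have "cov (0, 0) q = 0" by (simp add: cov_def inc_def)
      finally show ?thesis by simp
    qed
    have "(\<Sum>p\<in>P. \<Sum>q\<in>P. \<sigma> p * \<sigma> q * cov p q) \<le> (\<Sum>p\<in>P. \<Sum>q\<in>P. cov p q)"
    proof (intro sum_mono)
      fix p q assume pq: "p \<in> P" "q \<in> P"
      show "\<sigma> p * \<sigma> q * cov p q \<le> cov p q"
        using \<sigma>[OF pq(1)] \<sigma>[OF pq(2)] cn[OF pq] by auto
    qed
    also have "\<dots> \<le> (\<Sum>p\<in>P. cov (0, T) p)"
      using tel pp by (intro sum_mono) (simp add: cov_commute less_imp_le)
    also have "\<dots> = (\<Sum>p\<in>P. cov p (0, T))" by (intro sum.cong refl cov_commute)
    also have "\<dots> \<le> cov (0, T) (0, T)" using T by (intro tel) auto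
    also have "\<dots> = K * T powr (2 * H)" using T by (subst cov_self) auto
    also have "\<dots> \<le> 2 * K * (card P + T powr \<alpha>)"
    proof -
      have "T powr (2 * H) \<le> T powr \<alpha>" using T by (intro powr_mono) (auto simp: \<alpha>_def)
      also have "\<dots> \<le> 2 * (card P + T powr \<alpha>)" by simp
      finally have "K * T powr (2 * H) \<le> K * (2 * (card P + T powr \<alpha>))" using K by (intro mult_left_mono) auto
      then show ?thesis by (simp add: algebra_simps)
    qed
    finally show ?thesis unfolding signed_sum_square[OF P D0] .
  qed
qed

lemma tvs_poincare:
  assumes D: "finite D" "D \<subseteq> {0..T}" and T: "1 \<le> T" and c: "c' < c"
  defines "f \<equiv> \<lambda>\<omega>. enn2real (tvs c (\<lambda>t. B t \<omega>) D)"
  shows "(\<integral>\<^sup>+\<omega>. \<integral>\<^sup>+\<omega>'. ennreal ((f \<omega> - f \<omega>')\<^sup>2) \<partial>M \<partial>M) \<le>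
    ennreal (2 * pi\<^sup>2 * K) * (ennreal (T powr \<alpha>) + ennreal (1 / (c - c')) * (\<integral>\<^sup>+\<omega>. tvs c' (\<lambda>t. B t \<omega>) D \<partial>M))"
proof -
  have D0: "D \<subseteq> {0..}" using D by auto
  interpret G: gaussian_family M D B by (rule gaussian[OF D(1) D0])
  obtain n P Q where n: "0 < n" and P': "\<forall>k<n. P k \<in> segs D"
    and tv': "\<forall>c x. tvs c x D = ennreal (affine_max D n (\<lambda>k. seg_coef (Q k) (P k)) (\<lambda>k. c * real (card (P k))) x)"
    and nn': "\<forall>c x. 0 \<le> affine_max D n (\<lambda>k. seg_coef (Q k) (P k)) (\<lambda>k. c * real (card (P k))) x"
    using tvs_affine_max[OF D(1)] by blast
  note P = P'[rule_format] and tv = tv'[rule_format] and nn = nn'[rule_format]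
  let ?a = "\<lambda>k. seg_coef (Q k) (P k)"
  define b where "b c k = c * real (card (P k))" for c k
  have f: "f \<omega> = affine_max D n ?a (b c) (\<lambda>t. B t \<omega>)" for \<omega>
    unfolding f_def tv b_def using nn by simp
  define s where "s \<omega> = affine_argmax D n ?a (b c) (\<lambda>t. B t \<omega>)" for \<omega>
  have s: "s \<omega> < n" for \<omega> unfolding s_def by (rule affine_argmax(1)[OF n])
  have E1: "(\<integral>\<^sup>+\<omega>. \<integral>\<^sup>+\<omega>'. ennreal ((f \<omega> - f \<omega>')\<^sup>2) \<partial>M \<partial>M) \<le> ennreal (pi\<^sup>2) * (\<integral>\<^sup>+\<omega>. ennreal (G.var (?a (s \<omega>))) \<partial>M)"
    unfolding f s_def by (rule G.affine_max_poincare[OF n])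
  have "(\<integral>\<^sup>+\<omega>. ennreal (G.var (?a (s \<omega>))) \<partial>M) \<le>
      (\<integral>\<^sup>+\<omega>. ennreal (2 * K) * (ennreal (T powr \<alpha>) + ennreal (1 / (c - c')) * tvs c' (\<lambda>t. B t \<omega>) D) \<partial>M)"
  proof (rule nn_integral_mono)
    fix \<omega>
    define k where "k = s \<omega>"
    have k: "k < n" using s by (simp add: k_def)
    define F where "F c = affine_max D n ?a (b c) (\<lambda>t. B t \<omega>)" for c
    have "F c = (\<Sum>t\<in>D. ?a k t * B t \<omega>) - b c k"
      unfolding F_def k_def s_def by (rule affine_argmax(2)[OF n, symmetric])
    moreover have "(\<Sum>t\<in>D. ?a k t * B t \<omega>) - b c' k \<le> F c'"
      unfolding F_def by (rule affine_max_ge[OF k])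
    moreover have "0 \<le> F c" unfolding F_def b_def by (rule nn)
    \<comment> \<open>The maximiser for \<open>c\<close> has nonnegative value, and at threshold
      \<open>c'\<close> the same index is worth \<open>c - c'\<close> more per interval, yet at most
      \<open>F c'\<close>.\<close>
    ultimately have "(c - c') * real (card (P k)) \<le> F c'" by (simp add: b_def algebra_simps)
    then have card: "real (card (P k)) \<le> 1 / (c - c') * F c'" using c by (simp add: field_simps)
    have lin: "G.lin (?a k) = (\<lambda>\<omega>. \<Sum>p\<in>P k. (if p \<in> Q k then 1 else - 1) * inc p \<omega>)"
      unfolding G.lin_def[abs_def] sum_seg_coef[OF D(1) P[OF k]] inc_def ..
    have "G.var (?a k) \<le> 2 * K * (card (P k) + T powr \<alpha>)"
      unfolding G.var_def lin by (rule signed_sum_le[OF P[OF k] D(2) T]) auto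
    also have "\<dots> \<le> 2 * K * (T powr \<alpha> + 1 / (c - c') * F c')"
      using card K by (intro mult_left_mono) auto
    finally have "ennreal (G.var (?a k)) \<le> ennreal (2 * K * (T powr \<alpha> + 1 / (c - c') * F c'))" by (rule ennreal_leI)
    also have "\<dots> = ennreal (2 * K) * (ennreal (T powr \<alpha>) + ennreal (1 / (c - c')) * ennreal (F c'))"
    proof -
      have F0: "0 \<le> F c'" unfolding F_def b_def by (rule nn)
      have c0: "0 \<le> 1 / (c - c')" using c by simp
      show ?thesis using K F0 c0 by (simp only: ennreal_mult ennreal_plus mult_nonneg_nonneg powr_ge_zero add_nonneg_nonneg zero_le_numeral less_imp_le)
    qed
    also have "ennreal (F c') = tvs c' (\<lambda>t. B t \<omega>) D" unfolding F_def b_def tv ..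
    finally show "ennreal (G.var (?a (s \<omega>))) \<le> ennreal (2 * K) * (ennreal (T powr \<alpha>) + ennreal (1 / (c - c')) * tvs c' (\<lambda>t. B t \<omega>) D)"
      by (simp only: k_def)
  qed
  also have "\<dots> = ennreal (2 * K) * (ennreal (T powr \<alpha>) + ennreal (1 / (c - c')) * (\<integral>\<^sup>+\<omega>. tvs c' (\<lambda>t. B t \<omega>) D \<partial>M))"
  proof -
    have [measurable]: "(\<lambda>\<omega>. tvs c' (\<lambda>t. B t \<omega>) D) \<in> borel_measurable M"
      using D0 by (intro tvs_measurable D B_meas) auto
    show ?thesis by (simp add: nn_integral_cmult nn_integral_add emeasure_space_1)
  qed
  finally have "ennreal (pi\<^sup>2) * (\<integral>\<^sup>+\<omega>. ennreal (G.var (?a (s \<omega>))) \<partial>M) \<le>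
    ennreal (pi\<^sup>2) * (ennreal (2 * K) * (ennreal (T powr \<alpha>) + ennreal (1 / (c - c')) * (\<integral>\<^sup>+\<omega>. tvs c' (\<lambda>t. B t \<omega>) D \<partial>M)))"
    by (rule mult_left_mono) simp
  moreover have "ennreal (pi\<^sup>2) * ennreal (2 * K) = ennreal (2 * pi\<^sup>2 * K)"
  proof -
    have "ennreal (pi\<^sup>2) * ennreal (2 * K) = ennreal (pi\<^sup>2 * (2 * K))" using K by (intro ennreal_mult[symmetric]) auto
    also have "pi\<^sup>2 * (2 * K) = 2 * pi\<^sup>2 * K" by simp
    finally show ?thesis .
  qed
  ultimately have "ennreal (pi\<^sup>2) * (\<integral>\<^sup>+\<omega>. ennreal (G.var (?a (s \<omega>))) \<partial>M) \<le>
    ennreal (2 * pi\<^sup>2 * K) * (ennreal (T powr \<alpha>) + ennreal (1 / (c - c')) * (\<integral>\<^sup>+\<omega>. tvs c' (\<lambda>t. B t \<omega>) D \<partial>M))"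
    by (simp only: mult.assoc[symmetric])
  with E1 show ?thesis by (rule order_trans)
qed

end

section \<open>Scaling of the truncated variation\<close>

text \<open>Fekete's lemma: the limit is the supremum of \<open>u n / n\<close>, finite by the
  linear bound.\<close>

lemma superadditive_limit:
  fixes u :: "nat \<Rightarrow> real" and b :: real
  assumes super: "\<And>m n. u m + u n \<le> u (m + n)" and nn: "\<And>n. 0 \<le> u n" and le: "\<And>n. u n \<le> b * real n"
  shows "\<exists>L\<ge>0. (\<lambda>n. u n / n) \<longlonglongrightarrow> L"
proof -
  define L where "L = (SUP n\<in>{0<..}. u n / real n)"
  have bdd: "bdd_above ((\<lambda>n. u n / real n) ` {0<..})"
    using le by (intro bdd_aboveI[of _ b]) (auto simp: field_simps)
  have up: "u n / n \<le> L" if "0 < n" for n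
    unfolding L_def using bdd that by (intro cSUP_upper) auto
  have mult: "real k * u m \<le> u (k * m)" for k m
  proof (induction k)
    case (Suc k)
    have "real (Suc k) * u m = u m + real k * u m" by (simp add: algebra_simps)
    also have "\<dots> \<le> u m + u (k * m)" using Suc by simp
    also have "\<dots> \<le> u (Suc k * m)" using super[of m "k * m"] by simp
    finally show ?case .
  qed (use nn in simp)
  have "(\<lambda>n. u n / n) \<longlonglongrightarrow> L"
  proof (rule LIMSEQ_I)
    fix e :: real assume e: "0 < e"
    have "\<exists>m\<in>{0<..}. L - e / 2 < u m / real m"
      using e less_cSUP_iff[OF _ bdd, of "L - e / 2"] by (auto simp: L_def)
    then obtain m where m: "0 < m" "L - e / 2 < u m / m" by auto
    have um: "0 \<le> u m" by (rule nn)
    obtain n0 :: nat where n0: "2 * (u m + 1) / e < n0" using reals_Archimedean2 by blast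
    have "norm (u n / n - L) < e" if n: "n \<ge> max 1 n0" for n
    proof -
      have n1: "0 < n" using n by simp
      have "real (n div m) * u m \<le> u (n div m * m)" by (rule mult)
      also have "\<dots> \<le> u n" using super[of "n div m * m" "n mod m"] nn[of "n mod m"] by simp
      finally have 1: "real (n div m) * u m \<le> u n" .
      have "real n \<le> (real (n div m) + 1) * m"
      proof -
        have "n \<le> (n div m + 1) * m" using m(1) by (simp add: dividend_less_div_times less_imp_le)
        then have "real n \<le> real ((n div m + 1) * m)" by (simp only: of_nat_le_iff)
        then show ?thesis by (simp add: distrib_right)
      qed
      then have "real n * (u m / m) \<le> (real (n div m) + 1) * m * (u m / m)"
        using um by (intro mult_right_mono) auto
      also have "\<dots> = real (n div m) * u m + u m" using m by (simp add: field_simps)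
      also have "\<dots> \<le> u n + u m" using 1 by simp
      finally have 2: "u m / m \<le> u n / n + u m / n" using n1 by (simp add: field_simps)
      have "2 * (u m + 1) / e < n" using n0 n by linarith
      then have "u m / n < e / 2" using e n1 um by (simp add: field_simps)
      then have "L - u n / n < e" using 2 m(2) by linarith
      moreover have "u n / n \<le> L" by (rule up[OF n1])
      ultimately show ?thesis by simp
    qed
    then show "\<exists>n0. \<forall>n\<ge>n0. norm (u n / n - L) < e" by blast
  qed
  moreover have "0 \<le> L" using up[of 1] nn[of 1] by simp
  ultimately show ?thesis by blast
qed

text \<open>Between consecutive members of the sequence, monotonicity of \<open>g\<close> sandwiches
  the function at the cost of powers of the ratio \<open>c k / c (Suc k)\<close>, which tends to
  1.\<close>

lemma at_right_limit_of_sequence: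
  fixes g :: "real \<Rightarrow> real"
  assumes q: "0 \<le> q" and anti: "\<And>x y. 0 < x \<Longrightarrow> x \<le> y \<Longrightarrow> g y \<le> g x" and nn: "\<And>x. 0 \<le> g x"
    and c: "\<And>k. 0 < c k" "decseq c" "c \<longlonglongrightarrow> 0" "(\<lambda>k. c k / c (Suc k)) \<longlonglongrightarrow> 1"
    and lim: "(\<lambda>k. c k powr q * g (c k)) \<longlonglongrightarrow> l"
  shows "((\<lambda>x. x powr q * g x) \<longlongrightarrow> l) (at_right 0)"
proof -
  \<comment> \<open>For \<open>0 < x <= c 0\<close> this index satisfies
    \<open>c (Suc (\<kappa> x)) < x <= c (\<kappa> x)\<close>.\<close>
  define \<kappa> where "\<kappa> x = (LEAST k. c (Suc k) < x)" for x
  have \<kappa>1: "c (Suc (\<kappa> x)) < x" if x: "0 < x" for x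
  proof -
    have "eventually (\<lambda>k. c k < x) sequentially" using c(3) x by (rule order_tendstoD)
    then obtain k where "\<And>n. n \<ge> k \<Longrightarrow> c n < x" unfolding eventually_sequentially by blast
    then have "c (Suc k) < x" by simp
    then show ?thesis unfolding \<kappa>_def by (rule LeastI)
  qed
  have \<kappa>2: "x \<le> c (\<kappa> x)" if "x \<le> c 0" for x
  proof (cases "\<kappa> x")
    case (Suc j)
    then have "\<not> c (Suc j) < x" using not_less_Least[of j "\<lambda>k. c (Suc k) < x"] by (simp add: \<kappa>_def)
    then show ?thesis using Suc by simp
  qed (use that in simp)
  have \<kappa>3: "m \<le> \<kappa> x" if "0 < x" "x \<le> c m" for x m
  proof (rule ccontr)
    assume "\<not> m \<le> \<kappa> x"
    then have "c m \<le> c (Suc (\<kappa> x))" by (intro decseqD[OF c(2)]) auto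
    then show False using \<kappa>1[OF that(1)] that(2) by simp
  qed
  have ev: "eventually (\<lambda>x. 0 < x \<and> x \<le> c m) (at_right 0)" for m
    unfolding eventually_at_right_field using c(1)[of m] by (intro exI[of _ "c m"]) auto
  have fl: "filterlim \<kappa> sequentially (at_right 0)"
    unfolding filterlim_at_top
  proof
    fix m
    show "eventually (\<lambda>x. m \<le> \<kappa> x) (at_right 0)"
      by (rule eventually_mono[OF ev[of m]]) (simp add: \<kappa>3)
  qed
  have up: "((\<lambda>x. (c (\<kappa> x) / c (Suc (\<kappa> x))) powr q * (c (Suc (\<kappa> x)) powr q * g (c (Suc (\<kappa> x))))) \<longlongrightarrow> l) (at_right 0)"
  proof -
    have "(\<lambda>k. (c k / c (Suc k)) powr q * (c (Suc k) powr q * g (c (Suc k)))) \<longlonglongrightarrow> 1 powr q * l"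
      by (intro tendsto_intros c lim[THEN LIMSEQ_Suc]) simp
    from filterlim_compose[OF this fl] show ?thesis by simp
  qed
  have lo: "((\<lambda>x. (c (\<kappa> x) / c (Suc (\<kappa> x))) powr (- q) * (c (\<kappa> x) powr q * g (c (\<kappa> x)))) \<longlongrightarrow> l) (at_right 0)"
  proof -
    have "(\<lambda>k. (c k / c (Suc k)) powr (- q) * (c k powr q * g (c k))) \<longlonglongrightarrow> 1 powr (- q) * l"
      by (intro tendsto_intros c lim) simp
    from filterlim_compose[OF this fl] show ?thesis by simp
  qed
  show ?thesis
  proof (rule tendsto_sandwich[OF _ _ lo up])
    show "eventually (\<lambda>x. (c (\<kappa> x) / c (Suc (\<kappa> x))) powr (- q) * (c (\<kappa> x) powr q * g (c (\<kappa> x))) \<le> x powr q * g x) (at_right 0)"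
      using ev[of 0]
    proof eventually_elim
      case (elim x)
      let ?a = "c (\<kappa> x)" and ?b = "c (Suc (\<kappa> x))"
      have b: "0 < ?a" "0 < ?b" "?b < x" "x \<le> ?a" using c(1) \<kappa>1 \<kappa>2 elim by auto
      have "(?a / ?b) powr (- q) * (?a powr q * g ?a) = ?b powr q * g ?a"
        using b by (simp add: powr_divide powr_minus field_simps)
      also have "\<dots> \<le> x powr q * g x"
        using b q nn elim by (intro mult_mono powr_mono2 anti) auto
      finally show ?case .
    qed
    show "eventually (\<lambda>x. x powr q * g x \<le> (c (\<kappa> x) / c (Suc (\<kappa> x))) powr q * (c (Suc (\<kappa> x)) powr q * g (c (Suc (\<kappa> x))))) (at_right 0)"
      using ev[of 0]
    proof eventually_elim
      case (elim x)
      let ?a = "c (\<kappa> x)" and ?b = "c (Suc (\<kappa> x))"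
      have b: "0 < ?a" "0 < ?b" "?b < x" "x \<le> ?a" using c(1) \<kappa>1 \<kappa>2 elim by auto
      have "x powr q * g x \<le> ?a powr q * g ?b"
        using b q nn elim by (intro mult_mono powr_mono2 anti) auto
      also have "\<dots> = (?a / ?b) powr q * (?b powr q * g ?b)"
        using b by (simp add: powr_divide field_simps)
      finally show ?case .
    qed
  qed
qed

lemma dy_image: "dy N (s + \<rho> * a) (s + \<rho> * b) = (\<lambda>t. s + \<rho> * t) ` dy N a b"
  unfolding dy_def image_image by (intro image_cong refl) (simp add: algebra_simps)

lemma dy_nonneg: "0 \<le> s \<Longrightarrow> s \<le> t \<Longrightarrow> dy N s t \<subseteq> {0..}"
  using dy_subset[of s t N] by force

lemma tvs_singleton: "D \<subseteq> {s} \<Longrightarrow> tvs c x D = 0"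
proof -
  assume D: "D \<subseteq> {s}"
  have "P = {}" if P: "P \<in> segs D" for P
  proof (rule ccontr)
    assume "P \<noteq> {}"
    then obtain p where "p \<in> P" by blast
    then have "fst p \<in> D" "snd p \<in> D" "fst p < snd p" using segs_mem[OF P, of p] by blast+
    moreover then have "fst p = s" "snd p = s" using D by blast+
    ultimately show False by simp
  qed
  then have "segs D = {{}}" by auto
  then show ?thesis by (simp add: tvs_def)
qed

lemma (in prob_space) double_integral_square_diff:
  fixes f :: "'a \<Rightarrow> real"
  assumes i: "integrable M f" "integrable M (\<lambda>x. (f x)\<^sup>2)"
  shows "(\<integral>\<^sup>+\<omega>. \<integral>\<^sup>+\<omega>'. ennreal ((f \<omega> - f \<omega>')\<^sup>2) \<partial>M \<partial>M) = ennreal (2 * (expectation (\<lambda>x. (f x)\<^sup>2) - (expectation f)\<^sup>2))"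
proof -
  let ?m = "expectation f" and ?q = "expectation (\<lambda>x. (f x)\<^sup>2)"
  have e: "(f \<omega> - f \<omega>')\<^sup>2 = (f \<omega>)\<^sup>2 - 2 * f \<omega> * f \<omega>' + (f \<omega>')\<^sup>2" for \<omega> \<omega>'
    by (simp add: power2_diff)
  have inner: "(\<integral>\<^sup>+\<omega>'. ennreal ((f \<omega> - f \<omega>')\<^sup>2) \<partial>M) = ennreal ((f \<omega>)\<^sup>2 - 2 * f \<omega> * ?m + ?q)"
    and inner0: "0 \<le> (f \<omega>)\<^sup>2 - 2 * f \<omega> * ?m + ?q" for \<omega>
  proof -
    have "integrable M (\<lambda>\<omega>'. (f \<omega> - f \<omega>')\<^sup>2)" unfolding e using i by simp
    then have "(\<integral>\<^sup>+\<omega>'. ennreal ((f \<omega> - f \<omega>')\<^sup>2) \<partial>M) = ennreal (\<integral>\<omega>'. (f \<omega> - f \<omega>')\<^sup>2 \<partial>M)"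
      by (intro nn_integral_eq_integral) auto
    also have eq: "(\<integral>\<omega>'. (f \<omega> - f \<omega>')\<^sup>2 \<partial>M) = (f \<omega>)\<^sup>2 - 2 * f \<omega> * ?m + ?q"
      unfolding e using i by (simp add: prob_space)
    finally show "(\<integral>\<^sup>+\<omega>'. ennreal ((f \<omega> - f \<omega>')\<^sup>2) \<partial>M) = ennreal ((f \<omega>)\<^sup>2 - 2 * f \<omega> * ?m + ?q)" .
    show "0 \<le> (f \<omega>)\<^sup>2 - 2 * f \<omega> * ?m + ?q" unfolding eq[symmetric] by simp
  qed
  have i': "integrable M (\<lambda>\<omega>. (f \<omega>)\<^sup>2 - 2 * f \<omega> * ?m + ?q)" using i by simp
  have "(\<integral>\<^sup>+\<omega>. \<integral>\<^sup>+\<omega>'. ennreal ((f \<omega> - f \<omega>')\<^sup>2) \<partial>M \<partial>M) = (\<integral>\<^sup>+\<omega>. ennreal ((f \<omega>)\<^sup>2 - 2 * f \<omega> * ?m + ?q) \<partial>M)"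
    by (simp only: inner)
  also have "\<dots> = ennreal (\<integral>\<omega>. (f \<omega>)\<^sup>2 - 2 * f \<omega> * ?m + ?q \<partial>M)"
    using i' inner0 by (intro nn_integral_eq_integral) auto
  also have "(\<integral>\<omega>. (f \<omega>)\<^sup>2 - 2 * f \<omega> * ?m + ?q \<partial>M) = 2 * (?q - ?m\<^sup>2)"
    using i by (simp add: prob_space power2_eq_square)
  finally show ?thesis .
qed

section \<open>Stationarity and self-similarity applied to the truncated variation\<close>

lemma process_law_transfer:
  assumes law: "process_law M X = process_law M Y"
    and X: "\<And>t. 0 \<le> t \<Longrightarrow> X t \<in> borel_measurable M" and Y: "\<And>t. 0 \<le> t \<Longrightarrow> Y t \<in> borel_measurable M"
    and G: "G \<in> borel_measurable (\<Pi>\<^sub>M t\<in>{0..}. borel)"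
  shows "(\<integral>\<^sup>+\<omega>. G (restrict (\<lambda>t. X t \<omega>) {0..}) \<partial>M) = (\<integral>\<^sup>+\<omega>. G (restrict (\<lambda>t. Y t \<omega>) {0..}) \<partial>M)"
proof -
  have "integral\<^sup>N (process_law M Z) G = (\<integral>\<^sup>+\<omega>. G (restrict (\<lambda>t. Z t \<omega>) {0..}) \<partial>M)"
    if Z: "\<And>t. 0 \<le> t \<Longrightarrow> Z t \<in> borel_measurable M" for Z :: "real \<Rightarrow> 'a \<Rightarrow> real"
    unfolding process_law_def
  proof (rule nn_integral_distr)
    show "(\<lambda>\<omega>. restrict (\<lambda>t. Z t \<omega>) {0..}) \<in> measurable M (\<Pi>\<^sub>M t\<in>{0..}. borel)"
      by (rule measurable_restrict) (simp add: Z)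
  qed (use G in simp)
  from this[of X, OF X] this[of Y, OF Y] show ?thesis using law by simp
qed

context fbm
begin

text \<open>Stationarity of the increments moves the starting point \<open>s\<close> to
  \<open>0\<close>, then self-similarity removes the factor \<open>\<rho>\<close>; the truncated
  variation sees only increments, so the value at the starting point cancels. Since
  \<open>process_law\<close> lives on a product space, where measurable functionals depend on
  countably many times, a supremum over grids appears instead of an interval. The function
  \<open>g\<close> admits moments other than the mean.\<close>

lemma law_scaling:
  assumes \<rho>: "0 < \<rho>" and s: "0 \<le> s" and D: "\<And>N::nat. finite (D N)" "\<And>N. D N \<subseteq> {0..}"
    and g [measurable]: "g \<in> borel_measurable (borel :: ennreal measure)"
  shows "(\<integral>\<^sup>+\<omega>. g (SUP N. tvs (\<rho> powr H * c) (\<lambda>t. B t \<omega>) ((\<lambda>t. s + \<rho> * t) ` D N)) \<partial>M) =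
    (\<integral>\<^sup>+\<omega>. g (ennreal (\<rho> powr H) * (SUP N. tvs c (\<lambda>t. B t \<omega>) (D N))) \<partial>M)"
proof -
  define k where "k = \<rho> powr H"
  have k: "0 < k" using \<rho> by (simp add: k_def)
  have ki: "\<rho> powr (- H) = inverse k" by (simp add: k_def powr_minus)
  define G where "G x = g (ennreal k * (SUP N. tvs c (\<lambda>t. inverse k * x (\<rho> * t)) (D N)))" for x
  define G' where "G' x = g (ennreal k * (SUP N. tvs c x (D N)))" for x
  have G_meas: "G \<in> borel_measurable (\<Pi>\<^sub>M t\<in>{0..}. borel)"
  proof -
    have [measurable]: "(\<lambda>x. tvs c (\<lambda>t. inverse k * x (\<rho> * t)) (D N)) \<in> borel_measurable (\<Pi>\<^sub>M t\<in>{0..}. borel)" for N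
    proof (rule tvs_measurable[OF D(1)])
      fix t assume "t \<in> D N"
      then have "\<rho> * t \<in> {0..}" using D(2) \<rho> by (auto intro!: mult_nonneg_nonneg)
      then show "(\<lambda>x. inverse k * x (\<rho> * t)) \<in> borel_measurable (\<Pi>\<^sub>M t\<in>{0..}. borel)"
        by (intro borel_measurable_times borel_measurable_const measurable_component_singleton)
    qed
    show ?thesis unfolding G_def by measurable
  qed
  have G'_meas: "G' \<in> borel_measurable (\<Pi>\<^sub>M t\<in>{0..}. borel)"
  proof -
    have [measurable]: "(\<lambda>x. tvs c x (D N)) \<in> borel_measurable (\<Pi>\<^sub>M t\<in>{0..}. borel)" for N
    proof (rule tvs_measurable[OF D(1)])
      fix t assume "t \<in> D N"
      then have "t \<in> {0..}" using D(2) by auto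
      then show "(\<lambda>x. x t) \<in> borel_measurable (\<Pi>\<^sub>M t\<in>{0..}. borel)"
        by (rule measurable_component_singleton)
    qed
    show ?thesis unfolding G'_def by measurable
  qed
  have t0: "0 \<le> t" "0 \<le> \<rho> * t" if "t \<in> D N" for t N using that D(2) \<rho> by (auto intro!: mult_nonneg_nonneg)
  have 1: "g (SUP N. tvs (k * c) (\<lambda>t. B t \<omega>) ((\<lambda>t. s + \<rho> * t) ` D N)) = G (restrict (\<lambda>t. B (s + t) \<omega> - B s \<omega>) {0..})" for \<omega>
  proof -
    have "tvs (k * c) (\<lambda>t. B t \<omega>) ((\<lambda>t. s + \<rho> * t) ` D N) =
        ennreal k * tvs c (\<lambda>t. inverse k * restrict (\<lambda>t. B (s + t) \<omega> - B s \<omega>) {0..} (\<rho> * t)) (D N)" for N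
    proof -
      have "tvs (k * c) (\<lambda>t. B t \<omega>) ((\<lambda>t. s + \<rho> * t) ` D N) = tvs (k * c) (\<lambda>t. B (s + \<rho> * t) \<omega>) (D N)"
        using \<rho> by (intro tvs_image strict_mono_onI) auto
      also have "\<dots> = tvs (k * c) (\<lambda>t. k * (inverse k * restrict (\<lambda>t. B (s + t) \<omega> - B s \<omega>) {0..} (\<rho> * t)) + B s \<omega>) (D N)"
        using k t0 by (intro tvs_cong) (simp add: mult.assoc[symmetric])
      also have "\<dots> = ennreal k * tvs c (\<lambda>t. inverse k * restrict (\<lambda>t. B (s + t) \<omega> - B s \<omega>) {0..} (\<rho> * t)) (D N)"
        by (rule tvs_scale[OF k])
      finally show ?thesis .
    qed
    then show ?thesis unfolding G_def by (simp add: SUP_mult_left_ennreal)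
  qed
  have 2: "G (restrict (\<lambda>t. B t \<omega> - B 0 \<omega>) {0..}) = G' (restrict (\<lambda>t. \<rho> powr (- H) * B (\<rho> * t) \<omega>) {0..})" for \<omega>
  proof -
    have "tvs c (\<lambda>t. inverse k * restrict (\<lambda>t. B t \<omega> - B 0 \<omega>) {0..} (\<rho> * t)) (D N) =
        tvs c (restrict (\<lambda>t. \<rho> powr (- H) * B (\<rho> * t) \<omega>) {0..}) (D N)" for N
    proof -
      have "tvs c (\<lambda>t. inverse k * restrict (\<lambda>t. B t \<omega> - B 0 \<omega>) {0..} (\<rho> * t)) (D N) =
          tvs (1 * c) (\<lambda>t. 1 * restrict (\<lambda>t. \<rho> powr (- H) * B (\<rho> * t) \<omega>) {0..} t + (- inverse k * B 0 \<omega>)) (D N)"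
        unfolding mult_1_left using t0 by (intro tvs_cong) (simp add: ki algebra_simps)
      also have "\<dots> = ennreal 1 * tvs c (restrict (\<lambda>t. \<rho> powr (- H) * B (\<rho> * t) \<omega>) {0..}) (D N)"
        by (rule tvs_scale) simp
      finally show ?thesis by simp
    qed
    then show ?thesis unfolding G_def G'_def by simp
  qed
  have 3: "g (ennreal k * (SUP N. tvs c (\<lambda>t. B t \<omega>) (D N))) = G' (restrict (\<lambda>t. B t \<omega>) {0..})" for \<omega>
  proof -
    have "tvs c (\<lambda>t. B t \<omega>) (D N) = tvs c (restrict (\<lambda>t. B t \<omega>) {0..}) (D N)" for N
      using t0 by (intro tvs_cong) simp
    then show ?thesis unfolding G'_def by simp
  qed
  have st: "process_law M (\<lambda>t \<omega>. B (s + t) \<omega> - B s \<omega>) = process_law M (\<lambda>t \<omega>. B t \<omega> - B 0 \<omega>)"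
    using fbm s by (simp add: fractional_brownian_motion_def stationary_increments_def)
  have ss: "process_law M (\<lambda>t \<omega>. \<rho> powr (- H) * B (\<rho> * t) \<omega>) = process_law M B"
    using fbm \<rho> by (simp add: fractional_brownian_motion_def self_similar_def)
  have "(\<integral>\<^sup>+\<omega>. G (restrict (\<lambda>t. B (s + t) \<omega> - B s \<omega>) {0..}) \<partial>M) = (\<integral>\<^sup>+\<omega>. G (restrict (\<lambda>t. B t \<omega> - B 0 \<omega>) {0..}) \<partial>M)"
    using s by (intro process_law_transfer[OF st] borel_measurable_diff B_meas G_meas) auto
  also have "\<dots> = (\<integral>\<^sup>+\<omega>. G' (restrict (\<lambda>t. B t \<omega>) {0..}) \<partial>M)"
    unfolding 2 using \<rho> by (intro process_law_transfer[OF ss] borel_measurable_times borel_measurable_const B_meas G'_meas) auto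
  finally show ?thesis by (simp only: 1[symmetric] 3[symmetric] k_def)
qed

lemma tvs_grid_meas: "finite D \<Longrightarrow> D \<subseteq> {0..} \<Longrightarrow> (\<lambda>\<omega>. tvs c (\<lambda>t. B t \<omega>) D) \<in> borel_measurable M"
  by (intro tvs_measurable B_meas) auto

lemma tvs_interval:
  assumes "0 \<le> s" "s < t" "\<omega> \<in> space M"
  shows "tvs c (\<lambda>t. B t \<omega>) {s..t} = (SUP N. tvs c (\<lambda>t. B t \<omega>) (dy N s t))"
  using assms by (intro tvs_dyadic B_cont) auto

lemma tvs_interval_meas:
  assumes "0 \<le> s" "s < t"
  shows "(\<lambda>\<omega>. tvs c (\<lambda>t. B t \<omega>) {s..t}) \<in> borel_measurable M"
proof -
  have [measurable]: "(\<lambda>\<omega>. tvs c (\<lambda>t. B t \<omega>) (dy N s t)) \<in> borel_measurable M" for N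
    using assms by (intro tvs_grid_meas dy_nonneg) auto
  have "(\<lambda>\<omega>. SUP N. tvs c (\<lambda>t. B t \<omega>) (dy N s t)) \<in> borel_measurable M" by measurable
  then show ?thesis by (rule measurable_cong[THEN iffD2, rotated]) (rule tvs_interval[OF assms])
qed

lemma tvs_interval_finite: "0 < c \<Longrightarrow> 0 \<le> s \<Longrightarrow> \<omega> \<in> space M \<Longrightarrow> tvs c (\<lambda>t. B t \<omega>) {s..t} < \<top>"
  using tvs_finite_continuous[OF B_cont, of \<omega> s t c] by (auto simp: infinity_ennreal_def)

lemma law_grid:
  assumes "0 < \<rho>" "0 \<le> s" "finite D" "D \<subseteq> {0..}"
  shows "(\<integral>\<^sup>+\<omega>. tvs (\<rho> powr H * c) (\<lambda>t. B t \<omega>) ((\<lambda>t. s + \<rho> * t) ` D) \<partial>M) =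
    ennreal (\<rho> powr H) * (\<integral>\<^sup>+\<omega>. tvs c (\<lambda>t. B t \<omega>) D \<partial>M)"
  using law_scaling[OF assms(1,2), of "\<lambda>_. D" "\<lambda>x. x" c] assms tvs_grid_meas[OF assms(3,4)]
  by (simp add: nn_integral_cmult)

lemma law_interval:
  assumes "0 < \<rho>" "0 \<le> s" "0 < T" "g \<in> borel_measurable (borel :: ennreal measure)"
  shows "(\<integral>\<^sup>+\<omega>. g (tvs (\<rho> powr H * c) (\<lambda>t. B t \<omega>) {s..s + \<rho> * T}) \<partial>M) =
    (\<integral>\<^sup>+\<omega>. g (ennreal (\<rho> powr H) * tvs c (\<lambda>t. B t \<omega>) {0..T}) \<partial>M)"
proof -
  have "(\<integral>\<^sup>+\<omega>. g (tvs (\<rho> powr H * c) (\<lambda>t. B t \<omega>) {s..s + \<rho> * T}) \<partial>M) =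
      (\<integral>\<^sup>+\<omega>. g (SUP N. tvs (\<rho> powr H * c) (\<lambda>t. B t \<omega>) ((\<lambda>t. s + \<rho> * t) ` dy N 0 T)) \<partial>M)"
    using assms dy_image[of _ s \<rho> 0 T] by (intro nn_integral_cong) (simp add: tvs_interval)
  also have "\<dots> = (\<integral>\<^sup>+\<omega>. g (ennreal (\<rho> powr H) * (SUP N. tvs c (\<lambda>t. B t \<omega>) (dy N 0 T))) \<partial>M)"
    using assms by (intro law_scaling dy_nonneg) auto
  also have "\<dots> = (\<integral>\<^sup>+\<omega>. g (ennreal (\<rho> powr H) * tvs c (\<lambda>t. B t \<omega>) {0..T}) \<partial>M)"
    using assms by (intro nn_integral_cong) (simp add: tvs_interval)
  finally show ?thesis .
qed

text \<open>On a fixed grid the increments over all pairs of grid points dominate, and these have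
  second moments. The bound deteriorates as the grid is refined; it only secures
  integrability.\<close>

lemma tvs_grid_moments:
  assumes D: "finite D" "D \<subseteq> {0..}" and c: "0 \<le> c"
  defines "f \<equiv> \<lambda>\<omega>. enn2real (tvs c (\<lambda>t. B t \<omega>) D)"
  shows "integrable M f" "integrable M (\<lambda>\<omega>. (f \<omega>)\<^sup>2)"
    "(\<integral>\<^sup>+\<omega>. tvs c (\<lambda>t. B t \<omega>) D \<partial>M) = ennreal (expectation f)"
proof -
  have [measurable]: "(\<lambda>\<omega>. tvs c (\<lambda>t. B t \<omega>) D) \<in> borel_measurable M" by (rule tvs_grid_meas[OF D])
  have fm [measurable]: "f \<in> borel_measurable M" unfolding f_def by measurable
  define S where "S \<omega> = (\<Sum>p\<in>D \<times> D. \<bar>inc p \<omega>\<bar>)" for \<omega>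
  have le: "f \<omega> \<le> S \<omega>" for \<omega>
  proof -
    have "tvs c (\<lambda>t. B t \<omega>) D \<le> ennreal (S \<omega>)"
    proof (rule tvs_least, rule ennreal_leI)
      fix P assume P: "P \<in> segs D"
      have "P \<subseteq> D \<times> D"
      proof
        fix p assume "p \<in> P"
        then show "p \<in> D \<times> D" using segs_mem[OF P] by (simp add: mem_Times_iff)
      qed
      then have "sum (gain c (\<lambda>t. B t \<omega>)) P \<le> sum (gain c (\<lambda>t. B t \<omega>)) (D \<times> D)"
        using D by (intro sum_mono2) auto
      also have "\<dots> \<le> S \<omega>" unfolding S_def using c by (intro sum_mono) (auto simp: gain_def inc_def)
      finally show "sum (gain c (\<lambda>t. B t \<omega>)) P \<le> S \<omega>" .
    qed
    then show ?thesis unfolding f_def by (intro enn2real_leI) (auto simp: S_def sum_nonneg)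
  qed
  have f0: "0 \<le> f \<omega>" for \<omega> by (simp add: f_def)
  have p0: "0 \<le> fst p" "0 \<le> snd p" if "p \<in> D \<times> D" for p using that D by (auto simp: mem_Times_iff)
  have S1: "integrable M S"
    unfolding S_def inc_def using p0 by (intro Bochner_Integration.integrable_sum integrable_abs B_increment_moments)
  show i1: "integrable M f"
    by (rule Bochner_Integration.integrable_bound[OF S1]) (use le f0 in \<open>auto intro: order_trans[OF _ abs_ge_self]\<close>)
  have S2: "integrable M (\<lambda>\<omega>. (\<Sum>p\<in>D \<times> D. card (D \<times> D) * (inc p \<omega>)\<^sup>2))"
    unfolding inc_def using p0 by (intro Bochner_Integration.integrable_sum integrable_mult_right B_increment_moments)
  have le2: "(f \<omega>)\<^sup>2 \<le> (\<Sum>p\<in>D \<times> D. card (D \<times> D) * (inc p \<omega>)\<^sup>2)" for \<omega>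
  proof -
    have "(f \<omega>)\<^sup>2 \<le> (S \<omega>)\<^sup>2" using le f0 by (intro power_mono)
    also have "\<dots> \<le> (\<Sum>p\<in>D \<times> D. (\<bar>inc p \<omega>\<bar>)\<^sup>2) * card (D \<times> D)"
      unfolding S_def by (rule sum_squared_le_sum_of_squares)
    also have "\<dots> = (\<Sum>p\<in>D \<times> D. card (D \<times> D) * (inc p \<omega>)\<^sup>2)"
      unfolding power2_abs by (subst mult.commute) (rule sum_distrib_left)
    finally show ?thesis .
  qed
  show "integrable M (\<lambda>\<omega>. (f \<omega>)\<^sup>2)"
    by (rule Bochner_Integration.integrable_bound[OF S2]) (use le2 in \<open>auto intro: order_trans[OF _ abs_ge_self]\<close>)
  have "(\<integral>\<^sup>+\<omega>. tvs c (\<lambda>t. B t \<omega>) D \<partial>M) = (\<integral>\<^sup>+\<omega>. ennreal (f \<omega>) \<partial>M)"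
    using tvs_finite_set[OF D(1)] by (simp add: f_def)
  also have "\<dots> = ennreal (expectation f)" using i1 f0 by (intro nn_integral_eq_integral) auto
  finally show "(\<integral>\<^sup>+\<omega>. tvs c (\<lambda>t. B t \<omega>) D \<partial>M) = ennreal (expectation f)" .
qed

lemma tvs_grid_variance:
  assumes D: "finite D" "D \<subseteq> {0..T}" and T: "1 \<le> T" and c: "0 \<le> c'" "c' < c"
    and bound: "(\<integral>\<^sup>+\<omega>. tvs c' (\<lambda>t. B t \<omega>) D \<partial>M) \<le> ennreal b" "0 \<le> b"
  defines "f \<equiv> \<lambda>\<omega>. enn2real (tvs c (\<lambda>t. B t \<omega>) D)"
  shows "expectation (\<lambda>\<omega>. (f \<omega>)\<^sup>2) - (expectation f)\<^sup>2 \<le> pi\<^sup>2 * K * (T powr \<alpha> + b / (c - c'))"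
proof -
  have D0: "D \<subseteq> {0..}" using D by auto
  have c0: "0 \<le> c" using c by simp
  have i: "integrable M f" "integrable M (\<lambda>\<omega>. (f \<omega>)\<^sup>2)"
    unfolding f_def by (rule tvs_grid_moments[OF D(1) D0 c0])+
  have "ennreal (2 * (expectation (\<lambda>x. (f x)\<^sup>2) - (expectation f)\<^sup>2)) \<le>
      ennreal (2 * pi\<^sup>2 * K) * (ennreal (T powr \<alpha>) + ennreal (1 / (c - c')) * (\<integral>\<^sup>+\<omega>. tvs c' (\<lambda>t. B t \<omega>) D \<partial>M))"
    unfolding double_integral_square_diff[OF i, symmetric] unfolding f_def by (rule tvs_poincare[OF D T c(2)])
  also have "\<dots> \<le> ennreal (2 * pi\<^sup>2 * K) * (ennreal (T powr \<alpha>) + ennreal (1 / (c - c')) * ennreal b)"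
    using bound by (intro mult_left_mono add_left_mono) auto
  also have "\<dots> = ennreal (2 * pi\<^sup>2 * K * (T powr \<alpha> + 1 / (c - c') * b))"
  proof -
    have c0: "0 \<le> 1 / (c - c')" using c by simp
    show ?thesis using K bound(2) c0 by (simp only: ennreal_mult ennreal_plus mult_nonneg_nonneg powr_ge_zero add_nonneg_nonneg zero_le_numeral less_imp_le zero_le_power2)
  qed
  finally have "2 * (expectation (\<lambda>x. (f x)\<^sup>2) - (expectation f)\<^sup>2) \<le> 2 * pi\<^sup>2 * K * (T powr \<alpha> + 1 / (c - c') * b)"
    using K bound(2) c by (subst (asm) ennreal_le_iff) (auto intro!: mult_nonneg_nonneg add_nonneg_nonneg)
  then show ?thesis by simp
qed

end

section \<open>Strong law for the truncated variation\<close>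

context fbm
begin

text \<open>Halving time turns the threshold \<open>1\<close> into \<open>\<theta>\<close>. It is
  the smaller threshold inserted into the variance bound for threshold \<open>1\<close>.\<close>

definition \<theta> :: real where "\<theta> = (1 / 2) powr H"

lemma \<theta>: "0 < \<theta>" "\<theta> < 1"
proof -
  show "0 < \<theta>" by (simp add: \<theta>_def)
  have "(1 / 2 :: real) powr H < (1 / 2) powr 0" using H by (intro powr_less_mono') auto
  then show "\<theta> < 1" by (simp add: \<theta>_def)
qed

lemma dy_double: "dy N 0 2 \<subseteq> dy N 0 1 \<union> dy N 1 2"
proof
  fix u assume "u \<in> dy N 0 2"
  then obtain j where j: "j \<le> 2 ^ N" "u = 2 * (real j / 2 ^ N)" by (auto simp: dy_def)
  show "u \<in> dy N 0 1 \<union> dy N 1 2"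
  proof (cases "2 * j \<le> 2 ^ N")
    case True
    have "u = 0 + (1 - 0) * (real (2 * j) / 2 ^ N)" using j by simp
    then show ?thesis using True unfolding dy_def by blast
  next
    case False
    then have "real (2 * j - 2 ^ N) = 2 * real j - 2 ^ N" by (simp add: of_nat_diff)
    then have "u = 1 + (2 - 1) * (real (2 * j - 2 ^ N) / 2 ^ N)" using j by (simp add: field_simps)
    moreover have "2 * j - 2 ^ N \<le> 2 ^ N" using j by simp
    ultimately show ?thesis unfolding dy_def by blast
  qed
qed

text \<open>Scaling turns threshold \<open>\<theta>\<close> on \<open>[0, 1]\<close> into threshold
  \<open>1\<close> on \<open>[0, 2]\<close>, which is cut at time \<open>1\<close> at a cost of
  \<open>1\<close>. Both sides concern the same level \<open>N\<close>, so the variance on this grid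
  gets bounded by means on the same grid.\<close>

lemma grid_mean_half:
  "(\<integral>\<^sup>+\<omega>. tvs \<theta> (\<lambda>t. B t \<omega>) (dy N 0 1) \<partial>M) \<le> 2 * (\<integral>\<^sup>+\<omega>. tvs 1 (\<lambda>t. B t \<omega>) (dy N 0 1) \<partial>M) + 1"
proof -
  have d0: "dy N 0 1 \<subseteq> {0..}" "dy N 0 2 \<subseteq> {0..}" "dy N 1 2 \<subseteq> {0..}" by (intro dy_nonneg; simp)+
  have [measurable]: "(\<lambda>\<omega>. tvs 1 (\<lambda>t. B t \<omega>) (dy N 0 1)) \<in> borel_measurable M"
    "(\<lambda>\<omega>. tvs 1 (\<lambda>t. B t \<omega>) (dy N 1 2)) \<in> borel_measurable M"
    using d0 by (intro tvs_grid_meas; simp)+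
  have "(\<integral>\<^sup>+\<omega>. tvs \<theta> (\<lambda>t. B t \<omega>) (dy N 0 1) \<partial>M) = ennreal \<theta> * (\<integral>\<^sup>+\<omega>. tvs 1 (\<lambda>t. B t \<omega>) (dy N 0 2) \<partial>M)"
    using law_grid[of "1/2" 0 "dy N 0 2" 1] d0 dy_image[of N 0 "1/2" 0 2] by (simp add: \<theta>_def)
  also have "\<dots> \<le> 1 * (\<integral>\<^sup>+\<omega>. tvs 1 (\<lambda>t. B t \<omega>) (dy N 0 2) \<partial>M)"
    using \<theta> by (intro mult_right_mono) (auto simp: ennreal_le_1)
  also have "\<dots> \<le> (\<integral>\<^sup>+\<omega>. tvs 1 (\<lambda>t. B t \<omega>) (dy N 0 1) + tvs 1 (\<lambda>t. B t \<omega>) (dy N 1 2) + 1 \<partial>M)"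
    unfolding mult_1_left
  proof (rule nn_integral_mono)
    fix \<omega>
    let ?x = "\<lambda>t. B t \<omega>"
    let ?D = "dy N 0 1 \<union> dy N 1 2"
    have "tvs 1 ?x (dy N 0 2) \<le> tvs 1 ?x ?D" by (intro tvs_mono_set dy_double)
    also have "\<dots> \<le> tvs 1 ?x (?D \<inter> {..1}) + tvs 1 ?x (?D \<inter> {1..}) + ennreal 1"
      by (intro tvs_subadditive) (auto simp: dy_ends)
    also have "\<dots> \<le> tvs 1 ?x (dy N 0 1) + tvs 1 ?x (dy N 1 2) + ennreal 1"
    proof (intro add_mono tvs_mono_set order_refl)
      show "?D \<inter> {..1} \<subseteq> dy N 0 1"
        using dy_subset[of 1 2 N] dy_ends(2)[of 1 N 0] by force
      show "?D \<inter> {1..} \<subseteq> dy N 1 2"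
        using dy_subset[of 0 1 N] dy_ends(1)[of 1 N 2] by force
    qed
    finally show "tvs 1 ?x (dy N 0 2) \<le> tvs 1 ?x (dy N 0 1) + tvs 1 ?x (dy N 1 2) + 1" by simp
  qed
  also have "\<dots> = (\<integral>\<^sup>+\<omega>. tvs 1 (\<lambda>t. B t \<omega>) (dy N 0 1) \<partial>M) + (\<integral>\<^sup>+\<omega>. tvs 1 (\<lambda>t. B t \<omega>) (dy N 1 2) \<partial>M) + 1"
    by (simp add: nn_integral_add emeasure_space_1)
  also have "(\<integral>\<^sup>+\<omega>. tvs 1 (\<lambda>t. B t \<omega>) (dy N 1 2) \<partial>M) = (\<integral>\<^sup>+\<omega>. tvs 1 (\<lambda>t. B t \<omega>) (dy N 0 1) \<partial>M)"
    using law_grid[of 1 1 "dy N 0 1" 1] d0 dy_image[of N 1 1 0 1] by simp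
  finally show ?thesis by (simp add: mult_2)
qed

text \<open>The grid means are bounded uniformly in the mesh: a median of the limit is an upper bound for
  them up to a standard deviation, and the variance grows at most linearly with the mean.\<close>

lemma grid_mean_bounded:
  "\<exists>R. \<forall>N. (\<integral>\<^sup>+\<omega>. tvs 1 (\<lambda>t. B t \<omega>) (dy N 0 1) \<partial>M) \<le> ennreal R"
proof -
  define f where "f N \<omega> = enn2real (tvs 1 (\<lambda>t. B t \<omega>) (dy N 0 1))" for N \<omega>
  define g where "g \<omega> = enn2real (tvs 1 (\<lambda>t. B t \<omega>) {0..1})" for \<omega>
  define e where "e N = expectation (f N)" for N
  have d0: "finite (dy N 0 1)" "dy N 0 1 \<subseteq> {0..}" "dy N 0 1 \<subseteq> {0..1}" for N
    using dy_nonneg[of 0 1 N] dy_subset[of 0 1 N] by simp_all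
  have [measurable]: "g \<in> borel_measurable M"
    unfolding g_def by (intro measurable_compose[OF tvs_interval_meas]) auto
  have fm: "integrable M (f N)" "integrable M (\<lambda>\<omega>. (f N \<omega>)\<^sup>2)"
    and e: "(\<integral>\<^sup>+\<omega>. tvs 1 (\<lambda>t. B t \<omega>) (dy N 0 1) \<partial>M) = ennreal (e N)" for N
    unfolding f_def[abs_def] e_def by (rule tvs_grid_moments[OF d0(1,2)]; simp)+
  have e0: "0 \<le> e N" for N unfolding e_def by (intro Bochner_Integration.integral_nonneg) (simp add: f_def)
  have fg: "f N \<omega> \<le> g \<omega>" if "\<omega> \<in> space M" for N \<omega>
    unfolding f_def g_def using d0 tvs_interval_finite[of 1 0 \<omega> 1] that
    by (intro enn2real_mono tvs_mono_set) auto
  obtain A :: nat where A: "1 / 2 \<le> prob {\<omega>\<in>space M. g \<omega> \<le> real A}"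
  proof -
    have "(\<lambda>n. prob {\<omega>\<in>space M. g \<omega> \<le> real n}) \<longlonglongrightarrow> prob (\<Union>n. {\<omega>\<in>space M. g \<omega> \<le> real n})"
      by (intro finite_Lim_measure_incseq) (auto simp: incseq_def)
    also have "(\<Union>n. {\<omega>\<in>space M. g \<omega> \<le> real n}) = space M" using real_arch_simple by auto
    finally have "(\<lambda>n. prob {\<omega>\<in>space M. g \<omega> \<le> real n}) \<longlonglongrightarrow> 1" by (simp add: prob_space)
    then have "eventually (\<lambda>n. 1 / 2 < prob {\<omega>\<in>space M. g \<omega> \<le> real n}) sequentially"
      by (rule order_tendstoD) simp
    then show thesis using that unfolding eventually_sequentially by (meson less_imp_le order_refl)
  qed
  define \<beta> where "\<beta> = pi\<^sup>2 * K * (1 + 1 / (1 - \<theta>))"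
  define \<gamma> where "\<gamma> = pi\<^sup>2 * K * (2 / (1 - \<theta>))"
  have bg: "0 \<le> \<beta>" "0 \<le> \<gamma>" using K \<theta> by (auto simp: \<beta>_def \<gamma>_def)
  have var: "expectation (\<lambda>\<omega>. (f N \<omega>)\<^sup>2) - (e N)\<^sup>2 \<le> \<beta> + \<gamma> * e N" for N
  proof -
    have "(\<integral>\<^sup>+\<omega>. tvs \<theta> (\<lambda>t. B t \<omega>) (dy N 0 1) \<partial>M) \<le> 2 * ennreal (e N) + 1"
      using grid_mean_half[of N] unfolding e .
    also have "\<dots> = ennreal (2 * e N + 1)" using e0 by (simp add: ennreal_plus ennreal_mult)
    finally have b: "(\<integral>\<^sup>+\<omega>. tvs \<theta> (\<lambda>t. B t \<omega>) (dy N 0 1) \<partial>M) \<le> ennreal (2 * e N + 1)" .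
    have "expectation (\<lambda>\<omega>. (f N \<omega>)\<^sup>2) - (e N)\<^sup>2 \<le> pi\<^sup>2 * K * (1 powr \<alpha> + (2 * e N + 1) / (1 - \<theta>))"
      unfolding e_def f_def[abs_def]
      by (rule tvs_grid_variance[OF d0(1,3) _ _ _ b[unfolded e_def f_def[abs_def]]])
         (use \<theta> e0[of N] in \<open>simp_all add: e_def f_def[abs_def]\<close>)
    also have "\<dots> = \<beta> + \<gamma> * e N" unfolding \<beta>_def \<gamma>_def by (simp add: algebra_simps add_divide_distrib)
    finally show ?thesis .
  qed
  \<comment> \<open>With \<open>y = e N - A\<close>, Chebyshev's inequality on the event of
    probability at least \<open>1 / 2\<close> gives
    \<open>y * y <= 2 * \<gamma> * y + (2 * \<beta> + 2 * \<gamma> * A)\<close>. The constant is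
    chosen beyond the larger root of this quadratic, and at least \<open>1\<close> so that the
    constant term can be compared with a multiple of \<open>y\<close>.\<close>
  have "e N \<le> A + (2 * \<gamma> + (2 * \<beta> + 2 * \<gamma> * A) + 1)" for N
  proof (rule ccontr)
    assume neg: "\<not> ?thesis"
    define y where "y = e N - A"
    have y: "y > 2 * \<gamma> + (2 * \<beta> + 2 * \<gamma> * A) + 1" using neg by (simp add: y_def)
    have c0: "0 \<le> 2 * \<beta> + 2 * \<gamma> * A" using bg by simp
    have y1: "1 \<le> y" using y c0 bg by linarith
    let ?S = "{\<omega>\<in>space M. g \<omega> \<le> real A}"
    have "y\<^sup>2 * prob ?S = expectation (\<lambda>\<omega>. y\<^sup>2 * indicator ?S \<omega>)" by simp
    also have "\<dots> \<le> expectation (\<lambda>\<omega>. (f N \<omega> - e N)\<^sup>2)"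
    proof (rule integral_mono)
      show "integrable M (\<lambda>\<omega>. y\<^sup>2 * indicator ?S \<omega>)"
        by (intro integrable_mult_right integrable_real_indicator) (auto simp: less_top[symmetric])
      show "integrable M (\<lambda>\<omega>. (f N \<omega> - e N)\<^sup>2)"
        using fm[of N] by (simp add: power2_diff)
      fix \<omega> assume \<omega>: "\<omega> \<in> space M"
      show "y\<^sup>2 * indicator ?S \<omega> \<le> (f N \<omega> - e N)\<^sup>2"
      proof (cases "\<omega> \<in> ?S")
        case True
        then have "y \<le> e N - f N \<omega>" using fg[OF \<omega>, of N] by (simp add: y_def)
        then have "y\<^sup>2 \<le> (e N - f N \<omega>)\<^sup>2" using y1 by (intro power_mono) auto
        then show ?thesis using True by (simp add: power2_commute)
      qed simp
    qed
    also have "\<dots> = expectation (\<lambda>\<omega>. (f N \<omega>)\<^sup>2) - (e N)\<^sup>2"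
      using variance_eq[OF fm[of N]] by (simp add: e_def)
    also have "\<dots> \<le> \<beta> + \<gamma> * e N" by (rule var)
    finally have 1: "y\<^sup>2 * prob ?S \<le> \<beta> + \<gamma> * (y + A)" by (simp add: y_def)
    have "y\<^sup>2 * (1 / 2) \<le> y\<^sup>2 * prob ?S" using A by (intro mult_left_mono) auto
    then have 2: "y * y \<le> 2 * \<gamma> * y + (2 * \<beta> + 2 * \<gamma> * A)" using 1 by (simp add: power2_eq_square algebra_simps)
    have "(2 * \<gamma> + (2 * \<beta> + 2 * \<gamma> * A) + 1) * y \<le> y * y" using y y1 by (intro mult_right_mono) auto
    moreover have "(2 * \<beta> + 2 * \<gamma> * A) * 1 \<le> (2 * \<beta> + 2 * \<gamma> * A) * y" using c0 y1 by (intro mult_left_mono) auto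
    ultimately show False using 2 y1 by (simp only: distrib_right mult_1_left mult_1_right)
  qed
  then show ?thesis unfolding e by (meson ennreal_leI)
qed

lemma mean_dyadic_le:
  assumes "0 \<le> s" "s < t" "\<And>N. (\<integral>\<^sup>+\<omega>. tvs c (\<lambda>r. B r \<omega>) (dy N s t) \<partial>M) \<le> z"
  shows "(\<integral>\<^sup>+\<omega>. tvs c (\<lambda>r. B r \<omega>) {s..t} \<partial>M) \<le> z"
proof -
  have d0: "dy N s t \<subseteq> {0..}" for N using assms by (intro dy_nonneg) auto
  have "(\<integral>\<^sup>+\<omega>. tvs c (\<lambda>r. B r \<omega>) {s..t} \<partial>M) = (\<integral>\<^sup>+\<omega>. (SUP N. tvs c (\<lambda>r. B r \<omega>) (dy N s t)) \<partial>M)"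
    using assms by (intro nn_integral_cong tvs_interval) auto
  also have "\<dots> = (SUP N. \<integral>\<^sup>+\<omega>. tvs c (\<lambda>r. B r \<omega>) (dy N s t) \<partial>M)"
  proof (rule nn_integral_monotone_convergence_SUP)
    show "incseq (\<lambda>N \<omega>. tvs c (\<lambda>r. B r \<omega>) (dy N s t))"
      by (intro incseq_SucI le_funI tvs_mono_set dy_Suc)
  qed (rule tvs_grid_meas; simp add: d0)
  also have "\<dots> \<le> z" using assms(3) by (rule SUP_least)
  finally show ?thesis .
qed

section \<open>Means over integer intervals, their limit and the variance bound\<close>

definition u :: "nat \<Rightarrow> real" where
  "u n = enn2real (\<integral>\<^sup>+\<omega>. tvs 1 (\<lambda>t. B t \<omega>) {0..real n} \<partial>M)"

lemma mean_shift:
  assumes "0 \<le> s" "0 \<le> T"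
  shows "(\<integral>\<^sup>+\<omega>. tvs c (\<lambda>t. B t \<omega>) {s..s + T} \<partial>M) = (\<integral>\<^sup>+\<omega>. tvs c (\<lambda>t. B t \<omega>) {0..T} \<partial>M)"
proof (cases "T = 0")
  case False
  then show ?thesis using law_interval[of 1 s T "\<lambda>x. x" c] assms by simp
qed (simp add: tvs_singleton)

lemma mean_linear: "\<exists>b\<ge>0. \<forall>n. (\<integral>\<^sup>+\<omega>. tvs 1 (\<lambda>t. B t \<omega>) {0..real n} \<partial>M) \<le> ennreal (b * real n)"
proof -
  obtain R where R: "\<And>N. (\<integral>\<^sup>+\<omega>. tvs 1 (\<lambda>t. B t \<omega>) (dy N 0 1) \<partial>M) \<le> ennreal R" using grid_mean_bounded by blast
  \<comment> \<open>The bound for the mean over one unit interval plus the cost \<open>1\<close> of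
    one more cut.\<close>
  define b where "b = max R 0 + 1"
  have 1: "(\<integral>\<^sup>+\<omega>. tvs 1 (\<lambda>t. B t \<omega>) {0..1} \<partial>M) \<le> ennreal (max R 0)"
    by (rule mean_dyadic_le) (use R in \<open>auto intro: order_trans ennreal_leI\<close>)
  have "(\<integral>\<^sup>+\<omega>. tvs 1 (\<lambda>t. B t \<omega>) {0..real n} \<partial>M) \<le> ennreal (b * real n)" for n
  proof (induction n)
    case 0
    then show ?case by (simp add: tvs_singleton)
  next
    case (Suc n)
    have [measurable]: "(\<lambda>\<omega>. tvs 1 (\<lambda>t. B t \<omega>) {0..real n}) \<in> borel_measurable M"
      using tvs_interval_meas[of 0 "real n" 1] by (cases "n = 0") (simp_all add: tvs_singleton)
    have [measurable]: "(\<lambda>\<omega>. tvs 1 (\<lambda>t. B t \<omega>) {real n..real n + 1}) \<in> borel_measurable M"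
      by (intro tvs_interval_meas) auto
    have "(\<integral>\<^sup>+\<omega>. tvs 1 (\<lambda>t. B t \<omega>) {0..real (Suc n)} \<partial>M) \<le>
       (\<integral>\<^sup>+\<omega>. tvs 1 (\<lambda>t. B t \<omega>) {0..real n} + tvs 1 (\<lambda>t. B t \<omega>) {real n..real n + 1} + 1 \<partial>M)"
    proof (rule nn_integral_mono)
      fix \<omega>
      have "{0..real (Suc n)} \<inter> {..real n} = {0..real n}" "{0..real (Suc n)} \<inter> {real n..} = {real n..real n + 1}" by auto
      then show "tvs 1 (\<lambda>t. B t \<omega>) {0..real (Suc n)} \<le> tvs 1 (\<lambda>t. B t \<omega>) {0..real n} + tvs 1 (\<lambda>t. B t \<omega>) {real n..real n + 1} + 1"
        using tvs_subadditive[of "real n" "{0..real (Suc n)}" 1 "\<lambda>t. B t \<omega>"] by (simp add: add.commute)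
    qed
    also have "\<dots> = (\<integral>\<^sup>+\<omega>. tvs 1 (\<lambda>t. B t \<omega>) {0..real n} \<partial>M) + (\<integral>\<^sup>+\<omega>. tvs 1 (\<lambda>t. B t \<omega>) {real n..real n + 1} \<partial>M) + 1"
      by (simp add: nn_integral_add emeasure_space_1)
    also have "\<dots> \<le> ennreal (b * real n) + ennreal (max R 0) + 1"
      using Suc 1 mean_shift[of "real n" 1 1] by (intro add_mono) auto
    also have "\<dots> = ennreal (b * real n + max R 0 + 1)"
      by (simp add: b_def ennreal_plus)
    also have "b * real n + max R 0 + 1 = b * real (Suc n)" by (simp add: b_def algebra_simps)
    finally show ?case .
  qed
  moreover have "0 \<le> b" by (simp add: b_def)
  ultimately show ?thesis by blast
qed

lemma u_ennreal: "(\<integral>\<^sup>+\<omega>. tvs 1 (\<lambda>t. B t \<omega>) {0..real n} \<partial>M) = ennreal (u n)"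
proof -
  obtain b where "\<And>n. (\<integral>\<^sup>+\<omega>. tvs 1 (\<lambda>t. B t \<omega>) {0..real n} \<partial>M) \<le> ennreal (b * real n)" using mean_linear by blast
  then have "(\<integral>\<^sup>+\<omega>. tvs 1 (\<lambda>t. B t \<omega>) {0..real n} \<partial>M) < \<top>" using le_less_trans ennreal_less_top by blast
  then show ?thesis by (simp add: u_def)
qed

lemma u_nonneg: "0 \<le> u n"
  by (simp add: u_def)

lemma u_le: "\<exists>b\<ge>0. \<forall>n. u n \<le> b * real n"
proof -
  obtain b where b: "0 \<le> b" "\<And>n. (\<integral>\<^sup>+\<omega>. tvs 1 (\<lambda>t. B t \<omega>) {0..real n} \<partial>M) \<le> ennreal (b * real n)" using mean_linear by blast
  have "u n \<le> b * real n" for n using b(2)[of n] b(1) unfolding u_ennreal by (subst (asm) ennreal_le_iff) auto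
  then show ?thesis using b(1) by blast
qed

lemma u_superadditive: "u m + u n \<le> u (m + n)"
proof -
  have [measurable]: "(\<lambda>\<omega>. tvs 1 (\<lambda>t. B t \<omega>) {0..real m}) \<in> borel_measurable M"
    using tvs_interval_meas[of 0 "real m" 1] by (cases "m = 0") (simp_all add: tvs_singleton)
  have [measurable]: "(\<lambda>\<omega>. tvs 1 (\<lambda>t. B t \<omega>) {real m..real m + real n}) \<in> borel_measurable M"
    using tvs_interval_meas[of "real m" "real m + real n" 1] by (cases "n = 0") (simp_all add: tvs_singleton)
  have "ennreal (u m + u n) = (\<integral>\<^sup>+\<omega>. tvs 1 (\<lambda>t. B t \<omega>) {0..real m} \<partial>M) + (\<integral>\<^sup>+\<omega>. tvs 1 (\<lambda>t. B t \<omega>) {real m..real m + real n} \<partial>M)"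
    by (simp add: mean_shift u_ennreal u_nonneg ennreal_plus)
  also have "\<dots> = (\<integral>\<^sup>+\<omega>. tvs 1 (\<lambda>t. B t \<omega>) {0..real m} + tvs 1 (\<lambda>t. B t \<omega>) {real m..real m + real n} \<partial>M)"
    by (simp add: nn_integral_add)
  also have "\<dots> \<le> (\<integral>\<^sup>+\<omega>. tvs 1 (\<lambda>t. B t \<omega>) {0..real (m + n)} \<partial>M)"
  proof (rule nn_integral_mono)
    fix \<omega>
    have e: "{0..real m} \<union> {real m..real m + real n} = {0..real (m + n)}" by auto
    have "tvs 1 (\<lambda>t. B t \<omega>) {0..real m} + tvs 1 (\<lambda>t. B t \<omega>) {real m..real m + real n} \<le> tvs 1 (\<lambda>t. B t \<omega>) ({0..real m} \<union> {real m..real m + real n})"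
      by (rule tvs_superadditive) auto
    then show "tvs 1 (\<lambda>t. B t \<omega>) {0..real m} + tvs 1 (\<lambda>t. B t \<omega>) {real m..real m + real n} \<le> tvs 1 (\<lambda>t. B t \<omega>) {0..real (m + n)}"
      unfolding e .
  qed
  finally show ?thesis unfolding u_ennreal by (subst (asm) ennreal_le_iff) (auto simp: u_nonneg)
qed

definition L :: real where "L = (SOME L. 0 \<le> L \<and> (\<lambda>n. u n / n) \<longlonglongrightarrow> L)"

lemma L: "0 \<le> L" "(\<lambda>n. u n / n) \<longlonglongrightarrow> L"
proof -
  obtain b where "\<And>n. u n \<le> b * real n" using u_le by blast
  from superadditive_limit[OF u_superadditive u_nonneg this]
  have "\<exists>L. 0 \<le> L \<and> (\<lambda>n. u n / n) \<longlonglongrightarrow> L" by blast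
  from someI_ex[OF this] show "0 \<le> L" "(\<lambda>n. u n / n) \<longlonglongrightarrow> L" unfolding L_def by blast+
qed

text \<open>All grids of \<open>[0, n]\<close> share one bound, because the mean at threshold
  \<open>\<theta>\<close> is at most the mean at threshold \<open>1\<close> over
  \<open>[0, 2 * n]\<close>, hence linear in \<open>n\<close>. Fatou's lemma carries the second
  moments over to the interval, whose mean is \<open>u n\<close>.\<close>

lemma variance_bound:
  "\<exists>\<kappa>\<ge>0. \<forall>n>0. (\<integral>\<^sup>+\<omega>. ennreal ((enn2real (tvs 1 (\<lambda>t. B t \<omega>) {0..real n}) - u n)\<^sup>2) \<partial>M) \<le> ennreal (\<kappa> * real n powr \<alpha>)"
proof -
  obtain b where b: "0 \<le> b" "\<And>n. u n \<le> b * real n" using u_le by blast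
  define \<kappa> where "\<kappa> = pi\<^sup>2 * K * (1 + 2 * b / (1 - \<theta>))"
  have \<kappa>0: "0 \<le> \<kappa>" using K b \<theta> by (simp add: \<kappa>_def)
  have "(\<integral>\<^sup>+\<omega>. ennreal ((enn2real (tvs 1 (\<lambda>t. B t \<omega>) {0..real n}) - u n)\<^sup>2) \<partial>M) \<le> ennreal (\<kappa> * real n powr \<alpha>)"
    if n: "0 < n" for n :: nat
  proof -
    define F where "F \<omega> = enn2real (tvs 1 (\<lambda>t. B t \<omega>) {0..real n})" for \<omega>
    define f where "f N \<omega> = enn2real (tvs 1 (\<lambda>t. B t \<omega>) (dy N 0 (real n)))" for N \<omega>
    have d0: "finite (dy N 0 (real n))" "dy N 0 (real n) \<subseteq> {0..}" "dy N 0 (real n) \<subseteq> {0..real n}" for N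
      using dy_nonneg[of 0 "real n" N] dy_subset[of 0 "real n" N] by simp_all
    have n1: "1 \<le> real n" using n by simp
    have Fm [measurable]: "F \<in> borel_measurable M"
      unfolding F_def using n by (intro measurable_compose[OF tvs_interval_meas]) auto
    have fm: "integrable M (f N)" "integrable M (\<lambda>\<omega>. (f N \<omega>)\<^sup>2)"
      and e: "(\<integral>\<^sup>+\<omega>. tvs 1 (\<lambda>t. B t \<omega>) (dy N 0 (real n)) \<partial>M) = ennreal (expectation (f N))" for N
      unfolding f_def[abs_def] by (rule tvs_grid_moments[OF d0(1,2)]; simp)+
    have e0: "0 \<le> expectation (f N)" for N by (intro Bochner_Integration.integral_nonneg) (simp add: f_def)
    have eu: "expectation (f N) \<le> u n" for N
    proof -
      have "ennreal (expectation (f N)) \<le> ennreal (u n)"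
        unfolding e[symmetric] u_ennreal[symmetric] using d0 by (intro nn_integral_mono tvs_mono_set)
      then show ?thesis using u_nonneg by simp
    qed
    have half: "(\<integral>\<^sup>+\<omega>. tvs \<theta> (\<lambda>t. B t \<omega>) (dy N 0 (real n)) \<partial>M) \<le> ennreal (2 * b * real n)" for N
    proof -
      have "(\<integral>\<^sup>+\<omega>. tvs \<theta> (\<lambda>t. B t \<omega>) (dy N 0 (real n)) \<partial>M) \<le> (\<integral>\<^sup>+\<omega>. tvs \<theta> (\<lambda>t. B t \<omega>) {0..real n} \<partial>M)"
        using d0 by (intro nn_integral_mono tvs_mono_set)
      also have "\<dots> = (\<integral>\<^sup>+\<omega>. ennreal \<theta> * tvs 1 (\<lambda>t. B t \<omega>) {0..real (2 * n)} \<partial>M)"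
        using law_interval[of "1/2" 0 "real (2 * n)" "\<lambda>x. x" 1] n by (simp add: \<theta>_def)
      also have "\<dots> \<le> (\<integral>\<^sup>+\<omega>. 1 * tvs 1 (\<lambda>t. B t \<omega>) {0..real (2 * n)} \<partial>M)"
        using \<theta> by (intro nn_integral_mono mult_right_mono) (auto simp: ennreal_le_1)
      also have "\<dots> = ennreal (u (2 * n))" by (simp only: mult_1_left u_ennreal)
      also have "\<dots> \<le> ennreal (2 * b * real n)" using b(2)[of "2 * n"] by (intro ennreal_leI) simp
      finally show ?thesis .
    qed
    have sq: "expectation (\<lambda>\<omega>. (f N \<omega>)\<^sup>2) \<le> (u n)\<^sup>2 + \<kappa> * real n powr \<alpha>" for N
    proof -
      have "expectation (\<lambda>\<omega>. (f N \<omega>)\<^sup>2) - (expectation (f N))\<^sup>2 \<le> pi\<^sup>2 * K * (real n powr \<alpha> + 2 * b * real n / (1 - \<theta>))"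
        unfolding f_def[abs_def]
        by (rule tvs_grid_variance[OF d0(1,3) n1 _ _ half]) (use \<theta> b in auto)
      also have "\<dots> \<le> pi\<^sup>2 * K * (real n powr \<alpha> + 2 * b * real n powr \<alpha> / (1 - \<theta>))"
      proof -
        have "real n powr 1 \<le> real n powr \<alpha>" using n1 \<alpha> by (intro powr_mono) auto
        then have "real n \<le> real n powr \<alpha>" using n by simp
        then show ?thesis using K b \<theta> by (intro mult_left_mono add_left_mono divide_right_mono) auto
      qed
      also have "\<dots> = \<kappa> * real n powr \<alpha>" by (simp add: \<kappa>_def algebra_simps)
      finally have "expectation (\<lambda>\<omega>. (f N \<omega>)\<^sup>2) \<le> (expectation (f N))\<^sup>2 + \<kappa> * real n powr \<alpha>" by simp
      moreover have "(expectation (f N))\<^sup>2 \<le> (u n)\<^sup>2" using eu e0 by (intro power_mono)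
      ultimately show ?thesis by simp
    qed
    have Ff: "ennreal (F \<omega>) = tvs 1 (\<lambda>t. B t \<omega>) {0..real n}" if "\<omega> \<in> space M" for \<omega>
      unfolding F_def using tvs_interval_finite[of 1 0 \<omega> "real n"] that by simp
    have ff: "ennreal (f N \<omega>) = tvs 1 (\<lambda>t. B t \<omega>) (dy N 0 (real n))" for N \<omega>
      unfolding f_def using tvs_finite_set[OF d0(1)] by simp
    have F0: "0 \<le> F \<omega>" "0 \<le> f N \<omega>" for N \<omega> by (simp_all add: F_def f_def)
    have lim: "(\<lambda>N. ennreal ((f N \<omega>)\<^sup>2)) \<longlonglongrightarrow> ennreal ((F \<omega>)\<^sup>2)" if \<omega>: "\<omega> \<in> space M" for \<omega>
    proof -
      have "(\<lambda>N. ennreal (f N \<omega>)) \<longlonglongrightarrow> (SUP N. ennreal (f N \<omega>))"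
        unfolding ff by (intro LIMSEQ_SUP incseq_SucI tvs_mono_set dy_Suc)
      also have "(SUP N. ennreal (f N \<omega>)) = ennreal (F \<omega>)"
        unfolding ff Ff[OF \<omega>] using tvs_interval[of 0 "real n" \<omega> 1] \<omega> n by simp
      finally have "(\<lambda>N. f N \<omega>) \<longlonglongrightarrow> F \<omega>" using F0 by (subst (asm) tendsto_ennreal_iff) auto
      then show ?thesis by (intro tendsto_ennrealI tendsto_power)
    qed
    have "(\<integral>\<^sup>+\<omega>. ennreal ((F \<omega>)\<^sup>2) \<partial>M) = (\<integral>\<^sup>+\<omega>. liminf (\<lambda>N. ennreal ((f N \<omega>)\<^sup>2)) \<partial>M)"
      by (intro nn_integral_cong lim_imp_Liminf[symmetric] lim) simp_all
    also have "\<dots> \<le> liminf (\<lambda>N. \<integral>\<^sup>+\<omega>. ennreal ((f N \<omega>)\<^sup>2) \<partial>M)"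
      using fm by (intro nn_integral_liminf) auto
    also have "\<dots> \<le> ennreal ((u n)\<^sup>2 + \<kappa> * real n powr \<alpha>)"
    proof -
      have "(\<integral>\<^sup>+\<omega>. ennreal ((f N \<omega>)\<^sup>2) \<partial>M) \<le> ennreal ((u n)\<^sup>2 + \<kappa> * real n powr \<alpha>)" for N
        using nn_integral_eq_integral[OF fm(2), of N] sq[of N] by (simp add: ennreal_leI)
      then show ?thesis by (intro order_trans[OF Liminf_le_Limsup Limsup_bounded]) auto
    qed
    finally have F2: "(\<integral>\<^sup>+\<omega>. ennreal ((F \<omega>)\<^sup>2) \<partial>M) \<le> ennreal ((u n)\<^sup>2 + \<kappa> * real n powr \<alpha>)" .
    have iF2: "integrable M (\<lambda>\<omega>. (F \<omega>)\<^sup>2)"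
      using F2 by (intro integrableI_bounded) (auto intro: le_less_trans)
    have iF: "integrable M F" using F0 by (intro integrable_mult_of_squares[of F M "\<lambda>_. 1", simplified]) (auto simp: iF2)
    have EF: "expectation F = u n"
    proof -
      have "ennreal (expectation F) = (\<integral>\<^sup>+\<omega>. ennreal (F \<omega>) \<partial>M)"
        using iF F0 by (intro nn_integral_eq_integral[symmetric]) auto
      also have "\<dots> = ennreal (u n)" unfolding u_ennreal[symmetric] using Ff by (intro nn_integral_cong) auto
      finally show ?thesis using u_nonneg F0 by (subst (asm) ennreal_inj) (auto intro: Bochner_Integration.integral_nonneg)
    qed
    have "(\<integral>\<^sup>+\<omega>. ennreal ((F \<omega> - u n)\<^sup>2) \<partial>M) = ennreal (expectation (\<lambda>\<omega>. (F \<omega> - u n)\<^sup>2))"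
    proof (rule nn_integral_eq_integral)
      show "integrable M (\<lambda>\<omega>. (F \<omega> - u n)\<^sup>2)" using iF iF2 by (simp add: power2_diff)
    qed simp
    also have "expectation (\<lambda>\<omega>. (F \<omega> - u n)\<^sup>2) = expectation (\<lambda>\<omega>. (F \<omega>)\<^sup>2) - (u n)\<^sup>2"
      using variance_eq[OF iF iF2] by (simp add: EF)
    also have "ennreal \<dots> \<le> ennreal (\<kappa> * real n powr \<alpha>)"
    proof (rule ennreal_leI)
      have "ennreal (expectation (\<lambda>\<omega>. (F \<omega>)\<^sup>2)) \<le> ennreal ((u n)\<^sup>2 + \<kappa> * real n powr \<alpha>)"
        using F2 nn_integral_eq_integral[OF iF2] by simp
      then have "expectation (\<lambda>\<omega>. (F \<omega>)\<^sup>2) \<le> (u n)\<^sup>2 + \<kappa> * real n powr \<alpha>"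
        using \<kappa>0 by (subst (asm) ennreal_le_iff) auto
      then show "expectation (\<lambda>\<omega>. (F \<omega>)\<^sup>2) - (u n)\<^sup>2 \<le> \<kappa> * real n powr \<alpha>" by simp
    qed
    finally show ?thesis by (simp add: F_def)
  qed
  then show ?thesis using \<kappa>0 by blast
qed

text \<open>Summable second moments make the series of squares finite almost surely, so its terms
  tend to \<open>0\<close>.\<close>

lemma AE_tendsto_0_of_summable:
  fixes Y :: "nat \<Rightarrow> 'a \<Rightarrow> real"
  assumes [measurable]: "\<And>k. Y k \<in> borel_measurable M"
    and le: "\<And>k. (\<integral>\<^sup>+\<omega>. ennreal ((Y k \<omega>)\<^sup>2) \<partial>M) \<le> ennreal (b k)" and b: "summable b" "\<And>k. 0 \<le> b k"
  shows "AE \<omega> in M. (\<lambda>k. Y k \<omega>) \<longlonglongrightarrow> 0"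
proof -
  have "(\<integral>\<^sup>+\<omega>. (\<Sum>k. ennreal ((Y k \<omega>)\<^sup>2)) \<partial>M) = (\<Sum>k. \<integral>\<^sup>+\<omega>. ennreal ((Y k \<omega>)\<^sup>2) \<partial>M)"
    by (rule nn_integral_suminf) simp
  also have "\<dots> \<le> (\<Sum>k. ennreal (b k))" using le by (intro suminf_le) auto
  also have "\<dots> = ennreal (suminf b)" using b by (intro suminf_ennreal2) auto
  also have "\<dots> < \<infinity>" by simp
  finally have "AE \<omega> in M. (\<Sum>k. ennreal ((Y k \<omega>)\<^sup>2)) \<noteq> \<infinity>"
    by (intro nn_integral_PInf_AE) auto
  then show ?thesis
  proof eventually_elim
    case (elim \<omega>)
    then have "summable (\<lambda>k. (Y k \<omega>)\<^sup>2)" by (intro summable_suminf_not_top) (auto simp: infinity_ennreal_def)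
    then have "(\<lambda>k. (Y k \<omega>)\<^sup>2) \<longlonglongrightarrow> 0" by (rule summable_LIMSEQ_zero)
    then show ?case by (simp add: power_tendsto_0_iff)
  qed
qed

text \<open>Along $c_k = ((t-s)/n_k)^H$ with $n_k$ growing polynomially the variances are summable, while
  consecutive terms have ratio tending to 1, so monotonicity in $c$ fills the gaps.\<close>

lemma tvs_strong_law:
  assumes st: "0 \<le> s" "s < t"
  shows "AE \<omega> in M. ((\<lambda>c. c powr (1 / H - 1) * enn2real (tvs c (\<lambda>r. B r \<omega>) {s..t})) \<longlongrightarrow> L * (t - s)) (at_right 0)"
proof -
  define A where "A = t - s"
  have A: "0 < A" using st by (simp add: A_def)
  \<comment> \<open>With \<open>n k = Suc k ^ p\<close> the normalised variance has order
    \<open>n k powr (\<alpha> - 2)\<close>, which is at most \<open>Suc k powr (- 2)\<close> as soon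
    as \<open>p * (2 - \<alpha>) >= 2\<close>.\<close>
  define p where "p = nat \<lceil>2 / (2 - \<alpha>)\<rceil>"
  have p: "2 \<le> real p * (2 - \<alpha>)"
  proof -
    have "2 / (2 - \<alpha>) \<le> real p" unfolding p_def by (rule real_nat_ceiling_ge)
    then show ?thesis using \<alpha> by (simp add: field_simps)
  qed
  define n where "n k = Suc k ^ p" for k
  have n0: "0 < n k" for k by (simp add: n_def)
  define c where "c k = (A / n k) powr H" for k
  have c0: "0 < c k" for k using A n0[of k] by (simp add: c_def)
  obtain \<kappa> where \<kappa>: "0 \<le> \<kappa>"
    "\<And>n. 0 < n \<Longrightarrow> (\<integral>\<^sup>+\<omega>. ennreal ((enn2real (tvs 1 (\<lambda>t. B t \<omega>) {0..real n}) - u n)\<^sup>2) \<partial>M) \<le> ennreal (\<kappa> * real n powr \<alpha>)"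
    using variance_bound by blast
  define Y where "Y k \<omega> = c k powr (1 / H - 1) * enn2real (tvs (c k) (\<lambda>r. B r \<omega>) {s..t}) - A * (u (n k) / n k)" for k \<omega>
  have Ym [measurable]: "Y k \<in> borel_measurable M" for k
  proof -
    have [measurable]: "(\<lambda>\<omega>. tvs (c k) (\<lambda>r. B r \<omega>) {s..t}) \<in> borel_measurable M" using st by (rule tvs_interval_meas)
    show ?thesis unfolding Y_def by measurable
  qed
  have Y2: "(\<integral>\<^sup>+\<omega>. ennreal ((Y k \<omega>)\<^sup>2) \<partial>M) \<le> ennreal (A\<^sup>2 * \<kappa> * inverse (real (Suc k) ^ 2))" for k
  proof -
    define \<rho> where "\<rho> = A / n k"
    have \<rho>: "0 < \<rho>" using A n0[of k] by (simp add: \<rho>_def)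
    have t: "t = s + \<rho> * real (n k)" using n0[of k] by (simp add: \<rho>_def A_def)
    have ck: "c k = \<rho> powr H * 1" by (simp add: c_def \<rho>_def)
    \<comment> \<open>As \<open>c k = \<rho> powr H\<close>, the normalisation times the factor
      \<open>\<rho> powr H\<close> from scaling is \<open>\<rho> = A / n k\<close>; this turns the
      deviation over \<open>[s, t]\<close> into \<open>\<rho>\<close> times the one over
      \<open>[0, n k]\<close>.\<close>
    have pw: "c k powr (1 / H - 1) * \<rho> powr H = \<rho>"
    proof -
      have "c k powr (1 / H - 1) * \<rho> powr H = \<rho> powr (H * (1 / H - 1) + H)"
        by (simp add: ck powr_powr powr_add)
      also have "H * (1 / H - 1) + H = 1" using H by (simp add: field_simps)
      finally show ?thesis using \<rho> by simp
    qed
    define g where "g z = ennreal ((c k powr (1 / H - 1) * enn2real z - A * (u (n k) / n k))\<^sup>2)" for z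
    have [measurable]: "g \<in> borel_measurable borel" unfolding g_def by measurable
    have "(\<integral>\<^sup>+\<omega>. ennreal ((Y k \<omega>)\<^sup>2) \<partial>M) = (\<integral>\<^sup>+\<omega>. g (tvs (\<rho> powr H * 1) (\<lambda>r. B r \<omega>) {s..s + \<rho> * real (n k)}) \<partial>M)"
      unfolding Y_def g_def t[symmetric] ck[symmetric] ..
    also have "\<dots> = (\<integral>\<^sup>+\<omega>. g (ennreal (\<rho> powr H) * tvs 1 (\<lambda>r. B r \<omega>) {0..real (n k)}) \<partial>M)"
      using st n0[of k] \<rho> by (intro law_interval) auto
    also have "\<dots> = (\<integral>\<^sup>+\<omega>. ennreal (\<rho>\<^sup>2) * ennreal ((enn2real (tvs 1 (\<lambda>t. B t \<omega>) {0..real (n k)}) - u (n k))\<^sup>2) \<partial>M)"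
    proof (rule nn_integral_cong)
      fix \<omega>
      have "c k powr (1 / H - 1) * enn2real (ennreal (\<rho> powr H) * tvs 1 (\<lambda>r. B r \<omega>) {0..real (n k)}) - A * (u (n k) / n k)
          = (c k powr (1 / H - 1) * \<rho> powr H) * enn2real (tvs 1 (\<lambda>r. B r \<omega>) {0..real (n k)}) - \<rho> * u (n k)"
        by (simp add: enn2real_mult \<rho>_def)
      also have "\<dots> = \<rho> * (enn2real (tvs 1 (\<lambda>r. B r \<omega>) {0..real (n k)}) - u (n k))"
        unfolding pw by (simp add: right_diff_distrib)
      finally have eq: "c k powr (1 / H - 1) * enn2real (ennreal (\<rho> powr H) * tvs 1 (\<lambda>r. B r \<omega>) {0..real (n k)}) - A * (u (n k) / n k)
          = \<rho> * (enn2real (tvs 1 (\<lambda>r. B r \<omega>) {0..real (n k)}) - u (n k))" .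
      show "g (ennreal (\<rho> powr H) * tvs 1 (\<lambda>r. B r \<omega>) {0..real (n k)}) =
          ennreal (\<rho>\<^sup>2) * ennreal ((enn2real (tvs 1 (\<lambda>t. B t \<omega>) {0..real (n k)}) - u (n k))\<^sup>2)"
        unfolding g_def eq power_mult_distrib by (rule ennreal_mult) simp_all
    qed
    also have "\<dots> = ennreal (\<rho>\<^sup>2) * (\<integral>\<^sup>+\<omega>. ennreal ((enn2real (tvs 1 (\<lambda>t. B t \<omega>) {0..real (n k)}) - u (n k))\<^sup>2) \<partial>M)"
    proof (rule nn_integral_cmult)
      have [measurable]: "(\<lambda>\<omega>. tvs 1 (\<lambda>r. B r \<omega>) {0..real (n k)}) \<in> borel_measurable M" using n0[of k] by (intro tvs_interval_meas) auto
      show "(\<lambda>\<omega>. ennreal ((enn2real (tvs 1 (\<lambda>t. B t \<omega>) {0..real (n k)}) - u (n k))\<^sup>2)) \<in> borel_measurable M" by measurable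
    qed
    also have "\<dots> \<le> ennreal (\<rho>\<^sup>2) * ennreal (\<kappa> * real (n k) powr \<alpha>)"
      using \<kappa>(2)[OF n0] by (intro mult_left_mono) auto
    also have "\<dots> = ennreal (\<rho>\<^sup>2 * (\<kappa> * real (n k) powr \<alpha>))" using \<kappa>(1) by (intro ennreal_mult[symmetric]) auto
    also have "\<dots> \<le> ennreal (A\<^sup>2 * \<kappa> * inverse (real (Suc k) ^ 2))"
    proof (rule ennreal_leI)
      have "real (n k) powr \<alpha> / (real (n k))\<^sup>2 = real (n k) powr (\<alpha> - 2)"
        using n0[of k] by (simp add: powr_diff powr_numeral)
      also have "\<dots> = real (Suc k) powr (real p * (\<alpha> - 2))"
        by (simp add: n_def powr_realpow[symmetric] powr_powr)
      also have "\<dots> \<le> real (Suc k) powr (- 2)"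
        using p by (intro powr_mono) (auto simp: algebra_simps)
      also have "\<dots> = inverse (real (Suc k) ^ 2)" by (simp add: powr_minus powr_numeral)
      finally have "A\<^sup>2 * \<kappa> * (real (n k) powr \<alpha> / (real (n k))\<^sup>2) \<le> A\<^sup>2 * \<kappa> * inverse (real (Suc k) ^ 2)"
        using \<kappa>(1) by (intro mult_left_mono) auto
      then show "\<rho>\<^sup>2 * (\<kappa> * real (n k) powr \<alpha>) \<le> A\<^sup>2 * \<kappa> * inverse (real (Suc k) ^ 2)"
        by (simp add: \<rho>_def power_divide)
    qed
    finally show ?thesis .
  qed
  have sum: "summable (\<lambda>k. A\<^sup>2 * \<kappa> * inverse (real (Suc k) ^ 2))"
    by (intro summable_mult) (use inverse_power_summable[of 2, where 'a=real] in \<open>subst summable_Suc_iff\<close>, simp)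
  have "AE \<omega> in M. (\<lambda>k. Y k \<omega>) \<longlonglongrightarrow> 0"
    by (rule AE_tendsto_0_of_summable[OF Ym Y2 sum]) (use \<kappa>(1) in auto)
  then have "AE \<omega> in M. \<omega> \<in> space M \<and> (\<lambda>k. Y k \<omega>) \<longlonglongrightarrow> 0" by auto
  then show ?thesis
  proof (rule AE_mp, intro AE_I2 impI)
    fix \<omega> assume "\<omega> \<in> space M \<and> (\<lambda>k. Y k \<omega>) \<longlonglongrightarrow> 0"
    then have \<omega>: "\<omega> \<in> space M" and Y0: "(\<lambda>k. Y k \<omega>) \<longlonglongrightarrow> 0" by blast+
    show "((\<lambda>c. c powr (1 / H - 1) * enn2real (tvs c (\<lambda>r. B r \<omega>) {s..t})) \<longlongrightarrow> L * (t - s)) (at_right 0)"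
    proof (rule at_right_limit_of_sequence[where c=c])
    have n_lim: "filterlim (\<lambda>k. real (n k)) at_top sequentially"
    proof -
      have p0: "0 < p" using p \<alpha> by (cases "p = 0") auto
      have le: "real (Suc k) \<le> real (n k)" for k
        unfolding n_def of_nat_le_iff using p0 self_le_power[of "Suc k" p] by simp
      have "filterlim (\<lambda>k. real (Suc k)) at_top sequentially"
        using filterlim_real_sequentially by (rule filterlim_compose[OF _ filterlim_Suc])
      from filterlim_at_top_mono[OF this always_eventually[OF allI[OF le]]] show ?thesis .
    qed
    have n_lim': "filterlim n at_top sequentially"
      using n_lim by (simp add: filterlim_sequentially_iff_filterlim_real)
    show "0 \<le> 1 / H - 1" using H by (simp add: field_simps)
    show "enn2real (tvs y (\<lambda>r. B r \<omega>) {s..t}) \<le> enn2real (tvs x (\<lambda>r. B r \<omega>) {s..t})" if "0 < x" "x \<le> y" for x y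
      using that \<omega> st tvs_interval_finite[of x s \<omega> t] by (intro enn2real_mono tvs_antimono) auto
    show "0 \<le> enn2real (tvs x (\<lambda>r. B r \<omega>) {s..t})" for x by simp
    show "0 < c k" for k by (rule c0)
    show "decseq c"
    proof (rule decseq_SucI)
      fix k
      have "n k \<le> n (Suc k)" unfolding n_def by (intro power_mono) auto
      then have "A / n (Suc k) \<le> A / n k" using A n0[of k] by (intro divide_left_mono) auto
      then show "c (Suc k) \<le> c k" unfolding c_def using H A n0[of "Suc k"] by (intro powr_mono2) auto
    qed
    show "c \<longlonglongrightarrow> 0"
    proof -
      have "(\<lambda>k. A / real (n k)) \<longlonglongrightarrow> 0"
        using n_lim by (intro tendsto_divide_0[OF tendsto_const] filterlim_at_top_imp_at_infinity)
      then have "(\<lambda>k. (A / real (n k)) powr H) \<longlonglongrightarrow> 0 powr H"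
        using H A by (intro tendsto_powr') (auto intro!: always_eventually)
      then show ?thesis unfolding c_def[abs_def] using H by simp
    qed
    show "(\<lambda>k. c k / c (Suc k)) \<longlonglongrightarrow> 1"
    proof -
      have "c k / c (Suc k) = ((1 + inverse (real (Suc k))) ^ p) powr H" for k
      proof -
        have "c k / c (Suc k) = ((A / n k) / (A / n (Suc k))) powr H"
          unfolding c_def by (rule powr_divide[symmetric])
        also have "(A / n k) / (A / n (Suc k)) = (real (Suc (Suc k)) / real (Suc k)) ^ p"
          using A by (simp add: n_def power_divide del: of_nat_Suc)
        also have "real (Suc (Suc k)) / real (Suc k) = 1 + inverse (real (Suc k))"
          by (simp add: field_simps)
        finally show ?thesis .
      qed
      moreover have "(\<lambda>k. ((1 + inverse (real (Suc k))) ^ p) powr H) \<longlonglongrightarrow> ((1 + 0) ^ p) powr H"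
        by (intro tendsto_powr tendsto_power tendsto_add tendsto_const LIMSEQ_inverse_real_of_nat) simp
      ultimately show ?thesis by simp
    qed
    have "(\<lambda>k. Y k \<omega> + A * (u (n k) / n k)) \<longlonglongrightarrow> 0 + A * L"
      by (intro tendsto_add Y0 tendsto_mult tendsto_const filterlim_compose[OF L(2) n_lim'])
    then show "(\<lambda>k. c k powr (1 / H - 1) * enn2real (tvs (c k) (\<lambda>r. B r \<omega>) {s..t})) \<longlonglongrightarrow> L * (t - s)"
      by (simp add: Y_def A_def mult.commute)
    qed
  qed
qed

end

section \<open>Existence of the local time\<close>

lemma swap_nn_integral:
  assumes "sigma_finite_measure M1" "sigma_finite_measure M2" "(\<lambda>z. f (fst z) (snd z)) \<in> borel_measurable (M1 \<Otimes>\<^sub>M M2)"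
  shows "(\<integral>\<^sup>+x. \<integral>\<^sup>+y. f x y \<partial>M2 \<partial>M1) = (\<integral>\<^sup>+y. \<integral>\<^sup>+x. f x y \<partial>M1 \<partial>M2)"
proof -
  interpret M1: sigma_finite_measure M1 by fact
  interpret M2: sigma_finite_measure M2 by fact
  interpret pair_sigma_finite M1 M2 ..
  show ?thesis using assms(3) by (intro Fubini'[symmetric]) (simp add: case_prod_beta')
qed

lemma emeasure_distr_indicator:
  assumes "x \<in> borel_measurable \<Lambda>" "N \<in> sets borel"
  shows "emeasure (distr \<Lambda> borel x) N = (\<integral>\<^sup>+s. indicator N (x s) \<partial>\<Lambda>)"
proof -
  have "emeasure (distr \<Lambda> borel x) N = (\<integral>\<^sup>+z. indicator N z \<partial>distr \<Lambda> borel x)" using assms by simp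
  also have "\<dots> = (\<integral>\<^sup>+s. indicator N (x s) \<partial>\<Lambda>)" using assms by (intro nn_integral_distr) auto
  finally show ?thesis .
qed

text \<open>The radius is \<open>2 * \<epsilon>\<close> because windows of radius
  \<open>\<epsilon>\<close> around two values meet only when the values differ by less than
  \<open>2 * \<epsilon>\<close>.\<close>

definition close_pairs :: "'a measure \<Rightarrow> ('a \<Rightarrow> real) \<Rightarrow> real \<Rightarrow> ennreal" where
  "close_pairs \<Lambda> x \<epsilon> = (\<integral>\<^sup>+s. \<integral>\<^sup>+u. indicator {- 2 * \<epsilon><..<2 * \<epsilon>} (x s - x u) \<partial>\<Lambda> \<partial>\<Lambda>)"

text \<open>The square is a double integral over pairs of times. After exchanging the order, a pair
  contributes the length of the overlap of its two windows, which is at most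
  \<open>2 * \<epsilon>\<close> and nonzero for close pairs only.\<close>

lemma smoothed_square_le:
  assumes fin: "finite_measure \<Lambda>" and x [measurable]: "x \<in> borel_measurable \<Lambda>" and e: "0 < \<epsilon>"
  shows "(\<integral>\<^sup>+y. (\<integral>\<^sup>+s. indicator {- \<epsilon><..<\<epsilon>} (x s - y) \<partial>\<Lambda>)\<^sup>2 \<partial>lborel) \<le> ennreal (2 * \<epsilon>) * close_pairs \<Lambda> x \<epsilon>"
proof -
  interpret finite_measure \<Lambda> by fact
  have sf: "sigma_finite_measure \<Lambda>" "sigma_finite_measure (lborel :: real measure)"
    by (rule sigma_finite_measure_axioms lborel.sigma_finite_measure_axioms)+
  let ?I = "\<lambda>s y. indicator {- \<epsilon><..<\<epsilon>} (x s - y) :: ennreal"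
  have "(\<integral>\<^sup>+y. (\<integral>\<^sup>+s. ?I s y \<partial>\<Lambda>)\<^sup>2 \<partial>lborel) = (\<integral>\<^sup>+y. \<integral>\<^sup>+s. \<integral>\<^sup>+u. ?I s y * ?I u y \<partial>\<Lambda> \<partial>\<Lambda> \<partial>lborel)"
    by (intro nn_integral_cong) (simp add: power2_eq_square nn_integral_cmult nn_integral_multc)
  also have "\<dots> = (\<integral>\<^sup>+s. \<integral>\<^sup>+y. \<integral>\<^sup>+u. ?I s y * ?I u y \<partial>\<Lambda> \<partial>lborel \<partial>\<Lambda>)"
    by (rule swap_nn_integral[OF sf(2) sf(1)]) measurable
  also have "\<dots> = (\<integral>\<^sup>+s. \<integral>\<^sup>+u. \<integral>\<^sup>+y. ?I s y * ?I u y \<partial>lborel \<partial>\<Lambda> \<partial>\<Lambda>)"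
    by (intro nn_integral_cong swap_nn_integral[OF sf(2) sf(1)]) measurable
  also have "\<dots> \<le> (\<integral>\<^sup>+s. \<integral>\<^sup>+u. ennreal (2 * \<epsilon>) * indicator {- 2 * \<epsilon><..<2 * \<epsilon>} (x s - x u) \<partial>\<Lambda> \<partial>\<Lambda>)"
  proof (intro nn_integral_mono)
    fix s u
    have "(\<integral>\<^sup>+y. ?I s y * ?I u y \<partial>lborel) \<le> (\<integral>\<^sup>+y. indicator {- 2 * \<epsilon><..<2 * \<epsilon>} (x s - x u) * indicator {x s - \<epsilon><..<x s + \<epsilon>} y \<partial>lborel)"
      by (intro nn_integral_mono) (auto simp: indicator_def split: if_splits)
    also have "\<dots> = indicator {- 2 * \<epsilon><..<2 * \<epsilon>} (x s - x u) * ennreal (2 * \<epsilon>)"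
      using e by (subst nn_integral_cmult) auto
    finally show "(\<integral>\<^sup>+y. ?I s y * ?I u y \<partial>lborel) \<le> ennreal (2 * \<epsilon>) * indicator {- 2 * \<epsilon><..<2 * \<epsilon>} (x s - x u)"
      by (simp only: mult.commute)
  qed
  also have "\<dots> = ennreal (2 * \<epsilon>) * close_pairs \<Lambda> x \<epsilon>"
    unfolding close_pairs_def by (simp add: nn_integral_cmult)
  finally show ?thesis .
qed

text \<open>If the normalised number of close pairs stays bounded along a sequence of scales, the smoothed
  occupation densities are bounded in $L^2$; as $g \le \kappa + g^2/\kappa$, they are uniformly
  integrable, so sets of small Lebesgue measure carry little occupation time.\<close>

lemma absolutely_continuous_of_close_pairs:
  assumes fin: "finite_measure \<Lambda>" and x [measurable]: "x \<in> borel_measurable \<Lambda>"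
    and e: "\<And>n. 0 < e n" "e \<longlonglongrightarrow> 0"
    and lim: "liminf (\<lambda>n. ennreal (1 / (2 * e n)) * close_pairs \<Lambda> x (e n)) < \<infinity>"
  shows "absolutely_continuous lborel (distr \<Lambda> borel x)"
  unfolding absolutely_continuous_def
proof
  interpret finite_measure \<Lambda> by fact
  have sf: "sigma_finite_measure \<Lambda>" "sigma_finite_measure (lborel :: real measure)"
    by (rule sigma_finite_measure_axioms lborel.sigma_finite_measure_axioms)+
  let ?\<mu> = "distr \<Lambda> borel x"
  let ?W = "\<lambda>n. ennreal (1 / (2 * e n)) * close_pairs \<Lambda> x (e n)"
  fix N :: "real set" assume "N \<in> null_sets lborel"
  then have N: "N \<in> sets borel" "emeasure lborel N = 0" by auto
  obtain w where w: "0 \<le> w" "liminf ?W < ennreal w"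
  proof -
    obtain r where "liminf ?W = ennreal r" "0 \<le> r" using lim by (cases "liminf ?W") (auto simp: infinity_ennreal_def)
    then show thesis by (intro that[of "r + 1"]) (auto simp: ennreal_less_iff)
  qed
  have bound: "emeasure ?\<mu> N \<le> ennreal ((1 + w) / \<kappa>)" if \<kappa>: "0 < \<kappa>" for \<kappa> :: real
  proof -
    \<comment> \<open>This choice balances the two terms: \<open>\<kappa>\<close> times the measure
      of \<open>U\<close>, and \<open>1 / \<kappa>\<close> times the integral of the squared
      density, are both of order \<open>1 / \<kappa>\<close>.\<close>
    define \<delta> where "\<delta> = 1 / \<kappa>\<^sup>2"
    have \<delta>: "0 < \<delta>" using \<kappa> by (simp add: \<delta>_def)
    obtain U where U: "open U" "N \<subseteq> U" "emeasure lborel (U - N) < ennreal \<delta>"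
      using outer_regular_lborel[OF N(1) \<delta>] .
    have Um [measurable]: "U \<in> sets borel" using U(1) by simp
    have "emeasure lborel U = emeasure lborel (U - N)"
      using N by (intro emeasure_Diff_null_set[symmetric]) auto
    then have LU: "emeasure lborel U \<le> ennreal \<delta>" using U(3) by simp
    \<comment> \<open>The indicator of \<open>U\<close> averaged over a window of radius
      \<open>e n\<close>. At each point of the open set \<open>U\<close> it is eventually at least
      \<open>1\<close>, so Fatou's lemma bounds the occupation time of \<open>U\<close> by the lower
      limit of the averages.\<close>
    define \<phi> where "\<phi> n z = ennreal (1 / (2 * e n)) * (\<integral>\<^sup>+y. indicator U y * indicator {- e n<..<e n} (z - y) \<partial>lborel)" for n z
    have \<phi>_meas [measurable]: "\<phi> n \<in> borel_measurable borel" for n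
      unfolding \<phi>_def by measurable
    have ind: "indicator U z \<le> liminf (\<lambda>n. \<phi> n z)" for z :: real
    proof (cases "z \<in> U")
      case True
      then obtain r where r: "0 < r" "ball z r \<subseteq> U" using U(1) openE by blast
      have "eventually (\<lambda>n. e n < r) sequentially" using e(2) r(1) by (rule order_tendstoD)
      then have "eventually (\<lambda>n. 1 \<le> \<phi> n z) sequentially"
      proof eventually_elim
        case (elim n)
        have sub: "{z - e n<..<z + e n} \<subseteq> U"
        proof
          fix y assume "y \<in> {z - e n<..<z + e n}"
          then have "y \<in> ball z r" using elim by (auto simp: dist_real_def)
          then show "y \<in> U" using r(2) by blast
        qed
        have "ennreal (2 * e n) = (\<integral>\<^sup>+y. indicator {z - e n<..<z + e n} y \<partial>lborel)" using e(1)[of n] by simp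
        also have "\<dots> \<le> (\<integral>\<^sup>+y. indicator U y * indicator {- e n<..<e n} (z - y) \<partial>lborel)"
          using sub by (intro nn_integral_mono) (auto simp: indicator_def)
        finally have "ennreal (1 / (2 * e n)) * ennreal (2 * e n) \<le> \<phi> n z" unfolding \<phi>_def by (rule mult_left_mono) simp
        moreover have "ennreal (1 / (2 * e n)) * ennreal (2 * e n) = 1"
          using e(1)[of n] by (subst ennreal_mult[symmetric]) auto
        ultimately show ?case by simp
      qed
      then have "1 \<le> liminf (\<lambda>n. \<phi> n z)" by (rule Liminf_bounded)
      then show ?thesis using True by simp
    qed simp
    have le: "(\<integral>\<^sup>+s. \<phi> n (x s) \<partial>\<Lambda>) \<le> ennreal (1 / \<kappa>) + ennreal (1 / \<kappa>) * ?W n" for n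
    proof -
      define g where "g y = ennreal (1 / (2 * e n)) * (\<integral>\<^sup>+s. indicator {- e n<..<e n} (x s - y) \<partial>\<Lambda>)" for y
      have g_meas [measurable]: "g \<in> borel_measurable borel"
        unfolding g_def by measurable
      have "(\<integral>\<^sup>+s. \<phi> n (x s) \<partial>\<Lambda>) = ennreal (1 / (2 * e n)) * (\<integral>\<^sup>+s. \<integral>\<^sup>+y. indicator U y * indicator {- e n<..<e n} (x s - y) \<partial>lborel \<partial>\<Lambda>)"
        unfolding \<phi>_def by (rule nn_integral_cmult) measurable
      also have "(\<integral>\<^sup>+s. \<integral>\<^sup>+y. indicator U y * indicator {- e n<..<e n} (x s - y) \<partial>lborel \<partial>\<Lambda>) = (\<integral>\<^sup>+y. \<integral>\<^sup>+s. indicator U y * indicator {- e n<..<e n} (x s - y) \<partial>\<Lambda> \<partial>lborel)"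
        by (rule swap_nn_integral[OF sf]) measurable
      also have "ennreal (1 / (2 * e n)) * \<dots> = (\<integral>\<^sup>+y. ennreal (1 / (2 * e n)) * (\<integral>\<^sup>+s. indicator U y * indicator {- e n<..<e n} (x s - y) \<partial>\<Lambda>) \<partial>lborel)"
        by (rule nn_integral_cmult[symmetric]) measurable
      also have "\<dots> = (\<integral>\<^sup>+y. indicator U y * g y \<partial>lborel)"
        unfolding g_def by (intro nn_integral_cong) (simp add: nn_integral_cmult mult.left_commute)
      also have "\<dots> \<le> (\<integral>\<^sup>+y. ennreal \<kappa> * indicator U y + ennreal (1 / \<kappa>) * (g y)\<^sup>2 \<partial>lborel)"
      proof (rule nn_integral_mono)
        fix y
        have "v \<le> ennreal \<kappa> + ennreal (1 / \<kappa>) * v\<^sup>2" for v :: ennreal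
        proof (cases v)
          case (real r)
          have "r \<le> \<kappa> + 1 / \<kappa> * r\<^sup>2"
          proof -
            have "2 * (r * \<kappa>) \<le> r\<^sup>2 + \<kappa>\<^sup>2" using sum_squares_bound[of r \<kappa>] by (simp only: mult.assoc)
            moreover have "0 \<le> r * \<kappa>" using real(1) \<kappa> by simp
            ultimately have "r * \<kappa> \<le> \<kappa>\<^sup>2 + r\<^sup>2" by linarith
            then have "r * \<kappa> / \<kappa> \<le> (\<kappa>\<^sup>2 + r\<^sup>2) / \<kappa>" using \<kappa> by (intro divide_right_mono) auto
            then show ?thesis using \<kappa> by (simp add: add_divide_distrib power2_eq_square)
          qed
          then have "ennreal r \<le> ennreal (\<kappa> + 1 / \<kappa> * r\<^sup>2)" by (rule ennreal_leI)
          also have "\<dots> = ennreal \<kappa> + ennreal (1 / \<kappa>) * (ennreal r)\<^sup>2"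
            using \<kappa> real(1) by (simp only: ennreal_plus ennreal_mult ennreal_power mult_nonneg_nonneg zero_le_power2 less_imp_le divide_pos_pos zero_less_one)
          finally show ?thesis using real by simp
        next
          case top
          then show ?thesis using \<kappa> by (simp add: ennreal_mult_top power2_eq_square)
        qed
        then show "indicator U y * g y \<le> ennreal \<kappa> * indicator U y + ennreal (1 / \<kappa>) * (g y)\<^sup>2"
          by (simp add: indicator_def)
      qed
      also have "\<dots> = ennreal \<kappa> * emeasure lborel U + ennreal (1 / \<kappa>) * (\<integral>\<^sup>+y. (g y)\<^sup>2 \<partial>lborel)"
        by (simp add: nn_integral_add nn_integral_cmult)
      also have "\<dots> \<le> ennreal \<kappa> * ennreal \<delta> + ennreal (1 / \<kappa>) * ?W n"
      proof (intro add_mono mult_left_mono LU)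
        have "(\<integral>\<^sup>+y. (g y)\<^sup>2 \<partial>lborel) = (ennreal (1 / (2 * e n)))\<^sup>2 * (\<integral>\<^sup>+y. (\<integral>\<^sup>+s. indicator {- e n<..<e n} (x s - y) \<partial>\<Lambda>)\<^sup>2 \<partial>lborel)"
          unfolding g_def power_mult_distrib by (rule nn_integral_cmult) measurable
        also have "\<dots> \<le> (ennreal (1 / (2 * e n)))\<^sup>2 * (ennreal (2 * e n) * close_pairs \<Lambda> x (e n))"
          by (intro mult_left_mono smoothed_square_le fin x e) simp
        also have "\<dots> = ennreal (1 / (2 * e n)) * (ennreal (1 / (2 * e n)) * ennreal (2 * e n)) * close_pairs \<Lambda> x (e n)"
          by (simp only: power2_eq_square mult.assoc)
        also have "ennreal (1 / (2 * e n)) * ennreal (2 * e n) = 1"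
          using e(1)[of n] by (subst ennreal_mult[symmetric]) auto
        finally show "(\<integral>\<^sup>+y. (g y)\<^sup>2 \<partial>lborel) \<le> ?W n" by simp
      qed simp_all
      also have "ennreal \<kappa> * ennreal \<delta> = ennreal (1 / \<kappa>)"
        using \<kappa> by (simp add: \<delta>_def ennreal_mult[symmetric] power2_eq_square)
      finally show ?thesis .
    qed
    have "emeasure ?\<mu> N \<le> emeasure ?\<mu> U" using U(2) by (intro emeasure_mono) auto
    also have "\<dots> = (\<integral>\<^sup>+s. indicator U (x s) \<partial>\<Lambda>)"
      by (rule emeasure_distr_indicator[OF x Um])
    also have "\<dots> \<le> (\<integral>\<^sup>+s. liminf (\<lambda>n. \<phi> n (x s)) \<partial>\<Lambda>)" by (intro nn_integral_mono ind)
    also have "\<dots> \<le> liminf (\<lambda>n. \<integral>\<^sup>+s. \<phi> n (x s) \<partial>\<Lambda>)" by (rule nn_integral_liminf) measurable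
    also have "\<dots> \<le> ennreal ((1 + w) / \<kappa>)"
    proof (rule ccontr)
      assume "\<not> ?thesis"
      then have "ennreal ((1 + w) / \<kappa>) < liminf (\<lambda>n. \<integral>\<^sup>+s. \<phi> n (x s) \<partial>\<Lambda>)" by simp
      then have "eventually (\<lambda>n. ennreal ((1 + w) / \<kappa>) < (\<integral>\<^sup>+s. \<phi> n (x s) \<partial>\<Lambda>)) sequentially" by (rule less_LiminfD)
      then have "eventually (\<lambda>n. ennreal w \<le> ?W n) sequentially"
      proof eventually_elim
        case (elim n)
        show ?case
        proof (rule ccontr)
          assume "\<not> ennreal w \<le> ?W n"
          then have "?W n \<le> ennreal w" by simp
          then have "ennreal (1 / \<kappa>) + ennreal (1 / \<kappa>) * ?W n \<le> ennreal (1 / \<kappa>) + ennreal (1 / \<kappa>) * ennreal w"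
            by (intro add_left_mono mult_left_mono) auto
          also have "\<dots> = ennreal (1 / \<kappa> + 1 / \<kappa> * w)"
            using \<kappa> w(1) by (simp only: ennreal_plus ennreal_mult mult_nonneg_nonneg less_imp_le divide_pos_pos zero_less_one)
          also have "1 / \<kappa> + 1 / \<kappa> * w = (1 + w) / \<kappa>" by (simp add: add_divide_distrib)
          finally have "(\<integral>\<^sup>+s. \<phi> n (x s) \<partial>\<Lambda>) \<le> ennreal ((1 + w) / \<kappa>)" using le[of n] by (rule order_trans[rotated])
          then show False using elim by simp
        qed
      qed
      then have "ennreal w \<le> liminf ?W" by (rule Liminf_bounded)
      then show False using w(2) by simp
    qed
    finally show ?thesis .
  qed
  have "(\<lambda>n. ennreal ((1 + w) / real (Suc n))) \<longlonglongrightarrow> ennreal 0"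
    by (intro tendsto_ennrealI) (rule LIMSEQ_Suc[OF lim_const_over_n])
  then have "emeasure ?\<mu> N \<le> ennreal 0"
    by (rule tendsto_lowerbound) (auto intro!: always_eventually bound simp del: of_nat_Suc)
  then show "N \<in> null_sets ?\<mu>" using N(1) by (intro null_setsI) auto
qed

section \<open>Absolute continuity of the occupation measures of fractional Brownian motion\<close>

context fbm
begin

definition time :: "real \<Rightarrow> real measure" where "time T = restrict_space lborel {0..T}"

lemma finite_time: "finite_measure (time T)"
  unfolding time_def by (intro finite_measureI) (simp add: emeasure_restrict_space space_restrict_space emeasure_lborel_Icc_eq)

lemma nn_integral_time: "(\<integral>\<^sup>+s. f s \<partial>time T) = (\<integral>\<^sup>+s. f s * indicator {0..T} s \<partial>lborel)"
  unfolding time_def by (rule nn_integral_restrict_space) simp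

lemma space_time: "space (time T) = {0..T}"
  by (simp add: time_def space_restrict_space)

text \<open>Rounding time down to multiples of \<open>1 / Suc n\<close> gives jointly measurable
  functions, and continuity of the paths passes this to the limit. The \<open>max\<close> with
  \<open>0\<close> extends the process to the whole real line.\<close>

lemma B_joint_meas: "(\<lambda>z. B (max (fst z) 0) (snd z)) \<in> borel_measurable (borel \<Otimes>\<^sub>M M)"
proof (rule borel_measurable_LIMSEQ_real)
  define F where "F n z = B (max (real_of_int \<lfloor>real (Suc n) * fst z\<rfloor> / real (Suc n)) 0) (snd z)" for n and z :: "real \<times> 'a"
  show "F n \<in> borel_measurable (borel \<Otimes>\<^sub>M M)" for n
  proof -
    have [measurable]: "(\<lambda>z. B (max (real_of_int i / real (Suc n)) 0) (snd z)) \<in> borel_measurable (borel \<Otimes>\<^sub>M M)" for i :: int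
      by (rule measurable_compose[OF measurable_snd B_meas]) simp
    have [measurable]: "(\<lambda>z. \<lfloor>real (Suc n) * fst z\<rfloor>) \<in> measurable (borel \<Otimes>\<^sub>M M) (count_space UNIV)" by measurable
    show ?thesis unfolding F_def[abs_def]
      by (rule measurable_compose_countable[where f="\<lambda>i z. B (max (real_of_int i / real (Suc n)) 0) (snd z)" and g="\<lambda>z. \<lfloor>real (Suc n) * fst z\<rfloor>"]) measurable
  qed
  fix z :: "real \<times> 'a" assume z: "z \<in> space (borel \<Otimes>\<^sub>M M)"
  have "(\<lambda>n. real_of_int \<lfloor>real (Suc n) * fst z\<rfloor> / real (Suc n)) \<longlonglongrightarrow> fst z"
  proof (rule tendsto_sandwich[of "\<lambda>n. fst z - 1 / real (Suc n)" _ _ "\<lambda>n. fst z"])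
    show "eventually (\<lambda>n. fst z - 1 / real (Suc n) \<le> real_of_int \<lfloor>real (Suc n) * fst z\<rfloor> / real (Suc n)) sequentially"
    proof (intro always_eventually allI)
      fix n
      have "real (Suc n) * fst z - 1 \<le> real_of_int \<lfloor>real (Suc n) * fst z\<rfloor>" by linarith
      then have "(real (Suc n) * fst z - 1) / real (Suc n) \<le> real_of_int \<lfloor>real (Suc n) * fst z\<rfloor> / real (Suc n)" by (rule divide_right_mono) simp
      then show "fst z - 1 / real (Suc n) \<le> real_of_int \<lfloor>real (Suc n) * fst z\<rfloor> / real (Suc n)" by (simp add: diff_divide_distrib del: of_nat_Suc)
    qed
    show "eventually (\<lambda>n. real_of_int \<lfloor>real (Suc n) * fst z\<rfloor> / real (Suc n) \<le> fst z) sequentially"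
    proof (intro always_eventually allI)
      fix n
      have "real_of_int \<lfloor>real (Suc n) * fst z\<rfloor> \<le> fst z * real (Suc n)" by (simp only: mult.commute of_int_floor_le)
      then show "real_of_int \<lfloor>real (Suc n) * fst z\<rfloor> / real (Suc n) \<le> fst z" by (subst pos_divide_le_eq) auto
    qed
    have "(\<lambda>n. fst z - 1 / real (Suc n)) \<longlonglongrightarrow> fst z - 0"
      by (intro tendsto_diff tendsto_const LIMSEQ_Suc[OF lim_1_over_n])
    then show "(\<lambda>n. fst z - 1 / real (Suc n)) \<longlonglongrightarrow> fst z" by simp
  qed simp
  then have lim: "(\<lambda>n. max (real_of_int \<lfloor>real (Suc n) * fst z\<rfloor> / real (Suc n)) 0) \<longlonglongrightarrow> max (fst z) 0"
    by (intro tendsto_max tendsto_const)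
  have "snd z \<in> space M" using z by (auto simp: space_pair_measure)
  from continuous_on_tendsto_compose[OF B_cont[OF this order_refl] lim]
  show "(\<lambda>n. F n z) \<longlonglongrightarrow> B (max (fst z) 0) (snd z)"
    unfolding F_def by simp
qed

lemma B_joint_meas_time: "(\<lambda>z. B (fst z) (snd z)) \<in> borel_measurable (time T \<Otimes>\<^sub>M M)"
proof -
  have "(\<lambda>z. (fst z, snd z)) \<in> measurable (time T \<Otimes>\<^sub>M M) (borel \<Otimes>\<^sub>M M)"
  proof (intro measurable_Pair measurable_snd)
    have "(\<lambda>s. s) \<in> measurable (time T) borel" unfolding time_def by (intro measurable_restrict_space1) simp
    then show "fst \<in> measurable (time T \<Otimes>\<^sub>M M) borel" by (rule measurable_compose[OF measurable_fst])
  qed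
  from measurable_compose[OF this B_joint_meas]
  have "(\<lambda>z. B (max (fst z) 0) (snd z)) \<in> borel_measurable (time T \<Otimes>\<^sub>M M)" by simp
  then show ?thesis
    by (rule measurable_cong[THEN iffD1, rotated]) (auto simp: space_pair_measure space_time max_def)
qed

text \<open>A centred normal density is at most the inverse of its standard deviation, here
  \<open>sqrt K * \<bar>r - s\<bar> powr H\<close>, and the interval has length
  \<open>4 * \<epsilon>\<close>. The factor \<open>2 * \<epsilon>\<close> is kept apart to cancel
  the normalisation of \<open>close_pairs\<close>.\<close>

lemma small_increment_prob:
  assumes "0 \<le> s" "0 \<le> r" "s \<noteq> r" "0 < \<epsilon>"
  shows "(\<integral>\<^sup>+\<omega>. indicator {- 2 * \<epsilon><..<2 * \<epsilon>} (B s \<omega> - B r \<omega>) \<partial>M) \<le> ennreal (2 * \<epsilon>) * ennreal (2 / sqrt K * \<bar>r - s\<bar> powr (- H))"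
proof -
  define v where "v = K * \<bar>s - r\<bar> powr (2 * H)"
  have v: "0 < v" using K assms by (simp add: v_def)
  have m: "(\<lambda>\<omega>. B s \<omega> - B r \<omega>) \<in> borel_measurable M" using B_meas assms by (intro borel_measurable_diff) auto
  have "(\<integral>\<^sup>+\<omega>. indicator {- 2 * \<epsilon><..<2 * \<epsilon>} (B s \<omega> - B r \<omega>) \<partial>M) = (\<integral>\<^sup>+z. indicator {- 2 * \<epsilon><..<2 * \<epsilon>} z \<partial>distr M borel (\<lambda>\<omega>. B s \<omega> - B r \<omega>))"
    using m by (intro nn_integral_distr[symmetric]) auto
  also have "distr M borel (\<lambda>\<omega>. B s \<omega> - B r \<omega>) = density lborel (normal_density 0 (sqrt v))"
    unfolding B_increment[OF assms(2,1)] v_def[symmetric] using v by (simp add: normal_law_def)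
  also have "(\<integral>\<^sup>+z. indicator {- 2 * \<epsilon><..<2 * \<epsilon>} z \<partial>density lborel (normal_density 0 (sqrt v))) =
      (\<integral>\<^sup>+z. ennreal (normal_density 0 (sqrt v) z) * indicator {- 2 * \<epsilon><..<2 * \<epsilon>} z \<partial>lborel)"
    by (rule nn_integral_density) auto
  also have "\<dots> \<le> (\<integral>\<^sup>+z. ennreal (1 / sqrt v) * indicator {- 2 * \<epsilon><..<2 * \<epsilon>} z \<partial>lborel)"
  proof (intro nn_integral_mono mult_right_mono ennreal_leI)
    fix z
    have "normal_density 0 (sqrt v) z \<le> 1 / sqrt (2 * pi * v) * 1"
      unfolding normal_density_def using v by (intro mult_mono) auto
    also have "\<dots> \<le> 1 / sqrt v"
    proof -
      have "1 * v \<le> 2 * pi * v" using v pi_ge_two by (intro mult_right_mono) auto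
      then have "sqrt v \<le> sqrt (2 * pi * v)" by simp
      then show ?thesis using v by (simp add: frac_le)
    qed
    finally show "normal_density 0 (sqrt v) z \<le> 1 / sqrt v" .
  qed simp
  also have "\<dots> = ennreal (1 / sqrt v) * ennreal (4 * \<epsilon>)"
    using assms by (subst nn_integral_cmult_indicator) auto
  also have "\<dots> = ennreal (2 * \<epsilon>) * ennreal (2 / sqrt K * \<bar>r - s\<bar> powr (- H))"
  proof -
    have "sqrt v = sqrt K * \<bar>r - s\<bar> powr H"
    proof -
      have "\<bar>s - r\<bar> powr (2 * H) = (\<bar>r - s\<bar> powr H)\<^sup>2"
        using powr_powr[of "\<bar>r - s\<bar>" H 2] assms by (simp add: abs_minus_commute mult.commute powr_numeral)
      then show ?thesis by (simp add: v_def real_sqrt_mult)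
    qed
    then have "1 / sqrt v * (4 * \<epsilon>) = 2 * \<epsilon> * (2 / sqrt K * \<bar>r - s\<bar> powr (- H))"
      by (simp add: powr_minus field_simps)
    moreover have "ennreal (1 / sqrt v) * ennreal (4 * \<epsilon>) = ennreal (1 / sqrt v * (4 * \<epsilon>))"
      using v assms by (intro ennreal_mult[symmetric]) auto
    moreover have "ennreal (2 * \<epsilon>) * ennreal (2 / sqrt K * \<bar>r - s\<bar> powr (- H)) = ennreal (2 * \<epsilon> * (2 / sqrt K * \<bar>r - s\<bar> powr (- H)))"
      using K assms by (intro ennreal_mult[symmetric]) auto
    ultimately show ?thesis by simp
  qed
  finally show ?thesis .
qed

text \<open>The integral is split at \<open>s\<close>; after translation or reflection each half is
  dominated by the integral of \<open>v powr (- H)\<close> over \<open>[0, T]\<close>, which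
  converges because \<open>H < 1\<close>.\<close>

lemma singular_kernel_bound:
  assumes T: "0 \<le> T" and s: "s \<in> {0..T}"
  shows "(\<integral>\<^sup>+r. ennreal (\<bar>r - s\<bar> powr (- H)) \<partial>time T) \<le> ennreal (2 * (T powr (1 - H) / (1 - H)))"
proof -
  define k where "k v = indicator {0..T} v * ennreal (v powr (- H))" for v :: real
  have [measurable]: "k \<in> borel_measurable borel" unfolding k_def by measurable
  have hi: "((\<lambda>v. v powr (- H)) has_integral (T powr (- H + 1) / (- H + 1))) {0..T}"
    using H T by (intro has_integral_powr_from_0) auto
  have "(\<integral>\<^sup>+v. k v \<partial>lborel) = (\<integral>\<^sup>+v. ennreal (indicator {0..T} v * v powr (- H)) \<partial>lborel)"
    by (intro nn_integral_cong) (simp add: k_def indicator_def)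
  also have "\<dots> = ennreal (T powr (- H + 1) / (- H + 1))"
    by (rule nn_integral_has_integral_lebesgue[OF _ hi]) simp
  also have "- H + 1 = 1 - H" by simp
  finally have k: "(\<integral>\<^sup>+v. k v \<partial>lborel) = ennreal (T powr (1 - H) / (1 - H))" .
  have "(\<integral>\<^sup>+r. ennreal (\<bar>r - s\<bar> powr (- H)) \<partial>time T) \<le> (\<integral>\<^sup>+r. k (- s + 1 * r) + k (s + (-1) * r) \<partial>lborel)"
    unfolding nn_integral_time
  proof (rule nn_integral_mono)
    fix r
    show "ennreal (\<bar>r - s\<bar> powr (- H)) * indicator {0..T} r \<le> k (- s + 1 * r) + k (s + (-1) * r)"
      using s by (cases "s \<le> r") (auto simp: k_def indicator_def)
  qed
  also have "\<dots> = (\<integral>\<^sup>+r. k (- s + 1 * r) \<partial>lborel) + (\<integral>\<^sup>+r. k (s + (-1) * r) \<partial>lborel)"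
    by (rule nn_integral_add) measurable
  also have "(\<integral>\<^sup>+r. k (- s + 1 * r) \<partial>lborel) = (\<integral>\<^sup>+v. k v \<partial>lborel)"
    using nn_integral_real_affine[of k 1 "- s"] by simp
  also have "(\<integral>\<^sup>+r. k (s + (-1) * r) \<partial>lborel) = (\<integral>\<^sup>+v. k v \<partial>lborel)"
    using nn_integral_real_affine[of k "-1" s] by simp
  also have "(\<integral>\<^sup>+v. k v \<partial>lborel) + (\<integral>\<^sup>+v. k v \<partial>lborel) = ennreal (2 * (T powr (1 - H) / (1 - H)))"
    unfolding k using H by (subst ennreal_plus[symmetric]) auto
  finally show ?thesis .
qed

text \<open>The expected normalised number of close pairs is bounded uniformly in the scale
  \<open>e n\<close>, and Fatou's lemma makes its lower limit finite almost surely.\<close>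

lemma occupation_absolutely_continuous_at:
  assumes T: "0 \<le> T"
  shows "AE \<omega> in M. absolutely_continuous lborel (distr (time T) borel (\<lambda>s. B s \<omega>))"
proof -
  define e where "e n = 1 / real (Suc n)" for n
  have e: "0 < e n" "e \<longlonglongrightarrow> 0" for n
    unfolding e_def[abs_def] by (simp, rule LIMSEQ_Suc[OF lim_1_over_n])
  have sfT: "sigma_finite_measure (time T)" using finite_time finite_measure.axioms(1) by blast
  have sfM: "sigma_finite_measure M" by (rule sigma_finite_measure_axioms)
  interpret Ti: finite_measure "time T" by (rule finite_time)
  interpret TM: pair_sigma_finite "time T" M ..
  have joint: "(\<lambda>z. B (fst z) (snd z)) \<in> borel_measurable (time T \<Otimes>\<^sub>M M)" by (rule B_joint_meas_time)
  have j1 [measurable]: "(\<lambda>z. B (fst (fst z)) (snd z)) \<in> borel_measurable ((time T \<Otimes>\<^sub>M time T) \<Otimes>\<^sub>M M)"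
    using measurable_compose[of "\<lambda>z. (fst (fst z), snd z)" "(time T \<Otimes>\<^sub>M time T) \<Otimes>\<^sub>M M" "time T \<Otimes>\<^sub>M M", OF _ joint] by simp
  have j2 [measurable]: "(\<lambda>z. B (snd (fst z)) (snd z)) \<in> borel_measurable ((time T \<Otimes>\<^sub>M time T) \<Otimes>\<^sub>M M)"
    using measurable_compose[of "\<lambda>z. (snd (fst z), snd z)" "(time T \<Otimes>\<^sub>M time T) \<Otimes>\<^sub>M M" "time T \<Otimes>\<^sub>M M", OF _ joint] by simp
  define I where "I n s r \<omega> = (indicator {- 2 * e n<..<2 * e n} (B s \<omega> - B r \<omega>) :: ennreal)" for n s r \<omega>
  have I1: "(\<lambda>z. I n (fst (fst z)) (snd (fst z)) (snd z)) \<in> borel_measurable ((time T \<Otimes>\<^sub>M time T) \<Otimes>\<^sub>M M)" for n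
    unfolding I_def by measurable
  have I2: "(\<lambda>z. I n (snd (fst z)) (snd z) (fst (fst z))) \<in> borel_measurable ((M \<Otimes>\<^sub>M time T) \<Otimes>\<^sub>M time T)" for n
  proof -
    have "(\<lambda>z. ((snd (fst z), snd z), fst (fst z))) \<in> measurable ((M \<Otimes>\<^sub>M time T) \<Otimes>\<^sub>M time T) ((time T \<Otimes>\<^sub>M time T) \<Otimes>\<^sub>M M)"
      by measurable
    from measurable_compose[OF this I1] show ?thesis by simp
  qed
  have I3: "(\<lambda>z. I n s (snd z) (fst z)) \<in> borel_measurable (M \<Otimes>\<^sub>M time T)" if "s \<in> {0..T}" for n s
    using measurable_compose[of "\<lambda>z. ((s, snd z), fst z)" "M \<Otimes>\<^sub>M time T" "(time T \<Otimes>\<^sub>M time T) \<Otimes>\<^sub>M M", OF _ I1] that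
    by (simp add: space_time)
  have I4: "(\<lambda>z. \<integral>\<^sup>+r. I n (snd z) r (fst z) \<partial>time T) \<in> borel_measurable (M \<Otimes>\<^sub>M time T)" for n
    using Ti.borel_measurable_nn_integral_fst[OF I2, of n] by simp
  define W where "W n \<omega> = ennreal (1 / (2 * e n)) * close_pairs (time T) (\<lambda>s. B s \<omega>) (e n)" for n \<omega>
  have cp: "close_pairs (time T) (\<lambda>s. B s \<omega>) (e n) = (\<integral>\<^sup>+s. \<integral>\<^sup>+r. I n s r \<omega> \<partial>time T \<partial>time T)" for n \<omega>
    unfolding close_pairs_def I_def ..
  have J: "(\<lambda>\<omega>. \<integral>\<^sup>+s. \<integral>\<^sup>+r. I n s r \<omega> \<partial>time T \<partial>time T) \<in> borel_measurable M" for n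
    using Ti.borel_measurable_nn_integral_fst[OF I4, of n] by simp
  have W_meas: "W n \<in> borel_measurable M" for n
    unfolding W_def[abs_def] cp by (intro borel_measurable_times_ennreal borel_measurable_const J)
  define Cst where "Cst = ennreal (2 / sqrt K) * (ennreal (2 * (T powr (1 - H) / (1 - H))) * ennreal T)"
  have EW: "(\<integral>\<^sup>+\<omega>. W n \<omega> \<partial>M) \<le> Cst" for n
  proof -
    have "(\<integral>\<^sup>+\<omega>. close_pairs (time T) (\<lambda>s. B s \<omega>) (e n) \<partial>M) = (\<integral>\<^sup>+\<omega>. \<integral>\<^sup>+s. \<integral>\<^sup>+r. I n s r \<omega> \<partial>time T \<partial>time T \<partial>M)"
      unfolding cp ..
    also have "\<dots> = (\<integral>\<^sup>+s. \<integral>\<^sup>+\<omega>. \<integral>\<^sup>+r. I n s r \<omega> \<partial>time T \<partial>M \<partial>time T)"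
      by (rule swap_nn_integral[OF sfM sfT I4])
    also have "\<dots> = (\<integral>\<^sup>+s. \<integral>\<^sup>+r. \<integral>\<^sup>+\<omega>. I n s r \<omega> \<partial>M \<partial>time T \<partial>time T)"
      by (intro nn_integral_cong swap_nn_integral[OF sfM sfT] I3) (simp add: space_time)
    also have "\<dots> \<le> (\<integral>\<^sup>+s. ennreal (2 * e n) * (ennreal (2 / sqrt K) * ennreal (2 * (T powr (1 - H) / (1 - H)))) \<partial>time T)"
    proof (rule nn_integral_mono)
      fix s assume "s \<in> space (time T)"
      then have s: "s \<in> {0..T}" by (simp add: space_time)
      have AEs: "AE r in time T. r \<noteq> s"
        unfolding time_def by (subst AE_restrict_space_iff) (use AE_lborel_singleton[of s] in auto)
      have "(\<integral>\<^sup>+r. \<integral>\<^sup>+\<omega>. I n s r \<omega> \<partial>M \<partial>time T) \<le> (\<integral>\<^sup>+r. ennreal (2 * e n) * (ennreal (2 / sqrt K) * ennreal (\<bar>r - s\<bar> powr (- H))) \<partial>time T)"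
      proof (rule nn_integral_mono_AE)
        show "AE r in time T. (\<integral>\<^sup>+\<omega>. I n s r \<omega> \<partial>M) \<le> ennreal (2 * e n) * (ennreal (2 / sqrt K) * ennreal (\<bar>r - s\<bar> powr (- H)))"
          using AEs AE_space
        proof eventually_elim
          case (elim r)
          have "ennreal (2 / sqrt K * \<bar>r - s\<bar> powr (- H)) = ennreal (2 / sqrt K) * ennreal (\<bar>r - s\<bar> powr (- H))"
            using K by (intro ennreal_mult) auto
          then show ?case using small_increment_prob[of s r "e n"] elim s e(1)[of n] unfolding I_def space_time by auto
        qed
      qed
      also have "\<dots> = ennreal (2 * e n) * (ennreal (2 / sqrt K) * (\<integral>\<^sup>+r. ennreal (\<bar>r - s\<bar> powr (- H)) \<partial>time T))"
      proof -
        have "(\<lambda>r. r) \<in> measurable (time T) borel" unfolding time_def by (intro measurable_restrict_space1) simp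
        then have "(\<lambda>r. ennreal (\<bar>r - s\<bar> powr (- H))) \<in> borel_measurable (time T)" by measurable
        then show ?thesis by (simp add: nn_integral_cmult)
      qed
      also have "\<dots> \<le> ennreal (2 * e n) * (ennreal (2 / sqrt K) * ennreal (2 * (T powr (1 - H) / (1 - H))))"
        by (intro mult_left_mono singular_kernel_bound T s) auto
      finally show "(\<integral>\<^sup>+r. \<integral>\<^sup>+\<omega>. I n s r \<omega> \<partial>M \<partial>time T) \<le> ennreal (2 * e n) * (ennreal (2 / sqrt K) * ennreal (2 * (T powr (1 - H) / (1 - H))))" .
    qed
    also have "\<dots> = ennreal (2 * e n) * Cst"
    proof -
      have "emeasure (time T) (space (time T)) = ennreal T"
        using T unfolding space_time by (simp add: time_def emeasure_restrict_space)
      then show ?thesis by (simp add: Cst_def mult.assoc)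
    qed
    finally have *: "(\<integral>\<^sup>+\<omega>. close_pairs (time T) (\<lambda>s. B s \<omega>) (e n) \<partial>M) \<le> ennreal (2 * e n) * Cst" .
    have "(\<integral>\<^sup>+\<omega>. W n \<omega> \<partial>M) = ennreal (1 / (2 * e n)) * (\<integral>\<^sup>+\<omega>. close_pairs (time T) (\<lambda>s. B s \<omega>) (e n) \<partial>M)"
      unfolding W_def cp by (rule nn_integral_cmult[OF J])
    also have "\<dots> \<le> ennreal (1 / (2 * e n)) * (ennreal (2 * e n) * Cst)" using * by (rule mult_left_mono) simp
    also have "\<dots> = Cst"
    proof -
      have "ennreal (1 / (2 * e n)) * ennreal (2 * e n) = 1"
        using e(1)[of n] by (subst ennreal_mult[symmetric]) auto
      then show ?thesis by (simp add: mult.assoc[symmetric])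
    qed
    finally show ?thesis .
  qed
  have "(\<integral>\<^sup>+\<omega>. liminf (\<lambda>n. W n \<omega>) \<partial>M) \<le> liminf (\<lambda>n. \<integral>\<^sup>+\<omega>. W n \<omega> \<partial>M)"
    by (rule nn_integral_liminf) (rule W_meas)
  also have "\<dots> \<le> Cst" using EW by (intro order_trans[OF Liminf_le_Limsup Limsup_bounded]) auto
  also have "\<dots> < \<infinity>" by (simp add: Cst_def ennreal_mult_less_top)
  finally have "AE \<omega> in M. liminf (\<lambda>n. W n \<omega>) \<noteq> \<infinity>"
    using W_meas by (intro nn_integral_PInf_AE borel_measurable_liminf) auto
  with AE_space show ?thesis
  proof eventually_elim
    case (elim \<omega>)
    have "(\<lambda>s. B s \<omega>) \<in> borel_measurable (time T)"
      using measurable_compose[of "\<lambda>s. (s, \<omega>)" "time T" "time T \<Otimes>\<^sub>M M", OF _ joint] elim by simp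
    then show ?case
      using elim(2) finite_time e by (intro absolutely_continuous_of_close_pairs[where e=e]) (auto simp: W_def less_top infinity_ennreal_def)
  qed
qed

lemma occupation_absolutely_continuous:
  "AE \<omega> in M. \<forall>t. absolutely_continuous lborel (occupation_measure (\<lambda>s. B s \<omega>) t)"
proof -
  have "AE \<omega> in M. \<forall>n::nat. absolutely_continuous lborel (distr (time (real n)) borel (\<lambda>s. B s \<omega>))"
    unfolding AE_all_countable by (intro allI occupation_absolutely_continuous_at) simp
  with AE_space show ?thesis
  proof eventually_elim
    case (elim \<omega>)
    have m: "(\<lambda>s. B s \<omega>) \<in> borel_measurable (time T)" for T
      using measurable_compose[of "\<lambda>s. (s, \<omega>)" "time T" "time T \<Otimes>\<^sub>M M", OF _ B_joint_meas_time] elim by simp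
    show ?case
    proof
      fix t
      obtain n :: nat where n: "t \<le> real n" using real_arch_simple by blast
      show "absolutely_continuous lborel (occupation_measure (\<lambda>s. B s \<omega>) t)"
        unfolding absolutely_continuous_def
      proof
        fix N :: "real set" assume N: "N \<in> null_sets lborel"
        then have Nb: "N \<in> sets borel" by auto
        have "N \<in> null_sets (distr (time (real n)) borel (\<lambda>s. B s \<omega>))"
          using elim(2) N unfolding absolutely_continuous_def by blast
        then have 0: "(\<integral>\<^sup>+s. indicator N (B s \<omega>) \<partial>time (real n)) = 0"
          unfolding emeasure_distr_indicator[OF m Nb, symmetric] by auto
        have "emeasure (distr (time t) borel (\<lambda>s. B s \<omega>)) N = (\<integral>\<^sup>+s. indicator N (B s \<omega>) \<partial>time t)"
          by (rule emeasure_distr_indicator[OF m Nb])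
        also have "\<dots> \<le> (\<integral>\<^sup>+s. indicator N (B s \<omega>) \<partial>time (real n))"
          unfolding nn_integral_time using n by (intro nn_integral_mono mult_left_mono) (auto simp: indicator_def)
        finally show "N \<in> null_sets (occupation_measure (\<lambda>s. B s \<omega>) t)"
          unfolding occupation_measure_def time_def[symmetric] using 0 Nb by (intro null_setsI) auto
      qed
    qed
  qed
qed

end

section \<open>Weak convergence of the crossing measures\<close>

text \<open>The lower bound is applied to \<open>f + b\<close> and to \<open>b - f\<close>, which
  gives an estimate of the integral of \<open>f\<close> from either side; the bound on the masses
  absorbs the constant \<open>b\<close>. Thus only one-sided estimates have to be proved.\<close>

lemma converges_weakly_criterion:
  fixes \<mu> :: "nat \<Rightarrow> real measure" and \<nu> :: "real measure"
  assumes fm: "\<And>n. finite_measure (\<mu> n)" and fn: "finite_measure \<nu>"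
    and sets: "\<And>n. sets (\<mu> n) = sets borel" "sets \<nu> = sets borel"
    and lower: "\<And>(f :: real \<Rightarrow> real) b \<epsilon> :: real. continuous_on UNIV f \<Longrightarrow> (\<And>y. 0 \<le> f y \<and> f y \<le> b) \<Longrightarrow> 0 < \<epsilon> \<Longrightarrow>
       eventually (\<lambda>n. (\<integral>y. f y \<partial>\<nu>) - \<epsilon> \<le> (\<integral>y. f y \<partial>\<mu> n)) sequentially"
    and upper: "\<And>\<epsilon>. 0 < \<epsilon> \<Longrightarrow> eventually (\<lambda>n. measure (\<mu> n) UNIV \<le> measure \<nu> UNIV + \<epsilon>) sequentially"
  shows "converges_weakly \<mu> \<nu>"
  unfolding converges_weakly_def
proof (intro conjI allI impI fm fn sets)
  fix f :: "real \<Rightarrow> real" assume f: "continuous_on UNIV f \<and> bounded (range f)"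
  then obtain b where b: "0 < b" "\<And>y. \<bar>f y\<bar> \<le> b"
    unfolding bounded_pos by auto
  have fb: "- b \<le> f y" "f y \<le> b" for y using b(2)[of y] by auto
  have f_meas: "f \<in> borel_measurable borel" using f by (intro borel_measurable_continuous_onI) simp
  have int: "integrable \<kappa> f" "(\<integral>y. f y + b \<partial>\<kappa>) = (\<integral>y. f y \<partial>\<kappa>) + b * measure \<kappa> UNIV"
    "(\<integral>y. b - f y \<partial>\<kappa>) = b * measure \<kappa> UNIV - (\<integral>y. f y \<partial>\<kappa>)"
    if "finite_measure \<kappa>" and s: "sets \<kappa> = sets borel" for \<kappa>
  proof -
    interpret finite_measure \<kappa> by fact
    have sp: "space \<kappa> = UNIV" using sets_eq_imp_space_eq[OF s] by simp
    have m: "f \<in> borel_measurable \<kappa>" using f_meas measurable_cong_sets[OF s refl] by blast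
    show i: "integrable \<kappa> f" using m b(2) by (intro integrable_const_bound[of _ b]) auto
    show "(\<integral>y. f y + b \<partial>\<kappa>) = (\<integral>y. f y \<partial>\<kappa>) + b * measure \<kappa> UNIV"
      "(\<integral>y. b - f y \<partial>\<kappa>) = b * measure \<kappa> UNIV - (\<integral>y. f y \<partial>\<kappa>)"
      using i by (simp_all add: sp)
  qed
  show "(\<lambda>n. \<integral>y. f y \<partial>\<mu> n) \<longlonglongrightarrow> (\<integral>y. f y \<partial>\<nu>)"
  proof (rule LIMSEQ_I)
    fix r :: real assume r: "0 < r"
    \<comment> \<open>The two errors, \<open>\<epsilon>\<close> from the integral and
      \<open>b * \<epsilon>\<close> from the mass, together make \<open>r / 2\<close>.\<close>
    define \<epsilon> where "\<epsilon> = r / 2 / (1 + b)"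
    have e: "0 < \<epsilon>" using r b by (simp add: \<epsilon>_def)
    have e': "\<epsilon> + b * \<epsilon> < r"
    proof -
      have "\<epsilon> + b * \<epsilon> = (1 + b) * \<epsilon>" by (simp add: algebra_simps)
      also have "\<dots> = r / 2"
      proof -
        have "1 + b \<noteq> 0" using b(1) by linarith
        then show ?thesis using nonzero_divide_eq_eq[of "1 + b" "r / 2" \<epsilon>] \<epsilon>_def by (metis mult.commute)
      qed
      finally show ?thesis using r by simp
    qed
    have cf: "continuous_on UNIV f" using f by simp
    have g1: "0 \<le> f y + b \<and> f y + b \<le> 2 * b" and g2: "0 \<le> b - f y \<and> b - f y \<le> 2 * b" for y
      using fb[of y] by linarith+
    have "eventually (\<lambda>n. (\<integral>y. f y + b \<partial>\<nu>) - \<epsilon> \<le> (\<integral>y. f y + b \<partial>\<mu> n)) sequentially"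
      by (rule lower[OF _ g1 e]) (intro continuous_intros cf)
    moreover have "eventually (\<lambda>n. (\<integral>y. b - f y \<partial>\<nu>) - \<epsilon> \<le> (\<integral>y. b - f y \<partial>\<mu> n)) sequentially"
      by (rule lower[OF _ g2 e]) (intro continuous_intros cf)
    moreover have "eventually (\<lambda>n. measure (\<mu> n) UNIV \<le> measure \<nu> UNIV + \<epsilon>) sequentially"
      by (rule upper[OF e])
    ultimately have "eventually (\<lambda>n. norm ((\<integral>y. f y \<partial>\<mu> n) - (\<integral>y. f y \<partial>\<nu>)) < r) sequentially"
    proof eventually_elim
      case (elim n)
      have "b * measure (\<mu> n) UNIV \<le> b * (measure \<nu> UNIV + \<epsilon>)" using elim(3) b(1) by (intro mult_left_mono) auto
      then show ?case
        using elim(1,2) e' unfolding int(2,3)[OF fm sets(1)] int(2,3)[OF fn sets(2)]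
        by (simp add: distrib_left abs_less_iff)
    qed
    then show "\<exists>n0. \<forall>n\<ge>n0. norm ((\<integral>y. f y \<partial>\<mu> n) - (\<integral>y. f y \<partial>\<nu>)) < r"
      by (simp add: eventually_sequentially)
  qed
qed

lemma crossings_sum_le:
  assumes cont: "continuous_on {0..real m / real N} x" and c: "0 < c" and k: "k \<le> m"
  shows "(\<Sum>i<k. crossings y c x (real i / real N) (real (Suc i) / real N)) \<le> crossings y c x 0 (real k / real N)"
  using k
proof (induction k)
  case (Suc k)
  have "(\<Sum>i<Suc k. crossings y c x (real i / real N) (real (Suc i) / real N)) \<le>
      crossings y c x 0 (real k / real N) + crossings y c x (real k / real N) (real (Suc k) / real N)"
    using Suc by simp
  also have "\<dots> \<le> crossings y c x 0 (real (Suc k) / real N)"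
  proof (rule crossings_superadditive[OF _ c])
    have "real (Suc k) / real N \<le> real m / real N" using Suc.prems by (intro divide_right_mono) auto
    then show "continuous_on {0..real (Suc k) / real N} x" by (intro continuous_on_subset[OF cont]) auto
  qed (auto intro: divide_right_mono)
  finally show ?case .
qed simp

text \<open>What is used of a single sample path, with \<open>q\<close> for
  \<open>1 / H - 1\<close>. The limit is assumed for rational end points only, since almost sure
  statements can be combined for countably many intervals.\<close>

locale truncated_variation_limit =
  fixes x :: "real \<Rightarrow> real" and q L :: real
  assumes cont: "continuous_on {0..} x" and q: "0 < q" and L: "0 \<le> L"
    and lim: "\<And>s t. s \<in> \<rat> \<Longrightarrow> t \<in> \<rat> \<Longrightarrow> 0 \<le> s \<Longrightarrow> s < t \<Longrightarrow>
      ((\<lambda>c. c powr q * enn2real (tvs c x {s..t})) \<longlongrightarrow> L * (t - s)) (at_right 0)"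
    and ac: "\<And>t. absolutely_continuous lborel (occupation_measure x t)"
begin

lemma cont_Icc: "0 \<le> s \<Longrightarrow> continuous_on {s..t} x"
  by (rule continuous_on_subset[OF cont]) auto

definition cross_measure :: "real \<Rightarrow> real \<Rightarrow> real measure" where
  "cross_measure c t = density lborel (\<lambda>y. ennreal (c powr q) * of_nat (crossings y c x 0 t))"

definition limit_measure :: "real \<Rightarrow> real measure" where
  "limit_measure t = density lborel (\<lambda>y. ennreal L * local_time x t y)"

lemma cross_meas: "0 < c \<Longrightarrow> 0 \<le> s \<Longrightarrow> s \<le> t \<Longrightarrow> (\<lambda>y. of_nat (crossings y c x s t) :: ennreal) \<in> borel_measurable borel"
  by (rule measurable_compose[OF measurable_crossings[OF cont_Icc]]) simp_all

lemma x_meas: "x \<in> borel_measurable (restrict_space lborel {0..t})"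
proof -
  have "x \<in> borel_measurable (restrict_space borel {0..t})"
    by (intro borel_measurable_continuous_on_restrict cont_Icc) simp
  moreover have "borel_measurable (restrict_space borel {0..t}) = (borel_measurable (restrict_space lborel {0..t}) :: (real \<Rightarrow> real) set)"
    by (intro measurable_cong_sets) (simp_all add: sets_restrict_space)
  ultimately show ?thesis by simp
qed

lemma nn_integral_cross_measure:
  assumes "0 < c" "0 \<le> t" and g: "g \<in> borel_measurable borel"
  shows "(\<integral>\<^sup>+y. g y \<partial>cross_measure c t) = ennreal (c powr q) * (\<integral>\<^sup>+y. of_nat (crossings y c x 0 t) * g y \<partial>lborel)"
proof -
  note [measurable] = cross_meas[OF assms(1) order_refl assms(2)] g
  have "(\<integral>\<^sup>+y. g y \<partial>cross_measure c t) = (\<integral>\<^sup>+y. ennreal (c powr q) * of_nat (crossings y c x 0 t) * g y \<partial>lborel)"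
    unfolding cross_measure_def by (rule nn_integral_density) measurable
  also have "\<dots> = ennreal (c powr q) * (\<integral>\<^sup>+y. of_nat (crossings y c x 0 t) * g y \<partial>lborel)"
    unfolding mult.assoc by (rule nn_integral_cmult) measurable
  finally show ?thesis .
qed

text \<open>The local time is a density of the occupation measure, so the integral over levels
  becomes an integral over times (the occupation time formula).\<close>

lemma nn_integral_limit_measure:
  assumes g: "g \<in> borel_measurable borel"
  shows "(\<integral>\<^sup>+y. g y \<partial>limit_measure t) = ennreal L * (\<integral>\<^sup>+s. g (x s) \<partial>restrict_space lborel {0..t})"
proof -
  have rn [measurable]: "local_time x t \<in> borel_measurable lborel" unfolding local_time_def[abs_def] by simp
  note [measurable] = g
  have "(\<integral>\<^sup>+y. g y \<partial>limit_measure t) = (\<integral>\<^sup>+y. ennreal L * local_time x t y * g y \<partial>lborel)"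
    unfolding limit_measure_def by (rule nn_integral_density) measurable
  also have "\<dots> = ennreal L * (\<integral>\<^sup>+y. local_time x t y * g y \<partial>lborel)"
    unfolding mult.assoc by (rule nn_integral_cmult) measurable
  also have "(\<integral>\<^sup>+y. local_time x t y * g y \<partial>lborel) = (\<integral>\<^sup>+y. g y \<partial>density lborel (local_time x t))"
    by (rule nn_integral_density[symmetric]) measurable
  also have "density lborel (local_time x t) = occupation_measure x t"
    unfolding local_time_def[abs_def]
    by (rule sigma_finite_measure.density_RN_deriv[OF lborel.sigma_finite_measure_axioms ac]) (simp add: occupation_measure_def)
  also have "(\<integral>\<^sup>+y. g y \<partial>occupation_measure x t) = (\<integral>\<^sup>+s. g (x s) \<partial>restrict_space lborel {0..t})"
    unfolding occupation_measure_def by (rule nn_integral_distr[OF x_meas]) simp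
  finally show ?thesis .
qed

lemma sets_measures [simp]: "sets (cross_measure c t) = sets borel" "sets (limit_measure t) = sets borel"
  by (simp_all add: cross_measure_def limit_measure_def)

lemma space_measures [simp]: "space (cross_measure c t) = UNIV" "space (limit_measure t) = UNIV"
  by (simp_all add: cross_measure_def limit_measure_def)

lemma emeasure_cross: "0 < c \<Longrightarrow> 0 \<le> t \<Longrightarrow> emeasure (cross_measure c t) UNIV = ennreal (c powr q) * (\<integral>\<^sup>+y. of_nat (crossings y c x 0 t) \<partial>lborel)"
  using nn_integral_cross_measure[of c t "\<lambda>_. 1"] by simp

lemma emeasure_limit: "0 \<le> t \<Longrightarrow> emeasure (limit_measure t) UNIV = ennreal (L * t)"
  using nn_integral_limit_measure[of "\<lambda>_. 1" t] L
  by (simp add: emeasure_restrict_space space_restrict_space ennreal_mult)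

lemma finite_cross: "0 < c \<Longrightarrow> 0 \<le> t \<Longrightarrow> finite_measure (cross_measure c t)"
proof (rule finite_measureI)
  assume c: "0 < c" and t: "0 \<le> t"
  have "(\<integral>\<^sup>+y. of_nat (crossings y c x 0 t) \<partial>lborel) \<le> tvs (c / 2) x {0..t} + ennreal (c / 2 / 2)"
    using c t by (intro nn_integral_crossings_le cont_Icc) auto
  also have "\<dots> < \<infinity>"
    using tvs_finite_continuous[OF cont_Icc, of 0 "c / 2" t] c by (simp add: infinity_ennreal_def)
  finally show "emeasure (cross_measure c t) (space (cross_measure c t)) \<noteq> \<infinity>"
    using c t by (simp add: emeasure_cross ennreal_mult_eq_top_iff infinity_ennreal_def)
qed

lemma finite_limit: "0 \<le> t \<Longrightarrow> finite_measure (limit_measure t)"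
  by (rule finite_measureI) (simp add: emeasure_limit)

text \<open>Two adjustments are made: \<open>t\<close> is enlarged to a rational \<open>T\<close>,
  where the limit is known, and the threshold is lowered to \<open>l * c\<close> with
  \<open>l < 1\<close>, as \<open>nn_integral_crossings_le\<close> requires. The latter costs the
  factor \<open>l powr (- q)\<close>, close to \<open>1\<close>.\<close>

lemma mass_upper:
  assumes t: "0 \<le> t" and e: "0 < \<epsilon>"
  shows "eventually (\<lambda>c. measure (cross_measure c t) UNIV \<le> measure (limit_measure t) UNIV + \<epsilon>) (at_right 0)"
proof -
  have "t < t + \<epsilon> / (2 * (L + 1))" using e L by simp
  then obtain T where T: "T \<in> \<rat>" "t < T" "T < t + \<epsilon> / (2 * (L + 1))" using Rats_dense_in_real by blast
  have LT: "L * T < L * t + \<epsilon>"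
  proof -
    have "L * T \<le> L * (t + \<epsilon> / (2 * (L + 1)))" using T L by (intro mult_left_mono) auto
    also have "\<dots> = L * t + \<epsilon> * (L / (2 * (L + 1)))" by (simp add: algebra_simps)
    also have "\<epsilon> * (L / (2 * (L + 1))) < \<epsilon> * 1" using L e by (intro mult_strict_left_mono) (auto simp: field_simps)
    finally show ?thesis by simp
  qed
  have "((\<lambda>l. l powr (- q) * (L * T)) \<longlongrightarrow> 1 powr (- q) * (L * T)) (at_left 1)"
    by (intro tendsto_intros) auto
  then have "eventually (\<lambda>l. l powr (- q) * (L * T) < L * t + \<epsilon>) (at_left 1)"
    using LT by (intro order_tendstoD(2)) auto
  moreover have "eventually (\<lambda>l::real. 0 < l \<and> l < 1) (at_left 1)"
    unfolding eventually_at_left_field by (intro exI[of _ 0]) auto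
  ultimately have "eventually (\<lambda>l. 0 < l \<and> l < 1 \<and> l powr (- q) * (L * T) < L * t + \<epsilon>) (at_left 1)"
    by eventually_elim auto
  from eventually_happens'[OF trivial_limit_at_left_real this]
  obtain l where l: "0 < l" "l < 1" "l powr (- q) * (L * T) < L * t + \<epsilon>" by blast
  \<comment> \<open>The bound on the mass, rewritten in the normalisation that belongs to
    \<open>l * c\<close>. The last term comes from the additive error of the crossing integral and
    vanishes with \<open>c\<close>.\<close>
  define G where "G c = l powr (- q) * ((l * c) powr q * enn2real (tvs (l * c) x {0..T})) + c powr q * (c / 2)" for c
  have G_le: "measure (cross_measure c t) UNIV \<le> G c" if c: "0 < c" for c
  proof -
    have fin: "tvs (l * c) x {0..T} < \<top>"
      using tvs_finite_continuous[OF cont_Icc, of 0 "l * c" T] c l by (simp add: infinity_ennreal_def)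
    have lc: "l * c < c" using c l by simp
    have "(\<integral>\<^sup>+y. of_nat (crossings y c x 0 t) \<partial>lborel) \<le> tvs (l * c) x {0..t} + ennreal (l * c / 2)"
      using c l t lc by (intro nn_integral_crossings_le cont_Icc) auto
    also have "\<dots> \<le> tvs (l * c) x {0..T} + ennreal (c / 2)"
      using T c lc by (intro add_mono tvs_mono_set ennreal_leI) auto
    also have "\<dots> = ennreal (enn2real (tvs (l * c) x {0..T}) + c / 2)"
      using fin c by (simp add: ennreal_plus)
    finally have "emeasure (cross_measure c t) UNIV \<le> ennreal (c powr q) * ennreal (enn2real (tvs (l * c) x {0..T}) + c / 2)"
      unfolding emeasure_cross[OF c t] by (rule mult_left_mono) simp
    also have "\<dots> = ennreal (c powr q * (enn2real (tvs (l * c) x {0..T}) + c / 2))"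
      using c by (intro ennreal_mult[symmetric]) auto
    also have "c powr q * (enn2real (tvs (l * c) x {0..T}) + c / 2) = G c"
    proof -
      have "l powr (- q) * (l * c) powr q = c powr q"
        using c l by (simp add: powr_mult powr_minus)
      then show ?thesis unfolding G_def by (simp only: mult.assoc[symmetric] distrib_left)
    qed
    finally have "measure (cross_measure c t) UNIV \<le> enn2real (ennreal (G c))"
      unfolding measure_def by (rule enn2real_mono) simp
    also have "\<dots> = G c" using c by (intro enn2real_ennreal) (simp add: G_def)
    finally show ?thesis .
  qed
  have "(G \<longlongrightarrow> l powr (- q) * (L * (T - 0)) + 0 powr q * (0 / 2)) (at_right 0)"
    unfolding G_def
  proof (rule tendsto_add[OF tendsto_mult[OF tendsto_const] tendsto_mult])
    have "filterlim (\<lambda>c. l * c) (at_right 0) (at_right 0)"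
    proof -
      have "((\<lambda>c. l * c) \<longlongrightarrow> l * 0) (at_right 0)" by (intro tendsto_intros)
      moreover have "eventually (\<lambda>c. l * c \<in> {0<..} \<and> l * c \<noteq> 0) (at_right 0)"
        using l eventually_at_right_less[of "0::real"] by (auto elim!: eventually_mono)
      ultimately show ?thesis unfolding filterlim_at by (simp add: eventually_mono)
    qed
    then show "((\<lambda>c. (l * c) powr q * enn2real (tvs (l * c) x {0..T})) \<longlongrightarrow> L * (T - 0)) (at_right 0)"
      using T t by (intro filterlim_compose[OF lim]) auto
    show "((\<lambda>c. c powr q) \<longlongrightarrow> 0 powr q) (at_right 0)"
      using q by (intro tendsto_powr') (auto intro!: tendsto_intros eventually_mono[OF eventually_at_right_less])
    show "((\<lambda>c. c / 2) \<longlongrightarrow> 0 / 2) (at_right (0::real))" by (intro tendsto_intros) simp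
  qed
  then have "(G \<longlongrightarrow> l powr (- q) * (L * T)) (at_right 0)" using q by simp
  then have "eventually (\<lambda>c. G c < L * t + \<epsilon>) (at_right 0)" using l(3) by (rule order_tendstoD)
  moreover have "eventually (\<lambda>c::real. 0 < c) (at_right 0)" by (rule eventually_at_right_less)
  ultimately show ?thesis
  proof eventually_elim
    case (elim c)
    have "measure (limit_measure t) UNIV = L * t" unfolding measure_def using emeasure_limit[OF t] L t by simp
    then show ?case using G_le[OF elim(2)] elim(1) by simp
  qed
qed

text \<open>Time is cut into pieces of length \<open>1 / N\<close>. Levels crossed during a piece
  are values of \<open>x\<close> on it, so \<open>f\<close> is there at least the infimum
  \<open>a i\<close>. The crossings during the pieces add up to at most all crossings, and their
  integrals over the level are at least the truncated variations over the pieces, whose limits are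
  known. The outcome is a lower Riemann sum for \<open>f (x s)\<close>.\<close>

lemma integral_lower:
  fixes f :: "real \<Rightarrow> real" and \<epsilon> :: real
  assumes t: "0 \<le> t" and f: "continuous_on UNIV f" and fb: "\<And>y. 0 \<le> f y \<and> f y \<le> b" and e: "0 < \<epsilon>"
  shows "eventually (\<lambda>c. (\<integral>y. f y \<partial>limit_measure t) - \<epsilon> \<le> (\<integral>y. f y \<partial>cross_measure c t)) (at_right 0)"
proof -
  have f_meas [measurable]: "f \<in> borel_measurable borel" using f by (rule borel_measurable_continuous_onI)
  have b0: "0 \<le> b" using fb[of 0] by simp
  \<comment> \<open>Chosen such that \<open>L * (\<eta> * (t + 1)) <= \<epsilon> / 2\<close>: an
    oscillation of at most \<open>\<eta>\<close> over the time \<open>t\<close>, and another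
    \<open>\<eta>\<close> for the incomplete last piece.\<close>
  define \<eta> where "\<eta> = \<epsilon> / 2 / (L + 1) / (t + 1)"
  have \<eta>: "0 < \<eta>" using e L t by (simp add: \<eta>_def)
  have "uniformly_continuous_on {0..t} (\<lambda>s. f (x s))"
    by (intro compact_uniformly_continuous continuous_on_compose2[OF f] cont_Icc) auto
  then obtain d where d: "0 < d" "\<And>s r. s \<in> {0..t} \<Longrightarrow> r \<in> {0..t} \<Longrightarrow> dist r s < d \<Longrightarrow> dist (f (x r)) (f (x s)) < \<eta>"
    using \<eta> unfolding uniformly_continuous_on_def by meson
  \<comment> \<open>\<open>N\<close> makes the pieces shorter than \<open>d\<close> and the
    contribution \<open>b / N\<close> of the incomplete last piece at most
    \<open>\<eta>\<close>.\<close>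
  obtain N :: nat where N: "max (2 / d) (b / \<eta>) < N" using reals_Archimedean2 by blast
  have N0: "0 < real N" using N d(1) by (smt (verit) divide_pos_pos)
  have Nd: "1 / real N < d" using N N0 d(1) by (simp add: field_simps)
  have Nb: "b / real N \<le> \<eta>" using N N0 \<eta> by (simp add: field_simps)
  define m where "m = nat \<lfloor>real N * t\<rfloor>"
  have m: "real m / N \<le> t" "t < (real m + 1) / N"
  proof -
    have "real m = real_of_int \<lfloor>real N * t\<rfloor>" using N0 t by (simp add: m_def)
    then have "real m \<le> real N * t" "real N * t < real m + 1" by linarith+
    then show "real m / N \<le> t" "t < (real m + 1) / N" using N0 by (simp_all add: field_simps)
  qed
  let ?J = "\<lambda>i. {real i / real N..real (Suc i) / real N}"
  have J: "0 \<le> real i / real N" "real i / real N \<le> real (Suc i) / real N" "real (Suc i) / real N - real i / real N = 1 / real N" for i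
    using N0 by (auto simp: field_simps)
  have Jt: "?J i \<subseteq> {0..t}" if "i < m" for i
  proof -
    have "real (Suc i) / real N \<le> real m / real N" using that N0 by (intro divide_right_mono) auto
    then show ?thesis using m(1) J(1)[of i] by auto
  qed
  define a where "a i = (INF s\<in>?J i. f (x s))" for i
  have bdd: "bdd_below ((\<lambda>s. f (x s)) ` ?J i)" for i using fb by (intro bdd_belowI[of _ 0]) auto
  have ne: "?J i \<noteq> {}" for i using J(2)[of i] by auto
  have a_le: "a i \<le> f (x s)" if "s \<in> ?J i" for i s unfolding a_def using bdd that by (rule cINF_lower)
  have a0: "0 \<le> a i" for i unfolding a_def using ne fb by (intro cINF_greatest) auto
  have a_ge: "f (x s) - \<eta> \<le> a i" if i: "i < m" and s: "s \<in> ?J i" for i s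
    unfolding a_def
  proof (rule cINF_greatest[OF ne])
    fix r assume r: "r \<in> ?J i"
    have "dist s r < d" using r s J(3)[of i] Nd by (auto simp: dist_real_def)
    then have "dist (f (x s)) (f (x r)) < \<eta>" using d(2)[of r s] Jt[OF i] r s by blast
    then show "f (x s) - \<eta> \<le> f (x r)" by (simp add: dist_real_def)
  qed
  define S where "S = (\<Sum>i<m. a i * (L * (1 / real N)))"
  have low: "(\<integral>y. f y \<partial>limit_measure t) \<le> S + \<epsilon> / 2"
  proof -
    have "(\<integral>\<^sup>+s. ennreal (f (x s)) \<partial>restrict_space lborel {0..t}) \<le>
        (\<integral>\<^sup>+s. (\<Sum>i<m. ennreal (a i + \<eta>) * indicator (?J i) s) + ennreal b * indicator {real m / N..t} s \<partial>lborel)"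
      unfolding nn_integral_restrict_space[of "{0..t}" lborel, simplified]
    proof (rule nn_integral_mono)
      fix s
      show "ennreal (f (x s)) * indicator {0..t} s \<le> (\<Sum>i<m. ennreal (a i + \<eta>) * indicator (?J i) s) + ennreal b * indicator {real m / N..t} s"
      proof (cases "s \<in> {0..t}")
        case s: True
        show ?thesis
        proof (cases "real m / N \<le> s")
          case True
          then have "ennreal (f (x s)) * indicator {0..t} s \<le> ennreal b * indicator {real m / N..t} s"
            using s fb by (simp add: ennreal_leI)
          then show ?thesis by (rule add_increasing[rotated]) simp
        next
          case False
          define i where "i = nat \<lfloor>real N * s\<rfloor>"
          have "real i = real_of_int \<lfloor>real N * s\<rfloor>" using N0 s by (simp add: i_def)
          then have i: "real i \<le> real N * s" "real N * s < real i + 1" by linarith+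
          have "real i < real m" using i(1) False N0 by (simp add: field_simps)
          then have im: "i < m" by simp
          have si: "s \<in> ?J i" using i N0 by (simp add: field_simps)
          have "ennreal (f (x s)) \<le> ennreal (a i + \<eta>)" using a_ge[OF im si] by (intro ennreal_leI) simp
          also have "\<dots> = ennreal (a i + \<eta>) * indicator (?J i) s" using si by simp
          also have "\<dots> \<le> (\<Sum>i<m. ennreal (a i + \<eta>) * indicator (?J i) s)"
            using im by (intro member_le_sum) auto
          finally have "ennreal (f (x s)) * indicator {0..t} s \<le> (\<Sum>i<m. ennreal (a i + \<eta>) * indicator (?J i) s)"
            using s by simp
          then show ?thesis by (rule add_increasing2[rotated]) simp
        qed
      qed simp
    qed
    also have "\<dots> = (\<Sum>i<m. ennreal (a i + \<eta>) * ennreal (1 / real N)) + ennreal b * ennreal (t - real m / N)"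
    proof -
      have E: "emeasure lborel (?J i) = ennreal (1 / real N)" for i using J(2)[of i] J(3)[of i] by (subst emeasure_lborel_Icc) auto
      have "(\<integral>\<^sup>+s. (\<Sum>i<m. ennreal (a i + \<eta>) * indicator (?J i) s) + ennreal b * indicator {real m / N..t} s \<partial>lborel) =
          (\<Sum>i<m. ennreal (a i + \<eta>) * emeasure lborel (?J i)) + ennreal b * emeasure lborel {real m / N..t}"
      proof -
        have "(\<integral>\<^sup>+s. (\<Sum>i<m. ennreal (a i + \<eta>) * indicator (?J i) s) + ennreal b * indicator {real m / N..t} s \<partial>lborel) =
            (\<integral>\<^sup>+s. (\<Sum>i<m. ennreal (a i + \<eta>) * indicator (?J i) s) \<partial>lborel) + (\<integral>\<^sup>+s. ennreal b * indicator {real m / N..t} s \<partial>lborel)"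
          by (rule nn_integral_add) measurable
        also have "(\<integral>\<^sup>+s. (\<Sum>i<m. ennreal (a i + \<eta>) * indicator (?J i) s) \<partial>lborel) = (\<Sum>i<m. \<integral>\<^sup>+s. ennreal (a i + \<eta>) * indicator (?J i) s \<partial>lborel)"
          by (rule nn_integral_sum) measurable
        also have "\<dots> = (\<Sum>i<m. ennreal (a i + \<eta>) * emeasure lborel (?J i))"
          by (intro sum.cong refl nn_integral_cmult_indicator) simp
        also have "(\<integral>\<^sup>+s. ennreal b * indicator {real m / N..t} s \<partial>lborel) = ennreal b * emeasure lborel {real m / N..t}"
          by (rule nn_integral_cmult_indicator) simp
        finally show ?thesis .
      qed
      then show ?thesis unfolding E using m(1) by simp
    qed
    also have "\<dots> = ennreal ((\<Sum>i<m. (a i + \<eta>) * (1 / real N)) + b * (t - real m / N))"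
    proof -
      have "(\<Sum>i<m. ennreal (a i + \<eta>) * ennreal (1 / real N)) = (\<Sum>i<m. ennreal ((a i + \<eta>) * (1 / real N)))"
        using a0 \<eta> N0 by (intro sum.cong refl ennreal_mult[symmetric]) auto
      also have "\<dots> = ennreal (\<Sum>i<m. (a i + \<eta>) * (1 / real N))"
        using a0 \<eta> N0 by (intro sum_ennreal) (auto intro!: divide_nonneg_pos add_nonneg_nonneg)
      finally have 1: "(\<Sum>i<m. ennreal (a i + \<eta>) * ennreal (1 / real N)) = ennreal (\<Sum>i<m. (a i + \<eta>) * (1 / real N))" .
      have 2: "ennreal b * ennreal (t - real m / N) = ennreal (b * (t - real m / N))"
        using b0 m(1) by (intro ennreal_mult[symmetric]) auto
      show ?thesis unfolding 1 2 using a0 \<eta> N0 b0 m(1)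
        by (intro ennreal_plus[symmetric]) (auto intro!: sum_nonneg mult_nonneg_nonneg divide_nonneg_pos add_nonneg_nonneg)
    qed
    finally have I: "(\<integral>\<^sup>+s. ennreal (f (x s)) \<partial>restrict_space lborel {0..t}) \<le> ennreal ((\<Sum>i<m. (a i + \<eta>) * (1 / real N)) + b * (t - real m / N))" .
    let ?R = "(\<Sum>i<m. (a i + \<eta>) * (1 / real N)) + b * (t - real m / N)"
    have R0: "0 \<le> ?R" using a0 \<eta> N0 b0 m(1)
      by (auto intro!: add_nonneg_nonneg sum_nonneg mult_nonneg_nonneg divide_nonneg_pos)
    have "(\<integral>y. f y \<partial>limit_measure t) = enn2real (\<integral>\<^sup>+y. ennreal (f y) \<partial>limit_measure t)"
      using fb by (intro integral_eq_nn_integral) (auto simp: measurable_cong_sets[OF sets_measures(2) refl])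
    also have "(\<integral>\<^sup>+y. ennreal (f y) \<partial>limit_measure t) = ennreal L * (\<integral>\<^sup>+s. ennreal (f (x s)) \<partial>restrict_space lborel {0..t})"
      by (rule nn_integral_limit_measure) measurable
    also have "enn2real \<dots> \<le> enn2real (ennreal L * ennreal ?R)"
      using I by (intro enn2real_mono mult_left_mono) (auto simp: ennreal_mult_less_top)
    also have "\<dots> = L * ?R" using L R0 by (simp add: enn2real_mult)
    also have "?R \<le> (\<Sum>i<m. a i * (1 / real N)) + \<eta> * t + \<eta>"
    proof -
      have "(\<Sum>i<m. (a i + \<eta>) * (1 / real N)) = (\<Sum>i<m. a i * (1 / real N)) + \<eta> * (real m / N)"
        by (simp add: distrib_right sum.distrib add_divide_distrib)
      moreover have "\<eta> * (real m / N) \<le> \<eta> * t" using m(1) \<eta> by (intro mult_left_mono) auto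
      moreover have "b * (t - real m / N) \<le> b * (1 / N)" using m(2) b0 by (intro mult_left_mono) (auto simp: add_divide_distrib)
      ultimately show ?thesis using Nb by simp
    qed
    also have "L * ((\<Sum>i<m. a i * (1 / real N)) + \<eta> * t + \<eta>) = S + L * (\<eta> * (t + 1))"
      unfolding S_def by (simp add: algebra_simps sum_distrib_left)
    also have "L * (\<eta> * (t + 1)) \<le> \<epsilon> / 2"
    proof -
      have "t + 1 \<noteq> 0" using t by linarith
      then have "\<eta> * (t + 1) = \<epsilon> / 2 / (L + 1)"
        using nonzero_divide_eq_eq[of "t + 1" "\<epsilon> / 2 / (L + 1)" \<eta>] \<eta>_def by metis
      then have "L * (\<eta> * (t + 1)) = \<epsilon> / 2 * (L / (L + 1))" by simp
      also have "\<dots> \<le> \<epsilon> / 2 * 1" using L e by (intro mult_left_mono) auto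
      finally show ?thesis by simp
    qed
    finally show ?thesis using L by (simp add: mult_left_mono)
  qed
  have cross: "(\<Sum>i<m. a i * (c powr q * enn2real (tvs c x (?J i)))) \<le> (\<integral>y. f y \<partial>cross_measure c t)" if c: "0 < c" for c
  proof -
    have fin: "tvs c x (?J i) < \<top>" for i
      using tvs_finite_continuous[OF cont_Icc[OF J(1)] c] by (simp add: infinity_ennreal_def)
    interpret cm: finite_measure "cross_measure c t" by (rule finite_cross[OF c t])
    have cm [measurable]: "(\<lambda>y. of_nat (crossings y c x (real i / real N) (real (Suc i) / real N)) :: ennreal) \<in> borel_measurable borel" for i
      by (rule cross_meas[OF c J(1,2)])
    have "ennreal (\<Sum>i<m. a i * (c powr q * enn2real (tvs c x (?J i)))) = (\<Sum>i<m. ennreal (a i * (c powr q * enn2real (tvs c x (?J i)))))"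
      using a0 by (intro sum_ennreal[symmetric]) auto
    also have "\<dots> = (\<Sum>i<m. ennreal (c powr q) * (ennreal (a i) * tvs c x (?J i)))"
    proof (rule sum.cong[OF refl])
      fix i
      have "ennreal (a i * (c powr q * enn2real (tvs c x (?J i)))) = ennreal (a i) * (ennreal (c powr q) * ennreal (enn2real (tvs c x (?J i))))"
        using a0 by (simp only: ennreal_mult mult_nonneg_nonneg powr_ge_zero enn2real_nonneg)
      then show "ennreal (a i * (c powr q * enn2real (tvs c x (?J i)))) = ennreal (c powr q) * (ennreal (a i) * tvs c x (?J i))"
        using fin[of i] by (simp only: ennreal_enn2real mult.left_commute)
    qed
    also have "\<dots> \<le> (\<Sum>i<m. ennreal (c powr q) * (ennreal (a i) * (\<integral>\<^sup>+y. of_nat (crossings y c x (real i / real N) (real (Suc i) / real N)) \<partial>lborel)))"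
      by (intro sum_mono mult_left_mono nn_integral_crossings_ge[OF cont_Icc[OF J(1)] c J(2)]) auto
    also have "\<dots> = ennreal (c powr q) * (\<integral>\<^sup>+y. (\<Sum>i<m. ennreal (a i) * of_nat (crossings y c x (real i / real N) (real (Suc i) / real N))) \<partial>lborel)"
    proof -
      have "(\<integral>\<^sup>+y. (\<Sum>i<m. ennreal (a i) * of_nat (crossings y c x (real i / real N) (real (Suc i) / real N))) \<partial>lborel) =
          (\<Sum>i<m. ennreal (a i) * (\<integral>\<^sup>+y. of_nat (crossings y c x (real i / real N) (real (Suc i) / real N)) \<partial>lborel))"
        using cm by (subst nn_integral_sum) (auto intro!: sum.cong nn_integral_cmult)
      then show ?thesis by (simp only: sum_distrib_left)
    qed
    also have "\<dots> \<le> ennreal (c powr q) * (\<integral>\<^sup>+y. of_nat (crossings y c x 0 t) * ennreal (f y) \<partial>lborel)"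
    proof (intro mult_left_mono nn_integral_mono)
      fix y
      have "(\<Sum>i<m. ennreal (a i) * of_nat (crossings y c x (real i / real N) (real (Suc i) / real N))) \<le>
          (\<Sum>i<m. ennreal (f y) * of_nat (crossings y c x (real i / real N) (real (Suc i) / real N)))"
      proof (rule sum_mono)
        fix i
        show "ennreal (a i) * of_nat (crossings y c x (real i / real N) (real (Suc i) / real N)) \<le>
            ennreal (f y) * of_nat (crossings y c x (real i / real N) (real (Suc i) / real N))"
        proof (cases "crossings y c x (real i / real N) (real (Suc i) / real N) = 0")
          case False
          then obtain s where s: "s \<in> ?J i" "y = x s"
            using crossings_range[OF cont_Icc[OF J(1)] c J(2)] by blast
          then show ?thesis using a_le[OF s(1)] by (intro mult_right_mono ennreal_leI) auto
        qed simp
      qed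
      also have "\<dots> = ennreal (f y) * of_nat (\<Sum>i<m. crossings y c x (real i / real N) (real (Suc i) / real N))"
        by (simp only: sum_distrib_left of_nat_sum)
      also have "\<dots> \<le> ennreal (f y) * of_nat (crossings y c x 0 t)"
      proof (intro mult_left_mono of_nat_mono)
        have "(\<Sum>i<m. crossings y c x (real i / real N) (real (Suc i) / real N)) \<le> crossings y c x 0 (real m / real N)"
          by (rule crossings_sum_le[where m=m, OF cont_Icc c]) simp_all
        also have "\<dots> \<le> crossings y c x 0 t"
          using crossings_superadditive[where a=0 and b=t and m="real m / real N" and y=y, OF cont_Icc c] m(1) by simp
        finally show "(\<Sum>i<m. crossings y c x (real i / real N) (real (Suc i) / real N)) \<le> crossings y c x 0 t" .
      qed simp
      finally show "(\<Sum>i<m. ennreal (a i) * of_nat (crossings y c x (real i / real N) (real (Suc i) / real N))) \<le> of_nat (crossings y c x 0 t) * ennreal (f y)"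
        by (simp only: mult.commute)
    qed simp
    also have "\<dots> = (\<integral>\<^sup>+y. ennreal (f y) \<partial>cross_measure c t)"
      by (rule nn_integral_cross_measure[OF c t, symmetric]) measurable
    also have "\<dots> = ennreal (\<integral>y. f y \<partial>cross_measure c t)"
    proof (rule nn_integral_eq_integral)
      show "integrable (cross_measure c t) f"
        using fb by (intro cm.integrable_const_bound[of _ b]) (auto simp: measurable_cong_sets[OF sets_measures(1) refl])
    qed (use fb in auto)
    finally show ?thesis
      using fb by (subst (asm) ennreal_le_iff) (auto intro!: Bochner_Integration.integral_nonneg)
  qed
  have "((\<lambda>c. \<Sum>i<m. a i * (c powr q * enn2real (tvs c x (?J i)))) \<longlongrightarrow> S) (at_right 0)"
    unfolding S_def
  proof (rule tendsto_sum, rule tendsto_mult[OF tendsto_const])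
    fix i
    have "((\<lambda>c. c powr q * enn2real (tvs c x (?J i))) \<longlongrightarrow> L * (real (Suc i) / real N - real i / real N)) (at_right 0)"
      using N0 J(1)[of i] by (intro lim Rats_divide Rats_of_nat divide_strict_right_mono) auto
    then show "((\<lambda>c. c powr q * enn2real (tvs c x (?J i))) \<longlongrightarrow> L * (1 / real N)) (at_right 0)"
      unfolding J(3) .
  qed
  moreover have "S - \<epsilon> / 2 < S" using e by simp
  ultimately have "eventually (\<lambda>c. S - \<epsilon> / 2 < (\<Sum>i<m. a i * (c powr q * enn2real (tvs c x (?J i))))) (at_right 0)"
    by (rule order_tendstoD)
  moreover have "eventually (\<lambda>c::real. 0 < c) (at_right 0)" by (rule eventually_at_right_less)
  ultimately show ?thesis
  proof eventually_elim
    case (elim c)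
    show ?case using low cross[OF elim(2)] elim(1) by linarith
  qed
qed

theorem crossings_converge_weakly:
  assumes c: "\<And>n. 0 < c n" "c \<longlonglongrightarrow> 0" and t: "0 \<le> t"
  shows "converges_weakly (\<lambda>n. cross_measure (c n) t) (limit_measure t)"
proof -
  have fl: "filterlim c (at_right 0) sequentially"
    unfolding filterlim_at using c by (simp add: less_imp_neq[symmetric])
  show ?thesis
  proof (rule converges_weakly_criterion)
    show "eventually (\<lambda>n. (\<integral>y. f y \<partial>limit_measure t) - \<epsilon> \<le> (\<integral>y. f y \<partial>cross_measure (c n) t)) sequentially"
      if "continuous_on UNIV f" "\<And>y. 0 \<le> f y \<and> f y \<le> b" "0 < \<epsilon>" for f :: "real \<Rightarrow> real" and b \<epsilon> :: real
      by (rule eventually_compose_filterlim[OF integral_lower[OF t that] fl])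
    show "eventually (\<lambda>n. measure (cross_measure (c n) t) UNIV \<le> measure (limit_measure t) UNIV + \<epsilon>) sequentially"
      if "0 < \<epsilon>" for \<epsilon>
      by (rule eventually_compose_filterlim[OF mass_upper[OF t that] fl])
  qed (use c t in \<open>simp_all add: finite_cross finite_limit\<close>)
qed

end

lemma (in fbm) mean_limit:
  "(\<lambda>n::nat. (\<integral>\<^sup>+\<omega>. truncated_variation 1 (\<lambda>s. B s \<omega>) 0 (real n) \<partial>M) / of_nat n) \<longlonglongrightarrow> ennreal L"
proof -
  have "(\<lambda>n. ennreal (u n / real n)) \<longlonglongrightarrow> ennreal L" by (intro tendsto_ennrealI L(2))
  moreover have "eventually (\<lambda>n. ennreal (u n / real n) =
      (\<integral>\<^sup>+\<omega>. truncated_variation 1 (\<lambda>s. B s \<omega>) 0 (real n) \<partial>M) / of_nat n) sequentially"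
    using eventually_gt_at_top[of 0]
  proof eventually_elim
    case (elim n)
    have "(\<integral>\<^sup>+\<omega>. truncated_variation 1 (\<lambda>s. B s \<omega>) 0 (real n) \<partial>M) = ennreal (u n)"
      by (simp add: truncated_variation_eq_tvs u_ennreal)
    then show ?case using elim u_nonneg[of n] by (simp add: divide_ennreal ennreal_of_nat_eq_real_of_nat)
  qed
  ultimately show ?thesis by (rule Lim_transform_eventually)
qed

theorem fact5p2:
  fixes M :: "'a measure" and B :: "real \<Rightarrow> 'a \<Rightarrow> real"
    and H :: real and C :: ennreal and c :: "nat \<Rightarrow> real"
  assumes "prob_space M"
    and "0 < H" and "H < 1"
    and "fractional_brownian_motion M H B"
    and "C = lim (\<lambda>n::nat.
           (\<integral>\<^sup>+\<omega>. truncated_variation 1 (\<lambda>s. B s \<omega>) 0 (real n) \<partial>M) / of_nat n)"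
    and "\<And>n. 0 < c n" and "c \<longlonglongrightarrow> 0"
  shows "AE \<omega> in M. \<forall>t\<ge>0.
    converges_weakly
      (\<lambda>n. density lborel (\<lambda>y.
         ennreal (c n powr (1 / H - 1)) * of_nat (crossings y (c n) (\<lambda>s. B s \<omega>) 0 t)))
      (density lborel (\<lambda>y. C * local_time (\<lambda>s. B s \<omega>) t y))"
proof -
  interpret fbm M H B using assms(1-4) by (simp add: fbm_def fbm_axioms_def)
  have C: "C = ennreal L" unfolding assms(5) by (rule limI[OF mean_limit])
  \<comment> \<open>One exceptional null set serves all pairs of rational times. As the limit is
    taken for \<open>c\<close> tending to \<open>0\<close> through all positive reals, this set
    depends neither on the given sequence nor on \<open>t\<close>.\<close>
  have "AE \<omega> in M. \<forall>a b::rat. 0 \<le> real_of_rat a \<and> real_of_rat a < real_of_rat b \<longrightarrow>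
      ((\<lambda>c. c powr (1 / H - 1) * enn2real (tvs c (\<lambda>r. B r \<omega>) {real_of_rat a..real_of_rat b})) \<longlongrightarrow>
        L * (real_of_rat b - real_of_rat a)) (at_right 0)"
    unfolding AE_all_countable
  proof (intro allI)
    fix a b :: rat
    show "AE \<omega> in M. 0 \<le> real_of_rat a \<and> real_of_rat a < real_of_rat b \<longrightarrow>
      ((\<lambda>c. c powr (1 / H - 1) * enn2real (tvs c (\<lambda>r. B r \<omega>) {real_of_rat a..real_of_rat b})) \<longlongrightarrow>
        L * (real_of_rat b - real_of_rat a)) (at_right 0)"
    proof (cases "0 \<le> real_of_rat a \<and> real_of_rat a < real_of_rat b")
      case True
      then have "AE \<omega> in M. ((\<lambda>c. c powr (1 / H - 1) * enn2real (tvs c (\<lambda>r. B r \<omega>) {real_of_rat a..real_of_rat b})) \<longlongrightarrow>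
        L * (real_of_rat b - real_of_rat a)) (at_right 0)" by (intro tvs_strong_law) simp_all
      then show ?thesis by (rule eventually_mono) blast
    next
      case False
      then show ?thesis by (intro AE_I2) blast
    qed
  qed
  with occupation_absolutely_continuous AE_space show ?thesis
  proof eventually_elim
    case (elim \<omega>)
    interpret truncated_variation_limit "\<lambda>s. B s \<omega>" "1 / H - 1" L
    proof
      show "continuous_on {0..} (\<lambda>s. B s \<omega>)" using B_cont[OF elim(2)] by simp
      show "0 < 1 / H - 1" using H by (simp add: field_simps)
      show "0 \<le> L" by (rule L)
      show "absolutely_continuous lborel (occupation_measure (\<lambda>s. B s \<omega>) t)" for t using elim(1) by blast
      fix s t :: real assume st: "s \<in> \<rat>" "t \<in> \<rat>" "0 \<le> s" "s < t"
      then obtain a b :: rat where "s = real_of_rat a" "t = real_of_rat b" by (auto elim!: Rats_cases)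
      then show "((\<lambda>c. c powr (1 / H - 1) * enn2real (tvs c (\<lambda>s. B s \<omega>) {s..t})) \<longlongrightarrow> L * (t - s)) (at_right 0)"
        using elim(3) st by blast
    qed
    show ?case
      using crossings_converge_weakly[of c] assms(6,7) unfolding cross_measure_def limit_measure_def C by blast
  qed
qed

end
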